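(* Let $\mathcal{G}$ be a marked labelled ecimahedron and $X_{\mathcal{G}}$ the moduli space of marked projective mirror polyhedra realizing $\mathcal{G}$. Then $X_{\mathcal{G}}$ is a manifold with finitely many connected components; all the connected components of $X_{\mathcal{G}}$ are homeomorphic to balls, and they all have the same dimension. Moreover, $X_{\mathcal{G}}$ is empty if and only if one of the following holds: 1. $\mathcal{G}$ is an exceptional prism whose unique prismatic 3-circuit is hyperbolic; 2. $m(\mathcal{G})\geq1$ and $\mathcal{G}$ is not an exceptional prism whose unique prismatic 3-circuit is affine with right angle.
   Context: Mirror polyhedra. $\mathbb{P}^+(\mathbb{R}^4)=(\mathbb{R}^4\setminus\{0\})/\mathbb{R}_{>0}$, $p$ the projection; its group of projective transformations is $\mathrm{SL}_4^{\pm}(\mathbb{R})=\{g:\det g=\pm1\}$. A projective polyhedron is a closed properly convex set (convex and bounded in some affine chart) $P$ with non-empty interior of the form $p(\{x\neq0:\alpha_i(x)\leq0\ \forall i\})$ for finitely many linear forms. Faces of codimension 1, 2, 3 are called faces, edges, vertices; two faces are adjacent if they share an edge. A projective mirror polyhedron is a projective polyhedron $P$ with, for each face $s\in S$, a reflection $\sigma_s=\mathrm{Id}-\alpha_s\otimes v_s$ fixing $s$, $\alpha_s(v_s)=2$, $P=p(\{x\neq0:\alpha_s(x)\leq0\ \forall s\in S\})$, such that for adjacent $s,t$: $-\alpha_s(v_t)\geq0$; $\alpha_s(v_t)=0\Leftrightarrow\alpha_t(v_s)=0$; $\alpha_s(v_t)\alpha_t(v_s)=4\cos^2\theta_{st}$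 with $\theta_{st}\in(0,\frac\pi2]$, the dihedral angle. Labelled graphs. A labelled graph is a planar 3-connected trivalent graph with a label $\theta_e\in(0,\frac\pi2]$ on each edge; marked means the faces are numbered. $Y_{\mathcal{G}}$ is the set of marked mirror polyhedra whose planar graph is identified with $\mathcal{G}$ compatibly with markings and whose dihedral angles are the labels (a subset of $(\mathbb{P}^+((\mathbb{R}^4)^* )\times\mathbb{P}^+(\mathbb{R}^4))^S$ via $([\alpha_s],[v_s])_s$); $X_{\mathcal{G}}=Y_{\mathcal{G}}/\mathrm{SL}_4^\pm(\mathbb{R})$. A combinatorial ecimahedron is a graph obtained from the complete graph on 4 vertices by finitely many truncations (replacing a vertex by a triangle whose vertices lie on the three edges issuing from it); a labelled ecimahedron is a labelled graph with such an underlying graph. An exceptional prism is a triangular prism whose six edges in the two triangular faces all have label $\frac\pi2$ (the other three labels being arbitrary in $(0,\frac\pi2]$); its unique prismatic 3-circuit passes through its three quadrilateral faces. 3-circuits. A 3-circuit is a cyclic sequence of three distinct faces, any two sharing an edge (up to cyclic permutation and reversal). It is prismatic if all endpoints of its three edges are distinct. It is spherical, affine, hyperbolic if the sum of its three labels is $>\pi$, $=\pi$, $<\pi$; it is with right angle if at least one of the three labels is $\frac\pi2$. $m(\mathcal{G})$ is the number of prismatic 3-circuits with right angle of $\mathcal{G}$ that are affine or spherical. *)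

theory Defs
  imports "HOL-Analysis.Analysis"
begin

section \<open>Topology\<close>

definition quot_topology :: "'a topology \<Rightarrow> ('a \<Rightarrow> 'b) \<Rightarrow> 'b topology" where
  "quot_topology X f =
     topology (\<lambda>U. U \<subseteq> f ` topspace X \<and> openin X {x \<in> topspace X. f x \<in> U})"

lemma istopology_quot:
  "istopology (\<lambda>U. U \<subseteq> f ` topspace X \<and> openin X {x \<in> topspace X. f x \<in> U})"
proof -
  have inter: "{x \<in> topspace X. f x \<in> S \<inter> T} =
      {x \<in> topspace X. f x \<in> S} \<inter> {x \<in> topspace X. f x \<in> T}" for S T
    by blast
  have union: "{x \<in> topspace X. f x \<in> \<Union>\<K>} = (\<Union>K\<in>\<K>. {x \<in> topspace X. f x \<in> K})" for \<K>
    by blast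
  show ?thesis
    unfolding istopology_def inter union
    by (intro conjI allI impI) (blast, blast intro: openin_Int, blast, blast intro: openin_Union)
qed

lemma openin_quot_topology:
  "openin (quot_topology X f) U \<longleftrightarrow>
     U \<subseteq> f ` topspace X \<and> openin X {x \<in> topspace X. f x \<in> U}"
  unfolding quot_topology_def topology_inverse'[OF istopology_quot] ..

lemma topspace_quot_topology: "topspace (quot_topology X f) = f ` topspace X"
proof -
  have "{x \<in> topspace X. f x \<in> f ` topspace X} = topspace X"
    by blast
  then have "openin (quot_topology X f) (f ` topspace X)"
    by (simp add: openin_quot_topology)
  then show ?thesis
    by (meson openin_quot_topology openin_subset openin_topspace subset_antisym)
qed

lemma quotient_map_quot_topology: "quotient_map X (quot_topology X f) f"
  unfolding quotient_map_def topspace_quot_topology openin_quot_topology by blast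

definition topological_manifold :: "nat \<Rightarrow> 'a topology \<Rightarrow> bool" where
  "topological_manifold d X \<longleftrightarrow>
     Hausdorff_space X \<and> second_countable X \<and>
     (\<forall>x \<in> topspace X. \<exists>U V. openin X U \<and> x \<in> U \<and> openin (Euclidean_space d) V \<and>
        subtopology X U homeomorphic_space subtopology (Euclidean_space d) V)"

definition ball_space :: "nat \<Rightarrow> (nat \<Rightarrow> real) topology" where
  "ball_space d = subtopology (Euclidean_space d) {x. (\<Sum>i<d. (x i)\<^sup>2) < 1}"


section \<open>Labelled planar graphs\<close>

text \<open>
  A finite simple graph is given by its vertices and its edges (two-element sets of vertices).
  The planar embedding is recorded by its facial cycles: face number \<open>i\<close>, for
  \<open>i < nfaces G\<close>, is the set \<open>face G i\<close> of the edges on its boundary, so that the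
  numbering of the faces (the marking) is part of the data.
\<close>

record 'v labelled_graph =
  verts :: "'v set"
  edges :: "'v set set"
  nfaces :: nat
  face :: "nat \<Rightarrow> 'v set set"
  label :: "'v set \<Rightarrow> real"

definition simple_graph :: "'v set \<Rightarrow> 'v set set \<Rightarrow> bool" where
  "simple_graph V E \<longleftrightarrow> finite V \<and> (\<forall>e\<in>E. e \<subseteq> V \<and> card e = 2)"

definition trivalent :: "'v set \<Rightarrow> 'v set set \<Rightarrow> bool" where
  "trivalent V E \<longleftrightarrow> (\<forall>v\<in>V. card {e \<in> E. v \<in> e} = 3)"

definition induces_connected :: "'v set set \<Rightarrow> 'v set \<Rightarrow> bool" where
  "induces_connected E W \<longleftrightarrow>
     (\<forall>u\<in>W. \<forall>v\<in>W. (u, v) \<in> {(x, y). x \<in> W \<and> y \<in> W \<and> {x, y} \<in> E}\<^sup>*)"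

definition three_connected :: "'v set \<Rightarrow> 'v set set \<Rightarrow> bool" where
  "three_connected V E \<longleftrightarrow>
     card V > 3 \<and> (\<forall>W \<subseteq> V. card W < 3 \<longrightarrow> induces_connected E (V - W))"

definition is_cycle :: "'v set set \<Rightarrow> bool" where
  "is_cycle C \<longleftrightarrow>
     (\<exists>vs. distinct vs \<and> length vs \<ge> 3 \<and>
        C = {{vs ! i, vs ! (Suc i mod length vs)} | i. i < length vs})"

text \<open>
  For a trivalent connected graph, gluing discs along cycles that cover every edge exactly twice
  gives a closed connected surface; it is the sphere exactly when its Euler characteristic is 2.
\<close>

definition planar_faces :: "'v set \<Rightarrow> 'v set set \<Rightarrow> nat \<Rightarrow> (nat \<Rightarrow> 'v set set) \<Rightarrow> bool" where
  "planar_faces V E n F \<longleftrightarrow>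
     (\<forall>i<n. F i \<subseteq> E \<and> is_cycle (F i)) \<and>
     inj_on F {..<n} \<and>
     (\<forall>e\<in>E. card {i. i < n \<and> e \<in> F i} = 2) \<and>
     int (card V) - int (card E) + int n = 2"

definition marked_labelled_graph :: "'v labelled_graph \<Rightarrow> bool" where
  "marked_labelled_graph G \<longleftrightarrow>
     simple_graph (verts G) (edges G) \<and>
     trivalent (verts G) (edges G) \<and>
     three_connected (verts G) (edges G) \<and>
     planar_faces (verts G) (edges G) (nfaces G) (face G) \<and>
     (\<forall>e \<in> edges G. 0 < label G e \<and> label G e \<le> pi / 2)"

text \<open>
  In a truncation the vertex \<open>v\<close>, with neighbours \<open>a\<close>, \<open>b\<close>, \<open>c\<close>, is replaced by a triangle
  \<open>x\<close>, \<open>y\<close>, \<open>z\<close>. The name \<open>v\<close> may be used again for one of the new vertices, which makes the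
  class closed under isomorphism whatever the type of vertices.
\<close>

inductive ecimahedron :: "'v set \<Rightarrow> 'v set set \<Rightarrow> bool" where
  K4: "card V = 4 \<Longrightarrow> ecimahedron V {e. e \<subseteq> V \<and> card e = 2}"
| truncation:
    "\<lbrakk>ecimahedron V E; v \<in> V; {e \<in> E. v \<in> e} = {{v, a}, {v, b}, {v, c}}; distinct [a, b, c];
      distinct [x, y, z]; {x, y, z} \<inter> (V - {v}) = {}\<rbrakk>
     \<Longrightarrow> ecimahedron ((V - {v}) \<union> {x, y, z})
           ((E - {{v, a}, {v, b}, {v, c}}) \<union>
            {{a, x}, {b, y}, {c, z}, {x, y}, {y, z}, {x, z}})"

definition marked_labelled_ecimahedron :: "'v labelled_graph \<Rightarrow> bool" where
  "marked_labelled_ecimahedron G \<longleftrightarrow>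
     marked_labelled_graph G \<and> ecimahedron (verts G) (edges G)"

text \<open>
  The graph is that of a triangular prism with triangles \<open>a b c\<close> and \<open>x y z\<close>.
\<close>

definition exceptional_prism :: "'v labelled_graph \<Rightarrow> bool" where
  "exceptional_prism G \<longleftrightarrow>
     (\<exists>a b c x y z. distinct [a, b, c, x, y, z] \<and>
        verts G = {a, b, c, x, y, z} \<and>
        edges G = {{a, b}, {b, c}, {a, c}, {x, y}, {y, z}, {x, z}, {a, x}, {b, y}, {c, z}} \<and>
        (\<forall>e \<in> {{a, b}, {b, c}, {a, c}, {x, y}, {y, z}, {x, z}}. label G e = pi / 2))"


subsection \<open>3-circuits\<close>

text \<open>
  A cyclic sequence of three distinct faces up to cyclic permutation and reversal is a
  three-element set of faces. Two distinct faces of a 3-connected planar graph share at most one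
  edge, so \<open>circuit_edges G c\<close> consists of the three edges of the 3-circuit \<open>c\<close>.
\<close>

definition circuit3 :: "'v labelled_graph \<Rightarrow> nat set \<Rightarrow> bool" where
  "circuit3 G c \<longleftrightarrow> c \<subseteq> {..<nfaces G} \<and> card c = 3 \<and>
     (\<forall>i\<in>c. \<forall>j\<in>c. i \<noteq> j \<longrightarrow> face G i \<inter> face G j \<noteq> {})"

definition circuit_edges :: "'v labelled_graph \<Rightarrow> nat set \<Rightarrow> 'v set set" where
  "circuit_edges G c = {e. \<exists>i\<in>c. \<exists>j\<in>c. i \<noteq> j \<and> e \<in> face G i \<inter> face G j}"

definition prismatic :: "'v labelled_graph \<Rightarrow> nat set \<Rightarrow> bool" where
  "prismatic G c \<longleftrightarrow> circuit3 G c \<and>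
     (\<forall>e \<in> circuit_edges G c. \<forall>e' \<in> circuit_edges G c. e \<noteq> e' \<longrightarrow> e \<inter> e' = {})"

definition spherical :: "'v labelled_graph \<Rightarrow> nat set \<Rightarrow> bool" where
  "spherical G c \<longleftrightarrow> (\<Sum>e\<in>circuit_edges G c. label G e) > pi"

definition affine_circuit :: "'v labelled_graph \<Rightarrow> nat set \<Rightarrow> bool" where
  "affine_circuit G c \<longleftrightarrow> (\<Sum>e\<in>circuit_edges G c. label G e) = pi"

definition hyperbolic :: "'v labelled_graph \<Rightarrow> nat set \<Rightarrow> bool" where
  "hyperbolic G c \<longleftrightarrow> (\<Sum>e\<in>circuit_edges G c. label G e) < pi"

definition with_right_angle :: "'v labelled_graph \<Rightarrow> nat set \<Rightarrow> bool" where
  "with_right_angle G c \<longleftrightarrow> (\<exists>e \<in> circuit_edges G c. label G e = pi / 2)"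

definition m_number :: "'v labelled_graph \<Rightarrow> nat" where
  "m_number G =
     card {c. prismatic G c \<and> with_right_angle G c \<and> (affine_circuit G c \<or> spherical G c)}"


section \<open>The projective space \<open>P\<^sup>+\<close>\<close>

text \<open>
  Points of \<open>P\<^sup>+\<close> are open rays. Linear forms on \<open>\<real>\<^sup>4\<close> are row vectors \<open>a\<close>, acting
  by \<open>x \<mapsto> a \<bullet> x\<close>, so the same construction serves for \<open>\<real>\<^sup>4\<close> and for its dual.
\<close>

definition ray :: "real^4 \<Rightarrow> (real^4) set" where
  "ray x = {c *\<^sub>R x | c. c > 0}"

definition proj_space :: "(real^4) set topology" where
  "proj_space = quot_topology (top_of_set (UNIV - {0})) ray"

definition cone_over :: "(real^4) set set \<Rightarrow> (real^4) set" where
  "cone_over A = insert 0 {x. x \<noteq> 0 \<and> ray x \<in> A}"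

text \<open>The affine chart of a nonzero form \<open>l\<close> is \<open>l > 0\<close>, identified with the hyperplane \<open>l = 1\<close>.\<close>

definition properly_convex :: "(real^4) set set \<Rightarrow> bool" where
  "properly_convex A \<longleftrightarrow>
     (\<exists>l. l \<noteq> 0 \<and> A \<subseteq> ray ` {x. l \<bullet> x > 0} \<and>
        convex {x. l \<bullet> x = 1 \<and> ray x \<in> A} \<and> bounded {x. l \<bullet> x = 1 \<and> ray x \<in> A})"

definition cut_out :: "(real^4) set \<Rightarrow> (real^4) set set" where
  "cut_out A = ray ` {x. x \<noteq> 0 \<and> (\<forall>a\<in>A. a \<bullet> x \<le> 0)}"

definition projective_polyhedron :: "(real^4) set set \<Rightarrow> bool" where
  "projective_polyhedron P \<longleftrightarrow>
     closedin proj_space P \<and> properly_convex P \<and> proj_space interior_of P \<noteq> {} \<and>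
     (\<exists>A. finite A \<and> P = cut_out A)"

text \<open>Passing to the cone raises dimensions by one: \<open>P\<close> has dimension 3 and its cone dimension 4.\<close>

definition codim_face :: "nat \<Rightarrow> (real^4) set set \<Rightarrow> (real^4) set set \<Rightarrow> bool" where
  "codim_face k P F \<longleftrightarrow>
     F \<subseteq> P \<and> cone_over F face_of cone_over P \<and> aff_dim (cone_over F) = 4 - int k"

definition adjacent :: "(real^4) set set \<Rightarrow> (real^4) set set \<Rightarrow> (real^4) set set \<Rightarrow> bool" where
  "adjacent P s t \<longleftrightarrow> s \<noteq> t \<and> (\<exists>e. codim_face 2 P e \<and> e \<subseteq> s \<and> e \<subseteq> t)"


section \<open>Mirror polyhedra\<close>

definition reflect :: "real^4 \<Rightarrow> real^4 \<Rightarrow> real^4 \<Rightarrow> real^4" where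
  "reflect a v x = x - (a \<bullet> x) *\<^sub>R v"

definition has_dihedral_angle ::
  "(nat \<Rightarrow> real^4) \<Rightarrow> (nat \<Rightarrow> real^4) \<Rightarrow> nat \<Rightarrow> nat \<Rightarrow> real \<Rightarrow> bool" where
  "has_dihedral_angle \<alpha> v s t \<theta> \<longleftrightarrow>
     0 < \<theta> \<and> \<theta> \<le> pi / 2 \<and> (\<alpha> s \<bullet> v t) * (\<alpha> t \<bullet> v s) = 4 * (cos \<theta>)\<^sup>2"

text \<open>
  \<open>\<F> s\<close>, for \<open>s < n\<close>, is the enumeration of the faces of \<open>P\<close>, and
  \<open>reflect (\<alpha> s) (v s)\<close> is the reflection attached to the face \<open>\<F> s\<close>.
\<close>

definition mirror_polyhedron ::
  "nat \<Rightarrow> (real^4) set set \<Rightarrow> (nat \<Rightarrow> (real^4) set set) \<Rightarrow>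
   (nat \<Rightarrow> real^4) \<Rightarrow> (nat \<Rightarrow> real^4) \<Rightarrow> bool" where
  "mirror_polyhedron n P \<F> \<alpha> v \<longleftrightarrow>
     projective_polyhedron P \<and>
     bij_betw \<F> {..<n} {F. codim_face 1 P F} \<and>
     (\<forall>s<n. \<alpha> s \<bullet> v s = 2 \<and> (\<forall>x \<in> cone_over (\<F> s). reflect (\<alpha> s) (v s) x = x)) \<and>
     P = cut_out (\<alpha> ` {..<n}) \<and>
     (\<forall>s<n. \<forall>t<n. adjacent P (\<F> s) (\<F> t) \<longrightarrow>
        - (\<alpha> s \<bullet> v t) \<ge> 0 \<and> (\<alpha> s \<bullet> v t = 0 \<longleftrightarrow> \<alpha> t \<bullet> v s = 0) \<and>
        (\<exists>\<theta>. has_dihedral_angle \<alpha> v s t \<theta>))"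

text \<open>
  An identification of the graph of \<open>P\<close> with \<open>G\<close>, compatible with the markings and the labels,
  is given by \<open>\<phi>\<close> on vertices and \<open>\<psi>\<close> on edges.
\<close>

definition realizes ::
  "'v labelled_graph \<Rightarrow> (real^4) set set \<Rightarrow> (nat \<Rightarrow> (real^4) set set) \<Rightarrow>
   (nat \<Rightarrow> real^4) \<Rightarrow> (nat \<Rightarrow> real^4) \<Rightarrow> bool" where
  "realizes G P \<F> \<alpha> v \<longleftrightarrow>
     (\<exists>\<phi> \<psi>.
        bij_betw \<phi> (verts G) {p. codim_face 3 P p} \<and>
        bij_betw \<psi> (edges G) {e. codim_face 2 P e} \<and>
        (\<forall>u \<in> verts G. \<forall>e \<in> edges G. u \<in> e \<longleftrightarrow> \<phi> u \<subseteq> \<psi> e) \<and>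
        (\<forall>s<nfaces G. \<forall>e \<in> edges G. e \<in> face G s \<longleftrightarrow> \<psi> e \<subseteq> \<F> s)) \<and>
     (\<forall>s<nfaces G. \<forall>t<nfaces G. \<forall>e \<in> face G s \<inter> face G t.
        s \<noteq> t \<longrightarrow> has_dihedral_angle \<alpha> v s t (label G e))"


section \<open>The moduli space\<close>

type_synonym config = "nat \<Rightarrow> (real^4) set \<times> (real^4) set"

definition Y_set :: "'v labelled_graph \<Rightarrow> config set" where
  "Y_set G = {(\<lambda>s\<in>{..<nfaces G}. (ray (\<alpha> s), ray (v s))) | P \<F> \<alpha> v.
     mirror_polyhedron (nfaces G) P \<F> \<alpha> v \<and> realizes G P \<F> \<alpha> v}"

definition Y_space :: "'v labelled_graph \<Rightarrow> config topology" where
  "Y_space G = subtopology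
     (product_topology (\<lambda>s. prod_topology proj_space proj_space) {..<nfaces G}) (Y_set G)"

text \<open>\<open>g\<close> maps a vector \<open>x\<close> to \<open>g x\<close> and a linear form \<open>a\<close> to \<open>a \<circ> g\<inverse>\<close>.\<close>

definition act :: "nat \<Rightarrow> real^4^4 \<Rightarrow> config \<Rightarrow> config" where
  "act n g y = (\<lambda>s\<in>{..<n}.
     ((\<lambda>a. a v* matrix_inv g) ` fst (y s), (\<lambda>x. g *v x) ` snd (y s)))"

definition orbit :: "nat \<Rightarrow> config \<Rightarrow> config set" where
  "orbit n y = {act n g y | g. det g = 1 \<or> det g = -1}"

definition X_space :: "'v labelled_graph \<Rightarrow> config set topology" where
  "X_space G = quot_topology (Y_space G) (orbit (nfaces G))"

end

theory Submission
 imports Defs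
begin

text \<open>
 The faces form a stack of simplices, since the polyhedron arises from a simplex by truncations. Up
 to projective transformations a configuration is determined by the entries \<open>al s .* v t\<close> of adjacent
 faces and, for each truncation, by the coefficient of the opposite face of the simplex in the relation
 that expresses the new form; the remaining coefficients solve a linear system whose matrix is the
 Cartan matrix of a prismatic circuit. The logarithms of these data are linear coordinates on which
 rescaling acts by translations, so that the quotient is a coordinate subspace. The determinants of
 the systems are nonpositive. If they do not vanish, they are negative, and conversely negativity
 suffices to reconstruct a polyhedron, because each truncation stays inside the cap cut off by the
 hyperplane that the three reflections leave invariant. Without right angles negativity means
 \<open>\<bar>f y\<bar> > t\<close> for a linear form \<open>f\<close>; with a right angle it means that the circuit is hyperbolic. Hence the
 moduli space is the complement of slabs and its components are convex. A determinant can vanish only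
 for the exceptional prism, whose moduli space is a set of roots of a quadratic polynomial.
\<close>

text \<open>The determinants are nonpositive because a relation
  \<open>al m = e1 al i + e2 al j + e3 al k - Z al l\<close> with positive coefficients, paired with
  the three \<open>v s\<close>, writes a nonpositive vector as a positive vector times the Cartan
  matrix, whose adjugate is nonnegative. They equal
  \<open>8 - 2 (k1 + k2 + k3) - sqrt (k1 k2 k3) (exp f + exp (- f))\<close>, where \<open>k\<close>
  is four times the squared cosine of a label and \<open>f\<close> is linear in the logarithms:
  hence the slabs, and hence with a right angle only the condition \<open>k1 + k2 + k3 > 4\<close>.
  At \<open>f = 0\<close> this is eight times the Gram determinant of the angles, whose sign depends
  on their sum. If a determinant vanishes, the faces on both sides are orthogonal to the circuit; a
  second truncation would then give a circuit with two right angles and a positive determinant. The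
  obstacle is the converse: entries with negative determinants yield forms and poles by linear
  equations, but a new hyperplane might cut off more than one vertex. The induction therefore
  carries pairwise disjoint caps, one at each vertex with negative determinant.\<close>

notation inner (infix ".*" 70)

abbreviation tetra :: "nat => nat => nat => nat => (nat set \<times> nat) set" where
 "tetra a b c d == {({b, c, d}, a), ({a, c, d}, b), ({a, b, d}, c), ({a, b, c}, d)}"

abbreviation (input) new_tris :: "nat => nat => nat => nat => nat set set" where
 "new_tris i j k m == {{i, j, m}, {j, k, m}, {i, k, m}}"

text \<open>Dually, the simplex \<open>{i, j, k, m}\<close> is glued to the stack along
  \<open>{i, j, k}\<close>. Each new vertex is therefore paired with the face of
  \<open>{i, j, k}\<close> that it misses.\<close>

abbreviation (input) cut :: "(nat set \<times> nat) set => nat => nat => nat => nat => nat => (nat set \<times> nat) set" where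
 "cut Q i j k l m == Q - {({i, j, k}, l)} Un {({i, j, m}, k), ({j, k, m}, i), ({i, k, m}, j)}"

abbreviation (input) comb :: "(nat => real^4) => real => real => real => nat => nat => nat => real^4" where
 "comb al e1 e2 e3 i j k == e1 *\<^sub>R al i + e2 *\<^sub>R al j + e3 *\<^sub>R al k"

abbreviation (input) grown :: "(nat => real) => (nat => real^4) => nat => real^4" where
 "grown h al == %s. exp (h s) *\<^sub>R al s"

abbreviation (input) shrunk :: "(nat => real) => (nat => real^4) => nat => real^4" where
 "shrunk h v == %s. exp (- h s) *\<^sub>R v s"

abbreviation (input) cells :: "'a topology => bool" where
 "cells X == EX d. topological_manifold d X & finite (connected_components_of X) &
   (ALL C : connected_components_of X. subtopology X C homeomorphic_space ball_space d)"

subsection \<open>Stacks of simplices\<close>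

lemma triples_of_four:
 assumes "T <= {a, b, c, d}" "card T = 3" "distinct [a, b, c, d]"
 shows "T : {{b, c, d}, {a, c, d}, {a, b, d}, {a, b, c}}"
proof -
 have "card ({a, b, c, d} - T) = 1"
  using assms by (subst card_Diff_subset) (auto intro: finite_subset)
 then obtain x where "{a, b, c, d} - T = {x}" by (auto simp: card_1_singleton_iff)
 then have "T = {a, b, c, d} - {x}" "x : {a, b, c, d}" using assms(1) by auto
 then show ?thesis using assms(3) by force
qed

text \<open>\<open>Q\<close> collects the vertices of the polyhedron, each given by the set of its three faces, together
 with the fourth face of the simplex that contains it. \<open>S\<close> records the truncations: \<open>(i, j, k, l, m)\<close>
 cuts off the vertex \<open>{i, j, k}\<close> of the simplex \<open>{i, j, k, l}\<close> by the face \<open>m\<close>.\<close>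

inductive stacked :: "nat => nat => nat => nat =>
  nat set => (nat set \<times> nat) set => (nat \<times> nat \<times> nat \<times> nat \<times> nat) set => bool"
 for a b c d where
 base: "distinct [a, b, c, d] ==>
  stacked a b c d {a, b, c, d} (tetra a b c d) {}"
| step: "[|stacked a b c d F Q S; ({i, j, k}, l) : Q; distinct [i, j, k]; m ~: F|] ==>
  stacked a b c d (insert m F)
   (cut Q i j k l m)
   (insert (i, j, k, l, m) S)"

text \<open>The polyhedron is trivalent, so two faces share an edge exactly when they share a
  vertex, and adjacency can be read off the vertex triples.\<close>

definition nbr :: "(nat set \<times> nat) set => nat => nat => bool" where
 "nbr Q s t \<longleftrightarrow> s ~= t & (EX T : fst ` Q. s : T & t : T)"

lemma nbr_sym: "nbr Q s t ==> nbr Q t s"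
 by (auto simp: nbr_def)

lemma nbrI: "(T, l) : Q ==> s : T ==> t : T ==> s ~= t ==> nbr Q s t"
 by (force simp: nbr_def)

definition removed :: "(nat \<times> nat \<times> nat \<times> nat \<times> nat) set => nat set set" where
 "removed S = (%(i, j, k, l, m). {i, j, k}) ` S"

lemma removed_insert: "removed (insert (i, j, k, l, m) S) = insert {i, j, k} (removed S)"
 by (simp add: removed_def)

lemma stacked_finite: "stacked a b c d F Q S ==> finite F & finite Q & finite S"
 by (induction rule: stacked.induct) auto

lemma stacked_base: "stacked a b c d F Q S ==> distinct [a, b, c, d] & {a, b, c, d} <= F"
 by (induction rule: stacked.induct) auto

lemma stacked_tri:
 "stacked a b c d F Q S ==> (T, l) : Q ==> T <= F & l : F & l ~: T & card T = 3"
proof (induction arbitrary: T l rule: stacked.induct)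
 case base
 then show ?case by auto
next
 case (step F Q S i j k l' m)
 then have "i : F" "j : F" "k : F" "i ~= m" "j ~= m" "k ~= m" by auto
 with step show ?case by auto
qed

lemma stacked_tri_unique:
 "stacked a b c d F Q S ==> (T, l) : Q ==> (T, l') : Q ==> l = l'"
proof (induction arbitrary: T l l' rule: stacked.induct)
 case base
 then show ?case by auto
next
 case (step F Q S i j k l0 m T l l')
 have ne: "i : F" "j : F" "k : F" "i ~= m" "j ~= m" "k ~= m"
  using step stacked_tri[OF step(1,2)] by auto
 show ?case
 proof (cases "m : T")
  case True
  then have "(T, l) ~: Q" "(T, l') ~: Q" using stacked_tri[OF step(1)] step(4) by blast+
  then have "(T, l) : {({i, j, m}, k), ({j, k, m}, i), ({i, k, m}, j)}"
   "(T, l') : {({i, j, m}, k), ({j, k, m}, i), ({i, k, m}, j)}"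
   using step.prems by auto
  then show ?thesis using ne step(3) by auto
 next
  case False
  then show ?thesis using step by auto
 qed
qed

lemma fst_image_remove:
 assumes "!!l'. (T, l') : Q ==> l' = l"
 shows "fst ` (Q - {(T, l)}) = fst ` Q - {T}"
 using assms by force

lemma stacked_step_tris:
 assumes "stacked a b c d F Q S" "({i, j, k}, l) : Q" "m ~: F"
 shows "fst ` (cut Q i j k l m) =
  (fst ` Q - {{i, j, k}}) Un (new_tris i j k m)"
proof -
 have "l' = l" if "({i, j, k}, l') : Q" for l'
  using stacked_tri_unique[OF assms(1) that assms(2)] .
 then show ?thesis unfolding image_Un by (subst fst_image_remove) simp_all
qed

text \<open>The discarded triple \<open>{i, j, k}\<close> takes no adjacency with it, since each of
  its pairs survives in one of the triples through \<open>m\<close>.\<close>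

lemma nbr_step:
 assumes "stacked a b c d F Q S" "({i, j, k}, l) : Q" "m ~: F" "distinct [i, j, k]"
 shows "nbr (cut Q i j k l m) s t \<longleftrightarrow>
  nbr Q s t | (s = m & t : {i, j, k}) | (t = m & s : {i, j, k})"
proof -
 have ne: "i ~= m" "j ~= m" "k ~= m"
  using stacked_tri[OF assms(1,2)] assms(3) by auto
 have old: "nbr Q s t" if "s ~= t" "s : {i, j, k}" "t : {i, j, k}"
  using nbrI[OF assms(2) that(2,3,1)] .
 have new: "(EX T : (new_tris i j k m). s : T & t : T) \<longleftrightarrow>
   s : {i, j, k} & t : {i, j, k} | s = m & t : {i, j, k, m} | t = m & s : {i, j, k, m}"
  if "s ~= t"
  using that by auto
 define A where "A = {i, j, k}"
 define R where "R \<longleftrightarrow> (EX T:fst ` Q - {A}. s : T & t : T)"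
 have A: "A : fst ` Q" using assms(2) A_def by force
 have "nbr (cut Q i j k l m) s t \<longleftrightarrow>
   s ~= t & (R | (EX T:(new_tris i j k m). s : T & t : T))"
  unfolding nbr_def stacked_step_tris[OF assms(1-3)] bex_Un R_def A_def ..
 moreover have "nbr Q s t \<longleftrightarrow> s ~= t & (R | s : A & t : A)"
  unfolding nbr_def R_def using A by blast
 ultimately show ?thesis using new ne unfolding A_def by auto
qed

lemma nbr_in: "stacked a b c d F Q S ==> nbr Q s t ==> s : F & t : F & s ~= t"
 by (force simp: nbr_def dest: stacked_tri)

lemma stacked_tetra_nbr:
 "stacked a b c d F Q S ==> (T, l) : Q ==> s : insert l T ==> t : insert l T ==> s ~= t ==> nbr Q s t"
proof (induction arbitrary: T l s t rule: stacked.induct)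
 case base
 then show ?case unfolding nbr_def by (auto; blast)
next
 case (step F Q S i j k l0 m T l s t)
 show ?case
 proof (cases "(T, l) : Q")
  case True
  then show ?thesis
   unfolding nbr_step[OF step(1,2,4,3)] using step by blast
 next
  case False
  then have "insert l T = {i, j, k, m}" using step.prems by auto
  moreover have "nbr Q s t" if "s : {i, j, k}" "t : {i, j, k}"
   using that step by auto
  ultimately show ?thesis
   unfolding nbr_step[OF step(1,2,4,3)] using step.prems by auto
 qed
qed

text \<open>A removed triple never becomes a vertex again, because every vertex created later
  contains a fresh face. Adjacency only grows, so the two simplices on either side of the triple
  remain cliques.\<close>

lemma stacked_steps:
 "stacked a b c d F Q S ==> (i, j, k, l, m) : S ==>
  distinct [i, j, k, l, m] & {i, j, k, l, m} <= F & {i, j, k} ~: fst ` Q & m ~: {a, b, c, d} &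
  (ALL s:{i, j, k, l}. ALL t:{i, j, k, l}. s ~= t --> nbr Q s t) &
  (ALL s:{i, j, k, m}. ALL t:{i, j, k, m}. s ~= t --> nbr Q s t)"
proof (induction arbitrary: i j k l m rule: stacked.induct)
 case base
 then show ?case by simp
next
 case (step F Q S i0 j0 k0 l0 m0 i j k l m)
 note tr = stacked_tri[OF step(1,2)] and te = stacked_tetra_nbr[OF step(1,2)]
 show ?case
 proof (cases "(i, j, k, l, m) : S")
  case True
  then have *: "distinct [i, j, k, l, m]" "{i, j, k, l, m} <= F" "{i, j, k} ~: fst ` Q" "m ~: {a, b, c, d}"
   "(ALL s:{i, j, k, l}. ALL t:{i, j, k, l}. s ~= t --> nbr Q s t)"
   "(ALL s:{i, j, k, m}. ALL t:{i, j, k, m}. s ~= t --> nbr Q s t)"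
   using step.IH by blast+
  have "m0 ~: {i, j, k}" using * step by auto
  then have "{i, j, k} ~: (fst ` Q - {{i0, j0, k0}}) Un (new_tris i0 j0 k0 m0)"
   using * by blast
  then show ?thesis
   unfolding nbr_step[OF step(1,2,4,3)] stacked_step_tris[OF step(1,2,4)]
  proof (intro conjI)
   show "{i, j, k} ~: fst ` Q - {{i0, j0, k0}} Un (new_tris i0 j0 k0 m0)" by fact
   show "{i, j, k, l, m} <= insert m0 F" using *(2) by (rule subset_insertI2)
   show "ALL s:{i, j, k, l}. ALL t:{i, j, k, l}. s ~= t -->
     nbr Q s t | s = m0 & t : {i0, j0, k0} | t = m0 & s : {i0, j0, k0}"
    by (intro ballI impI disjI1) (rule *(5)[rule_format]; assumption)
   show "ALL s:{i, j, k, m}. ALL t:{i, j, k, m}. s ~= t -->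
     nbr Q s t | s = m0 & t : {i0, j0, k0} | t = m0 & s : {i0, j0, k0}"
    by (intro ballI impI disjI1) (rule *(6)[rule_format]; assumption)
  qed (use * in auto)
 next
  case False
  then have eq: "i = i0" "j = j0" "k = k0" "l = l0" "m = m0" using step.prems by auto
  have d: "distinct [i, j, k, l, m]" "{i, j, k, l} <= F" using step tr eq by auto
  moreover have "m ~: {a, b, c, d}" using stacked_base[OF step(1)] step(4) eq by blast
  moreover have "{i, j, k} ~: (fst ` Q - {{i0, j0, k0}}) Un (new_tris i0 j0 k0 m0)"
   using d eq by (auto simp: set_eq_iff)
  moreover have "nbr Q s t" if "s : {i,j,k,l}" "t : {i,j,k,l}" "s ~= t" for s t
   using te that eq by blast
  ultimately show ?thesis
   unfolding nbr_step[OF step(1,2,4,3)] stacked_step_tris[OF step(1,2,4)]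
   using eq by auto
 qed
qed

text \<open>A fresh face is adjacent to \<open>i\<close>, \<open>j\<close>, \<open>k\<close> only,
  so the new cliques through it are vertices, and the only vertex that is lost is recorded in
  \<open>removed\<close>. This is what identifies the prismatic 3-circuits in
  \<open>prismatic_iff\<close>.\<close>

lemma stacked_clique:
 "stacked a b c d F Q S ==> nbr Q x y ==> nbr Q y z ==> nbr Q x z ==>
  {x, y, z} : fst ` Q Un removed S"
proof (induction arbitrary: x y z rule: stacked.induct)
 case base
 then have "{x, y, z} <= {a, b, c, d}" "x ~= y" "y ~= z" "x ~= z"
  using nbr_in[OF stacked.base[OF base(1)]] by simp_all
 then have "{x, y, z} : {{b, c, d}, {a, c, d}, {a, b, d}, {a, b, c}}"
  using base(1) by (intro triples_of_four) simp_all
 then show ?case unfolding image_insert fst_conv image_empty by (rule UnI1)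
next
 case (step F Q S i j k l m x y z)
 note N = step.prems[unfolded nbr_step[OF step(1,2,4,3)]]
 have F: "s : F & t : F" if "nbr Q s t" for s t using nbr_in[OF step(1) that] by auto
 have ijk: "i : F" "j : F" "k : F" using stacked_tri[OF step(1,2)] by auto
 show ?case
 proof (cases "m : {x, y, z}")
  case True
  obtain u v where uv: "{x, y, z} = {u, v, m}" "u : {i, j, k}" "v : {i, j, k}" "u ~= v"
  proof -
   consider "m = x" | "m = y" | "m = z" using True by auto
   then show thesis
   proof cases
    case 1
    show thesis by (rule that[of y z]) (use 1 N F step(4) ijk in \<open>auto simp: nbr_def\<close>)
   next
    case 2
    show thesis by (rule that[of x z]) (use 2 N F step(4) ijk in \<open>auto simp: nbr_def\<close>)
   next
    case 3
    show thesis by (rule that[of x y]) (use 3 N F step(4) ijk in \<open>auto simp: nbr_def\<close>)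
   qed
  qed
  then have "{x, y, z} : (new_tris i j k m)" by auto
  then show ?thesis unfolding stacked_step_tris[OF step(1,2,4)] by blast
 next
  case False
  then have "nbr Q x y" "nbr Q y z" "nbr Q x z" using N by auto
  then have "{x, y, z} : fst ` Q Un removed S"
   by (rule step.IH)
  then show ?thesis unfolding stacked_step_tris[OF step(1,2,4)] removed_insert
   by (rule rev_subsetD) blast
 qed
qed

text \<open>The two triples are the ends of the edge of \<open>s\<close> and \<open>t\<close>. When
  a truncation cuts off one end, the triple with \<open>m\<close> takes its place.\<close>

lemma stacked_two_tris:
 "stacked a b c d F Q S ==> nbr Q s t ==>
  EX u v. u ~= v & u ~: {s, t} & v ~: {s, t} & {s, t, u} : fst ` Q & {s, t, v} : fst ` Q"
proof (induction arbitrary: s t rule: stacked.induct)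
 case base
 then have st: "{s, t} <= {a, b, c, d}" "s ~= t" unfolding nbr_def by auto
 then obtain u v where uv: "u ~= v" "u ~: {s, t}" "v ~: {s, t}" "{s, t, u, v} = {a, b, c, d}"
  using base(1) by (auto; metis insert_commute)
 have "{s, t, w} : {{b, c, d}, {a, c, d}, {a, b, d}, {a, b, c}}" if "w = u | w = v" for w
 proof (rule triples_of_four[OF _ _ base(1)])
  show "{s, t, w} <= {a, b, c, d}" unfolding uv(4)[symmetric] using that by auto
  show "card {s, t, w} = 3" using that st(2) uv(2,3) by auto
 qed
 note W = this
 have "{s, t, u} : {{b, c, d}, {a, c, d}, {a, b, d}, {a, b, c}}"
  "{s, t, v} : {{b, c, d}, {a, c, d}, {a, b, d}, {a, b, c}}" by (rule W, rule disjI1 disjI2, rule refl)+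
 then show ?case unfolding image_insert fst_conv image_empty using uv(1-3) by (intro exI conjI)
next
 case (step F Q S i j k l m s t)
 note K = stacked_step_tris[OF step(1,2,4)]
 have ijk: "i : F" "j : F" "k : F" "i ~= m" "j ~= m" "k ~= m"
  using stacked_tri[OF step(1,2)] step(4) by auto
 consider "nbr Q s t" | "s = m" "t : {i,j,k}" | "t = m" "s : {i,j,k}"
  using step.prems nbr_step[OF step(1,2,4,3)] by blast
 then show ?case
 proof cases
  case 1
  obtain u v where uv: "u ~= v" "u ~: {s, t}" "v ~: {s, t}" "{s, t, u} : fst ` Q" "{s, t, v} : fst ` Q"
   using step.IH[OF 1] by blast
  have m: "m ~: {s,t,u,v}" using uv stacked_tri[OF step(1)] step(4) by force
  have "s ~= t" using 1 by (simp add: nbr_def)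
  have new: "{s, t, m} : (new_tris i j k m)" if "{s, t} <= {i, j, k}"
   using that \<open>s ~= t\<close> by auto
  show ?thesis
  proof (cases "{s, t, u} = {i, j, k}")
   case True
   then have "{s, t, v} ~= {i, j, k}" using uv by (auto simp: set_eq_iff)
   moreover have "{s, t} <= {i, j, k}" unfolding True[symmetric] by simp
   ultimately have "{s, t, m} : fst ` Q - {{i, j, k}} Un (new_tris i j k m)"
    "{s, t, v} : fst ` Q - {{i, j, k}} Un (new_tris i j k m)"
    using uv(5) new by (simp_all only: Un_iff Diff_iff singleton_iff simp_thms)
   then show ?thesis using uv m unfolding K
    by (intro exI[of _ m] exI[of _ v] conjI) simp_all
  next
   case u: False
   show ?thesis
   proof (cases "{s, t, v} = {i, j, k}")
    case True
    then have "{s, t} <= {i, j, k}" by blast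
    then have "{s, t, m} : fst ` Q - {{i, j, k}} Un (new_tris i j k m)"
     "{s, t, u} : fst ` Q - {{i, j, k}} Un (new_tris i j k m)"
     using uv(4) u new by (simp_all only: Un_iff Diff_iff singleton_iff simp_thms)
    then show ?thesis using uv m unfolding K
     by (intro exI[of _ m] exI[of _ u] conjI) simp_all
   next
    case False
    then have "{s, t, u} : fst ` Q - {{i, j, k}} Un (new_tris i j k m)"
     "{s, t, v} : fst ` Q - {{i, j, k}} Un (new_tris i j k m)"
     using uv(4,5) u by (simp_all only: Un_iff Diff_iff singleton_iff simp_thms)
    then show ?thesis using uv(1-3) unfolding K by (intro exI[of _ u] exI[of _ v] conjI)
   qed
  qed
 next
  case 2
  then consider "t = i" | "t = j" | "t = k" by blast
  then show ?thesis unfolding K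
   by cases (use ijk step(3) 2 in \<open>force intro: exI[of _ i] exI[of _ j] exI[of _ k]\<close>)+
 next
  case 3
  then consider "s = i" | "s = j" | "s = k" by blast
  then show ?thesis unfolding K
   by cases (use ijk step(3) 3 in \<open>force intro: exI[of _ i] exI[of _ j] exI[of _ k]\<close>)+
 qed
qed

text \<open>An edge has two ends, and a third face passes through at most one of them. Such vertices
  are summed in \<open>ksub_strict_point\<close> to get strict inequalities.\<close>

lemma stacked_pair_avoid:
 assumes "stacked a b c d F Q S" "nbr Q s t" "u ~: {s, t}"
 shows "EX T : fst ` Q. s : T & t : T & u ~: T"
proof -
 obtain x y where "x ~= y" "{s, t, x} : fst ` Q" "{s, t, y} : fst ` Q"
  using stacked_two_tris[OF assms(1,2)] by blast
 then show ?thesis using assms(3) by (cases "u = x") auto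
qed

lemma stacked_face_tri: "stacked a b c d F Q S ==> s : F ==> EX T : fst ` Q. s : T"
proof (induction arbitrary: s rule: stacked.induct)
 case base
 then show ?case by auto
next
 case (step F Q S i j k l m s)
 note K = stacked_step_tris[OF step(1,2,4)]
 show ?case
 proof (cases "s : {i, j, k, m}")
  case True
  then have "EX T:(new_tris i j k m). s : T" by auto
  then show ?thesis unfolding K bex_Un by (rule disjI2)
 next
  case False
  then obtain T where "T : fst ` Q" "s : T" using step by blast
  moreover have "T ~= {i, j, k}" using False \<open>s : T\<close> by blast
  ultimately show ?thesis unfolding K by blast
 qed
qed

lemma stacked_face_avoid:
 assumes "stacked a b c d F Q S" "s : F" "t ~= s"
 shows "EX T : fst ` Q. s : T & t ~: T"
proof -
 obtain T where T: "T : fst ` Q" "s : T" using stacked_face_tri[OF assms(1,2)] by blast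
 then have c: "card T = 3" using stacked_tri[OF assms(1)] by force
 have "~ T <= {s, t}"
 proof
  assume "T <= {s, t}"
  then have "card T <= card {s, t}" by (intro card_mono) auto
  also have "\<dots> <= 2" by (simp add: card_insert_if)
  finally have "card T <= 2" .
  then show False using c by simp
 qed
 then obtain x where x: "x : T" "x ~= s" "x ~= t" by blast
 then have "nbr Q s x" using T unfolding nbr_def by auto
 from stacked_pair_avoid[OF assms(1) this, of t] x assms(3) show ?thesis by auto
qed

lemma stacked_no_steps:
 assumes "stacked a b c d F Q S" "S = {}"
 shows "F = {a, b, c, d}" "Q = (tetra a b c d)"
 using assms by (cases rule: stacked.cases; simp)+

lemma bex_subset_insert: "EX x:A. P x ==> EX x:insert a A. P x"
 by blast

text \<open>As soon as there are two simplices, each one that carries a vertex is glued to another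
  along a removed triple.\<close>

lemma stacked_tetra_removed:
 "stacked a b c d F Q S ==> S ~= {} ==> (T, l) : Q ==> EX T' : removed S. T' <= insert l T"
proof (induction arbitrary: T l rule: stacked.induct)
 case base
 then show ?case by simp
next
 case (step F Q S i j k l0 m T l)
 show ?case
 proof (cases "(T, l) : Q")
  case True
  show ?thesis
  proof (cases "S = {}")
   case True
   note FQ = stacked_no_steps[OF step(1) True]
   then have "insert l T = F" "{i, j, k} <= F"
    using \<open>(T, l) : Q\<close> stacked_tri[OF step(1,2)] by auto
   then show ?thesis unfolding removed_insert by blast
  next
   case False
   then show ?thesis unfolding removed_insert by (intro bex_subset_insert step.IH True)
  qed
 next
  case False
  then have "{i, j, k} <= insert l T" using step.prems by auto
  then show ?thesis unfolding removed_insert by (intro bexI[of _ "{i, j, k}"] insertI1)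
 qed
qed

lemma stacked_single:
 assumes "stacked a b c d F Q S" "card S = 1"
 obtains i j k l m where "S = {(i, j, k, l, m)}" "F = {i, j, k, l, m}" "distinct [i, j, k, l, m]"
  "fst ` Q = {{j, k, l}, {i, k, l}, {i, j, l}, {i, j, m}, {j, k, m}, {i, k, m}}"
  "{i, j, k, l} = {a, b, c, d}"
 using assms(1)
proof cases
 case base
 then show ?thesis using assms by auto
next
 case (step F' Q' S' i j k l m)
 have fin: "finite S'" using stacked_finite[OF step(4)] by auto
 have st: "stacked a b c d F Q S" by fact
 have "(i, j, k, l, m) ~: S'" using stacked_steps[OF step(4)] step(7) by blast
 then have S': "S' = {}" using assms(2) step(3) fin by simp
 note F' = stacked_no_steps(1)[OF step(4) S'] and Q' = stacked_no_steps(2)[OF step(4) S']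
 have ab: "distinct [a,b,c,d]" using stacked_base[OF assms(1)] by simp
 have eq: "{i, j, k, l} = {a, b, c, d}" using step(5) unfolding Q' by auto
 have dist: "distinct [i, j, k, l, m]" using stacked_tri[OF step(4,5)] step(6,7) by auto
 have "fst ` Q' = {T. T <= {a, b, c, d} & card T = 3}"
 proof
  show "fst ` Q' <= {T. T <= {a, b, c, d} & card T = 3}" unfolding Q' using ab by auto
  show "{T. T <= {a, b, c, d} & card T = 3} <= fst ` Q'"
  proof
   fix T assume "T : {T. T <= {a, b, c, d} & card T = 3}"
   then have "T : {{b, c, d}, {a, c, d}, {a, b, d}, {a, b, c}}"
    by (intro triples_of_four[OF _ _ ab]) simp_all
   then show "T : fst ` Q'" unfolding Q' by simp
  qed
 qed
 also have "\<dots> = {{i, j, k}, {j, k, l}, {i, k, l}, {i, j, l}}"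
 proof -
  have "T : {{i, j, k}, {j, k, l}, {i, k, l}, {i, j, l}}" if T: "T <= {i, j, k, l}" "card T = 3" for T
  proof -
   have "T : {{j, k, l}, {i, k, l}, {i, j, l}, {i, j, k}}"
    using triples_of_four[OF T] dist by simp
   then show ?thesis by (simp only: insert_iff) argo
  qed
  then have "{T. T <= {i, j, k, l} & card T = 3} <= {{i, j, k}, {j, k, l}, {i, k, l}, {i, j, l}}"
   by blast
  moreover have "{{i, j, k}, {j, k, l}, {i, k, l}, {i, j, l}} <= {T. T <= {i, j, k, l} & card T = 3}"
   using dist by simp
  ultimately show ?thesis unfolding eq[symmetric] by (rule subset_antisym)
 qed
 finally have K': "fst ` Q' = {{i, j, k}, {j, k, l}, {i, k, l}, {i, j, l}}" .
 have new: "{i, j, k} ~: {{j, k, l}, {i, k, l}, {i, j, l}}" using dist by auto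
 have "fst ` Q = {{j, k, l}, {i, k, l}, {i, j, l}, {i, j, m}, {j, k, m}, {i, k, m}}"
  unfolding step(2) stacked_step_tris[OF step(4,5,7)] K'
   Diff_insert_absorb[OF new] by (simp only: insert_is_Un[symmetric] Un_insert_left Un_empty_left)
 moreover have "F = {i, j, k, l, m}" unfolding step(1) F' eq[symmetric] by auto
 ultimately show ?thesis using step(3) S' by (intro that[OF _ _ dist _ eq]) simp_all
qed

text \<open>The simplices form a tree whose edges are the removed triples; in a connected tree with
  at least two edges every edge meets another one. Through \<open>zero_step\<close> this turns a
  vanishing determinant into a contradiction.\<close>

lemma stacked_removed_neighbour:
 "stacked a b c d F Q S ==> card S >= 2 ==> (i, j, k, l, m) : S ==>
  EX T' : removed S. T' ~= {i, j, k} & (T' <= {i, j, k, l} | T' <= {i, j, k, m})"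
proof (induction arbitrary: i j k l m rule: stacked.induct)
 case base
 then show ?case by simp
next
 case (step F Q S i0 j0 k0 l0 m0 i j k l m)
 have fin: "finite S" using stacked_finite[OF step(1)] by auto
 have nin: "(i0, j0, k0, l0, m0) ~: S" using stacked_steps[OF step(1)] step(4) by blast
 then have S: "S ~= {}" "card S >= 1" using step.prems(1) fin by auto
 have K0: "{i0, j0, k0} : fst ` Q" using step(2) by force
 show ?case
 proof (cases "(i, j, k, l, m) : S")
  case True
  show ?thesis
  proof (cases "card S >= 2")
   case c: True
   show ?thesis using step.IH[OF c True] unfolding removed_insert by (rule bex_subset_insert)
  next
   case False
   then have "card S = 1" using S by simp
   then obtain i1 j1 k1 l1 m1 where *: "S = {(i1, j1, k1, l1, m1)}"
    "fst ` Q = {{j1, k1, l1}, {i1, k1, l1}, {i1, j1, l1}, {i1, j1, m1}, {j1, k1, m1}, {i1, k1, m1}}"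
    by (rule stacked_single[OF step(1)])
   then have "i1 = i" "j1 = j" "k1 = k" "l1 = l" "m1 = m" using True by auto
   then have K: "fst ` Q = {{j, k, l}, {i, k, l}, {i, j, l}, {i, j, m}, {j, k, m}, {i, k, m}}"
    using * by simp
   define T0 where "T0 = {i0, j0, k0}"
   have "{i, j, k} ~: fst ` Q" using stacked_steps[OF step(1) True] by auto
   then have ne: "T0 ~= {i, j, k}" using K0 T0_def by auto
   have "T0 : {{j, k, l}, {i, k, l}, {i, j, l}, {i, j, m}, {j, k, m}, {i, k, m}}"
    using K0 unfolding K T0_def .
   then have sub: "T0 <= {i, j, k, l} | T0 <= {i, j, k, m}" by (elim insertE) auto
   show ?thesis
    using sub ne unfolding removed_insert by (intro bexI[of _ T0]) (auto simp: T0_def)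
  qed
 next
  case False
  then have eq: "i = i0" "j = j0" "k = k0" "l = l0" "m = m0" using step.prems by auto
  obtain T' where *: "T' : removed S" "T' <= insert l0 {i0, j0, k0}"
   using stacked_tetra_removed[OF step(1) S(1) step(2)] by blast
  obtain i1 j1 k1 l1 m1 where "(i1, j1, k1, l1, m1) : S" "T' = {i1, j1, k1}"
   using *(1) unfolding removed_def by auto
  then have "T' ~: fst ` Q" using stacked_steps[OF step(1)] by simp
  then have "T' ~= {i, j, k}" using K0 eq by auto
  moreover have "T' <= {i, j, k, l}" using * eq by auto
  ultimately show ?thesis using * unfolding removed_insert by (intro bexI[of _ T']) simp_all
 qed
qed

lemma stacked_step_unique:
 "stacked a b c d F Q S ==> (i, j, k, l, m) : S ==> (i', j', k', l', m) : S ==>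
  (i, j, k, l) = (i', j', k', l')"
proof (induction arbitrary: i j k l m i' j' k' l' rule: stacked.induct)
 case base
 then show ?case by simp
next
 case (step F Q S i0 j0 k0 l0 m0 i j k l m)
 have "m0 ~= m" if "(i, j, k, l, m) : S" for i j k l m
  using stacked_steps[OF step(1) that] step(4) by auto
 then show ?case using step.IH step.prems by blast
qed

lemma stacked_card: "stacked a b c d F Q S ==> card F = card S + 4"
proof (induction rule: stacked.induct)
 case base
 then show ?case by simp
next
 case (step F Q S i j k l m)
 have "(i, j, k, l, m) ~: S" using stacked_steps[OF step(1)] step(4) by blast
 then show ?case using step stacked_finite[OF step(1)] by simp
qed

subsection \<open>Faces of an ecimahedron\<close>

text \<open>Being a cycle is weakened to having degree 0 or 2 at every vertex, a local parity
  condition that can be carried back through a truncation. Members must be nonempty, as otherwise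
  they could not be counted.\<close>

definition face_family :: "'v set => 'v set set => nat set => (nat => 'v set set) => bool" where
 "face_family V E I F \<longleftrightarrow> finite I &
   (ALL i:I. F i <= E & F i ~= {} & (ALL u:V. card {e : F i. u : e} : {0, 2})) &
   (ALL e:E. card {i : I. e : F i} = 2)"

definition sides :: "nat set => (nat => 'v set set) => 'v set => nat set" where
 "sides I F e = {i : I. e : F i}"

definition corner :: "'v set set => nat set => (nat => 'v set set) => 'v => nat set" where
 "corner E I F u = (UN e:{e : E. u : e}. sides I F e)"

text \<open>Around a trivalent vertex with faces \<open>p\<close>, \<open>q\<close>,
  \<open>r\<close>, these are the pairs of faces along its three edges.\<close>

definition tri3 :: "nat set => nat set => nat set => bool" where
 "tri3 A B C \<longleftrightarrow> (EX p q r. distinct [p, q, r] & A = {q, r} & B = {p, q} & C = {p, r})"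

lemma card_2_member:
 assumes "card B = 2" "p : B"
 obtains q where "B = {p, q}" "p ~= q"
proof -
 have "card (B - {p}) = 1" using assms by simp
 then obtain q where q: "B - {p} = {q}" by (auto simp: card_1_singleton_iff)
 then have "B = {p, q}" using assms(2) by (metis insert_Diff)
 then show thesis using that q by blast
qed

text \<open>By parity \<open>A\<close> is the symmetric difference of \<open>B\<close> and
  \<open>C\<close>. With three sets of size 2 this leaves only the three pairs of a three-element
  set.\<close>

lemma tri3_from_parity:
 assumes "card A = 2" "card B = 2" "card C = 2" and par: "!!i. i : A \<longleftrightarrow> (i : B) ~= (i : C)"
 shows "tri3 A B C"
proof -
 have A: "A = (B - C) Un (C - B)" using par by blast
 have fin: "finite B" "finite C" using assms by (metis card.infinite zero_neq_numeral)+
 have "B Int C ~= {}"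
 proof
  assume "B Int C = {}"
  then have "A = B Un C" using A by blast
  then have "card A = 4" using card_Un_disjoint[OF fin \<open>B Int C = {}\<close>] assms by simp
  then show False using assms by simp
 qed
 then obtain p where p: "p : B" "p : C" by blast
 obtain q where q: "B = {p, q}" "p ~= q" by (rule card_2_member[OF assms(2) p(1)])
 obtain r where r: "C = {p, r}" "p ~= r" by (rule card_2_member[OF assms(3) p(2)])
 have "q ~= r" using A q r assms(1) by auto
 then have "A = {q, r}" using A q r by auto
 then show ?thesis unfolding tri3_def using q r \<open>q ~= r\<close> by auto
qed

lemma vertex_sides:
 assumes ff: "face_family V E I F" and u: "u : V" and E: "{e : E. u : e} = {e1, e2, e3}"
  and d: "distinct [e1, e2, e3]"
 shows "tri3 (sides I F e1) (sides I F e2) (sides I F e3)"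
proof (rule tri3_from_parity)
 have e: "e1 : E" "e2 : E" "e3 : E" using E by auto
 then show "card (sides I F e1) = 2" "card (sides I F e2) = 2" "card (sides I F e3) = 2"
  using ff unfolding face_family_def sides_def by auto
 fix i
 show "(i : sides I F e1) = ((i : sides I F e2) ~= (i : sides I F e3))"
 proof (cases "i : I")
  case True
  have "{e : F i. u : e} = {e : {e1, e2, e3}. e : F i}"
   using ff True E unfolding face_family_def by blast
  also have "\<dots> = (if e1 : F i then {e1} else {}) Un
    (if e2 : F i then {e2} else {}) Un (if e3 : F i then {e3} else {})"
   by auto
  finally have eq: "{e : F i. u : e} = (if e1 : F i then {e1} else {}) Un
    (if e2 : F i then {e2} else {}) Un (if e3 : F i then {e3} else {})" .
  have "card {e : F i. u : e} = of_bool (e1 : F i) + of_bool (e2 : F i) + of_bool (e3 : F i)"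
   unfolding eq using d by (auto simp: card_insert_if)
  moreover have "card {e : F i. u : e} : {0, 2}"
   using ff True u unfolding face_family_def by blast
  ultimately have "of_bool (e1 : F i) + of_bool (e2 : F i) + of_bool (e3 : F i) : {0, 2::nat}"
   by simp
  then show ?thesis using True unfolding sides_def
   by (cases "e1 : F i"; cases "e2 : F i"; cases "e3 : F i") simp_all
 qed (auto simp: sides_def)
qed

text \<open>In the first outcome \<open>p\<close> runs along all three edges of the triangle. In the
  second only three members occur around it; this configuration is not planar and is later excluded
  by counting.\<close>

lemma triangle_sides:
 assumes "tri3 AX XY XZ" "tri3 BY XY YZ" "tri3 CZ XZ YZ"
 obtains p q r s where "distinct [p, q, r, s]" "XY = {p, q}" "XZ = {p, r}" "AX = {q, r}"
   "YZ = {p, s}" "BY = {q, s}" "CZ = {r, s}"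
 | p q r where "distinct [p, q, r]" "XY = {p, q}" "XZ = {p, r}" "AX = {q, r}"
   "YZ = {q, r}" "BY = {p, r}" "CZ = {p, q}"
proof -
 obtain p q r where 1: "distinct [p, q, r]" "XY = {p, q}" "XZ = {p, r}" "AX = {q, r}"
  using assms(1) unfolding tri3_def by blast
 have parity: "A = (B - C) Un (C - B)" if "tri3 A B C" for A B C
  using that unfolding tri3_def by auto
 have BY: "BY = (XY - YZ) Un (YZ - XY)" and CZ: "CZ = (XZ - YZ) Un (YZ - XZ)"
  using parity assms by blast+
 obtain p' q' r' where 2: "distinct [p', q', r']" "XY = {p', q'}" "YZ = {p', r'}" "BY = {q', r'}"
  using assms(2) unfolding tri3_def by blast
 obtain p'' q'' r'' where 3: "distinct [p'', q'', r'']" "XZ = {p'', q''}" "YZ = {p'', r''}" "CZ = {q'', r''}"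
  using assms(3) unfolding tri3_def by blast
 show thesis
 proof (cases "p : YZ")
  case True
  have "p' = p" using True 2 1 by (auto simp: doubleton_eq_iff)
  then have q': "q' = q" "YZ = {p, r'}" "r' ~= p" "r' ~= q" using 2 1 by (auto simp: doubleton_eq_iff)
  have "p'' = p" using True 3 1 by (auto simp: doubleton_eq_iff)
  then have "r' ~= r" using 3 1 q' by (auto simp: doubleton_eq_iff)
  then have dd: "distinct [p, q, r, r']" using 1(1) q'(3,4) by auto
  have "BY = {q, r'}" "CZ = {r, r'}" unfolding BY CZ 1(2,3) q'(2) using dd by auto
  then show thesis by (rule that(1)[OF dd 1(2-4) q'(2)])
 next
  case False
  then have "p' = q" using 2 1 by (auto simp: doubleton_eq_iff)
  moreover have "p'' = r" using False 3 1 by (auto simp: doubleton_eq_iff)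
  ultimately have "YZ = {q, r}" using 2 3 1 by (auto simp: doubleton_eq_iff)
  note yz = this
  have "BY = {p, r}" "CZ = {p, q}" unfolding BY CZ 1(2,3) yz using 1(1) by auto
  then show thesis by (rule that(2)[OF 1 yz])
 qed
qed

lemma ecimahedron_simple:
 "ecimahedron V E ==> finite V & finite E & (ALL e:E. e <= V & card e = 2)"
proof (induction rule: ecimahedron.induct)
 case (K4 V)
 then have "finite V" by (metis card.infinite zero_neq_numeral)
 then show ?case by auto
next
 case (truncation V E v a b c x y z)
 have "{v, a} : E" "{v, b} : E" "{v, c} : E" using truncation by blast+
 then have "a : V - {v}" "b : V - {v}" "c : V - {v}"
  using truncation.IH by (auto simp: card_2_iff)
 moreover have "e <= V - {v}" if "e : E - {{v, a}, {v, b}, {v, c}}" for e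
  using that truncation by blast
 moreover have "x ~: V - {v}" "y ~: V - {v}" "z ~: V - {v}" "x ~= y" "y ~= z" "x ~= z"
  using truncation by auto
 ultimately have *: "a : V - {v}" "b : V - {v}" "c : V - {v}" "x ~: V - {v}" "y ~: V - {v}" "z ~: V - {v}"
  "x ~= y" "y ~= z" "x ~= z" "!!e. e : E - {{v, a}, {v, b}, {v, c}} ==> e <= V - {v}" by auto
 have ne: "a ~= x" "b ~= y" "c ~= z" using *(1-6) by auto
 show ?case
 proof (intro conjI ballI)
  show "finite (V - {v} Un {x, y, z})" using truncation.IH by simp
  show "finite (E - {{v, a}, {v, b}, {v, c}} Un {{a, x}, {b, y}, {c, z}, {x, y}, {y, z}, {x, z}})"
   using truncation.IH by simp
  fix e assume "e : E - {{v, a}, {v, b}, {v, c}} Un {{a, x}, {b, y}, {c, z}, {x, y}, {y, z}, {x, z}}"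
  then consider "e : E - {{v, a}, {v, b}, {v, c}}" | "e : {{a, x}, {b, y}, {c, z}, {x, y}, {y, z}, {x, z}}"
   by (rule UnE)
  then have "e <= V - {v} Un {x, y, z} & card e = 2"
  proof cases
   case 1
   then show ?thesis using *(10)[OF 1] truncation.IH by blast
  next
   case 2
   then show ?thesis using *(1-3,7-9) ne by (elim insertE) simp_all
  qed
  then show "e <= V - {v} Un {x, y, z}" "card e = 2" by auto
 qed
qed

definition realizes_stack ::
 "'v set => 'v set set => nat set => (nat => 'v set set) => (nat set \<times> nat) set => bool" where
 "realizes_stack V E I F Q \<longleftrightarrow>
   bij_betw (corner E I F) V (fst ` Q) &
   bij_betw (sides I F) E {{s, t} | s t. nbr Q s t} &
   (ALL u:V. ALL e:E. u : e \<longleftrightarrow> sides I F e <= corner E I F u)"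

lemma nbr_base:
 assumes "distinct [a, b, c, d]"
 shows "nbr (tetra a b c d) s t \<longleftrightarrow>
  s ~= t & s : {a, b, c, d} & t : {a, b, c, d}"
proof
 assume "s ~= t & s : {a, b, c, d} & t : {a, b, c, d}"
 then show "nbr (tetra a b c d) s t"
  unfolding nbr_def by auto
next
 assume "nbr (tetra a b c d) s t"
 then show "s ~= t & s : {a, b, c, d} & t : {a, b, c, d}"
  using nbr_in[OF stacked.base[OF assms]] by blast
qed

lemma K4_stacked:
 assumes V: "card V = 4" and ff: "face_family V {e. e <= V & card e = 2} I F"
 shows "card I <= 4 & (card I = 4 -->
  (EX a b c d Q S. stacked a b c d I Q S & realizes_stack V {e. e <= V & card e = 2} I F Q))"
proof -
 define E where "E = {e. e <= V & card e = 2}"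
 note ff = ff[folded E_def]
 obtain w x y z where V: "V = {w, x, y, z}" and d: "distinct [w, x, y, z]"
  using V by (auto simp: card_Suc_eq numeral_eq_Suc)
 have E: "E = {{w, x}, {w, y}, {w, z}, {x, y}, {x, z}, {y, z}}"
 proof
  show "E <= {{w, x}, {w, y}, {w, z}, {x, y}, {x, z}, {y, z}}"
  proof
   fix e assume "e : E"
   then obtain s t where st: "e = {s, t}" "s ~= t" "s : V" "t : V"
    unfolding E_def by (auto simp: card_2_iff)
   then show "e : {{w, x}, {w, y}, {w, z}, {x, y}, {x, z}, {y, z}}"
    unfolding V by (elim insertE emptyE) (simp_all add: insert_commute)
  qed
  show "{{w, x}, {w, y}, {w, z}, {x, y}, {x, z}, {y, z}} <= E"
   unfolding E_def V using d by simp
 qed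
 have Ex: "{e : E. x : e} = {{w, x}, {x, y}, {x, z}}"
  and Ey: "{e : E. y : e} = {{w, y}, {x, y}, {y, z}}"
  and Ez: "{e : E. z : e} = {{w, z}, {x, z}, {y, z}}"
  and Ew: "{e : E. w : e} = {{w, x}, {w, y}, {w, z}}"
  unfolding E using d by auto
 let ?s = "sides I F"
 have tx: "tri3 (?s {w, x}) (?s {x, y}) (?s {x, z})"
  by (rule vertex_sides[OF ff _ Ex]) (use d V in \<open>auto simp: doubleton_eq_iff\<close>)
 have ty: "tri3 (?s {w, y}) (?s {x, y}) (?s {y, z})"
  by (rule vertex_sides[OF ff _ Ey]) (use d V in \<open>auto simp: doubleton_eq_iff\<close>)
 have tz: "tri3 (?s {w, z}) (?s {x, z}) (?s {y, z})"
  by (rule vertex_sides[OF ff _ Ez]) (use d V in \<open>auto simp: doubleton_eq_iff\<close>)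
 have I: "I = (UN e:E. ?s e)"
  using ff unfolding face_family_def sides_def by blast
 have cor: "corner E I F x = ?s {w, x} Un ?s {x, y} Un ?s {x, z}"
  "corner E I F y = ?s {w, y} Un ?s {x, y} Un ?s {y, z}"
  "corner E I F z = ?s {w, z} Un ?s {x, z} Un ?s {y, z}"
  "corner E I F w = ?s {w, x} Un ?s {w, y} Un ?s {w, z}"
  unfolding corner_def Ex Ey Ez Ew by auto
 show ?thesis
  unfolding E_def[symmetric]
 proof (rule triangle_sides[OF tx ty tz])
  fix p q r s
  assume *: "distinct [p, q, r, s]" "?s {x, y} = {p, q}" "?s {x, z} = {p, r}" "?s {w, x} = {q, r}"
   "?s {y, z} = {p, s}" "?s {w, y} = {q, s}" "?s {w, z} = {r, s}"
  have "(UN e:E. ?s e) = {p, q, r, s}" unfolding E UN_insert UN_empty * by auto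
  with I have I: "I = {p, q, r, s}" by (rule trans)
  let ?Q = "(tetra p q r s)"
  have st: "stacked p q r s I ?Q {}" unfolding I by (rule stacked.base[OF *(1)])
  have c: "corner E I F x = {p, q, r}" "corner E I F y = {p, q, s}" "corner E I F z = {p, r, s}"
   "corner E I F w = {q, r, s}"
   unfolding cor * by auto
  have b1: "bij_betw (corner E I F) V (fst ` ?Q)"
  proof (rule bij_betw_imageI)
   have ne: "{p, q, r} ~= {p, q, s}" "{p, q, r} ~= {p, r, s}" "{p, q, r} ~= {q, r, s}"
    "{p, q, s} ~= {p, r, s}" "{p, q, s} ~= {q, r, s}" "{p, r, s} ~= {q, r, s}"
    using *(1) by auto
   show "inj_on (corner E I F) V" unfolding V inj_on_def using c ne by (simp add: eq_commute)
   show "corner E I F ` V = fst ` ?Q" unfolding V by (simp add: c insert_commute)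
  qed
  have b2: "bij_betw ?s E {{s, t} |s t. nbr ?Q s t}"
  proof (rule bij_betw_imageI)
   have dd: "p ~= q" "p ~= r" "p ~= s" "q ~= r" "q ~= s" "r ~= s" using *(1) by auto
   have "?s ` E = {{q, r}, {q, s}, {r, s}, {p, q}, {p, r}, {p, s}}" unfolding E by (simp add: *)
   then have "card (?s ` E) = 6" using dd dd[symmetric] by (simp add: doubleton_eq_iff)
   moreover have "card E = 6" unfolding E using d by (auto simp: doubleton_eq_iff card_insert_if)
   moreover have "finite E" unfolding E by simp
   ultimately show "inj_on ?s E" by (simp add: eq_card_imp_inj_on)
   have "?s ` E = {{q, r}, {q, s}, {r, s}, {p, q}, {p, r}, {p, s}}" unfolding E by (simp add: *)
   also have "\<dots> = {{s', t} |s' t. s' ~= t & s' : {p, q, r, s} & t : {p, q, r, s}}"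
   proof
    show "{{q, r}, {q, s}, {r, s}, {p, q}, {p, r}, {p, s}} <=
      {{s', t} |s' t. s' ~= t & s' : {p, q, r, s} & t : {p, q, r, s}}"
     using *(1) by auto
    show "{{s', t} |s' t. s' ~= t & s' : {p, q, r, s} & t : {p, q, r, s}} <=
      {{q, r}, {q, s}, {r, s}, {p, q}, {p, r}, {p, s}}"
    proof
     fix e assume "e : {{s', t} |s' t. s' ~= t & s' : {p, q, r, s} & t : {p, q, r, s}}"
     then obtain s' t where "e = {s', t}" "s' ~= t" "s' : {p, q, r, s}" "t : {p, q, r, s}" by blast
     then show "e : {{q, r}, {q, s}, {r, s}, {p, q}, {p, r}, {p, s}}"
      by (elim insertE emptyE) (simp_all add: insert_commute)
    qed
   qed
   finally show "?s ` E = {{s, t} |s t. nbr ?Q s t}" unfolding nbr_base[OF *(1)] .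
  qed
  have inc: "ALL u:V. ALL e:E. u : e \<longleftrightarrow> ?s e <= corner E I F u"
  proof (intro ballI)
   fix u e assume u: "u : V" and e: "e : E"
   have dd: "p ~= q" "p ~= r" "p ~= s" "q ~= r" "q ~= s" "r ~= s" "w ~= x" "w ~= y" "w ~= z" "x ~= y" "x ~= z" "y ~= z"
    using *(1) d by auto
   have *: "u = w & ?s e <= {q, r, s} | u = x & ?s e <= {p, q, r} | u = y & ?s e <= {p, q, s} |
     u = z & ?s e <= {p, r, s} \<longleftrightarrow> u : e"
    using e u unfolding E V by - (elim insertE emptyE; simp add: * dd dd[symmetric])
   show "u : e \<longleftrightarrow> ?s e <= corner E I F u"
    unfolding *[symmetric] using u dd unfolding V by - (elim insertE emptyE; simp add: c dd[symmetric])
  qed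
  have "card I = 4" unfolding I using *(1) by simp
  moreover have "realizes_stack V E I F ?Q" unfolding realizes_stack_def using b1 b2 inc by (intro conjI)
  ultimately show "card I <= 4 & (card I = 4 --> (EX a b c d Q S. stacked a b c d I Q S & realizes_stack V E I F Q))"
   using st by (metis order_refl)
 next
  \<comment> \<open>The three 4-cycles of the complete graph also cover each edge twice; they
    describe its embedding in the projective plane. There are only three of them, so the second
    claim is vacuous.\<close>
  fix p q r
  assume *: "distinct [p, q, r]" "?s {x, y} = {p, q}" "?s {x, z} = {p, r}" "?s {w, x} = {q, r}"
   "?s {y, z} = {q, r}" "?s {w, y} = {p, r}" "?s {w, z} = {p, q}"
  have "(UN e:E. ?s e) = {p, q, r}" unfolding E UN_insert UN_empty * by auto
  with I have I: "I = {p, q, r}" by (rule trans)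
  have "card I = 3" unfolding I using *(1) by simp
  then show "card I <= 4 & (card I = 4 --> (EX a b c d Q S. stacked a b c d I Q S & realizes_stack V E I F Q))"
   by simp
 qed
qed

text \<open>Contracting the triangle back to \<open>v\<close> identifies the old edges with their
  images under \<open>h\<close>, and the family is pulled back along \<open>h\<close>. A truncation
  adds two vertices, so the bound on the number of members rises by one; attaining it forces one
  member to be the triangle, and this member is the new face of the stack.\<close>

lemma truncation_stacked:
 assumes simp: "finite V" "finite E" "ALL e:E. e <= V & card e = 2"
  and v: "v : V" and Ev: "{e : E. v : e} = {{v, a}, {v, b}, {v, c}}"
  and abc: "distinct [a, b, c]" and xyz: "distinct [x, y, z]" "{x, y, z} Int (V - {v}) = {}"
  and V2: "V2 = (V - {v}) Un {x, y, z}"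
  and E2: "E2 = (E - {{v, a}, {v, b}, {v, c}}) Un {{a, x}, {b, y}, {c, z}, {x, y}, {y, z}, {x, z}}"
  and IH: "!!I F. face_family V E I F ==> 2 * card I <= card V + 4 &
   (2 * card I = card V + 4 --> (EX a b c d Q S. stacked a b c d I Q S & realizes_stack V E I F Q))"
  and ff: "face_family V2 E2 I F"
 shows "2 * card I <= card V2 + 4 &
   (2 * card I = card V2 + 4 --> (EX a b c d Q S. stacked a b c d I Q S & realizes_stack V2 E2 I F Q))"
proof -
 define R where "R = E - {{v, a}, {v, b}, {v, c}}"
 define T where "T = {{x, y}, {y, z}, {x, z}}"
 have vE: "{v, a} : E" "{v, b} : E" "{v, c} : E" using Ev by blast+
 then have abcV: "a : V - {v}" "b : V - {v}" "c : V - {v}"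
  using simp(3) by (auto simp: card_2_iff)
 have xyzV: "x ~: V - {v}" "y ~: V - {v}" "z ~: V - {v}" using xyz(2) by blast+
 have ne: "a ~= x" "a ~= y" "a ~= z" "b ~= x" "b ~= y" "b ~= z" "c ~= x" "c ~= y" "c ~= z"
  "v ~= a" "v ~= b" "v ~= c"
  using abcV xyzV by blast+
 have d: "a ~= b" "b ~= c" "a ~= c" "x ~= y" "y ~= z" "x ~= z" using abc xyz by auto
 have R: "e <= V - {v}" if "e : R" for e
  using that simp(3) Ev unfolding R_def by blast
 have Rxyz: "x ~: e" "y ~: e" "z ~: e" "v ~: e" if "e : R" for e using R[OF that] xyzV by blast+
 have E2': "E2 = R Un {{a, x}, {b, y}, {c, z}} Un T" unfolding E2 R_def T_def by auto
 have Ecases: "e = {v, a} | e = {v, b} | e = {v, c} | e : R" if "e : E" for e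
  using that unfolding R_def by blast
 define h where "h e = (if e = {v, a} then {a, x} else if e = {v, b} then {b, y}
  else if e = {v, c} then {c, z} else e)" for e
 have hva: "h {v, a} = {a, x}" and hvb: "h {v, b} = {b, y}" and hvc: "h {v, c} = {c, z}"
  unfolding h_def using d by (auto simp: doubleton_eq_iff)
 have hR: "h e = e" if "e : R" for e using that unfolding h_def R_def by auto
 have hE: "h ` E = R Un {{a, x}, {b, y}, {c, z}}"
 proof
  show "h ` E <= R Un {{a, x}, {b, y}, {c, z}}"
  proof
   fix f assume "f : h ` E"
   then obtain e where "e : E" "f = h e" by blast
   then show "f : R Un {{a, x}, {b, y}, {c, z}}"
    using Ecases[of e] by - (drule (1) meta_mp, elim disjE, simp_all add: hva hvb hvc hR)
  qed
  show "R Un {{a, x}, {b, y}, {c, z}} <= h ` E"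
  proof -
   have "R <= h ` E" using hR unfolding R_def by (metis DiffD1 image_eqI subsetI)
   moreover have "{a, x} : h ` E" "{b, y} : h ` E" "{c, z} : h ` E"
    using hva hvb hvc vE by (metis image_eqI)+
   ultimately show ?thesis by simp
  qed
 qed
 have NT: "{a, x} ~: T" "{b, y} ~: T" "{c, z} ~: T" unfolding T_def using ne by (simp_all add: doubleton_eq_iff)
 have RT: "e ~: T" if "e : R" for e using Rxyz[OF that] unfolding T_def by auto
 have hT: "h ` E Int T = {}" unfolding hE using NT RT by blast
 have NR: "{a, x} ~: R" "{b, y} ~: R" "{c, z} ~: R" using Rxyz by blast+
 have injh: "inj_on h E"
 proof (rule inj_onI)
  fix e e' assume e: "e : E" "e' : E" "h e = h e'"
  have n3: "{a, x} ~= {b, y}" "{a, x} ~= {c, z}" "{b, y} ~= {c, z}"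
   using ne d by (simp_all add: doubleton_eq_iff)
  show "e = e'"
   using Ecases[OF e(1)] Ecases[OF e(2)] e(3) n3 NR hva hvb hvc hR by metis
 qed
 have hinc: "u : h e \<longleftrightarrow> u : e" if "u : V - {v}" "e : E" for u e
 proof -
  have "u ~= x" "u ~= y" "u ~= z" "u ~= v" using that xyzV by blast+
  then show ?thesis using Ecases[OF that(2)] hva hvb hvc hR by auto
 qed
 have E2h: "E2 = h ` E Un T" unfolding hE E2' ..
 define F' where "F' i = {e : E. h e : F i}" for i
 \<comment> \<open>A member that pulls back to nothing consists of edges of the triangle
   only.\<close>
 define I' where "I' = {i : I. F' i ~= {}}"
 let ?s = "sides I F"
 have FE: "F i <= E2" "F i ~= {}" if "i : I" for i using ff that unfolding face_family_def by blast+
 have sides': "sides I' F' e = ?s (h e)" if "e : E" for e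
  using that unfolding sides_def I'_def F'_def by blast
 have degu: "card {e : F' i. u : e} = card {e : F i. u : e}" if "i : I" "u : V - {v}" for i u
 proof -
  have "u ~: e" if "e : T" for e using that xyzV \<open>u : V - {v}\<close> unfolding T_def by blast
  then have "{e : F i. u : e} = h ` {e : F' i. u : e}"
   using FE(1)[OF that(1)] hinc[OF that(2)] unfolding E2h F'_def by blast
  moreover have "inj_on h {e : F' i. u : e}"
   by (rule inj_on_subset[OF injh]) (auto simp: F'_def)
  ultimately show ?thesis by (simp add: card_image)
 qed
 have degv: "card {e : F' i. v : e} = of_bool (i : ?s {a, x}) + of_bool (i : ?s {b, y}) + of_bool (i : ?s {c, z})"
  if "i : I" for i
 proof -
  have "{e : F' i. v : e} = {e : {{v, a}, {v, b}, {v, c}}. h e : F i}"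
   unfolding Ev[symmetric] F'_def by blast
  also have "\<dots> = (if i : ?s {a, x} then {{v, a}} else {}) Un (if i : ?s {b, y} then {{v, b}} else {})
    Un (if i : ?s {c, z} then {{v, c}} else {})"
   using hva hvb hvc that unfolding sides_def by auto
  finally show ?thesis using d by (simp add: card_insert_if doubleton_eq_iff)
 qed
 \<comment> \<open>All conditions except the parity at \<open>v\<close> are inherited. That one is
   checked separately in each outcome of \<open>triangle_sides\<close>.\<close>
 have ff': "face_family V E I' F'"
  if "ALL i:I. of_bool (i : ?s {a, x}) + of_bool (i : ?s {b, y}) + of_bool (i : ?s {c, z}) : {0, 2::nat}"
  unfolding face_family_def
 proof (intro conjI ballI)
  show "finite I'" using ff unfolding face_family_def I'_def by simp
  fix i assume i: "i : I'"
  then have iI: "i : I" unfolding I'_def by blast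
  show "F' i <= E" "F' i ~= {}" using i unfolding F'_def I'_def by auto
  fix u assume u: "u : V"
  show "card {e : F' i. u : e} : {0, 2}"
  proof (cases "u = v")
   case True
   then show ?thesis using degv[OF iI] that iI by simp
  next
   case False
   then have u': "u : V - {v}" using u by simp
   have "card {e : F i. u : e} : {0, 2}" using ff iI u' unfolding face_family_def V2 by blast
   then show ?thesis unfolding degu[OF iI u'] .
  qed
 next
  fix e assume e: "e : E"
  then have "h e : E2" unfolding E2h by blast
  then have "card (?s (h e)) = 2" using ff unfolding face_family_def sides_def by blast
  then have "card (sides I' F' e) = 2" unfolding sides'[OF e] .
  then show "card {i : I'. e : F' i} = 2" unfolding sides_def .
 qed
 have I'I: "i : (?s {x, y} Un ?s {y, z} Un ?s {x, z}) - (?s {a, x} Un ?s {b, y} Un ?s {c, z})"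
  if iI: "i : I" "i ~: I'" for i
 proof -
  have "F' i = {}" using that unfolding I'_def by blast
  then have no: "e ~: F i" if "e : h ` E" for e using that unfolding F'_def by blast
  then obtain e where "e : F i" "e : T" using FE[OF iI(1)] unfolding E2h by blast
  moreover have "{a, x} ~: F i" "{b, y} ~: F i" "{c, z} ~: F i" using no unfolding hE by blast+
  ultimately show ?thesis using iI(1) unfolding sides_def T_def by blast
 qed
 have cardV2: "card V2 = card V + 2"
 proof -
  have "card V2 = card (V - {v}) + card {x, y, z}"
   unfolding V2 using simp xyz by (intro card_Un_disjoint) auto
  moreover have "card V > 0" using v simp by (auto simp: card_gt_0_iff)
  ultimately show ?thesis using v simp d by simp
 qed
 have Ex: "{e : E2. x : e} = {{a, x}, {x, y}, {x, z}}"
  and Ey: "{e : E2. y : e} = {{b, y}, {x, y}, {y, z}}"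
  and Ez: "{e : E2. z : e} = {{c, z}, {x, z}, {y, z}}"
  unfolding E2' T_def using Rxyz ne d by auto
 have xV: "x : V2" "y : V2" "z : V2" unfolding V2 by auto
 have tx: "tri3 (?s {a, x}) (?s {x, y}) (?s {x, z})"
  by (rule vertex_sides[OF ff xV(1) Ex]) (use d ne in \<open>simp add: doubleton_eq_iff\<close>)
 have ty: "tri3 (?s {b, y}) (?s {x, y}) (?s {y, z})"
  by (rule vertex_sides[OF ff xV(2) Ey]) (use d ne in \<open>simp add: doubleton_eq_iff\<close>)
 have tz: "tri3 (?s {c, z}) (?s {x, z}) (?s {y, z})"
  by (rule vertex_sides[OF ff xV(3) Ez]) (use d ne in \<open>simp add: doubleton_eq_iff\<close>)
 have finI: "finite I" using ff unfolding face_family_def by blast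
 show ?thesis
 proof (rule triangle_sides[OF tx ty tz])
  fix p q r
  assume *: "distinct [p, q, r]" "?s {x, y} = {p, q}" "?s {x, z} = {p, r}" "?s {a, x} = {q, r}"
   "?s {y, z} = {q, r}" "?s {b, y} = {p, r}" "?s {c, z} = {p, q}"
  have "face_family V E I' F'" by (rule ff') (use *(1) in \<open>auto simp: *\<close>)
  moreover have "I' = I" using I'I unfolding * by (auto simp: I'_def)
  ultimately have "2 * card I <= card V + 4" using IH by blast
  then show ?thesis using cardV2 by linarith
 next
  fix p q r s
  assume *: "distinct [p, q, r, s]" "?s {x, y} = {p, q}" "?s {x, z} = {p, r}" "?s {a, x} = {q, r}"
   "?s {y, z} = {p, s}" "?s {b, y} = {q, s}" "?s {c, z} = {r, s}"
  have f': "face_family V E I' F'" by (rule ff') (use *(1) in \<open>auto simp: *\<close>)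
  have pI: "p : I" using *(2) unfolding sides_def by blast
  have sub: "i = p" if "i : I" "i ~: I'" for i using I'I[OF that] unfolding * by blast
  have I'sub: "I' <= I" unfolding I'_def by blast
  show ?thesis
  \<comment> \<open>If \<open>p\<close> also has edges outside the triangle, the pulled back family
    is just as large, and the count stays strictly below the new maximum.\<close>
  proof (cases "p : I'")
   case True
   then have "I' = I" using sub I'sub by blast
   then have "2 * card I <= card V + 4" using IH[OF f'] by simp
   then show ?thesis using cardV2 by linarith
  next
   case p: False
   then have I: "I = insert p I'" using sub I'sub pI by blast
   have "finite I'" using finI I'sub finite_subset by blast
   then have cI: "card I = Suc (card I')" unfolding I using p by simp
   have "2 * card I <= card V2 + 4" using IH[OF f'] cI cardV2 by linarith
   moreover have "EX a b c d Q S. stacked a b c d I Q S & realizes_stack V2 E2 I F Q"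
    if "2 * card I = card V2 + 4"
   proof -
    have "2 * card I' = card V + 4" using that cI cardV2 by linarith
    then obtain a0 b0 c0 d0 Q S where st: "stacked a0 b0 c0 d0 I' Q S" and re: "realizes_stack V E I' F' Q"
     using IH[OF f'] by blast
    define C' where "C' = corner E I' F'"
    define K where "K = fst ` Q"
    define A where "A = {q, r, s}"
    have bC: "bij_betw C' V K" and bN: "bij_betw (sides I' F') E {{s, t} |s t. nbr Q s t}"
     and inc: "!!u e. u : V ==> e : E ==> u : e \<longleftrightarrow> sides I' F' e <= C' u"
     using re unfolding realizes_stack_def C'_def K_def by blast+
    have "C' v = ?s {a, x} Un ?s {b, y} Un ?s {c, z}"
     unfolding C'_def corner_def Ev using vE by (simp add: sides' hva hvb hvc Un_assoc)
    then have C'v: "C' v = A" unfolding * A_def by auto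
    then have "A : K" using bC v by (metis bij_betwE)
    then obtain l where l: "(A, l) : Q" unfolding K_def by force
    define Q2 where "Q2 = cut Q q r s l p"
    have st2: "stacked a0 b0 c0 d0 I Q2 (insert (q, r, s, l, p) S)"
     unfolding Q2_def I by (rule stacked.step[OF st]) (use l *(1) p in \<open>auto simp: A_def\<close>)
    have K2: "fst ` Q2 = (K - {A}) Un (new_tris q r s p)"
     unfolding Q2_def K_def A_def by (rule stacked_step_tris[OF st l[unfolded A_def] p])
    have nb2: "nbr Q2 s' t \<longleftrightarrow> nbr Q s' t | (s' = p & t : A) | (t = p & s' : A)" for s' t
     unfolding Q2_def A_def by (rule nbr_step[OF st l[unfolded A_def] p]) (use *(1) in auto)
    let ?C = "corner E2 I F"
    have Cx: "?C x = {q, r, p}" "?C y = {q, s, p}" "?C z = {r, s, p}"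
     unfolding corner_def Ex Ey Ez by (auto simp: *)
    have Cu: "?C u = C' u" if "u : V - {v}" for u
    proof -
     have "u ~: e" if "e : T" for e using that xyzV \<open>u : V - {v}\<close> unfolding T_def by blast
     then have "{e : E2. u : e} = h ` {e : E. u : e}"
      using hinc[OF that] unfolding E2h by blast
     then show ?thesis unfolding corner_def C'_def by (simp add: sides')
    qed
    have KI: "B <= I'" if "B : K" for B using that stacked_tri[OF st] unfolding K_def by force
    have nbI: "s' : I'" "t : I'" if "nbr Q s' t" for s' t using nbr_in[OF st that] by blast+
    have b1: "bij_betw ?C V2 (fst ` Q2)"
     unfolding V2 K2
    proof (rule bij_betw_combine)
     have "C' ` (V - {v}) = K - {A}"
      using bC v C'v by (simp add: bij_betw_def inj_on_image_set_diff[where C = V])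
     then have "bij_betw C' (V - {v}) (K - {A})"
      using bC by (auto simp: bij_betw_def intro: inj_on_subset)
     then show "bij_betw ?C (V - {v}) (K - {A})"
      using bij_betw_cong[of "V - {v}" ?C C'] Cu by blast
     have n3: "{q, r, p} ~= {r, s, p}" "{q, r, p} ~= {q, s, p}" "{r, s, p} ~= {q, s, p}"
      using *(1) by auto
     show "bij_betw ?C {x, y, z} (new_tris q r s p)"
      unfolding bij_betw_def inj_on_def using d n3 by (auto simp: Cx)
     show "(K - {A}) Int (new_tris q r s p) = {}"
      using KI p by blast
    qed
    have b2: "bij_betw ?s E2 {{s, t} |s t. nbr Q2 s t}"
    proof -
     have "{{s, t} |s t. nbr Q2 s t} = {{s, t} |s t. nbr Q s t} Un {{p, q}, {p, r}, {p, s}}"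
      unfolding nb2 A_def by (auto simp: insert_commute)
     moreover have "bij_betw ?s (h ` E Un T) ({{s, t} |s t. nbr Q s t} Un {{p, q}, {p, r}, {p, s}})"
     proof (rule bij_betw_combine)
      have "bij_betw h E (h ` E)" using injh by (simp add: bij_betw_imageI)
      moreover have "bij_betw (?s \<circ> h) E {{s, t} |s t. nbr Q s t}"
       using bN bij_betw_cong[of E "sides I' F'" "?s \<circ> h"] sides' by simp
      ultimately show "bij_betw ?s (h ` E) {{s, t} |s t. nbr Q s t}"
       by (simp add: bij_betw_comp_iff)
      show "bij_betw ?s T {{p, q}, {p, r}, {p, s}}"
       unfolding bij_betw_def inj_on_def T_def using *(1) by (auto simp: * doubleton_eq_iff)
      show "{{s, t} |s t. nbr Q s t} Int {{p, q}, {p, r}, {p, s}} = {}"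
       using nbI p by (auto simp: doubleton_eq_iff)
     qed
     ultimately show ?thesis unfolding E2h by simp
    qed
    have NI: "?s (h e) <= I'" if "e : E" for e using sides'[OF that] unfolding sides_def by blast
    have pT: "p : ?s e" if "e : T" for e using that unfolding T_def by (auto simp: *)
    have injN: "e = e'" if "e : E2" "e' : E2" "?s e = ?s e'" for e e'
     using b2 that by (meson bij_betw_imp_inj_on inj_onD)
    have inE2: "{a, x} : E2" "{b, y} : E2" "{c, z} : E2" unfolding E2 by auto
    have c2: "card (?s e) = 2" if "e : E2" for e
     using ff that unfolding face_family_def sides_def by blast
    have old: "?s e <= insert p B \<longleftrightarrow> e = f"
     if "e : h ` E" "f : E2" "?s f = B" "p ~: B" "card B = 2" for e f B
    proof
     assume "?s e <= insert p B"
     then have "?s e <= B" using NI that(1) p by blast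
     moreover have "card (?s e) = 2" using c2 that(1) unfolding E2h by blast
     ultimately have "?s e = B" using that(5) by (metis card_subset_eq card.infinite zero_neq_numeral)
     then show "e = f" using injN that unfolding E2h by blast
    qed (use that in auto)
    have inc2: "u : e \<longleftrightarrow> ?s e <= ?C u" if u: "u : V2" and e: "e : E2" for u e
    proof (cases "u : V - {v}")
     case True
     show ?thesis
     proof (cases "e : T")
      case eT: True
      have "u ~: e" using eT True xyzV unfolding T_def by blast
      moreover have "C' u <= I'" using bC KI True by (metis DiffD1 bij_betwE)
      ultimately show ?thesis using pT[OF eT] p unfolding Cu[OF True] by blast
     next
      case False
      then obtain e0 where e0: "e0 : E" "e = h e0" using e unfolding E2h by blast
      then show ?thesis using hinc[OF True] inc[OF _ e0(1)] True sides'[OF e0(1)] Cu[OF True]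
       by (metis DiffD1)
     qed
    next
     case False
     then have u: "u = x | u = y | u = z" using u unfolding V2 by blast
     show ?thesis
     proof (cases "e : T")
      case True
      have dd: "p ~= q" "p ~= r" "p ~= s" "q ~= r" "q ~= s" "r ~= s" using *(1) by auto
      from True have "e = {x, y} | e = {y, z} | e = {x, z}" unfolding T_def by blast
      then show ?thesis using u d dd dd[symmetric] by (elim disjE) (simp_all add: Cx *)
     next
      case False
      then have eh: "e : h ` E" using e unfolding E2h by blast
      have xe: "x : e \<longleftrightarrow> e = {a, x}" "y : e \<longleftrightarrow> e = {b, y}" "z : e \<longleftrightarrow> e = {c, z}"
       using eh Rxyz ne d unfolding hE by auto
      have "?s e <= insert p {q, r} \<longleftrightarrow> e = {a, x}" "?s e <= insert p {q, s} \<longleftrightarrow> e = {b, y}"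
       "?s e <= insert p {r, s} \<longleftrightarrow> e = {c, z}"
       by (rule old[OF eh]; use inE2 *(1) in \<open>simp add: *\<close>)+
      moreover have "?C x = insert p {q, r}" "?C y = insert p {q, s}" "?C z = insert p {r, s}"
       unfolding Cx by auto
      ultimately show ?thesis using u xe by (elim disjE) simp_all
     qed
    qed
    show ?thesis
     using st2 b1 b2 inc2 unfolding realizes_stack_def by blast
   qed
   ultimately show ?thesis by blast
  qed
 qed
qed

text \<open>For a trivalent graph the bound says that the Euler characteristic is at most 2, and
  equality is the spherical case. Keeping the inequality for all families makes the induction over
  truncations possible.\<close>

lemma ecimahedron_stacked:
 "ecimahedron V E ==> face_family V E I F ==>
  2 * card I <= card V + 4 &
  (2 * card I = card V + 4 --> (EX a b c d Q S. stacked a b c d I Q S & realizes_stack V E I F Q))"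
proof (induction arbitrary: I F rule: ecimahedron.induct)
 case (K4 V)
 then show ?case using K4_stacked[OF K4] by simp
next
 case (truncation V E v a b c x y z)
 show ?case
  by (rule truncation_stacked[OF _ _ _ truncation(2-6) refl refl truncation.IH truncation.prems])
   (use ecimahedron_simple[OF truncation(1)] in auto)
qed

subsection \<open>Truncated cones\<close>

text \<open>The matrix of pairings is triangular with nonzero diagonal, so the four forms are
  independent and have no common zero.\<close>

lemma frame_from_dual:
 fixes p1 p2 p3 p4 :: "real^4"
 assumes d: "p1 .* x1 ~= 0" "p2 .* x2 ~= 0" "p3 .* x3 ~= 0" "p4 .* x4 ~= 0"
  and z: "p1 .* x2 = 0" "p1 .* x3 = 0" "p1 .* x4 = 0" "p2 .* x3 = 0" "p2 .* x4 = 0" "p3 .* x4 = 0"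
   "p2 .* x1 = 0" "p3 .* x1 = 0" "p3 .* x2 = 0"
  and y: "p1 .* y = 0" "p2 .* y = 0" "p3 .* y = 0" "p4 .* y = 0"
 shows "y = 0"
proof -
 have ne: "p1 ~= p2" "p1 ~= p3" "p1 ~= p4" "p2 ~= p3" "p2 ~= p4" "p3 ~= p4"
  using d z by auto
 have "independent {p1, p2, p3, p4}"
  unfolding independent_explicit
 proof (intro conjI allI impI)
  fix u :: "real^4 => real"
  assume "(SUM v:{p1, p2, p3, p4}. u v *\<^sub>R v) = 0"
  then have s: "u p1 *\<^sub>R p1 + u p2 *\<^sub>R p2 + u p3 *\<^sub>R p3 + u p4 *\<^sub>R p4 = 0"
   using ne by (simp add: add.assoc)
  have i: "u p1 * (p1 .* x) + u p2 * (p2 .* x) + u p3 * (p3 .* x) + u p4 * (p4 .* x) = 0" for x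
   using arg_cong[OF s, of "%w. w .* x"] by (simp add: inner_add_left)
  have u4: "u p4 = 0" using i[of x4] z d by simp
  have u3: "u p3 = 0" using i[of x3] z d u4 by simp
  have u2: "u p2 = 0" using i[of x2] z d u4 u3 by simp
  have "u p1 = 0" using i[of x1] z d u4 u3 u2 by simp
  then show "ALL v:{p1, p2, p3, p4}. u v = 0" using u2 u3 u4 by simp
 qed simp
 moreover have "card {p1, p2, p3, p4} = 4" using ne by simp
 ultimately have "UNIV <= span {p1, p2, p3, p4}"
  by (intro card_ge_dim_independent) auto
 then have "y : span {p1, p2, p3, p4}" by blast
 then have "orthogonal y y"
  by (rule orthogonal_to_span) (use y in \<open>auto simp: orthogonal_def inner_commute\<close>)
 then show ?thesis by (simp add: orthogonal_def)
qed

definition vertex_at :: "nat set => (nat => real^4) => nat set => real^4 => bool" where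
 "vertex_at F al T q \<longleftrightarrow> (ALL s:T. al s .* q = 0) & (ALL s:F - T. al s .* q < 0)"

lemma vertex_at_zero: "vertex_at F al T q ==> s : T ==> al s .* q = 0"
 and vertex_at_neg: "vertex_at F al T q ==> s : F ==> s ~: T ==> al s .* q < 0"
 unfolding vertex_at_def by blast+

text \<open>One ray for each vertex triple, active on exactly these faces, already pins down the
  combinatorial type of the cone; see \<open>codim_face_iff\<close>.\<close>

definition shaped :: "nat set => (nat set \<times> nat) set => (nat => real^4) => bool" where
 "shaped F Q al \<longleftrightarrow> (ALL T : fst ` Q. EX q. vertex_at F al T q)"

lemma shapedE:
 assumes "shaped F Q al" "T : fst ` Q"
 obtains q where "!!s. s : T ==> al s .* q = 0" "!!s. s : F ==> s ~: T ==> al s .* q < 0"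
proof -
 obtain q where "vertex_at F al T q" using assms unfolding shaped_def by blast
 then show thesis using that unfolding vertex_at_def by blast
qed

text \<open>\<open>q\<close> is the vertex that was cut off, and \<open>bi\<close> is the new vertex
  off the face \<open>i\<close>, on the edge where \<open>j\<close> and \<open>k\<close> meet;
  likewise \<open>bj\<close> and \<open>bk\<close>.\<close>

definition cut_basis :: "nat set => (nat => real^4) => nat => nat => nat => nat =>
  real^4 => real^4 => real^4 => real^4 => bool" where
 "cut_basis F al i j k m q bi bj bk \<longleftrightarrow> vertex_at F al {i, j, k} q & al m .* q > 0 &
  vertex_at (insert m F) al {j, k, m} bi & vertex_at (insert m F) al {i, k, m} bj &
  vertex_at (insert m F) al {i, j, m} bk &
  (ALL x. EX ga. x = (al i .* x / (al i .* bi)) *\<^sub>R bi + (al j .* x / (al j .* bj)) *\<^sub>R bj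
   + (al k .* x / (al k .* bk)) *\<^sub>R bk + ga *\<^sub>R q)"

lemma cut_basisD:
 assumes "cut_basis F al i j k m q bi bj bk"
 shows "vertex_at F al {i, j, k} q" "al m .* q > 0"
  "vertex_at (insert m F) al {j, k, m} bi" "vertex_at (insert m F) al {i, k, m} bj"
  "vertex_at (insert m F) al {i, j, m} bk"
  "EX ga. x = (al i .* x / (al i .* bi)) *\<^sub>R bi + (al j .* x / (al j .* bj)) *\<^sub>R bj
   + (al k .* x / (al k .* bk)) *\<^sub>R bk + ga *\<^sub>R q"
 using assms unfolding cut_basis_def by blast+

lemma stacked_tri_card: "stacked a b c d F Q S ==> T : fst ` Q ==> T <= F & card T = 3"
 using stacked_tri by fastforce

text \<open>The three vertices around the new face and the old vertex that it cuts off form a basis.\<close>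

lemma corner_basis:
 fixes al :: "nat => real^4"
 assumes q: "q ~= 0" "al i .* q = 0" "al j .* q = 0" "al k .* q = 0"
  and bk: "al i .* bk = 0" "al j .* bk = 0" "al k .* bk < 0"
  and bi: "al i .* bi < 0" "al j .* bi = 0" "al k .* bi = 0"
  and bj: "al i .* bj = 0" "al j .* bj < 0" "al k .* bj = 0"
 shows "EX ga. x = (al i .* x / (al i .* bi)) *\<^sub>R bi + (al j .* x / (al j .* bj)) *\<^sub>R bj
  + (al k .* x / (al k .* bk)) *\<^sub>R bk + ga *\<^sub>R q"
proof -
 define y where "y = x - ((al i .* x / (al i .* bi)) *\<^sub>R bi + (al j .* x / (al j .* bj)) *\<^sub>R bj
  + (al k .* x / (al k .* bk)) *\<^sub>R bk)"
 define w where "w = y - (q .* y / (q .* q)) *\<^sub>R q"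
 have y: "al i .* y = 0" "al j .* y = 0" "al k .* y = 0"
  unfolding y_def using bk bi bj by (simp_all add: inner_diff_right inner_add_right)
 have w: "al i .* w = 0" "al j .* w = 0" "al k .* w = 0" "q .* w = 0"
  unfolding w_def using q y by (simp_all add: inner_diff_right)
 have qq: "q .* q ~= 0" using q by simp
 have "w = 0"
 proof -
  define proj where "proj z = z - (q .* z / (q .* q)) *\<^sub>R q" for z
  have pr: "al i .* proj z = al i .* z" "al j .* proj z = al j .* z" "al k .* proj z = al k .* z" "q .* proj z = 0" for z
   unfolding proj_def using q by (simp_all add: inner_diff_right)
  show ?thesis
   by (rule frame_from_dual[of "al i" "proj bi" "al j" "proj bj" "al k" "proj bk" q q])
    (use pr bk bi bj q w qq in \<open>simp_all\<close>)
 qed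
 then obtain ga where "y = ga *\<^sub>R q" unfolding w_def by auto
 then show ?thesis unfolding y_def by (intro exI[of _ ga]) (simp add: diff_eq_eq add.commute)
qed

lemma kernel3_exists:
 fixes p1 p2 p3 :: "real^4"
 shows "EX q. q ~= 0 & p1 .* q = 0 & p2 .* q = 0 & p3 .* q = 0"
proof -
 have "dim {p1, p2, p3} <= card {p1, p2, p3}" by (rule dim_le_card') simp
 also have "\<dots> <= 3" by (simp add: card_insert_if)
 finally have "dim {p1, p2, p3} < DIM(real^4)" by simp
 then obtain q where "q ~= 0" "!!y. y : span {p1, p2, p3} ==> orthogonal q y"
  using orthogonal_to_subspace_exists by blast
 then show ?thesis by (metis insertI1 insertI2 orthogonal_def inner_commute span_base)
qed

text \<open>The vertex that was cut off spans the common kernel of \<open>al i\<close>,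
  \<open>al j\<close>, \<open>al k\<close>. Its sign is fixed by \<open>al m .* q > 0\<close>, and
  it must be shown to satisfy the remaining inequalities.\<close>

lemma truncation_geometry:
 fixes al :: "nat => real^4"
 assumes st: "stacked a b c d F Q S" and Tl: "({i, j, k}, l) : Q" and ijk: "distinct [i, j, k]"
  and m: "m ~: F"
  and sh: "shaped (insert m F)
   (cut Q i j k l m) al"
 shows "EX q bi bj bk. cut_basis F al i j k m q bi bj bk"
proof -
 let ?Q = "cut Q i j k l m"
 have st2: "stacked a b c d (insert m F) ?Q (insert (i, j, k, l, m) S)"
  by (rule stacked.step[OF st Tl ijk m])
 have K: "fst ` ?Q = (fst ` Q - {{i, j, k}}) Un (new_tris i j k m)"
  by (rule stacked_step_tris[OF st Tl m])
 have in_F: "i : F" "j : F" "k : F" "l : F" "l ~: {i, j, k}" using stacked_tri[OF st Tl] by auto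
 then have nm: "i ~= m" "j ~= m" "k ~= m" "l ~= m" using m by auto
 obtain bk where bk: "vertex_at (insert m F) al {i, j, m} bk"
  using sh unfolding shaped_def K by blast
 obtain bi where bi: "vertex_at (insert m F) al {j, k, m} bi"
  using sh unfolding shaped_def K by blast
 obtain bj where bj: "vertex_at (insert m F) al {i, k, m} bj"
  using sh unfolding shaped_def K by blast
 note b = bk[unfolded vertex_at_def] bi[unfolded vertex_at_def] bj[unfolded vertex_at_def]
 have bk': "al i .* bk = 0" "al j .* bk = 0" "al k .* bk < 0" "al m .* bk = 0"
  using b in_F nm ijk by auto
 have bi': "al i .* bi < 0" "al j .* bi = 0" "al k .* bi = 0" "al m .* bi = 0"
  using b in_F nm ijk by auto
 have bj': "al i .* bj = 0" "al j .* bj < 0" "al k .* bj = 0" "al m .* bj = 0"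
  using b in_F nm ijk by auto
 have bneg: "al s .* bi < 0" "al s .* bj < 0" "al s .* bk < 0" if "s : F" "s ~: {i, j, k}" for s
  using b that m by auto
 obtain q0 where q0: "q0 ~= 0" "al i .* q0 = 0" "al j .* q0 = 0" "al k .* q0 = 0"
  using kernel3_exists by blast
 note basis0 = corner_basis[OF q0 bk'(1-3) bi'(1-3) bj'(1-3)]
 have "al m .* q0 ~= 0"
 proof
  assume 0: "al m .* q0 = 0"
  obtain T where T: "T : fst ` ?Q" "m ~: T"
   using stacked_face_avoid[OF st2, of l m] in_F nm by auto
  obtain x where x: "al m .* x < 0"
   by (rule shapedE[OF sh T(1)]) (use T in blast)
  obtain ga where "x = (al i .* x / (al i .* bi)) *\<^sub>R bi + (al j .* x / (al j .* bj)) *\<^sub>R bj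
   + (al k .* x / (al k .* bk)) *\<^sub>R bk + ga *\<^sub>R q0" using basis0 by blast
  from arg_cong[OF this, of "%w. al m .* w"] have "al m .* x = 0"
   using 0 bk' bi' bj' by (simp add: inner_add_right)
  then show False using x by simp
 qed
 define q where "q = sgn (al m .* q0) *\<^sub>R q0"
 have q: "q ~= 0" "al i .* q = 0" "al j .* q = 0" "al k .* q = 0" "al m .* q > 0"
  using q0 \<open>al m .* q0 ~= 0\<close> unfolding q_def by (auto simp: sgn_real_def)
 note basis = corner_basis[OF q(1-4) bk'(1-3) bi'(1-3) bj'(1-3)]
 \<comment> \<open>Otherwise expand a vertex \<open>x\<close> on the face \<open>s\<close> in the
   basis: the terms of \<open>al s .* x\<close> are all nonpositive and add up to zero, so the
   coefficients of the three new vertices vanish. Then \<open>x\<close> lies on \<open>i\<close>,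
   \<open>j\<close> and \<open>k\<close>, which leaves no room for \<open>s\<close>.\<close>
 have "al s .* q < 0" if s: "s : F" "s ~: {i, j, k}" for s
 proof (rule ccontr)
  assume neg: "~ al s .* q < 0"
  obtain T where T: "T : fst ` ?Q" "s : T"
   using stacked_face_tri[OF st2, of s] s by blast
  have cT: "card T = 3" "T <= insert m F" using stacked_tri_card[OF st2 T(1)] by blast+
  have "T ~= {i, j, k}"
   using T s by auto
  obtain x where x: "!!s. s : T ==> al s .* x = 0" "!!s. s : insert m F ==> s ~: T ==> al s .* x < 0"
   by (rule shapedE[OF sh T(1)]) blast
  have xle: "al s .* x <= 0" if "s : insert m F" for s using x that by (cases "s : T") (auto simp: less_imp_le)
  define ui where "ui = al i .* x / (al i .* bi)"
  define uj where "uj = al j .* x / (al j .* bj)"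
  define uk where "uk = al k .* x / (al k .* bk)"
  have u: "ui >= 0" "uj >= 0" "uk >= 0"
   unfolding ui_def uj_def uk_def using xle in_F bi'(1) bj'(2) bk'(3) by (simp_all add: divide_nonpos_neg)
  obtain ga where g: "x = ui *\<^sub>R bi + uj *\<^sub>R bj + uk *\<^sub>R bk + ga *\<^sub>R q"
   using basis[of x] unfolding ui_def uj_def uk_def by blast
  from arg_cong[OF g, of "%w. al m .* w"] have "al m .* x = ga * (al m .* q)"
   using bk' bi' bj' by (simp add: inner_add_right)
  then have "ga * (al m .* q) <= 0" using xle[of m] by simp
  then have g0: "ga <= 0" using q(5) by (simp add: mult_le_0_iff)
  from arg_cong[OF g, of "%w. al s .* w"] x(1)[OF T(2)]
  have 0: "ui * (al s .* bi) + uj * (al s .* bj) + uk * (al s .* bk) + ga * (al s .* q) = 0"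
   by (simp add: inner_add_right)
  have t: "ui * (al s .* bi) <= 0" "uj * (al s .* bj) <= 0" "uk * (al s .* bk) <= 0" "ga * (al s .* q) <= 0"
   using u bneg[OF s] g0 neg by (auto intro: mult_nonneg_nonpos mult_nonpos_nonneg less_imp_le)
  then have "ui * (al s .* bi) = 0" "uj * (al s .* bj) = 0" "uk * (al s .* bk) = 0" using 0 by linarith+
  then have "ui = 0" "uj = 0" "uk = 0" using bneg[OF s] by auto
  then have "al i .* x = 0" "al j .* x = 0" "al k .* x = 0"
   using bi'(1) bj'(2) bk'(3) unfolding ui_def uj_def uk_def by auto
  then have "{i, j, k} <= T" using x(2) in_F by force
  moreover have "finite T" using cT by (metis card.infinite zero_neq_numeral)
  ultimately have "{i, j, k} = T" using cT ijk by (intro card_subset_eq) auto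
  then show False using \<open>T ~= {i, j, k}\<close> by simp
 qed
 then have "vertex_at F al {i, j, k} q" unfolding vertex_at_def using q by auto
 then have "cut_basis F al i j k m q bi bj bk"
  unfolding cut_basis_def using q(5) bi bj bk basis by (intro conjI allI)
 then show ?thesis by blast
qed

lemma shaped_truncation:
 assumes st: "stacked a b c d F Q S" and Tl: "({i, j, k}, l) : Q" and ijk: "distinct [i, j, k]"
  and m: "m ~: F"
  and sh: "shaped (insert m F)
   (cut Q i j k l m) al"
 shows "shaped F Q al"
 unfolding shaped_def
proof
 fix T assume T: "T : fst ` Q"
 show "EX q. vertex_at F al T q"
 proof (cases "T = {i, j, k}")
  case True
  then show ?thesis using truncation_geometry[OF assms] cut_basisD(1) by blast
 next
  case False
  then have "T : (fst ` Q - {{i, j, k}}) Un (new_tris i j k m)" using T by simp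
  then obtain q where "vertex_at (insert m F) al T q"
   using bspec[OF sh[unfolded shaped_def stacked_step_tris[OF st Tl m]]] by blast
  then show ?thesis unfolding vertex_at_def by blast
 qed
qed

lemma shaped_base_frame:
 assumes "distinct [a, b, c, d]"
  and "shaped {a, b, c, d} (tetra a b c d) al"
  and x: "ALL s:{a, b, c, d}. al s .* x = 0"
 shows "x = 0"
proof -
 have *: "EX q. vertex_at {a, b, c, d} al T q" if "T : {{b, c, d}, {a, c, d}, {a, b, d}, {a, b, c}}" for T
  using assms(2)[unfolded shaped_def image_insert fst_conv image_empty] that by (rule bspec)
 obtain qa qb qc qd where q: "vertex_at {a, b, c, d} al {b, c, d} qa" "vertex_at {a, b, c, d} al {a, c, d} qb"
  "vertex_at {a, b, c, d} al {a, b, d} qc" "vertex_at {a, b, c, d} al {a, b, c} qd"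
  using *[of "{b, c, d}"] *[of "{a, c, d}"] *[of "{a, b, d}"] *[of "{a, b, c}"] by auto
 have z: "al b .* qa = 0" "al c .* qa = 0" "al d .* qa = 0" "al a .* qb = 0" "al c .* qb = 0" "al d .* qb = 0"
  "al a .* qc = 0" "al b .* qc = 0" "al d .* qc = 0" "al a .* qd = 0" "al b .* qd = 0" "al c .* qd = 0"
  by (simp_all add: vertex_at_zero[OF q(1)] vertex_at_zero[OF q(2)] vertex_at_zero[OF q(3)] vertex_at_zero[OF q(4)])
 have n: "al a .* qa < 0" "al b .* qb < 0" "al c .* qc < 0" "al d .* qd < 0"
  using assms(1)
  by (simp_all add: vertex_at_neg[OF q(1)] vertex_at_neg[OF q(2)] vertex_at_neg[OF q(3)] vertex_at_neg[OF q(4)])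
 show ?thesis
  by (rule frame_from_dual[of "al a" qa "al b" qb "al c" qc "al d" qd]) (use z n x in simp_all)
qed

lemma shaped_frames:
 "stacked a b c d F Q S ==> shaped F Q al ==> (T, l) : Q ==> (ALL s:insert l T. al s .* x = 0) ==> x = 0"
proof (induction arbitrary: T l x rule: stacked.induct)
 case base
 have "insert l T = {a, b, c, d}" using base.prems(2) by auto
 then show ?case using shaped_base_frame[OF base(1,2)] base.prems(3) by simp
next
 case (step F Q S i j k l0 m T l x)
 have sh: "shaped F Q al" by (rule shaped_truncation[OF step(1-4) step.prems(1)])
 show ?case
 proof (cases "(T, l) : Q")
  case True
  then show ?thesis using step.IH[OF sh] step.prems by blast
 next
  case False
  then have il: "insert l T = {i, j, k, m}" using step.prems(2) by auto
  obtain q bi bj bk where cb: "cut_basis F al i j k m q bi bj bk"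
   using truncation_geometry[OF step(1-4) step.prems(1)] by blast
  note g = cut_basisD[OF cb]
  have x: "al i .* x = 0" "al j .* x = 0" "al k .* x = 0" "al m .* x = 0" using step.prems(3) il by auto
  then obtain ga where "x = ga *\<^sub>R q" using g(6)[of x] by auto
  then show ?thesis using x(4) g(2) by simp
 qed
qed

text \<open>This is simplicity of the polyhedron. On the new face a point is a nonnegative
  combination of \<open>bi\<close>, \<open>bj\<close>, \<open>bk\<close>, so it lies on no further
  face; off the new face the induction hypothesis applies, and the vertex that was cut off no longer
  belongs to the cone.\<close>

lemma shaped_active:
 "stacked a b c d F Q S ==> shaped F Q al ==> x ~= 0 ==> (ALL s:F. al s .* x <= 0) ==>
  EX T : fst ` Q. ALL s:F. al s .* x = 0 --> s : T"
proof (induction rule: stacked.induct)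
 case base
 then obtain t where t: "t : {a, b, c, d}" "al t .* x ~= 0" using shaped_base_frame[OF base(1,2)] by blast
 have "{a, b, c, d} - {t} : {{b, c, d}, {a, c, d}, {a, b, d}, {a, b, c}}"
  using t base(1) by (intro triples_of_four) auto
 then show ?case unfolding image_insert fst_conv image_empty
  by (rule rev_bexI) (use t in auto)
next
 case (step F Q S i j k l m)
 have sh: "shaped F Q al" by (rule shaped_truncation[OF step(1-4) step.prems(1)])
 note K = stacked_step_tris[OF step(1,2,4)]
 have in_F: "i : F" "j : F" "k : F" "l : F" "l ~: {i, j, k}" using stacked_tri[OF step(1,2)] by auto
 obtain q bi bj bk where cb: "cut_basis F al i j k m q bi bj bk"
   using truncation_geometry[OF step(1-4) step.prems(1)] by blast
  note g = cut_basisD[OF cb]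
 note b = g(3-5)[unfolded vertex_at_def]
 obtain ga where gam: "x = (al i .* x / (al i .* bi)) *\<^sub>R bi + (al j .* x / (al j .* bj)) *\<^sub>R bj
  + (al k .* x / (al k .* bk)) *\<^sub>R bk + ga *\<^sub>R q" using g(6) by blast
 have nm: "i ~= m" "j ~= m" "k ~= m" using in_F step(4) by auto
 have all: "ALL s:insert m F. al s .* x = 0 --> s : {i, j, k, m}" if "al m .* x = 0"
 proof (intro ballI impI)
  fix s assume s: "s : insert m F" "al s .* x = 0"
  show "s : {i, j, k, m}"
  proof (rule ccontr)
   assume n: "s ~: {i, j, k, m}"
   have bm: "al m .* bi = 0" "al m .* bj = 0" "al m .* bk = 0" using b by auto
   have neg: "al i .* bi < 0" "al j .* bj < 0" "al k .* bk < 0"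
    using b in_F nm step(3) by auto
   have sneg: "al s .* bi < 0" "al s .* bj < 0" "al s .* bk < 0" using b s n by auto
   from arg_cong[OF gam, of "%w. al m .* w"] have "ga * (al m .* q) = 0"
    using that bm by (simp add: inner_add_right)
   then have "ga = 0" using g(2) by simp
   define ui uj uk where "ui = al i .* x / (al i .* bi)" and "uj = al j .* x / (al j .* bj)"
    and "uk = al k .* x / (al k .* bk)"
   have xx: "x = ui *\<^sub>R bi + uj *\<^sub>R bj + uk *\<^sub>R bk" using gam \<open>ga = 0\<close> unfolding ui_def uj_def uk_def by simp
   have u: "ui >= 0" "uj >= 0" "uk >= 0"
    unfolding ui_def uj_def uk_def using step.prems(3) in_F neg by (simp_all add: divide_nonpos_neg)
   from arg_cong[OF xx, of "%w. al s .* w"]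
   have 0: "ui * (al s .* bi) + uj * (al s .* bj) + uk * (al s .* bk) = 0"
    using s by (simp add: inner_add_right)
   have t: "ui * (al s .* bi) <= 0" "uj * (al s .* bj) <= 0" "uk * (al s .* bk) <= 0"
    using u sneg by (auto intro: mult_nonneg_nonpos less_imp_le)
   then have "ui * (al s .* bi) = 0" "uj * (al s .* bj) = 0" "uk * (al s .* bk) = 0" using 0 by linarith+
   then have "ui = 0" "uj = 0" "uk = 0" using sneg by auto
   then show False using xx step.prems(2) by simp
  qed
 qed
 show ?case
 proof (cases "al m .* x = 0")
  case True
  have "~ (al i .* x = 0 & al j .* x = 0 & al k .* x = 0)"
  proof
   assume "al i .* x = 0 & al j .* x = 0 & al k .* x = 0"
   then have "x = ga *\<^sub>R q" using gam by simp
   then show False using True g(2) step.prems(2) by auto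
  qed
  then obtain B where "B : (new_tris i j k m)" "ALL s:insert m F. al s .* x = 0 --> s : B"
  proof -
   assume *: "!!B. B : (new_tris i j k m) ==> ALL s:insert m F. al s .* x = 0 --> s : B ==> thesis"
   assume "~ (al i .* x = 0 & al j .* x = 0 & al k .* x = 0)"
   then consider "al i .* x ~= 0" | "al j .* x ~= 0" | "al k .* x ~= 0" by blast
   then show thesis
   proof cases
    case 1 then show thesis using *[of "{j, k, m}"] all[OF True] by auto
   next
    case 2 then show thesis using *[of "{i, k, m}"] all[OF True] by auto
   next
    case 3 then show thesis using *[of "{i, j, m}"] all[OF True] by auto
   qed
  qed
  then show ?thesis unfolding K by (intro bexI[of _ B] UnI2)
 next
  case False
  obtain T where T: "T : fst ` Q" "ALL s:F. al s .* x = 0 --> s : T"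
   using step.IH[OF sh step.prems(2)] step.prems(3) by blast
  show ?thesis
  proof (cases "T = {i, j, k}")
   case Tijk: True
   \<comment> \<open>A point on all three faces is a multiple of \<open>q\<close>. Since
     \<open>al m .* x < 0\<close> it is a negative multiple, and there \<open>al l\<close> is
     positive.\<close>
   have "~ (al i .* x = 0 & al j .* x = 0 & al k .* x = 0)"
   proof
    assume 0: "al i .* x = 0 & al j .* x = 0 & al k .* x = 0"
    then have x: "x = ga *\<^sub>R q" using gam by simp
    have "al m .* x < 0" using False step.prems(3) by force
    then have "ga < 0" using x g(2) by (auto simp: mult_less_0_iff)
    moreover have "al l .* q < 0" using g(1) in_F unfolding vertex_at_def by auto
    ultimately have "al l .* x > 0" using x by (simp add: mult_neg_neg)
    then show False using step.prems(3) in_F(4) by force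
   qed
   then consider "al i .* x ~= 0" | "al j .* x ~= 0" | "al k .* x ~= 0" by blast
   then obtain B where "B : (new_tris i j k m)" "ALL s:insert m F. al s .* x = 0 --> s : B"
   proof cases
    case 1 show thesis by (rule that[of "{j, k, m}"]) (use T 1 Tijk False in auto)
   next
    case 2 show thesis by (rule that[of "{i, k, m}"]) (use T 2 Tijk False in auto)
   next
    case 3 show thesis by (rule that[of "{i, j, m}"]) (use T 3 Tijk False in auto)
   qed
   then show ?thesis unfolding K by (intro bexI[of _ B] UnI2)
  next
   case nT: False
   then show ?thesis using T False unfolding K by (intro bexI[of _ T]) auto
  qed
 qed
qed

subsection \<open>Cartan entries of three faces\<close>

text \<open>The determinant of the 3 by 3 matrix of the pairings \<open>al s .* v t\<close>, with
  the diagonal entries already replaced by 2.\<close>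

definition det3 :: "(nat => real^4) => (nat => real^4) => nat => nat => nat => real" where
 "det3 al v i j k = 8 + (al i .* v j) * (al j .* v k) * (al k .* v i) + (al i .* v k) * (al k .* v j) * (al j .* v i)
   - 2 * ((al i .* v j) * (al j .* v i) + (al j .* v k) * (al k .* v j) + (al i .* v k) * (al k .* v i))"

lemma det3_set:
 assumes "{i, j, k} = {i', j', k'}" "distinct [i, j, k]"
 shows "det3 al v i j k = det3 al v i' j' k'"
proof -
 have "card {i', j', k'} = 3" unfolding assms(1)[symmetric] using assms(2) by simp
 then have d: "i' ~= j'" "j' ~= k'" "i' ~= k'" by (auto simp: card_insert_if split: if_splits)
 have m: "i : {i', j', k'}" "j : {i', j', k'}" "k : {i', j', k'}" unfolding assms(1)[symmetric] by auto
 have n: "i ~= j" "j ~= k" "i ~= k" using assms(2) by auto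
 show ?thesis
  using m n d by - (elim insertE emptyE; simp add: det3_def algebra_simps)
qed

text \<open>The last clause says that the 2 by 2 principal minors are positive, that is, that the
  dihedral angles are not zero.\<close>

definition cartan :: "(nat => real^4) => (nat => real^4) => nat set => bool" where
 "cartan al v A \<longleftrightarrow> (ALL s:A. al s .* v s = 2) &
   (ALL s:A. ALL t:A. s ~= t --> al s .* v t <= 0 & (al s .* v t = 0 \<longleftrightarrow> al t .* v s = 0) &
    (al s .* v t) * (al t .* v s) < 4)"

lemma cartan_subset: "cartan al v A ==> B <= A ==> cartan al v B"
 unfolding cartan_def by blast

lemma cartanD:
 assumes "cartan al v A" "s : A"
 shows "al s .* v s = 2"
  "t : A ==> s ~= t ==> al s .* v t <= 0"
  "t : A ==> s ~= t ==> al s .* v t = 0 \<longleftrightarrow> al t .* v s = 0"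
  "t : A ==> s ~= t ==> (al s .* v t) * (al t .* v s) < 4"
 using assms unfolding cartan_def by blast+

lemma cartan_swap:
 assumes c: "cartan al v A"
 shows "cartan v al A"
 unfolding cartan_def
proof (intro conjI ballI impI)
 fix s assume s: "s : A"
 show "v s .* al s = 2" using cartanD(1)[OF c s] by (simp add: inner_commute)
 fix t assume t: "t : A" "s ~= t"
 show "v s .* al t <= 0" using cartanD(2)[OF c t(1) s] t by (simp add: inner_commute)
 show "v s .* al t = 0 \<longleftrightarrow> v t .* al s = 0"
  using cartanD(3)[OF c t(1) s] t by (simp add: inner_commute)
 show "(v s .* al t) * (v t .* al s) < 4"
  using cartanD(4)[OF c t(1) s] t by (simp add: inner_commute)
qed

text \<open>Cramer's rule for a row vector times the matrix with rows \<open>(2, p, q)\<close>,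
  \<open>(p', 2, r)\<close>, \<open>(q', r', 2)\<close>. The brackets are the cofactors.\<close>

lemma cofactor_solution:
 fixes p q r p' q' r' e1 e2 e3 w1 w2 w3 :: real
 assumes "2 * e1 + p' * e2 + q' * e3 = w1" "p * e1 + 2 * e2 + r' * e3 = w2"
  "q * e1 + r * e2 + 2 * e3 = w3"
 shows "e1 * (8 + p * r * q' + q * r' * p' - 2 * (p * p' + r * r' + q * q')) =
   w1 * (4 - r * r') + w2 * (r * q' - 2 * p') + w3 * (p' * r' - 2 * q')"
  "e2 * (8 + p * r * q' + q * r' * p' - 2 * (p * p' + r * r' + q * q')) =
   w1 * (q * r' - 2 * p) + w2 * (4 - q * q') + w3 * (p * q' - 2 * r')"
  "e3 * (8 + p * r * q' + q * r' * p' - 2 * (p * p' + r * r' + q * q')) =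
   w1 * (p * r - 2 * q) + w2 * (q * p' - 2 * r) + w3 * (4 - p * p')"
 unfolding assms[symmetric] by (simp_all add: algebra_simps)

lemma cofactor_exists:
 fixes p q r p' q' r' w1 w2 w3 :: real
 assumes D: "8 + p * r * q' + q * r' * p' - 2 * (p * p' + r * r' + q * q') ~= 0"
 shows "EX e1 e2 e3. 2 * e1 + p' * e2 + q' * e3 = w1 & p * e1 + 2 * e2 + r' * e3 = w2 &
  q * e1 + r * e2 + 2 * e3 = w3"
proof -
 define D where "D = 8 + p * r * q' + q * r' * p' - 2 * (p * p' + r * r' + q * q')"
 define A where "A = w1 * (4 - r * r') + w2 * (r * q' - 2 * p') + w3 * (p' * r' - 2 * q')"
 define B where "B = w1 * (q * r' - 2 * p) + w2 * (4 - q * q') + w3 * (p * q' - 2 * r')"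
 define C where "C = w1 * (p * r - 2 * q) + w2 * (q * p' - 2 * r) + w3 * (4 - p * p')"
 have D0: "D ~= 0" using assms unfolding D_def .
 have 1: "2 * A + p' * B + q' * C = w1 * D" "p * A + 2 * B + r' * C = w2 * D"
  "q * A + r * B + 2 * C = w3 * D"
  unfolding A_def B_def C_def D_def by (simp_all add: algebra_simps)
 have "2 * (A / D) + p' * (B / D) + q' * (C / D) = (2 * A + p' * B + q' * C) / D"
  "p * (A / D) + 2 * (B / D) + r' * (C / D) = (p * A + 2 * B + r' * C) / D"
  "q * (A / D) + r * (B / D) + 2 * (C / D) = (q * A + r * B + 2 * C) / D"
  by (simp_all add: add_divide_distrib)
 then show ?thesis unfolding 1 using D0
  by (intro exI[of _ "A / D"] exI[of _ "B / D"] exI[of _ "C / D"]) simp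
qed

text \<open>Off-diagonal cofactors are sums of nonnegative terms, so only strictness is at stake. If
  \<open>p = 0\<close>, a negative determinant means \<open>r * r' + q * q' > 4\<close>, and since
  both products are below 4, neither vanishes.\<close>

lemma cofactor_pos:
 fixes p q r p' q' r' :: real
 assumes le: "p <= 0" "q <= 0" "r <= 0" "p' <= 0" "q' <= 0" "r' <= 0"
  and z: "p = 0 \<longleftrightarrow> p' = 0"
  and lt: "r * r' < 4" "q * q' < 4"
  and D: "8 + p * r * q' + q * r' * p' - 2 * (p * p' + r * r' + q * q') < 0"
 shows "r * q' - 2 * p' > 0" "q * r' - 2 * p > 0"
proof -
 have n: "r * q' >= 0" "q * r' >= 0" using le by (auto intro: mult_nonpos_nonpos)
 have "r * q' - 2 * p' > 0 & q * r' - 2 * p > 0"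
 proof (cases "p = 0")
  case True
  then have "r * r' + q * q' > 4" using D z by simp
  then have "r * r' > 0" "q * q' > 0" using lt by linarith+
  then have "r < 0" "r' < 0" "q < 0" "q' < 0" using le by (auto simp: zero_less_mult_iff)
  then show ?thesis using True z by (simp add: mult_neg_neg)
 next
  case False
  then have "p < 0" "p' < 0" using le z by auto
  then show ?thesis using n by linarith
 qed
 then show "r * q' - 2 * p' > 0" "q * r' - 2 * p > 0" by auto
qed

text \<open>The vector \<open>e\<close> times a negative determinant equals \<open>w\<close> times
  an adjugate with positive entries. One negative coordinate of \<open>w\<close> therefore makes all
  coordinates of \<open>e\<close> positive.\<close>

lemma cofactor_sign:
 fixes p q r p' q' r' e1 e2 e3 w1 w2 w3 :: real
 assumes le: "p <= 0" "q <= 0" "r <= 0" "p' <= 0" "q' <= 0" "r' <= 0"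
  and z: "p = 0 \<longleftrightarrow> p' = 0" "q = 0 \<longleftrightarrow> q' = 0" "r = 0 \<longleftrightarrow> r' = 0"
  and lt: "p * p' < 4" "q * q' < 4" "r * r' < 4"
  and D: "8 + p * r * q' + q * r' * p' - 2 * (p * p' + r * r' + q * q') < 0"
  and e: "2 * e1 + p' * e2 + q' * e3 = w1" "p * e1 + 2 * e2 + r' * e3 = w2"
   "q * e1 + r * e2 + 2 * e3 = w3"
  and w: "w1 <= 0" "w2 <= 0" "w3 <= 0"
 shows "(e1 > 0 & e2 > 0 & e3 > 0) | (e1 = 0 & e2 = 0 & e3 = 0 & w1 = 0 & w2 = 0 & w3 = 0)"
proof -
 let ?D = "8 + p * r * q' + q * r' * p' - 2 * (p * p' + r * r' + q * q')"
 note sol = cofactor_solution[OF e]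
 note P1 = cofactor_pos[OF le z(1) lt(3,2) D]
 have D2: "8 + q * r' * p' + p * r * q' - 2 * (q * q' + r' * r + p * p') < 0"
  using D by (simp add: algebra_simps)
 note P2 = cofactor_pos[OF le(2,1,6,5,4,3) z(2) _ lt(1) D2]
 have D3: "8 + r * q' * p + p' * q * r' - 2 * (r * r' + q' * q + p' * p) < 0"
  using D by (simp add: algebra_simps)
 note P3 = cofactor_pos[OF le(3,4,5,6,1,2) z(3) _ _ D3]
 have pos: "r * q' - 2 * p' > 0" "q * r' - 2 * p > 0" "p' * r' - 2 * q' > 0" "p * r - 2 * q > 0"
  "p * q' - 2 * r' > 0" "q * p' - 2 * r > 0" "4 - r * r' > 0" "4 - q * q' > 0" "4 - p * p' > 0"
  using P1 P2 P3 lt by (simp_all add: mult.commute)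
 show ?thesis
 proof (cases "w1 = 0 & w2 = 0 & w3 = 0")
  case True
  then show ?thesis using sol D by simp
 next
  case False
  then consider "w1 < 0" | "w2 < 0" | "w3 < 0" using w by linarith
  then have "w1 * (4 - r * r') + w2 * (r * q' - 2 * p') + w3 * (p' * r' - 2 * q') < 0 &
   w1 * (q * r' - 2 * p) + w2 * (4 - q * q') + w3 * (p * q' - 2 * r') < 0 &
   w1 * (p * r - 2 * q) + w2 * (q * p' - 2 * r) + w3 * (4 - p * p') < 0"
  proof cases
   case 1
   then have "w1 * (4 - r * r') < 0" "w1 * (q * r' - 2 * p) < 0" "w1 * (p * r - 2 * q) < 0"
    using pos by (simp_all add: mult_neg_pos)
   moreover have "w2 * (r * q' - 2 * p') <= 0" "w2 * (4 - q * q') <= 0" "w2 * (q * p' - 2 * r) <= 0"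
    "w3 * (p' * r' - 2 * q') <= 0" "w3 * (p * q' - 2 * r') <= 0" "w3 * (4 - p * p') <= 0"
    using pos w by (simp_all add: mult_nonpos_nonneg)
   ultimately show ?thesis by linarith
  next
   case 2
   then have "w2 * (r * q' - 2 * p') < 0" "w2 * (4 - q * q') < 0" "w2 * (q * p' - 2 * r) < 0"
    using pos by (simp_all add: mult_neg_pos)
   moreover have "w1 * (4 - r * r') <= 0" "w1 * (q * r' - 2 * p) <= 0" "w1 * (p * r - 2 * q) <= 0"
    "w3 * (p' * r' - 2 * q') <= 0" "w3 * (p * q' - 2 * r') <= 0" "w3 * (4 - p * p') <= 0"
    using pos w by (simp_all add: mult_nonpos_nonneg)
   ultimately show ?thesis by linarith
  next
   case 3
   then have "w3 * (p' * r' - 2 * q') < 0" "w3 * (p * q' - 2 * r') < 0" "w3 * (4 - p * p') < 0"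
    using pos by (simp_all add: mult_neg_pos)
   moreover have "w1 * (4 - r * r') <= 0" "w1 * (q * r' - 2 * p) <= 0" "w1 * (p * r - 2 * q) <= 0"
    "w2 * (r * q' - 2 * p') <= 0" "w2 * (4 - q * q') <= 0" "w2 * (q * p' - 2 * r) <= 0"
    using pos w by (simp_all add: mult_nonpos_nonneg)
   ultimately show ?thesis by linarith
  qed
  then have "e1 * ?D < 0" "e2 * ?D < 0" "e3 * ?D < 0" unfolding sol by simp_all
  then show ?thesis using D by (simp add: mult_less_0_iff)
 qed
qed

text \<open>The adjugate of such a matrix has nonnegative entries.\<close>

lemma cofactor_nonpos:
 fixes p q r p' q' r' e1 e2 e3 w1 w2 w3 :: real
 assumes le: "p <= 0" "q <= 0" "r <= 0" "p' <= 0" "q' <= 0" "r' <= 0"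
  and lt: "p * p' < 4" "q * q' < 4" "r * r' < 4"
  and e: "2 * e1 + p' * e2 + q' * e3 = w1" "p * e1 + 2 * e2 + r' * e3 = w2"
   "q * e1 + r * e2 + 2 * e3 = w3"
  and w: "w1 <= 0" "w2 <= 0" "w3 <= 0" and pos: "e1 > 0" "e2 > 0" "e3 > 0"
  and D: "D = 8 + p * r * q' + q * r' * p' - 2 * (p * p' + r * r' + q * q')"
 shows "D < 0 | (D = 0 & w1 = 0 & w2 = 0 & w3 = 0)"
proof (cases "D < 0")
 case False
 note sol = cofactor_solution[OF e, folded D]
 have n: "r * q' >= 0" "q * r' >= 0" "p' * r' >= 0" "p * r >= 0" "p * q' >= 0" "q * p' >= 0"
  using le by (auto intro: mult_nonpos_nonpos)
 have "w2 * (r * q' - 2 * p') <= 0" "w3 * (p' * r' - 2 * q') <= 0" "w1 * (q * r' - 2 * p) <= 0"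
  "w3 * (p * q' - 2 * r') <= 0" "w1 * (p * r - 2 * q) <= 0" "w2 * (q * p' - 2 * r) <= 0"
  "w1 * (4 - r * r') <= 0" "w2 * (4 - q * q') <= 0" "w3 * (4 - p * p') <= 0"
  using n w le lt by (auto intro!: mult_nonpos_nonneg)
 moreover have "e1 * D >= 0" "e2 * D >= 0" "e3 * D >= 0" using pos False by auto
 ultimately have 0: "e1 * D = 0" "w1 * (4 - r * r') = 0" "w2 * (4 - q * q') = 0" "w3 * (4 - p * p') = 0"
  using sol by linarith+
 then show ?thesis using pos lt by auto
qed simp

text \<open>The two factors on the left are the mixed minors of a 4 by 4 Cartan matrix with
  principal minors \<open>?D\<close> and \<open>?D'\<close>, so by the Desnanot-Jacobi identity the
  claim says that its determinant is negative. Dropping \<open>g\<close> and \<open>g'\<close> only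
  decreases the product, and \<open>U * W - Q0 * R0 = B * E\<close> reduces the claim to
  \<open>E <= 2 * U\<close>.\<close>

lemma cofactor_cross:
 fixes p p' x1 x1' x2 x2' z1 z1' z2 z2' g g' :: real
 assumes le: "p <= 0" "p' <= 0" "x1 <= 0" "x1' <= 0" "x2 <= 0" "x2' <= 0" "z1 <= 0" "z1' <= 0"
   "z2 <= 0" "z2' <= 0" "g <= 0" "g' <= 0"
  and lt: "p * p' < 4" "x1 * x1' < 4" "x2 * x2' < 4" "z1 * z1' < 4" "z2 * z2' < 4"
  and D: "8 + p * x2 * x1' + x1 * x2' * p' - 2 * (p * p' + x2 * x2' + x1 * x1') < 0" (is "?D < 0")
  and D': "8 + p * z2 * z1' + z1 * z2' * p' - 2 * (p * p' + z2 * z2' + z1 * z1') < 0" (is "?D' < 0")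
 shows "(z1' * (p * x2 - 2 * x1) + z2' * (x1 * p' - 2 * x2) + g' * (4 - p * p')) *
   (x1' * (p * z2 - 2 * z1) + x2' * (z1 * p' - 2 * z2) + g * (4 - p * p')) > ?D * ?D'"
proof -
 define B where "B = 4 - p * p'"
 define U where "U = 2 * (x1 * x1') + 2 * (x2 * x2') - p * x2 * x1' - x1 * x2' * p'"
 define W where "W = 2 * (z1 * z1') + 2 * (z2 * z2') - p * z2 * z1' - z1 * z2' * p'"
 define Q0 where "Q0 = z1' * (p * x2 - 2 * x1) + z2' * (x1 * p' - 2 * x2)"
 define R0 where "R0 = x1' * (p * z2 - 2 * z1) + x2' * (z1 * p' - 2 * z2)"
 define E where "E = (x1 * z2 - x2 * z1) * (x1' * z2' - x2' * z1')"
 have B: "B > 0" using lt unfolding B_def by simp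
 have nn: "a * b >= 0" if "a <= 0" "b <= 0" for a b :: real using that by (rule mult_nonpos_nonpos)
 have "p * x2 * x1' <= 0" "x1 * x2' * p' <= 0"
  using le nn by (auto intro!: mult_nonneg_nonpos)
 then have U: "U >= 2 * (x1 * x1') + 2 * (x2 * x2')" unfolding U_def by linarith
 have Q0: "Q0 <= 0" unfolding Q0_def using le nn[of p x2] nn[of x1 p']
  by (intro add_nonpos_nonpos mult_nonpos_nonneg) auto
 have R0: "R0 <= 0" unfolding R0_def using le nn[of p z2] nn[of z1 p']
  by (intro add_nonpos_nonpos mult_nonpos_nonneg) auto
 have "g' * B <= 0" "g * B <= 0" using le B by (auto intro: mult_nonpos_nonneg)
 then have "(- Q0) * (- R0) <= (- (Q0 + g' * B)) * (- (R0 + g * B))"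
  using Q0 R0 by (intro mult_mono) auto
 then have QR: "(Q0 + g' * B) * (R0 + g * B) >= Q0 * R0" unfolding minus_mult_minus .
 have id: "U * W - Q0 * R0 = B * E"
  unfolding U_def W_def Q0_def R0_def B_def E_def by (simp add: algebra_simps)
 have "E = (x1 * x1') * (z2 * z2') + (x2 * x2') * (z1 * z1') - (x1 * z2) * (x2' * z1') - (x2 * z1) * (x1' * z2')"
  unfolding E_def by (simp add: algebra_simps)
 moreover have "(x1 * z2) * (x2' * z1') >= 0" "(x2 * z1) * (x1' * z2') >= 0"
  using le by (simp_all add: nn mult_nonneg_nonneg)
 moreover have "(x1 * x1') * (z2 * z2') <= (x1 * x1') * 4" "(x2 * x2') * (z1 * z1') <= (x2 * x2') * 4"
  using le lt nn by (auto intro!: mult_left_mono)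
 ultimately have "E <= 2 * U" using U by linarith
 then have "B * E <= B * (2 * U)" using B by simp
 moreover have DD: "?D = 2 * B - U" "?D' = 2 * B - W" unfolding B_def U_def W_def by (simp_all add: algebra_simps)
 moreover have "?D * ?D' = U * W - 2 * B * (U + W) + 4 * B * B" unfolding DD by (simp add: algebra_simps)
 moreover have "2 * B * (W - 2 * B) > 0" using D' B unfolding DD by simp
 ultimately have "Q0 * R0 > ?D * ?D'" using id by (simp add: algebra_simps)
 then show ?thesis using QR unfolding Q0_def R0_def B_def by linarith
qed

lemma row_solution_exists:
 assumes c: "cartan al v {i, j, k}" and d: "distinct [i, j, k]" and D: "det3 al v i j k ~= 0"
 shows "EX e1 e2 e3. ALL s:{i, j, k}. (comb al e1 e2 e3 i j k) .* v s = w s"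
proof -
 have two: "al i .* v i = 2" "al j .* v j = 2" "al k .* v k = 2" using c unfolding cartan_def by auto
 obtain e1 e2 e3 where "2 * e1 + (al j .* v i) * e2 + (al k .* v i) * e3 = w i"
  "(al i .* v j) * e1 + 2 * e2 + (al k .* v j) * e3 = w j"
  "(al i .* v k) * e1 + (al j .* v k) * e2 + 2 * e3 = w k"
  using cofactor_exists[of "al i .* v j" "al j .* v k" "al k .* v i" "al i .* v k" "al k .* v j" "al j .* v i" "w i" "w j" "w k"]
   D unfolding det3_def by auto
 then show ?thesis
  by (intro exI[of _ e1] exI[of _ e2] exI[of _ e3]) (simp add: inner_add_left two algebra_simps)
qed

lemma column_solution_exists:
 assumes c: "cartan al v {i, j, k}" and d: "distinct [i, j, k]" and D: "det3 al v i j k ~= 0"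
 shows "EX e1 e2 e3. ALL s:{i, j, k}. al s .* (e1 *\<^sub>R v i + e2 *\<^sub>R v j + e3 *\<^sub>R v k) = w s"
proof -
 have "det3 v al i j k = det3 al v i j k" unfolding det3_def by (simp add: inner_commute algebra_simps)
 moreover have "cartan v al {i, j, k}" using cartan_swap[OF c] .
 ultimately show ?thesis using row_solution_exists[of v al i j k w] D d by (simp add: inner_commute)
qed

lemma row_solution_sign:
 assumes c: "cartan al v {i, j, k}" and d: "distinct [i, j, k]" and D: "det3 al v i j k < 0"
  and e: "ALL s:{i, j, k}. (comb al e1 e2 e3 i j k) .* v s = w .* v s"
  and w: "ALL s:{i, j, k}. w .* v s <= 0"
 shows "(e1 > 0 & e2 > 0 & e3 > 0) | (e1 = 0 & e2 = 0 & e3 = 0 & (ALL s:{i, j, k}. w .* v s = 0))"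
proof -
 have two: "al i .* v i = 2" "al j .* v j = 2" "al k .* v k = 2" using c unfolding cartan_def by auto
 have n: "i ~= j" "j ~= k" "i ~= k" using d by auto
 have 1: "2 * e1 + (al j .* v i) * e2 + (al k .* v i) * e3 = w .* v i"
  "(al i .* v j) * e1 + 2 * e2 + (al k .* v j) * e3 = w .* v j"
  "(al i .* v k) * e1 + (al j .* v k) * e2 + 2 * e3 = w .* v k"
  using e by (simp_all add: inner_add_left two algebra_simps)
 have "(e1 > 0 & e2 > 0 & e3 > 0) | (e1 = 0 & e2 = 0 & e3 = 0 & w .* v i = 0 & w .* v j = 0 & w .* v k = 0)"
  by (rule cofactor_sign[OF _ _ _ _ _ _ _ _ _ _ _ _ _ 1])
   (use cartanD[OF c] n n[symmetric] w D in \<open>simp_all add: det3_def algebra_simps\<close>)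
 then show ?thesis by simp
qed

lemma row_solution_nonpos:
 assumes c: "cartan al v {i, j, k}" and d: "distinct [i, j, k]"
  and e: "ALL s:{i, j, k}. (comb al e1 e2 e3 i j k) .* v s = w .* v s"
  and w: "ALL s:{i, j, k}. w .* v s <= 0" and pos: "e1 > 0" "e2 > 0" "e3 > 0"
 shows "det3 al v i j k < 0 | (det3 al v i j k = 0 & (ALL s:{i, j, k}. w .* v s = 0))"
proof -
 have two: "al i .* v i = 2" "al j .* v j = 2" "al k .* v k = 2" using c unfolding cartan_def by auto
 have n: "i ~= j" "j ~= k" "i ~= k" using d by auto
 have 1: "2 * e1 + (al j .* v i) * e2 + (al k .* v i) * e3 = w .* v i"
  "(al i .* v j) * e1 + 2 * e2 + (al k .* v j) * e3 = w .* v j"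
  "(al i .* v k) * e1 + (al j .* v k) * e2 + 2 * e3 = w .* v k"
  using e by (simp_all add: inner_add_left two algebra_simps)
 have "det3 al v i j k < 0 | (det3 al v i j k = 0 & w .* v i = 0 & w .* v j = 0 & w .* v k = 0)"
  by (rule cofactor_nonpos[OF _ _ _ _ _ _ _ _ _ 1 _ _ _ pos])
   (use cartanD[OF c] n n[symmetric] w in \<open>simp_all add: det3_def algebra_simps\<close>)
 then show ?thesis by simp
qed

text \<open>By Cramer's rule \<open>d3\<close> and \<open>f3\<close> are the two mixed minors of
  \<open>cofactor_cross\<close> divided by the two principal ones. This inequality is what separates
  the caps at the two ends of an edge.\<close>

lemma row_cross:
 assumes c: "cartan al v {i, j, k, l}" and d: "distinct [i, j, k, l]"
  and D: "det3 al v i j k < 0" and D': "det3 al v i j l < 0"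
  and e: "ALL s:{i, j, k}. (comb al d1 d2 d3 i j k) .* v s = al l .* v s"
  and f: "ALL s:{i, j, l}. (comb al f1 f2 f3 i j l) .* v s = al k .* v s"
 shows "d3 * f3 > 1"
proof -
 have two: "al i .* v i = 2" "al j .* v j = 2" "al k .* v k = 2" "al l .* v l = 2" using c unfolding cartan_def by auto
 have n: "i ~= j" "j ~= k" "i ~= k" "i ~= l" "j ~= l" "k ~= l" using d by auto
 have 1: "2 * d1 + (al j .* v i) * d2 + (al k .* v i) * d3 = al l .* v i"
  "(al i .* v j) * d1 + 2 * d2 + (al k .* v j) * d3 = al l .* v j"
  "(al i .* v k) * d1 + (al j .* v k) * d2 + 2 * d3 = al l .* v k"
  using e by (simp_all add: inner_add_left two algebra_simps)
 have 2: "2 * f1 + (al j .* v i) * f2 + (al l .* v i) * f3 = al k .* v i"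
  "(al i .* v j) * f1 + 2 * f2 + (al l .* v j) * f3 = al k .* v j"
  "(al i .* v l) * f1 + (al j .* v l) * f2 + 2 * f3 = al k .* v l"
  using f by (simp_all add: inner_add_left two algebra_simps)
 have le: "al i .* v j <= 0" "al j .* v i <= 0" "al i .* v k <= 0" "al k .* v i <= 0" "al j .* v k <= 0" "al k .* v j <= 0"
  "al i .* v l <= 0" "al l .* v i <= 0" "al j .* v l <= 0" "al l .* v j <= 0" "al k .* v l <= 0" "al l .* v k <= 0"
  by (rule cartanD(2)[OF c]; simp add: n n[symmetric])+
 have lt: "(al i .* v j) * (al j .* v i) < 4" "(al i .* v k) * (al k .* v i) < 4" "(al j .* v k) * (al k .* v j) < 4"
  "(al i .* v l) * (al l .* v i) < 4" "(al j .* v l) * (al l .* v j) < 4"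
  by (rule cartanD(4)[OF c]; simp add: n n[symmetric])+
 note s1 = cofactor_solution(3)[OF 1] and s2 = cofactor_solution(3)[OF 2]
 let ?D = "8 + (al i .* v j) * (al j .* v k) * (al k .* v i) + (al i .* v k) * (al k .* v j) * (al j .* v i)
   - 2 * ((al i .* v j) * (al j .* v i) + (al j .* v k) * (al k .* v j) + (al i .* v k) * (al k .* v i))"
 let ?D' = "8 + (al i .* v j) * (al j .* v l) * (al l .* v i) + (al i .* v l) * (al l .* v j) * (al j .* v i)
   - 2 * ((al i .* v j) * (al j .* v i) + (al j .* v l) * (al l .* v j) + (al i .* v l) * (al l .* v i))"
 have "(d3 * ?D) * (f3 * ?D') > ?D * ?D'"
  unfolding s1 s2
  by (rule cofactor_cross[OF le lt D[unfolded det3_def] D'[unfolded det3_def]])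
 moreover have "?D * ?D' > 0" using D D' unfolding det3_def by (rule mult_neg_neg)
 ultimately have "(d3 * f3) * (?D * ?D') > 1 * (?D * ?D')" by (simp only: mult_ac)
 then show ?thesis using \<open>?D * ?D' > 0\<close> by (simp only: mult_less_cancel_right_pos)
qed

section \<open>Forms that vanish on the poles of a vertex\<close>

lemma frame_solve:
 fixes p1 p2 p3 p4 :: "real^4"
 assumes "!!x. p1 .* x = 0 ==> p2 .* x = 0 ==> p3 .* x = 0 ==> p4 .* x = 0 ==> x = 0"
 shows "EX x. p1 .* x = w1 & p2 .* x = w2 & p3 .* x = w3 & p4 .* x = w4"
proof -
 define f :: "real^4 => real^4" where
  "f x = (\<chi> i. (if i = 1 then p1 else if i = 2 then p2 else if i = 3 then p3 else p4) .* x)" for x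
 have lin: "linear f" unfolding f_def
  by (intro linearI) (simp_all add: vec_eq_iff inner_add_right)
 have f: "f x $ 1 = p1 .* x" "f x $ 2 = p2 .* x" "f x $ 3 = p3 .* x" "f x $ 4 = p4 .* x" for x
  unfolding f_def by simp_all
 have "inj f"
  unfolding linear_injective_0[OF lin]
  using assms f by (metis zero_index)
 then have "surj f" using lin linear_injective_imp_surjective by blast
 then obtain x where "(\<chi> i. if i = 1 then w1 else if i = 2 then w2 else if i = 3 then w3 else w4) = f x"
  by (rule surjE)
 note x = this[symmetric]
 have "f x $ 1 = w1" "f x $ 2 = w2" "f x $ 3 = w3" "f x $ 4 = w4" unfolding x by simp_all
 then show ?thesis unfolding f by blast
qed

text \<open>A form that vanishes on the three \<open>v s\<close> is unchanged by the three
  reflections, so its kernel is their invariant hyperplane. The sign makes the side of the vertex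
  positive.\<close>

definition pole :: "nat set => (nat => real^4) => (nat => real^4) => nat set => real^4 => bool" where
 "pole F al v T mu \<longleftrightarrow> (ALL s:T. mu .* v s = 0) & (ALL q. vertex_at F al T q --> mu .* q > 0)"

definition negative :: "(nat => real^4) => (nat => real^4) => nat set => bool" where
 "negative al v T \<longleftrightarrow> (EX i j k. distinct [i, j, k] & T = {i, j, k} & det3 al v i j k < 0)"

lemma negative_iff: "distinct [i, j, k] ==> negative al v {i, j, k} \<longleftrightarrow> det3 al v i j k < 0"
 unfolding negative_def using det3_set by metis

definition frame :: "(nat => real^4) => nat set => bool" where
 "frame al A \<longleftrightarrow> (ALL x. (ALL s:A. al s .* x = 0) --> x = 0)"

lemma frameD: "frame al A ==> ALL s:A. al s .* x = 0 ==> x = 0"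
 unfolding frame_def by blast

text \<open>When the determinant is nonzero, \<open>v i\<close>, \<open>v j\<close>,
  \<open>v k\<close> and the vertex ray \<open>q\<close> span the space, so a form is known from its
  values on them.\<close>

lemma form_unique:
 fixes al v :: "nat => real^4"
 assumes c: "cartan al v {i, j, k}" and d: "distinct [i, j, k]" and D: "det3 al v i j k ~= 0"
  and fr: "frame al {i, j, k, l}"
  and q: "ALL s:{i, j, k}. al s .* q = 0" "al l .* q ~= 0"
  and fg: "ALL s:{i, j, k}. f .* v s = g .* v s" "f .* q = g .* q"
 shows "f = g"
proof -
 have "f .* x = g .* x" for x
 proof -
  obtain e1 e2 e3 where e: "ALL s:{i, j, k}. al s .* (e1 *\<^sub>R v i + e2 *\<^sub>R v j + e3 *\<^sub>R v k) = al s .* x"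
   using column_solution_exists[OF c d D, of "%s. al s .* x"] by blast
  define y where "y = x - (e1 *\<^sub>R v i + e2 *\<^sub>R v j + e3 *\<^sub>R v k)"
  have "ALL s:{i, j, k}. al s .* y = 0" unfolding y_def inner_diff_right using e by simp
  then have "ALL s:{i, j, k, l}. al s .* (y - (al l .* y / (al l .* q)) *\<^sub>R q) = 0"
   using q by (simp add: inner_diff_right)
  then have "y - (al l .* y / (al l .* q)) *\<^sub>R q = 0" by (rule frameD[OF fr])
  then obtain ga where "y = ga *\<^sub>R q" by (metis eq_iff_diff_eq_0)
  then have x: "x = e1 *\<^sub>R v i + e2 *\<^sub>R v j + e3 *\<^sub>R v k + ga *\<^sub>R q" unfolding y_def by (simp add: algebra_simps)
  show ?thesis unfolding x using fg by (simp add: inner_add_right)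
 qed
 then show ?thesis using vector_eq_rdot[of f g] by blast
qed

text \<open>Subtracting \<open>al l\<close> from the combination of \<open>al i\<close>,
  \<open>al j\<close>, \<open>al k\<close> that has the same pairings with the three poles kills
  these pairings. The sign of the coefficients comes from \<open>row_solution_sign\<close>, and
  \<open>form_unique\<close> gives uniqueness up to a positive factor.\<close>

lemma pole_form:
 fixes al v :: "nat => real^4"
 assumes c: "cartan al v {i, j, k, l}" and d: "distinct [i, j, k, l]" and D: "det3 al v i j k < 0"
  and fr: "frame al {i, j, k, l}"
  and q: "vertex_at F al {i, j, k} q" and l: "l : F"
 shows "EX d1 d2 d3.
  (ALL s:{i, j, k}. (comb al d1 d2 d3 i j k) .* v s = al l .* v s) &
  ((d1 > 0 & d2 > 0 & d3 > 0) | (d1 = 0 & d2 = 0 & d3 = 0 & (ALL s:{i, j, k}. al l .* v s = 0))) &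
  pole F al v {i, j, k} (comb al d1 d2 d3 i j k - al l) &
  (ALL mu. pole F al v {i, j, k} mu --> (EX rh>0. mu = rh *\<^sub>R (comb al d1 d2 d3 i j k - al l)))"
proof -
 have c3: "cartan al v {i, j, k}" and d3: "distinct [i, j, k]" using cartan_subset[OF c] d by auto
 obtain d1 d2 d3 where e: "ALL s:{i, j, k}. (comb al d1 d2 d3 i j k) .* v s = al l .* v s"
  using row_solution_exists[OF c3 d3, of "%s. al l .* v s"] D by auto
 have le: "ALL s:{i, j, k}. al l .* v s <= 0"
  using cartanD(2)[OF c, of l] d by auto
 note sg = row_solution_sign[OF c3 d3 D e le]
 let ?l = "comb al d1 d2 d3 i j k - al l"
 have lq: "?l .* x = - (al l .* x)" if "vertex_at F al {i, j, k} x" for x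
  using vertex_at_zero[OF that] by (simp add: inner_diff_left inner_add_left)
 have lneg: "al l .* x < 0" if "vertex_at F al {i, j, k} x" for x
  using vertex_at_neg[OF that l] d by auto
 have p: "pole F al v {i, j, k} ?l"
  unfolding pole_def using e lq lneg by (auto simp: inner_diff_left)
 moreover have "EX rh>0. mu = rh *\<^sub>R ?l" if pl: "pole F al v {i, j, k} mu" for mu
 proof -
  define rh where "rh = (mu .* q) / (?l .* q)"
  have "?l .* q > 0" "mu .* q > 0" using p pl q unfolding pole_def by blast+
  then have r: "rh > 0" "(rh *\<^sub>R ?l) .* q = mu .* q" unfolding rh_def by simp_all
  have "mu = rh *\<^sub>R ?l"
  proof (rule form_unique[OF c3 d3 _ fr])
   show "det3 al v i j k ~= 0" using D by simp
   show "ALL s:{i, j, k}. al s .* q = 0" using vertex_at_zero[OF q] by blast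
   show "al l .* q ~= 0" using lneg[OF q] by simp
   show "ALL s:{i, j, k}. mu .* v s = (rh *\<^sub>R ?l) .* v s"
    using p pl unfolding pole_def by (metis inner_scaleR_left mult_zero_right)
   show "mu .* q = (rh *\<^sub>R ?l) .* q" using r by simp
  qed
  then show ?thesis using r by blast
 qed
 ultimately show ?thesis using e sg by (intro exI[of _ d1] exI[of _ d2] exI[of _ d3]) blast
qed

text \<open>Insert the inequality for one cap into that for the other: the value \<open>yl\<close>
  of \<open>al l\<close> satisfies \<open>yl <= (d3 * f3) * yl\<close>. As \<open>yl <= 0\<close>
  and \<open>d3 * f3 > 1\<close>, it vanishes, and then all four values vanish, contrary to
  \<open>x ~= 0\<close>.\<close>

lemma caps_disjoint:
 fixes al v :: "nat => real^4"
 assumes c: "cartan al v {i, j, k, l}" and d: "distinct [i, j, k, l]"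
  and D: "det3 al v i j k < 0" "det3 al v i j l < 0"
  and fr: "frame al {i, j, k, l}"
  and q: "vertex_at F al {i, j, k} q" "vertex_at F al {i, j, l} q'" and kl: "k : F" "l : F"
  and p: "pole F al v {i, j, k} mu" "pole F al v {i, j, l} mu'"
  and x: "x ~= 0" "ALL s:{i, j, k, l}. al s .* x <= 0" "mu .* x >= 0" "mu' .* x >= 0"
 shows False
proof -
 have c': "cartan al v {i, j, l, k}" and d': "distinct [i, j, l, k]"
  using c d by (auto simp: insert_commute)
 have fr': "frame al {i, j, l, k}" using fr by (simp add: insert_commute)
 obtain d1 d2 d3 where 1: "ALL s:{i, j, k}. (comb al d1 d2 d3 i j k) .* v s = al l .* v s"
  "(d1 > 0 & d2 > 0 & d3 > 0) | (d1 = 0 & d2 = 0 & d3 = 0 & (ALL s:{i, j, k}. al l .* v s = 0))"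
  "ALL mu. pole F al v {i, j, k} mu --> (EX rh>0. mu = rh *\<^sub>R (comb al d1 d2 d3 i j k - al l))"
  using pole_form[OF c d D(1) fr q(1) kl(2)] by (elim exE conjE)
 obtain f1 f2 f3 where 2: "ALL s:{i, j, l}. (comb al f1 f2 f3 i j l) .* v s = al k .* v s"
  "(f1 > 0 & f2 > 0 & f3 > 0) | (f1 = 0 & f2 = 0 & f3 = 0 & (ALL s:{i, j, l}. al k .* v s = 0))"
  "ALL mu. pole F al v {i, j, l} mu --> (EX rh>0. mu = rh *\<^sub>R (comb al f1 f2 f3 i j l - al k))"
  using pole_form[OF c' d' D(2) fr' q(2) kl(1)] by (elim exE conjE)
 have cross: "d3 * f3 > 1" by (rule row_cross[OF c d D 1(1) 2(1)])
 then have pos: "d1 > 0" "d2 > 0" "d3 > 0" "f1 > 0" "f2 > 0" "f3 > 0" using 1(2) 2(2) by auto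
 obtain r where r: "r > 0" "mu = r *\<^sub>R (comb al d1 d2 d3 i j k - al l)" using 1(3) p(1) by blast
 obtain r' where r': "r' > 0" "mu' = r' *\<^sub>R (comb al f1 f2 f3 i j l - al k)" using 2(3) p(2) by blast
 define yi yj yk yl where "yi = al i .* x" and "yj = al j .* x" and "yk = al k .* x" and "yl = al l .* x"
 have y: "yi <= 0" "yj <= 0" "yk <= 0" "yl <= 0" using x(2) unfolding yi_def yj_def yk_def yl_def by auto
 have "r * (d1 * yi + d2 * yj + d3 * yk - yl) >= 0"
  using x(3) unfolding r(2) yi_def yj_def yk_def yl_def by (simp add: inner_add_left inner_diff_left)
 then have a: "yl <= d1 * yi + d2 * yj + d3 * yk" using r(1) by (simp add: zero_le_mult_iff)
 have "r' * (f1 * yi + f2 * yj + f3 * yl - yk) >= 0"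
  using x(4) unfolding r'(2) yi_def yj_def yk_def yl_def by (simp add: inner_add_left inner_diff_left)
 then have b: "yk <= f1 * yi + f2 * yj + f3 * yl" using r'(1) by (simp add: zero_le_mult_iff)
 have n: "d1 * yi <= 0" "d2 * yj <= 0" "d3 * yk <= 0" "f1 * yi <= 0" "f2 * yj <= 0" "f3 * yl <= 0"
  using pos y by (auto intro!: mult_nonneg_nonpos)
 have "d3 * yk <= d3 * (f3 * yl)" using b n pos by (intro mult_left_mono) auto
 then have "yl <= (d3 * f3) * yl" using a n by (simp add: mult.assoc)
 then have "(d3 * f3 - 1) * yl >= 0" by (simp add: algebra_simps)
 then have "yl >= 0" using cross by (simp add: zero_le_mult_iff)
 then have yl: "yl = 0" using y by simp
 then have "d1 * yi = 0" "d2 * yj = 0" "d3 * yk = 0" using a n by linarith+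
 then have "yi = 0" "yj = 0" "yk = 0" using pos by auto
 then have "ALL s:{i, j, k, l}. al s .* x = 0" using yl unfolding yi_def yj_def yk_def yl_def by simp
 then have "x = 0" by (rule frameD[OF fr])
 then show False using x(1) by simp
qed

subsection \<open>Caps\<close>

text \<open>\<open>ka s t\<close> stands for four times the squared cosine of the dihedral angle: it
  is zero at a right angle, and \<open>weights\<close> keeps it below 4 because no angle is
  zero.\<close>

definition mirrored ::
 "(nat => nat => real) => nat set => (nat set \<times> nat) set => (nat => real^4) => (nat => real^4) => bool" where
 "mirrored ka F Q al v \<longleftrightarrow> (ALL s:F. al s .* v s = 2) &
   (ALL s t. nbr Q s t --> al s .* v t <= 0 & (al s .* v t = 0 \<longleftrightarrow> ka s t = 0) &
    (al s .* v t) * (al t .* v s) = ka s t)"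

definition weights :: "(nat => nat => real) => bool" where
 "weights ka \<longleftrightarrow> (ALL s t. ka s t = ka t s & ka s t < 4)"

lemma mirrored_cartan:
 assumes "mirrored ka F Q al v" "weights ka" "A <= F" "ALL s:A. ALL t:A. s ~= t --> nbr Q s t"
 shows "cartan al v A"
 unfolding cartan_def
proof (intro conjI ballI impI)
 show "al s .* v s = 2" if "s : A" for s using assms that unfolding mirrored_def by blast
 fix s t assume st: "s : A" "t : A" "s ~= t"
 note n = assms(4)[rule_format, OF st] assms(4)[rule_format, OF st(2,1) st(3)[symmetric]]
 have k: "ka s t = ka t s" "ka s t < 4" using assms(2) unfolding weights_def by blast+
 show "al s .* v t <= 0" using n assms(1) unfolding mirrored_def by blast
 have "al s .* v t = 0 \<longleftrightarrow> ka s t = 0" "al t .* v s = 0 \<longleftrightarrow> ka t s = 0"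
  using n assms(1) unfolding mirrored_def by blast+
 then show "al s .* v t = 0 \<longleftrightarrow> al t .* v s = 0" using k by simp
 have "(al s .* v t) * (al t .* v s) = ka s t" using n assms(1) unfolding mirrored_def by blast
 then show "(al s .* v t) * (al t .* v s) < 4" using k by simp
qed

text \<open>Compare the forms on the basis of \<open>cut_basis\<close>. The value on the removed
  vertex \<open>q\<close> determines \<open>Z\<close>, and the values on the three new vertices,
  where \<open>al m\<close> vanishes, determine the other coefficients; their signs can be read
  off.\<close>

lemma truncation_relation:
 fixes al :: "nat => real^4"
 assumes st: "stacked a b c d F Q S" and Tl: "({i, j, k}, l) : Q" and ijk: "distinct [i, j, k]"
  and m: "m ~: F"
  and sh: "shaped (insert m F)
   (cut Q i j k l m) al"
 shows "EX Z e1 e2 e3. Z > 0 & e1 > 0 & e2 > 0 & e3 > 0 &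
  al m = comb al e1 e2 e3 i j k - Z *\<^sub>R al l"
proof -
 obtain q bi bj bk where cb: "cut_basis F al i j k m q bi bj bk"
  using truncation_geometry[OF assms] by blast
 note g = cut_basisD[OF cb]
 have in_F: "i : F" "j : F" "k : F" "l : F" "l ~: {i, j, k}" using stacked_tri[OF st Tl] by auto
 then have nm: "i ~= m" "j ~= m" "k ~= m" "l ~= m" using m by auto
 have z: "al i .* q = 0" "al j .* q = 0" "al k .* q = 0" by (simp_all add: vertex_at_zero[OF g(1)])
 have lq: "al l .* q < 0" using in_F by (simp add: vertex_at_neg[OF g(1)])
 have bm: "al m .* bi = 0" "al m .* bj = 0" "al m .* bk = 0"
  using vertex_at_zero[OF g(3)] vertex_at_zero[OF g(4)] vertex_at_zero[OF g(5)] by auto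
 have bd: "al i .* bi < 0" "al j .* bj < 0" "al k .* bk < 0"
  using vertex_at_neg[OF g(3), of i] vertex_at_neg[OF g(4), of j] vertex_at_neg[OF g(5), of k]
   in_F nm ijk by auto
 have bl: "al l .* bi < 0" "al l .* bj < 0" "al l .* bk < 0"
  using vertex_at_neg[OF g(3), of l] vertex_at_neg[OF g(4), of l] vertex_at_neg[OF g(5), of l]
   in_F nm by auto
 define Z where "Z = (al m .* q) / - (al l .* q)"
 have Z: "Z > 0" using g(2) lq unfolding Z_def by (simp add: divide_pos_neg)
 have Zq: "al m .* q + Z * (al l .* q) = 0" using lq unfolding Z_def by simp
 define e1 where "e1 = Z * (al l .* bi) / (al i .* bi)"
 define e2 where "e2 = Z * (al l .* bj) / (al j .* bj)"
 define e3 where "e3 = Z * (al l .* bk) / (al k .* bk)"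
 have e: "e1 > 0" "e2 > 0" "e3 > 0"
  unfolding e1_def e2_def e3_def using Z bl bd by (simp_all add: divide_neg_neg mult_pos_neg)
 have "al m .* x = (comb al e1 e2 e3 i j k - Z *\<^sub>R al l) .* x" for x
 proof -
  define ui uj uk where "ui = al i .* x / (al i .* bi)" and "uj = al j .* x / (al j .* bj)"
   and "uk = al k .* x / (al k .* bk)"
  obtain ga where x: "x = ui *\<^sub>R bi + uj *\<^sub>R bj + uk *\<^sub>R bk + ga *\<^sub>R q"
   using g(6)[of x] unfolding ui_def uj_def uk_def by blast
  have "al m .* x = ga * (al m .* q)" by (subst x) (simp add: inner_add_right bm)
  moreover have "al l .* x = ui * (al l .* bi) + uj * (al l .* bj) + uk * (al l .* bk) + ga * (al l .* q)"
   by (subst x) (simp add: inner_add_right)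
  moreover have "e1 * (al i .* x) = Z * (ui * (al l .* bi))" "e2 * (al j .* x) = Z * (uj * (al l .* bj))"
   "e3 * (al k .* x) = Z * (uk * (al l .* bk))"
   unfolding e1_def e2_def e3_def ui_def uj_def uk_def by simp_all
  moreover have "ga * (al m .* q) = - (Z * (ga * (al l .* q)))" using Zq by algebra
  ultimately show ?thesis by (simp add: inner_add_left inner_diff_left algebra_simps)
 qed
 then have "al m = comb al e1 e2 e3 i j k - Z *\<^sub>R al l"
  using vector_eq_rdot[of "al m" "comb al e1 e2 e3 i j k - Z *\<^sub>R al l"] by blast
 then show ?thesis using Z e by blast
qed

lemma steps_relation:
 "stacked a b c d F Q S ==> shaped F Q al ==> (i, j, k, l, m) : S ==>
  EX Z e1 e2 e3. Z > 0 & e1 > 0 & e2 > 0 & e3 > 0 &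
  al m = comb al e1 e2 e3 i j k - Z *\<^sub>R al l"
proof (induction arbitrary: i j k l m rule: stacked.induct)
 case base
 then show ?case by simp
next
 case (step F Q S i0 j0 k0 l0 m0 i j k l m)
 have sh: "shaped F Q al" by (rule shaped_truncation[OF step(1-4) step.prems(1)])
 show ?case
 proof (cases "(i, j, k, l, m) : S")
  case True
  then show ?thesis by (rule step.IH[OF sh])
 next
  case False
  then have "i = i0" "j = j0" "k = k0" "l = l0" "m = m0" using step.prems(2) by auto
  then show ?thesis using truncation_relation[OF step(1-4) step.prems(1)] by blast
 qed
qed

text \<open>Paired with the poles of the circuit, the relation exhibits
  \<open>al m + Z *\<^sub>R al l\<close>, whose values are nonpositive, as the Cartan matrix applied
  to a positive vector. If the determinant is zero these values vanish, and since
  \<open>Z > 0\<close> both summands do.\<close>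

lemma steps_det:
 assumes st: "stacked a b c d F Q S" and sh: "shaped F Q al" and mi: "mirrored ka F Q al v"
  and w: "weights ka" and S: "(i, j, k, l, m) : S"
 shows "det3 al v i j k < 0 | (det3 al v i j k = 0 & (ALL s:{i, j, k}. ka l s = 0 & ka m s = 0))"
proof -
 obtain Z e1 e2 e3 where e: "Z > 0" "e1 > 0" "e2 > 0" "e3 > 0"
  and am: "al m = comb al e1 e2 e3 i j k - Z *\<^sub>R al l"
  using steps_relation[OF st sh S] by blast
 note stp = stacked_steps[OF st S]
 have d: "distinct [i, j, k]" and sub: "{i, j, k} <= F" "i : F" using stp by auto
 have n: "nbr Q l s" "nbr Q m s" if "s : {i, j, k}" for s using stp that by auto
 have c: "cartan al v {i, j, k}"
  by (rule mirrored_cartan[OF mi w sub(1)]) (use stp in simp)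
 define w0 where "w0 = al m + Z *\<^sub>R al l"
 have rows: "ALL s:{i, j, k}. (comb al e1 e2 e3 i j k) .* v s = w0 .* v s"
  unfolding w0_def am by simp
 have le: "al l .* v s <= 0" "al m .* v s <= 0" if "s : {i, j, k}" for s
  using mi n[OF that] unfolding mirrored_def by blast+
 have wle: "w0 .* v s <= 0" if "s : {i, j, k}" for s
  using le[OF that] e(1) unfolding w0_def inner_add_left inner_scaleR_left
  by (intro add_nonpos_nonpos mult_nonneg_nonpos) auto
 have "ka l s = 0 & ka m s = 0" if s: "s : {i, j, k}" and 0: "w0 .* v s = 0" for s
 proof -
  have "Z * (al l .* v s) <= 0" using le(1)[OF s] e(1) by (auto intro: mult_nonneg_nonpos)
  then have "al m .* v s = 0" "Z * (al l .* v s) = 0"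
   using le(2)[OF s] 0 unfolding w0_def inner_add_left inner_scaleR_left by linarith+
  then have "al m .* v s = 0" "al l .* v s = 0" using e(1) by auto
  then show ?thesis using mi n[OF s] unfolding mirrored_def by blast
 qed
 then show ?thesis using row_solution_nonpos[OF c d rows _ e(2-4)] wle by blast
qed

text \<open>Move along the segment from \<open>p s\<close> to \<open>p s + r s\<close>. At the
  smallest parameter \<open>- p s / r s\<close> where some value reaches zero, all values are still
  nonpositive, which \<open>h\<close> does not allow.\<close>

lemma affine_first_zero:
 fixes p r :: "'a => real"
 assumes "finite A" and p: "!!s. s : A ==> p s < 0"
  and h: "!!ta. 0 <= ta ==> ta <= 1 ==> (ALL s:A. p s + ta * r s <= 0) ==> (ALL s:A. p s + ta * r s < 0)"
  and t: "t : A"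
 shows "p t + r t < 0"
proof (rule ccontr)
 assume "~ p t + r t < 0"
 define B where "B = {s : A. p s + r s >= 0}"
 have B: "finite B" "t : B" using assms \<open>~ p t + r t < 0\<close> unfolding B_def by auto
 define f where "f s = - p s / r s" for s
 obtain s where s: "s : B" "!!u. u : B ==> f s <= f u"
  using ex_min_if_finite[of "f ` B"] B by (metis (no_types, opaque_lifting) empty_iff finite_imageI imageE imageI leI)
 have rs: "r u > 0" "f u > 0" "f u <= 1" "p u + f u * r u = 0" if "u : B" for u
 proof -
  have u: "p u < 0" "p u + r u >= 0" using that p unfolding B_def by auto
  then show r: "r u > 0" by linarith
  show "f u > 0" "f u <= 1" "p u + f u * r u = 0" unfolding f_def using r u by (simp_all add: field_simps)
 qed
 have le: "p u + f s * r u <= 0" if "u : A" for u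
 proof (cases "u : B")
  case True
  have "f s * r u <= f u * r u" using s(2)[OF True] rs(1)[OF True] by simp
  then show ?thesis using rs(4)[OF True] by linarith
 next
  case False
  then have u: "p u < 0" "p u + r u < 0" using that p unfolding B_def by auto
  show ?thesis
  proof (cases "r u <= 0")
   case True
   then have "f s * r u <= 0" using rs(2)[OF s(1)] by (simp add: mult_nonneg_nonpos)
   then show ?thesis using u by linarith
  next
   case False
   then have "f s * r u <= 1 * r u" using rs(3)[OF s(1)] by (intro mult_right_mono) auto
   then show ?thesis using u by linarith
  qed
 qed
 have "p s + f s * r s < 0"
  using h[of "f s"] rs[OF s(1)] le s(1) unfolding B_def by auto
 then show False using rs(4)[OF s(1)] by simp
qed

text \<open>Points of the bounding hyperplane count only if \<open>al l\<close> pairs nontrivially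
  with \<open>T\<close>. Otherwise the pole is a negative multiple of \<open>al l\<close>, so the
  hyperplane carries the face \<open>l\<close> itself and its points cannot be off that
  face.\<close>

definition in_cap :: "(nat => real^4) => (nat => real^4) => nat set => nat => real^4 => real^4 => bool" where
 "in_cap al v T l mu x \<longleftrightarrow> mu .* x > 0 | (mu .* x = 0 & (EX s:T. al l .* v s ~= 0))"

text \<open>When the determinant at a vertex \<open>T\<close> is negative, the pole of \<open>T\<close> spans the hyperplane that is
 invariant under the three reflections. It cuts a corner off the polyhedron; the corners are
 disjoint and only meet the faces of \<open>T\<close>. A truncation whose own reflection is compatible stays
 inside the corner, which is why its result is again a polyhedron of the expected type.\<close>

definition caps_ok :: "nat set => (nat set \<times> nat) set => (nat => real^4) => (nat => real^4) => bool" where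
 "caps_ok F Q al v \<longleftrightarrow>
   (ALL T l mu x. (T, l) : Q --> negative al v T --> pole F al v T mu --> x ~= 0 --> (ALL s:F. al s .* x <= 0) -->
    in_cap al v T l mu x --> (ALL s:F - T. al s .* x < 0)) &
   (ALL T T' mu mu' x. T : fst ` Q --> T' : fst ` Q --> T ~= T' --> negative al v T --> negative al v T' -->
    pole F al v T mu --> pole F al v T' mu' --> x ~= 0 --> (ALL s:F. al s .* x <= 0) -->
    ~ (mu .* x >= 0 & mu' .* x >= 0))"

lemma capsD1:
 "caps_ok F Q al v ==> (T, l) : Q ==> negative al v T ==> pole F al v T mu ==> x ~= 0 ==> ALL s:F. al s .* x <= 0 ==>
  in_cap al v T l mu x ==> s : F ==> s ~: T ==> al s .* x < 0"
 unfolding caps_ok_def by blast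

lemma capsD2:
 "caps_ok F Q al v ==> T : fst ` Q ==> T' : fst ` Q ==> T ~= T' ==> negative al v T ==> negative al v T' ==>
  pole F al v T mu ==> pole F al v T' mu' ==> x ~= 0 ==> ALL s:F. al s .* x <= 0 ==> mu .* x >= 0 ==> mu' .* x >= 0 ==> False"
 unfolding caps_ok_def by blast

text \<open>Only one face lies off a given vertex of a simplex, so the first property is a sign
  count in the formula for the pole. Two vertices of a simplex share two faces, which is the
  situation of \<open>caps_disjoint\<close>.\<close>

lemma caps_base:
 fixes al v :: "nat => real^4"
 assumes d: "distinct [a, b, c, d]"
  and Q: "Q = (tetra a b c d)"
  and sh: "shaped {a, b, c, d} Q al" and mi: "mirrored ka {a, b, c, d} Q al v" and w: "weights ka"
 shows "caps_ok {a, b, c, d} Q al v"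
proof -
 let ?F = "{a, b, c, d}"
 have st: "stacked a b c d ?F Q {}" unfolding Q by (rule stacked.base[OF d])
 have ca: "cartan al v ?F"
  by (rule mirrored_cartan[OF mi w subset_refl]) (simp add: nbr_base[OF d] Q)
 have fr: "frame al ?F"
  unfolding frame_def using shaped_base_frame[OF d sh[unfolded Q]] by blast
 have tri: "T <= ?F & card T = 3" if "T : fst ` Q" for T using stacked_tri_card[OF st that] .
 have part1: "al s .* x < 0"
  if Tl: "(T, l) : Q" and ne: "negative al v T" and p: "pole ?F al v T mu" and x: "x ~= 0" "ALL s:?F. al s .* x <= 0"
   and cap: "in_cap al v T l mu x" and s: "s : ?F - T" for T l mu x s
 proof -
  obtain i j k where T: "T = {i, j, k}" and ijk: "distinct [i, j, k]" and D: "det3 al v i j k < 0"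
   using ne unfolding negative_def by blast
  have "l : ?F" "l ~: T" "insert l T = ?F" using Tl stacked_tri[OF st Tl] d unfolding Q by auto
  then have s: "s = l" and F: "{i, j, k, l} = ?F" "distinct [i, j, k, l]"
   using s ijk unfolding T by auto
  obtain q where q: "vertex_at ?F al {i, j, k} q" using sh Tl unfolding shaped_def T by force
  have fr': "frame al {i, j, k, l}" unfolding F by (rule fr)
  obtain d1 d2 d3 where e: "(d1 > 0 & d2 > 0 & d3 > 0) | (d1 = 0 & d2 = 0 & d3 = 0 & (ALL s:{i, j, k}. al l .* v s = 0))"
   "ALL mu. pole ?F al v {i, j, k} mu --> (EX rh>0. mu = rh *\<^sub>R (comb al d1 d2 d3 i j k - al l))"
   using pole_form[OF ca[folded F(1)] F(2) D fr' q \<open>l : ?F\<close>] by (elim exE conjE)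
  obtain rh where r: "rh > 0" "mu = rh *\<^sub>R (comb al d1 d2 d3 i j k - al l)" using e(2) p T by blast
  show ?thesis
  proof (rule ccontr)
   assume "~ al s .* x < 0"
   then have l0: "al l .* x = 0" using x(2) \<open>l : ?F\<close> unfolding s by force
   have mx: "mu .* x = rh * (d1 * (al i .* x) + d2 * (al j .* x) + d3 * (al k .* x))"
    unfolding r(2) by (simp add: inner_add_left inner_diff_left l0)
   have ijkF: "i : ?F" "j : ?F" "k : ?F" unfolding F(1)[symmetric] by auto
   then have n: "d1 * (al i .* x) <= 0" "d2 * (al j .* x) <= 0" "d3 * (al k .* x) <= 0"
    using e(1) x(2) by (auto intro!: mult_nonneg_nonpos)
   then have "mu .* x <= 0" unfolding mx using r(1) by (intro mult_nonneg_nonpos) auto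
   then have m0: "mu .* x = 0" and fl: "EX s:T. al l .* v s ~= 0" using cap unfolding in_cap_def by auto
   then have pos: "d1 > 0" "d2 > 0" "d3 > 0" using e(1) unfolding T by auto
   have "d1 * (al i .* x) + d2 * (al j .* x) + d3 * (al k .* x) = 0" using m0 r(1) unfolding mx by simp
   then have "d1 * (al i .* x) = 0" "d2 * (al j .* x) = 0" "d3 * (al k .* x) = 0" using n by linarith+
   then have "ALL s:{i, j, k, l}. al s .* x = 0" using pos l0 by simp
   then have "x = 0" by (rule frameD[OF fr'])
   then show False using x(1) by simp
  qed
 qed
 have part2: False
  if T: "T : fst ` Q" "T' : fst ` Q" "T ~= T'" and ne: "negative al v T" "negative al v T'"
   and p: "pole ?F al v T mu" "pole ?F al v T' mu'" and x: "x ~= 0" "ALL s:?F. al s .* x <= 0"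
   and pos: "mu .* x >= 0" "mu' .* x >= 0" for T T' mu mu' x
 proof -
  have t: "T <= ?F" "card T = 3" "T' <= ?F" "card T' = 3" using tri T by blast+
  then have fin: "finite T" "finite T'" by (metis card.infinite zero_neq_numeral)+
  have "~ T <= T'" "~ T' <= T" using card_subset_eq[OF fin(2)] card_subset_eq[OF fin(1)] t T(3) by metis+
  then obtain k l where k: "k : T" "k ~: T'" and l: "l : T'" "l ~: T" by blast
  have "card (T - {k}) = 2" using t k fin by simp
  then obtain i j where ij: "T - {k} = {i, j}" "i ~= j" by (auto simp: card_2_iff)
  then have Te: "T = {i, j, k}" and ijk: "distinct [i, j, k, l]" using k l by auto
  have "card ?F = 4" using d by simp
  have F: "{i, j, k, l} = ?F"
   using t l Te ijk \<open>card ?F = 4\<close> by (intro card_subset_eq) auto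
  have "T' <= {i, j, l}" using t(3) k(2) unfolding F[symmetric] by auto
  then have T'e: "T' = {i, j, l}" using t(4) ijk by (intro card_subset_eq) auto
  have D: "det3 al v i j k < 0" "det3 al v i j l < 0"
   using ne ijk unfolding Te T'e by (simp_all add: negative_iff)
  obtain q q' where q: "vertex_at ?F al {i, j, k} q" "vertex_at ?F al {i, j, l} q'"
   using bspec[OF sh[unfolded shaped_def] T(1)] bspec[OF sh[unfolded shaped_def] T(2)]
   unfolding Te T'e by blast
  have xs: "ALL s:{i, j, k, l}. al s .* x <= 0" and kl: "k : ?F" "l : ?F"
   unfolding F using x(2) t k l by auto
  show False
   by (rule caps_disjoint[OF ca[folded F] ijk D fr[folded F] q kl p[unfolded Te T'e] x(1) xs pos])
 qed
 show ?thesis unfolding caps_ok_def using part1 part2 by blast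
qed

lemma two_of_three:
 "x : {t1, t2, t3} ==> y : {t1, t2, t3} ==> x ~= y ==>
  (x = t1 & y = t2) | (x = t1 & y = t3) | (x = t2 & y = t1) | (x = t2 & y = t3) |
  (x = t3 & y = t1) | (x = t3 & y = t2)"
 by blast

text \<open>Write \<open>al m\<close> as a nonnegative combination of \<open>al i\<close>,
  \<open>al j\<close>, \<open>al k\<close> plus \<open>Z\<close> times the pole of the vertex. On
  the cone the first part is nonpositive, so whatever \<open>m\<close> cuts off lies in the cap and
  no other vertex is touched. The caps at the new vertices in turn lie inside the old cap, which
  keeps them away from all other caps.\<close>

lemma caps_truncation:
 fixes al v :: "nat => real^4"
 assumes st: "stacked a b c d F Q S" and Tl: "({i, j, k}, l) : Q" and ijk: "distinct [i, j, k]"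
  and m: "m ~: F"
  and Q2: "Q2 = cut Q i j k l m"
  and sh: "shaped F Q al" and mi: "mirrored ka (insert m F) Q2 al v" and w: "weights ka"
  and D: "det3 al v i j k < 0"
  and am: "al m = comb al e1 e2 e3 i j k - Z *\<^sub>R al l" and Z: "Z > 0"
  and nf: "EX s:{i, j, k}. ka l s ~= 0 | ka m s ~= 0"
  and caps: "caps_ok F Q al v"
 shows "shaped (insert m F) Q2 al & caps_ok (insert m F) Q2 al v"
proof -
 let ?T0 = "{i, j, k}"
 have st2: "stacked a b c d (insert m F) Q2 (insert (i, j, k, l, m) S)"
  unfolding Q2 by (rule stacked.step[OF st Tl ijk m])
 have K2: "fst ` Q2 = (fst ` Q - {?T0}) Un (new_tris i j k m)"
  unfolding Q2 by (rule stacked_step_tris[OF st Tl m])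
 have T0: "?T0 : fst ` Q" using Tl by force
 have in_F: "i : F" "j : F" "k : F" "l : F" "l ~: ?T0" using stacked_tri[OF st Tl] by auto
 then have nm: "i ~= m" "j ~= m" "k ~= m" "l ~= m" using m by auto
 note stp = stacked_steps[OF st2, of i j k l m]
 have cl: "cartan al v {i, j, k, l}" and cm: "cartan al v {i, j, k, m}"
  by (rule mirrored_cartan[OF mi w]; use in_F stp in auto)+
 have dl: "distinct [i, j, k, l]" and dm: "distinct [i, j, k, m]" using ijk in_F nm by auto
 have c3: "cartan al v ?T0" by (rule cartan_subset[OF cl]) auto
 have nb: "nbr Q2 l s" "nbr Q2 m s" if "s : ?T0" for s
  using stp[OF insertI1] that in_F nm by auto
 have kl: "al l .* v s = 0 \<longleftrightarrow> ka l s = 0" and km: "al m .* v s = 0 \<longleftrightarrow> ka m s = 0" if "s : ?T0" for s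
  using mi nb[OF that] unfolding mirrored_def by blast+
 have nf': "(EX s:?T0. al l .* v s ~= 0) | (EX s:?T0. al m .* v s ~= 0)" using nf kl km by blast
 have fr: "frame al {i, j, k, l}"
  unfolding frame_def using shaped_frames[OF st sh Tl] by (simp add: insert_commute)
 obtain q where q: "vertex_at F al ?T0 q" using sh T0 unfolding shaped_def by blast
 have lq: "al l .* q < 0" using vertex_at_neg[OF q] in_F by blast
 obtain d1 d2 d3 where d: "ALL s:?T0. (comb al d1 d2 d3 i j k) .* v s = al l .* v s"
  and dpos: "(d1 > 0 & d2 > 0 & d3 > 0) | (d1 = 0 & d2 = 0 & d3 = 0 & (ALL s:?T0. al l .* v s = 0))"
  and p0: "pole F al v ?T0 (comb al d1 d2 d3 i j k - al l)"
  using pole_form[OF cl dl D fr q in_F(4)] by (elim exE conjE)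
 define mu0 where "mu0 = comb al d1 d2 d3 i j k - al l"
 define c1 where "c1 = e1 - Z * d1"
 define c2 where "c2 = e2 - Z * d2"
 define c3' where "c3' = e3 - Z * d3"
 \<comment> \<open>The pole has zero pairings, so the remainder has the same pairings with the
   circuit as \<open>al m\<close>, and \<open>row_solution_sign\<close> makes its coefficients
   nonnegative.\<close>
 have am': "al m = comb al c1 c2 c3' i j k + Z *\<^sub>R mu0"
  unfolding am mu0_def c1_def c2_def c3'_def by (simp add: algebra_simps)
 have crow: "ALL s:?T0. (comb al c1 c2 c3' i j k) .* v s = al m .* v s"
 proof
  fix s assume s: "s : ?T0"
  have "mu0 .* v s = 0" unfolding mu0_def inner_diff_left bspec[OF d s] by simp
  then show "(comb al c1 c2 c3' i j k) .* v s = al m .* v s"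
   unfolding am' inner_add_left by simp
 qed
 have mle: "ALL s:?T0. al m .* v s <= 0" using cartanD(2)[OF cm, of m] nm by auto
 have cpos: "(c1 > 0 & c2 > 0 & c3' > 0) | (c1 = 0 & c2 = 0 & c3' = 0 & (ALL s:?T0. al m .* v s = 0))"
  by (rule row_solution_sign[OF c3 ijk D crow mle])
 have neg0: "negative al v ?T0" unfolding negative_iff[OF ijk] by (rule D)
 have q0: "mu0 .* x = - (al l .* x)" if "ALL s:?T0. al s .* x = 0" for x
  using that unfolding mu0_def by (simp add: inner_add_left inner_diff_left)
 \<comment> \<open>The value of the pole is nonnegative by \<open>am'\<close>. If it is zero and
   \<open>al l\<close> is orthogonal to the circuit, then by \<open>nf\<close> the face
   \<open>m\<close> is not, so \<open>c1\<close>, \<open>c2\<close>, \<open>c3'\<close> are positive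
   and \<open>x\<close> would have to be zero.\<close>
 have claimA: "in_cap al v ?T0 l mu0 x" if x: "x ~= 0" "ALL s:F. al s .* x <= 0" "al m .* x >= 0" for x
 proof -
  have n: "c1 * (al i .* x) <= 0" "c2 * (al j .* x) <= 0" "c3' * (al k .* x) <= 0"
   using cpos x(2) in_F by (auto intro!: mult_nonneg_nonpos)
  have eq: "al m .* x = c1 * (al i .* x) + c2 * (al j .* x) + c3' * (al k .* x) + Z * (mu0 .* x)"
   unfolding am' by (simp add: inner_add_left)
  then have "Z * (mu0 .* x) >= 0" using n x(3) by linarith
  then have ge: "mu0 .* x >= 0" using Z by (simp add: zero_le_mult_iff)
  show ?thesis
  proof (cases "mu0 .* x = 0 & (ALL s:?T0. al l .* v s = 0)")
   case True
   then have "c1 > 0" "c2 > 0" "c3' > 0" using nf' cpos by auto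
   moreover have "c1 * (al i .* x) = 0" "c2 * (al j .* x) = 0" "c3' * (al k .* x) = 0"
    using eq n x(3) arg_cong[OF conjunct1[OF True], of "(*) Z"] by (simp_all only: mult_zero_right)
   ultimately have z: "ALL s:?T0. al s .* x = 0" by auto
   then have "ALL s:{i, j, k, l}. al s .* x = 0" using q0[OF z] True by auto
   then have "x = 0" by (rule frameD[OF fr])
   then show ?thesis using x(1) by simp
  next
   case False
   then show ?thesis using ge unfolding in_cap_def by fastforce
  qed
 qed
 have A': "al s .* x < 0" if "x ~= 0" "ALL s:F. al s .* x <= 0" "al m .* x >= 0" "s : F" "s ~: ?T0" for x s
  using capsD1[OF caps Tl neg0 p0 that(1,2) _ that(4,5)] claimA[OF that(1-3)] unfolding mu0_def by blast
 have frm: "frame al {i, j, k, m}"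
  unfolding frame_def
 proof (intro allI impI)
  fix x assume x: "ALL s:{i, j, k, m}. al s .* x = 0"
  have "al m .* x = e1 * (al i .* x) + e2 * (al j .* x) + e3 * (al k .* x) - Z * (al l .* x)"
   unfolding am by (simp add: inner_add_left inner_diff_left)
  moreover have "al i .* x = 0" "al j .* x = 0" "al k .* x = 0" "al m .* x = 0" using x by blast+
  ultimately have "Z * (al l .* x) = 0" by simp
  then have "ALL s:{i, j, k, l}. al s .* x = 0" using x Z by auto
  then show "x = 0" by (rule frameD[OF fr])
 qed
 have vle: "ALL s:F. al s .* x <= 0" if "vertex_at F al T x" for T x
  using that unfolding vertex_at_def by (metis DiffI less_imp_le order_refl)
 have vne: "x ~= 0" if T: "T : fst ` Q" and x: "vertex_at F al T x" for T x
 proof -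
  obtain l' where "(T, l') : Q" using T by auto
  then have "al l' .* x < 0" using vertex_at_neg[OF x] stacked_tri[OF st] by blast
  then show ?thesis by auto
 qed
 \<comment> \<open>An old vertex that is not cut off properly would lie in the cap, which meets only
   the faces of \<open>?T0\<close>, so its triple would be \<open>?T0\<close>.\<close>
 have old: "al m .* x < 0" if T: "T : fst ` Q" "T ~= ?T0" and x: "vertex_at F al T x" for T x
 proof (rule ccontr)
  assume "~ al m .* x < 0"
  then have neg: "al s .* x < 0" if "s : F" "s ~: ?T0" for s
   using A'[OF vne[OF T(1) x] vle[OF x] _ that] by simp
  have t: "T <= F" "card T = 3" using stacked_tri_card[OF st T(1)] by auto
  have "T <= ?T0" using neg vertex_at_zero[OF x] t by (metis less_irrefl subset_iff)
  then have "T = ?T0" using t ijk by (intro card_subset_eq) auto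
  then show False using T by simp
 qed
 have vnew: "vertex_at (insert m F) al T x" if "T : fst ` Q" "T ~= ?T0" "vertex_at F al T x" for T x
  using old[OF that] that(3) unfolding vertex_at_def by auto
 have mq: "al m .* q > 0"
  using q0[of q] vertex_at_zero[OF q] lq Z unfolding am' by (simp add: inner_add_left mult_pos_neg)
 \<comment> \<open>The candidate \<open>u\<close> solves four linear equations. On the segment from
   \<open>q\<close> to \<open>u\<close> the value of \<open>al m\<close> stays nonnegative, so by
   \<open>A'\<close> no face outside \<open>?T0\<close> is ever reached, and
   \<open>affine_first_zero\<close> gives the strict inequalities at \<open>u\<close>.\<close>
 have newv: "EX u. (ALL s:?T0 - {z}. al s .* u = 0) & al m .* u = 0 & al z .* u < 0 & (ALL s:F - ?T0. al s .* u < 0)"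
  if z: "z : ?T0" for z
 proof -
  have "EX u. al i .* u = (if i = z then -1 else 0) & al j .* u = (if j = z then -1 else 0) &
   al k .* u = (if k = z then -1 else 0) & al m .* u = 0"
   by (rule frame_solve) (rule frameD[OF frm], simp)
  then obtain u where u: "al i .* u = (if i = z then -1 else 0)" "al j .* u = (if j = z then -1 else 0)"
   "al k .* u = (if k = z then -1 else 0)" "al m .* u = 0" by blast
  have u': "al s .* u = (if s = z then -1 else 0)" if "s : ?T0" for s using that u by blast
  have "al t .* u < 0" if t: "t : F - ?T0" for t
  proof -
   define y where "y ta = (1 - ta) *\<^sub>R q + ta *\<^sub>R u" for ta
   have ay: "al s .* y ta = al s .* q + ta * (al s .* u - al s .* q)" for s ta
    unfolding y_def by (simp add: inner_add_right algebra_simps)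
   have "al t .* q + (al t .* u - al t .* q) < 0"
   proof (rule affine_first_zero[of "F - ?T0" "%s. al s .* q" "%s. al s .* u - al s .* q"])
    show "finite (F - ?T0)" using stacked_finite[OF st] by simp
    show "al s .* q < 0" if "s : F - ?T0" for s using vertex_at_neg[OF q] that by blast
    fix ta :: real assume tau: "0 <= ta" "ta <= 1" and le: "ALL s:F - ?T0. al s .* q + ta * (al s .* u - al s .* q) <= 0"
    have T0y: "al s .* y ta = (if s = z then - ta else 0)" if "s : ?T0" for s
     using vertex_at_zero[OF q that] u'[OF that] unfolding ay by simp
    have "ALL s:F. al s .* y ta <= 0"
    proof
     fix s assume "s : F"
     then show "al s .* y ta <= 0" using le T0y[of s] tau by (cases "s : ?T0") (auto simp: ay)
    qed
    moreover have "al m .* y ta >= 0" unfolding ay using u(4) mq tau by (simp add: algebra_simps mult_left_le_one_le)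
    moreover have "y ta ~= 0"
    proof
     assume 0: "y ta = 0"
     then have "ta = 0" using T0y[OF z] by simp
     then show False using 0 lq unfolding y_def by auto
    qed
    ultimately show "ALL s:F - ?T0. al s .* q + ta * (al s .* u - al s .* q) < 0"
     using A'[of "y ta"] unfolding ay by blast
   qed (rule t)
   then show ?thesis by simp
  qed
  then show ?thesis using u u' z by (intro exI[of _ u]) auto
 qed
 have newv': "EX u. vertex_at (insert m F) al {x, y, m} u"
  if "{x, y, z} = ?T0" "distinct [x, y, z]" for x y z
 proof -
  have z: "z : ?T0" and xy: "?T0 - {z} = {x, y}" using that by auto
  obtain u where u: "ALL s:{x, y}. al s .* u = 0" "al m .* u = 0" "al z .* u < 0" "ALL s:F - ?T0. al s .* u < 0"
   using newv[OF z] unfolding xy by blast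
  have "insert m F - {x, y, m} <= insert z (F - ?T0)" unfolding that(1)[symmetric] by auto
  then show ?thesis using u unfolding vertex_at_def by (intro exI[of _ u]) auto
 qed
 have perms: "{i, j, k} = ?T0" "distinct [i, j, k]" "{j, k, i} = ?T0" "distinct [j, k, i]"
  "{i, k, j} = ?T0" "distinct [i, k, j]" using ijk by auto
 have shaped2: "shaped (insert m F) Q2 al"
  unfolding shaped_def
 proof
  fix T assume "T : fst ` Q2"
  then consider "T : fst ` Q" "T ~= ?T0" | "T : (new_tris i j k m)" unfolding K2 by blast
  then show "EX q. vertex_at (insert m F) al T q"
  proof cases
   case 1
   then obtain x where "vertex_at F al T x" using bspec[OF sh[unfolded shaped_def]] by blast
   then show ?thesis using vnew[OF 1] by blast
  next
   case 2
   then show ?thesis using newv'[OF perms(1,2)] newv'[OF perms(3,4)] newv'[OF perms(5,6)] by blast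
  qed
 qed
 have poleold: "pole F al v T mu" if "T : fst ` Q" "T ~= ?T0" "pole (insert m F) al v T mu" for T mu
  using that(3) vnew[OF that(1,2)] unfolding pole_def by blast
 \<comment> \<open>Substitute \<open>am'\<close> for \<open>al m\<close> in the pole of the new
   vertex. The coefficient of \<open>al z\<close> becomes \<open>g3 * f3 - 1\<close>, positive by
   \<open>row_cross\<close>, so all terms other than the one with \<open>mu0\<close> are
   nonpositive, and that of \<open>z\<close> is even negative.\<close>
 have new: "mu0 .* x > 0 & al z .* x < 0"
  if e: "{xx, yy, z} = ?T0" "distinct [xx, yy, z]"
   and ne: "negative al v {xx, yy, m}" and p: "pole (insert m F) al v {xx, yy, m} mu"
   and x: "x ~= 0" "ALL s:insert m F. al s .* x <= 0" "mu .* x >= 0" for xx yy z mu x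
 proof -
  have set4: "{xx, yy, m, z} = {i, j, k, m}" "{xx, yy, z, m} = {i, j, k, m}" using e(1) by auto
  have z: "z : ?T0" "xx : ?T0" "yy : ?T0" using e(1) by auto
  then have zF: "z : insert m F" "xx : F" "yy : F" "z : F" using in_F by auto
  have dist: "distinct [xx, yy, m, z]" "distinct [xx, yy, m]" "distinct [xx, yy, z, m]"
   using e(2) z nm by auto
  have Dn: "det3 al v xx yy m < 0" using ne unfolding negative_iff[OF dist(2)] .
  have D0: "det3 al v xx yy z < 0" using D det3_set[OF e(1)[symmetric] ijk] by simp
  obtain u where u: "vertex_at (insert m F) al {xx, yy, m} u" using newv'[OF e] by blast
  obtain f1 f2 f3 where f: "ALL s:{xx, yy, m}. (comb al f1 f2 f3 xx yy m) .* v s = al z .* v s"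
   and fpos: "(f1 > 0 & f2 > 0 & f3 > 0) | (f1 = 0 & f2 = 0 & f3 = 0 & (ALL s:{xx, yy, m}. al z .* v s = 0))"
   and fp: "ALL mu. pole (insert m F) al v {xx, yy, m} mu -->
    (EX rh>0. mu = rh *\<^sub>R (comb al f1 f2 f3 xx yy m - al z))"
   using pole_form[OF cm[folded set4(1)] dist(1) Dn frm[folded set4(1)] u zF(1)] by (elim exE conjE)
  obtain g1 g2 g3 where g: "comb al c1 c2 c3' i j k = comb al g1 g2 g3 xx yy z"
   and gpos: "(g1 > 0 & g2 > 0 & g3 > 0) | g3 = 0"
  proof -
   have 3: "xx : {i, j, k}" "yy : {i, j, k}" "z : {i, j, k}" using z by auto
   define h where "h s = (if s = i then c1 else if s = j then c2 else c3')" for s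
   have h: "h i = c1" "h j = c2" "h k = c3'" unfolding h_def using ijk by auto
   have "(SUM s:{i, j, k}. h s *\<^sub>R al s) = (SUM s:{xx, yy, z}. h s *\<^sub>R al s)" unfolding e(1) ..
   then have "comb al c1 c2 c3' i j k = h xx *\<^sub>R al xx + h yy *\<^sub>R al yy + h z *\<^sub>R al z"
    using ijk e(2) h by (simp add: add.assoc)
   moreover have "(h xx > 0 & h yy > 0 & h z > 0) | h z = 0"
    using cpos 3 unfolding h_def by auto
   ultimately show thesis by (rule that)
  qed
  have grow: "ALL s:{xx, yy, z}. (comb al g1 g2 g3 xx yy z) .* v s = al m .* v s"
   using crow unfolding g e(1) .
  have cross: "g3 * f3 > 1"
   by (rule row_cross[OF cm[folded set4(2)] dist(3) D0 Dn grow f])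
  then have pos: "g1 > 0" "g2 > 0" "g3 > 0" "f1 > 0" "f2 > 0" "f3 > 0" using gpos fpos by auto
  obtain rh where r: "rh > 0" "mu = rh *\<^sub>R (comb al f1 f2 f3 xx yy m - al z)" using fp p by blast
  define X Y W M where "X = al xx .* x" and "Y = al yy .* x" and "W = al z .* x" and "M = al m .* x"
  have n: "X <= 0" "Y <= 0" "W <= 0" "M <= 0" using x(2) zF unfolding X_def Y_def W_def M_def by auto
  have "rh * (f1 * X + f2 * Y + f3 * M - W) >= 0"
   using x(3) unfolding r(2) X_def Y_def W_def M_def by (simp add: inner_add_left inner_diff_left)
  then have ge: "f1 * X + f2 * Y + f3 * M - W >= 0" using r(1) by (simp add: zero_le_mult_iff)
  have M: "M = g1 * X + g2 * Y + g3 * W + Z * (mu0 .* x)"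
   unfolding M_def am' g X_def Y_def W_def by (simp add: inner_add_left)
  have ge2: "(f1 + f3 * g1) * X + (f2 + f3 * g2) * Y + (g3 * f3 - 1) * W + f3 * Z * (mu0 .* x) >= 0"
   using ge unfolding M by (simp add: algebra_simps)
  have fn: "f1 * X <= 0" "f2 * Y <= 0" "f3 * M <= 0" using pos n by (auto intro!: mult_nonneg_nonpos)
  have zero: False if "X = 0" "Y = 0" "M = 0" "W = 0"
  proof -
   have "ALL s:{xx, yy, m, z}. al s .* x = 0" using that unfolding X_def Y_def W_def M_def by simp
   then have "x = 0" using frameD[OF frm[folded set4(1)]] by blast
   then show False using x(1) by simp
  qed
  have W: "W < 0"
  proof (rule ccontr)
   assume "~ W < 0"
   then have "W = 0" using n by simp
   moreover have "f1 * X = 0" "f2 * Y = 0" "f3 * M = 0" using fn ge \<open>W = 0\<close> by linarith+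
   ultimately show False using zero pos by auto
  qed
  have cn: "(f1 + f3 * g1) * X <= 0" "(f2 + f3 * g2) * Y <= 0"
   using pos n by (auto intro!: mult_nonneg_nonpos add_nonneg_nonneg mult_nonneg_nonneg)
  have "(g3 * f3 - 1) * W < 0" using cross W by (simp add: mult_pos_neg)
  then have "f3 * Z * (mu0 .* x) > 0" using ge2 cn by linarith
  moreover have "f3 * Z > 0" using pos(6) Z by (rule mult_pos_pos)
  ultimately have "mu0 .* x > 0" by (rule zero_less_mult_pos)
  then show ?thesis using W unfolding W_def by blast
 qed
 have xF: "ALL s:F. al s .* x <= 0" if "ALL s:insert m F. al s .* x <= 0" for x using that by simp
 have new': "EX xx yy z. {xx, yy, z} = ?T0 & distinct [xx, yy, z] & T = {xx, yy, m}"
  if "T : (new_tris i j k m)" for T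
  using that perms by blast
 have cap2: "al s .* x < 0"
  if T: "(T, l') : Q2" and ne: "negative al v T" and p: "pole (insert m F) al v T mu"
   and x: "x ~= 0" "ALL s:insert m F. al s .* x <= 0" and cap: "in_cap al v T l' mu x"
   and s: "s : insert m F - T" for T l' mu x s
 proof (cases "T : fst ` Q & T ~= ?T0")
  case True
  then have TQ: "(T, l') : Q" using T stacked_tri_card[OF st, of T] m unfolding Q2 by auto
  note po = poleold[OF conjunct1[OF True] conjunct2[OF True] p]
  have mu: "mu .* x >= 0" using cap unfolding in_cap_def by auto
  have mx: "al m .* x < 0"
  proof (rule ccontr)
   assume "~ al m .* x < 0"
   then have "in_cap al v ?T0 l mu0 x" using claimA[OF x(1) xF[OF x(2)]] by simp
   then have "mu0 .* x >= 0" unfolding in_cap_def by auto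
   then show False
    using capsD2[OF caps _ T0 _ ne neg0 po p0 x(1) xF[OF x(2)] mu] True unfolding mu0_def by blast
  qed
  show ?thesis
  proof (cases "s = m")
   case True then show ?thesis using mx by simp
  next
   case False
   then show ?thesis using capsD1[OF caps TQ ne po x(1) xF[OF x(2)] cap] s by blast
  qed
 next
  case False
  have "T : fst ` Q2" using T by force
  then have "T : (new_tris i j k m)" using False unfolding K2 by blast
  then have "EX xx yy z. {xx, yy, z} = ?T0 & distinct [xx, yy, z] & T = {xx, yy, m}" by (rule new')
  then obtain xx yy z where t: "{xx, yy, z} = ?T0" "distinct [xx, yy, z]" "T = {xx, yy, m}"
   by (elim exE conjE)
  have mu: "mu .* x >= 0" using cap unfolding in_cap_def by auto
  have n: "mu0 .* x > 0" "al z .* x < 0" using new[OF t(1,2) ne[unfolded t(3)] p[unfolded t(3)] x mu] by auto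
  have "in_cap al v ?T0 l mu0 x" using n(1) unfolding in_cap_def by blast
  then have "al s .* x < 0" if "s : F" "s ~: ?T0" for s
   using capsD1[OF caps Tl neg0 p0 x(1) xF[OF x(2)] _ that] unfolding mu0_def by blast
  moreover have "s = z | (s : F & s ~: ?T0)" using s unfolding t(3) t(1)[symmetric] by blast
  ultimately show ?thesis using n(2) by blast
 qed
 have capnew0: "mu0 .* x >= 0"
  if tt: "T : (new_tris i j k m)" "negative al v T" "pole (insert m F) al v T mu"
   "x ~= 0" "ALL s:insert m F. al s .* x <= 0" "mu .* x >= 0" for T mu x
 proof -
  obtain xx yy z where t: "{xx, yy, z} = ?T0" "distinct [xx, yy, z]" "T = {xx, yy, m}"
   using new'[OF tt(1)] by (elim exE conjE)
  show ?thesis using new[OF t(1,2) tt(2,3)[unfolded t(3)] tt(4-6)] by simp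
 qed
 have capnewnew: False
  if e: "{xx, yy, z} = ?T0" "distinct [xx, yy, z]"
   and ne: "negative al v {xx, yy, m}" "negative al v {xx, z, m}"
   and p: "pole (insert m F) al v {xx, yy, m} mu" "pole (insert m F) al v {xx, z, m} mu'"
   and x: "x ~= 0" "ALL s:insert m F. al s .* x <= 0" "mu .* x >= 0" "mu' .* x >= 0" for xx yy z mu mu' x
 proof -
  have set4: "{xx, m, yy, z} = {i, j, k, m}" using e(1) by auto
  have z: "z : ?T0" "xx : ?T0" "yy : ?T0" using e(1) by auto
  then have zF: "yy : insert m F" "z : insert m F" using in_F by auto
  have dist: "distinct [xx, m, yy, z]" "distinct [xx, m, yy]" "distinct [xx, m, z]"
   using e(2) z nm by auto
  have sw: "{xx, yy, m} = {xx, m, yy}" "{xx, z, m} = {xx, m, z}" by auto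
  have e': "{xx, z, yy} = ?T0" "distinct [xx, z, yy]" using e by auto
  obtain u u' where u: "vertex_at (insert m F) al {xx, m, yy} u" "vertex_at (insert m F) al {xx, m, z} u'"
   using newv'[OF e] newv'[OF e'] unfolding sw by blast
  have xs: "ALL s:{xx, m, yy, z}. al s .* x <= 0" unfolding set4 using x(2) in_F by auto
  show False
   by (rule caps_disjoint[OF cm[folded set4] dist(1) _ _ frm[folded set4] u zF p[unfolded sw] x(1) xs x(3,4)])
    (use ne in \<open>simp_all add: sw negative_iff[OF dist(2)] negative_iff[OF dist(3)]\<close>)
 qed
 have disj: False
  if T: "T : fst ` Q2" "T' : fst ` Q2" "T ~= T'" and ne: "negative al v T" "negative al v T'"
   and p: "pole (insert m F) al v T mu" "pole (insert m F) al v T' mu'"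
   and x: "x ~= 0" "ALL s:insert m F. al s .* x <= 0" "mu .* x >= 0" "mu' .* x >= 0" for T T' mu mu' x
 proof -
  have mixed: False
   if T: "T : fst ` Q" "T ~= ?T0" "T' : (new_tris i j k m)" and ne: "negative al v T" "negative al v T'"
   and p: "pole (insert m F) al v T mu" "pole (insert m F) al v T' mu'"
   and x: "x ~= 0" "ALL s:insert m F. al s .* x <= 0" "mu .* x >= 0" "mu' .* x >= 0" for T T' mu mu'
  proof -
   have "mu0 .* x >= 0" by (rule capnew0[OF T(3) ne(2) p(2) x(1,2,4)])
   then show False
    using capsD2[OF caps T(1) T0 T(2) ne(1) neg0 poleold[OF T(1,2) p(1)] p0 x(1) xF[OF x(2)] x(3)]
    unfolding mu0_def by blast
  qed
  have K2': "A : fst ` Q & A ~= ?T0 | A : (new_tris i j k m)" if "A : fst ` Q2" for A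
   using that unfolding K2 by (simp only: Un_iff Diff_iff singleton_iff simp_thms)
  show False
   using K2'[OF T(1)] K2'[OF T(2)]
  proof (elim disjE conjE)
   assume 1: "T : fst ` Q" "T ~= ?T0" "T' : fst ` Q" "T' ~= ?T0"
   show False
    by (rule capsD2[OF caps 1(1,3) T(3) ne poleold[OF 1(1,2) p(1)] poleold[OF 1(3,4) p(2)]
      x(1) xF[OF x(2)] x(3,4)])
  next
   assume 2: "T : fst ` Q" "T ~= ?T0" "T' : (new_tris i j k m)"
   show False by (rule mixed[OF 2 ne p x])
  next
   assume 3: "T' : fst ` Q" "T' ~= ?T0" "T : (new_tris i j k m)"
   show False by (rule mixed[OF 3 ne(2,1) p(2,1) x(1,2,4,3)])
  next
   assume 4: "T : (new_tris i j k m)" "T' : (new_tris i j k m)"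
   have "EX xx yy z. {xx, yy, z} = ?T0 & distinct [xx, yy, z] & T = {xx, yy, m} & T' = {xx, z, m}"
   proof -
    have s: "{j, i, m} = {i, j, m}" "{k, j, m} = {j, k, m}" "{k, i, m} = {i, k, m}" by auto
    have "(T = {i, j, m} & T' = {j, k, m}) | (T = {i, j, m} & T' = {i, k, m}) |
     (T = {j, k, m} & T' = {i, j, m}) | (T = {j, k, m} & T' = {i, k, m}) |
     (T = {i, k, m} & T' = {i, j, m}) | (T = {i, k, m} & T' = {j, k, m})"
     by (rule two_of_three[OF 4 T(3)])
    then show ?thesis
    proof (elim disjE conjE)
     assume "T = {i, j, m}" "T' = {j, k, m}"
     then show ?thesis using ijk by (intro exI[of _ j] exI[of _ i] exI[of _ k]) auto
    next
     assume "T = {i, j, m}" "T' = {i, k, m}"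
     then show ?thesis using ijk by (intro exI[of _ i] exI[of _ j] exI[of _ k]) auto
    next
     assume "T = {j, k, m}" "T' = {i, j, m}"
     then show ?thesis using ijk by (intro exI[of _ j] exI[of _ k] exI[of _ i]) auto
    next
     assume "T = {j, k, m}" "T' = {i, k, m}"
     then show ?thesis using ijk by (intro exI[of _ k] exI[of _ j] exI[of _ i]) auto
    next
     assume "T = {i, k, m}" "T' = {i, j, m}"
     then show ?thesis using ijk by (intro exI[of _ i] exI[of _ k] exI[of _ j]) auto
    next
     assume "T = {i, k, m}" "T' = {j, k, m}"
     then show ?thesis using ijk by (intro exI[of _ k] exI[of _ i] exI[of _ j]) auto
    qed
   qed
   then obtain xx yy z where e: "{xx, yy, z} = ?T0" "distinct [xx, yy, z]"
    "T = {xx, yy, m}" "T' = {xx, z, m}" by blast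
   show False by (rule capnewnew[OF e(1,2) ne[unfolded e(3,4)] p[unfolded e(3,4)] x])
  qed
 qed
 have "caps_ok (insert m F) Q2 al v" unfolding caps_ok_def using cap2 disj by blast
 then show ?thesis using shaped2 by blast
qed

lemma mirrored_truncation:
 assumes st: "stacked a b c d F Q S" and Tl: "({i, j, k}, l) : Q" and ijk: "distinct [i, j, k]"
  and m: "m ~: F"
  and mi: "mirrored ka (insert m F)
   (cut Q i j k l m) al v"
 shows "mirrored ka F Q al v"
 using mi unfolding mirrored_def nbr_step[OF st Tl m ijk] by blast

text \<open>Converse of \<open>steps_relation\<close> and \<open>steps_det\<close>. The positivity
  of \<open>e1\<close>, \<open>e2\<close>, \<open>e3\<close> is not assumed: the caps provide what
  it would give.\<close>

lemma shaped_from_relations: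
 assumes "stacked a b c d F Q S" and "weights ka" and "mirrored ka F Q al v"
  and "shaped {a, b, c, d} (tetra a b c d) al"
  and "!!i j k l m. (i, j, k, l, m) : S ==> det3 al v i j k < 0 &
   (EX Z e1 e2 e3. Z > 0 & al m = comb al e1 e2 e3 i j k - Z *\<^sub>R al l) &
   (EX s:{i, j, k}. ka l s ~= 0 | ka m s ~= 0)"
 shows "shaped F Q al & caps_ok F Q al v"
 using assms
proof (induction rule: stacked.induct)
 case base
 then show ?case using caps_base[OF base(1) refl base.prems(3,2,1)] by blast
next
 case (step F Q S i j k l m)
 have mi: "mirrored ka F Q al v" by (rule mirrored_truncation[OF step(1-4) step.prems(2)])
 have "shaped F Q al & caps_ok F Q al v"
  by (rule step.IH[OF step.prems(1) mi step.prems(3)]) (rule step.prems(4), simp)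
 then have IH: "shaped F Q al" "caps_ok F Q al v" by auto
 note h = step.prems(4)[OF insertI1]
 obtain Z e1 e2 e3 where Z: "Z > 0" and am: "al m = comb al e1 e2 e3 i j k - Z *\<^sub>R al l"
  using h by blast
 show ?case
  by (rule caps_truncation[OF step(1-4) refl IH(1) step.prems(2) step.prems(1) _ am Z _ IH(2)])
   (use h in auto)
qed

subsection \<open>Faces of a polyhedron\<close>

lemma ray_eq_iff: "ray x = ray y \<longleftrightarrow> (EX c>0. y = c *\<^sub>R x)"
proof
 assume "ray x = ray y"
 moreover have "y : ray y" unfolding ray_def by (auto intro: exI[of _ 1])
 ultimately show "EX c>0. y = c *\<^sub>R x" unfolding ray_def by blast
next
 assume "EX c>0. y = c *\<^sub>R x"
 then obtain c where c: "c > 0" "y = c *\<^sub>R x" by blast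
 show "ray x = ray y"
 proof
  show "ray x <= ray y"
  proof
   fix z assume "z : ray x"
   then obtain b where "b > 0" "z = b *\<^sub>R x" unfolding ray_def by blast
   then have "z = (b / c) *\<^sub>R y" "b / c > 0" using c by auto
   then show "z : ray y" unfolding ray_def by blast
  qed
  show "ray y <= ray x"
  proof
   fix z assume "z : ray y"
   then obtain b where "b > 0" "z = b *\<^sub>R y" unfolding ray_def by blast
   then have "z = (b * c) *\<^sub>R x" "b * c > 0" using c by auto
   then show "z : ray x" unfolding ray_def by blast
  qed
 qed
qed

definition poly_cone :: "nat set => (nat => real^4) => (real^4) set" where
 "poly_cone F al = {x. ALL s:F. al s .* x <= 0}"

definition rays_of :: "(real^4) set => (real^4) set set" where
 "rays_of D = ray ` (D - {0})"

definition conic_set :: "(real^4) set => bool" where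
 "conic_set D \<longleftrightarrow> 0 : D & (ALL x:D. ALL c>0. c *\<^sub>R x : D)"

lemma cone_over_rays_of: "conic_set D ==> cone_over (rays_of D) = D"
 unfolding cone_over_def rays_of_def conic_set_def
 by (auto simp: ray_eq_iff) (metis divideR_right less_irrefl scaleR_left.zero zero_less_divide_1_iff
  inverse_eq_divide scaleR_scaleR right_inverse scaleR_one inverse_positive_iff_positive)

lemma conic_cone_over: "conic_set (cone_over A)"
 unfolding conic_set_def cone_over_def by (auto simp: ray_eq_iff) (metis ray_eq_iff)

lemma rays_of_cone_over:
 assumes "A <= rays_of D"
 shows "rays_of (cone_over A) = A"
 using assms unfolding rays_of_def cone_over_def by (auto simp: image_iff subset_iff)

lemma cut_out_eq: "cut_out (al ` F) = rays_of (poly_cone F al)"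
 unfolding cut_out_def rays_of_def poly_cone_def by (rule arg_cong[of _ _ "image ray"]) auto

lemma conic_poly_cone: "conic_set (poly_cone F al)"
 unfolding conic_set_def poly_cone_def by (auto simp: mult_nonneg_nonpos)

lemma convex_poly_cone: "convex (poly_cone F al)"
proof -
 have "poly_cone F al = (INT s:F. {x. al s .* x <= 0})" unfolding poly_cone_def by auto
 then show ?thesis by (simp add: convex_INT convex_halfspace_le)
qed

lemma polyhedron_poly_cone: "finite F ==> polyhedron (poly_cone F al)"
proof -
 assume "finite F"
 moreover have "poly_cone F al = \<Inter>((%s. {x. al s .* x <= 0}) ` F)" unfolding poly_cone_def by auto
 ultimately show ?thesis by (simp only:) (intro polyhedron_Inter, auto simp: polyhedron_halfspace_le)
qed

lemma rays_of_subset_iff: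
 assumes "conic_set A" "conic_set B"
 shows "rays_of A <= rays_of B \<longleftrightarrow> A <= B"
proof
 assume "rays_of A <= rays_of B"
 then have "cone_over (rays_of A) <= cone_over (rays_of B)" unfolding cone_over_def by blast
 then show "A <= B" using assms by (simp add: cone_over_rays_of)
qed (auto simp: rays_of_def)

text \<open>Shrinking a vector uses convexity together with 0. Stretching it uses the defining
  property of a face, since \<open>x\<close> lies inside the segment from 0 to
  \<open>c *\<^sub>R x\<close>.\<close>

lemma face_conic:
 assumes "D face_of C" "conic_set C" "0 : D"
 shows "conic_set D"
 unfolding conic_set_def
proof (intro conjI ballI allI impI)
 show "0 : D" by fact
 fix x c assume x: "x : D" and c: "(c::real) > 0"
 have cv: "convex D" using assms(1) by (simp add: face_of_imp_convex)
 show "c *\<^sub>R x : D"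
 proof (cases "x = 0 | c <= 1")
  case True
  then show ?thesis
  proof
   assume "c <= 1"
   then show ?thesis using convexD[OF cv x \<open>0 : D\<close>, of c "1 - c"] c by simp
  qed (use \<open>0 : D\<close> in simp)
 next
  case False
  have "x : open_segment 0 (c *\<^sub>R x)"
   unfolding open_segment_image_interval using False c
   by (auto intro!: image_eqI[of _ _ "1 / c"])
  moreover have "0 : C" "c *\<^sub>R x : C"
   using assms x c face_of_imp_subset[OF assms(1)] unfolding conic_set_def by blast+
  ultimately show ?thesis using assms(1) x unfolding face_of_def by blast
 qed
qed

definition flat_face :: "nat set => (nat => real^4) => nat set => (real^4) set" where
 "flat_face F al I = {x : poly_cone F al. ALL s:I. al s .* x = 0}"

lemma conic_flat_face: "conic_set (flat_face F al I)"
 using conic_poly_cone unfolding conic_set_def flat_face_def by (auto simp: poly_cone_def)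

lemma flat_face_face_of:
 assumes "finite I" "I <= F"
 shows "flat_face F al I face_of poly_cone F al"
proof -
 have le: "(SUM s:I. al s .* x) <= 0 & ((SUM s:I. al s .* x) = 0 \<longleftrightarrow> (ALL s:I. al s .* x = 0))" if "x : poly_cone F al" for x
 proof -
  have n: "al s .* x <= 0" if "s : I" for s using that assms(2) \<open>x : _\<close> unfolding poly_cone_def by blast
  then have "(SUM s:I. - (al s .* x)) = 0 \<longleftrightarrow> (ALL s:I. - (al s .* x) = 0)"
   by (intro sum_nonneg_eq_0_iff) (use assms(1) in auto)
  then show ?thesis using n by (auto simp: sum_negf intro: sum_nonpos)
 qed
 have "flat_face F al I = poly_cone F al Int {x. (SUM s:I. al s) .* x = 0}"
  using le unfolding flat_face_def by (auto simp: inner_sum_left)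
 moreover have "(poly_cone F al Int {x. (SUM s:I. al s) .* x = 0}) face_of poly_cone F al"
  by (rule face_of_Int_supporting_hyperplane_le[OF convex_poly_cone]) (use le in \<open>simp add: inner_sum_left\<close>)
 ultimately show ?thesis by simp
qed

definition strict_point :: "nat set => (nat => real^4) => nat set => real^4 => bool" where
 "strict_point F al I z \<longleftrightarrow> (ALL s:I. al s .* z = 0) & (ALL s:F - I. al s .* z < 0)"

lemma strict_point_in: "strict_point F al I z ==> z : flat_face F al I"
 unfolding strict_point_def flat_face_def poly_cone_def by force

text \<open>Near a strict point the cone is constrained by the equations of \<open>I\<close> alone,
  so the face contains a relatively open piece of the subspace that they define.\<close>

lemma flat_face_hull:
 assumes fin: "finite F" and z: "strict_point F al I z"
 shows "affine hull (flat_face F al I) = {x. ALL s:I. al s .* x = 0}" and "z : rel_interior (flat_face F al I)"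
proof -
 define L where "L = {x. ALL s:I. al s .* x = 0}"
 define U where "U = {x. ALL s:F - I. al s .* x < 0}"
 have "U = (INT s:F - I. {x. al s .* x < 0})" unfolding U_def by auto
 then have U: "open U" using fin by (auto intro!: open_INT open_halfspace_lt)
 have sL: "subspace L" unfolding L_def by (simp add: subspace_def inner_add_right)
 have zLU: "z : L Int U" using z unfolding L_def U_def strict_point_def by auto
 have 1: "affine hull (L Int U) = L"
  using affine_hull_convex_Int_open[OF subspace_imp_convex[OF sL] U] zLU sL
  by (auto simp: affine_hull_eq[THEN iffD2, OF subspace_imp_affine[OF sL]])
 have sub: "L Int U <= flat_face F al I" "flat_face F al I <= L"
  unfolding L_def U_def flat_face_def poly_cone_def by force+
 have "affine hull (flat_face F al I) = L"
 proof
  show "affine hull flat_face F al I <= L" using sub(2) sL by (simp add: hull_minimal subspace_imp_affine)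
  show "L <= affine hull flat_face F al I" using hull_mono[OF sub(1), of affine] 1 by simp
 qed
 then show *: "affine hull (flat_face F al I) = {x. ALL s:I. al s .* x = 0}" unfolding L_def .
 have "openin (top_of_set (affine hull (flat_face F al I))) (L Int U)"
  unfolding * L_def[symmetric] using U by (rule openin_open_Int)
 then show "z : rel_interior (flat_face F al I)"
  using rel_interior_maximal[OF sub(1)] zLU by blast
qed

lemma frame_independent:
 assumes "frame al A" "card A = 4" "finite A"
 shows "inj_on al A" "independent (al ` A)"
proof -
 let ?S = "{y : UNIV. ALL x:span (al ` A). orthogonal x y}"
 have "?S = {0}"
 proof -
  have "y = 0" if y: "ALL x:span (al ` A). orthogonal x y" for y
  proof (rule frameD[OF assms(1)], rule ballI)
   fix s assume "s : A"
   then have "al s : span (al ` A)" by (simp add: span_base)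
   then show "al s .* y = 0" using y unfolding orthogonal_def by blast
  qed
  then show ?thesis by (auto simp: orthogonal_def)
 qed
 moreover have "dim ?S + dim (span (al ` A)) = dim (UNIV :: (real^4) set)"
  by (rule dim_subspace_orthogonal_to_vectors) auto
 ultimately have d: "dim (al ` A) = 4" by simp
 have "dim (al ` A) <= card (al ` A)" using assms(3) by (intro dim_le_card') auto
 moreover have "card (al ` A) <= card A" using assms(3) by (rule card_image_le)
 ultimately have c: "card (al ` A) = card A" using d assms(2) by simp
 then show "inj_on al A" using assms(3) by (simp add: eq_card_imp_inj_on)
 show "independent (al ` A)"
 proof (rule card_le_dim_spanning[OF span_superset subset_refl])
  show "card (al ` A) <= dim (span (al ` A))" using c d assms(2) by simp
 qed (use assms(3) in auto)
qed

lemma aff_dim_flat_face: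
 assumes fin: "finite F" and z: "strict_point F al I z"
  and fr: "frame al A" "card A = 4" "I <= A" and finA: "finite A"
 shows "aff_dim (flat_face F al I) = 4 - int (card I)"
proof -
 define L where "L = {x. ALL s:I. al s .* x = 0}"
 have sL: "subspace L" unfolding L_def by (simp add: subspace_def inner_add_right)
 have "aff_dim (flat_face F al I) = aff_dim (affine hull (flat_face F al I))" by simp
 also have "\<dots> = aff_dim L" unfolding flat_face_hull(1)[OF fin z] L_def ..
 also have "\<dots> = int (dim L)" by (rule aff_dim_subspace[OF sL])
 finally have 1: "aff_dim (flat_face F al I) = int (dim L)" .
 have "{y : UNIV. ALL x:span (al ` I). orthogonal x y} = L"
 proof -
  have "(ALL x:span (al ` I). orthogonal x y) \<longleftrightarrow> (ALL s:I. al s .* y = 0)" for y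
  proof
   assume *: "ALL x:span (al ` I). orthogonal x y"
   show "ALL s:I. al s .* y = 0" using * span_base[of _ "al ` I"] unfolding orthogonal_def by blast
  next
   assume *: "ALL s:I. al s .* y = 0"
   show "ALL x:span (al ` I). orthogonal x y"
   proof
    fix x assume "x : span (al ` I)"
    then have "orthogonal y x"
     by (rule orthogonal_to_span) (use * in \<open>auto simp: orthogonal_def inner_commute\<close>)
    then show "orthogonal x y" by (simp add: orthogonal_commute)
   qed
  qed
  then show ?thesis unfolding L_def by auto
 qed
 moreover have "dim {y : UNIV. ALL x:span (al ` I). orthogonal x y} + dim (span (al ` I)) = dim (UNIV :: (real^4) set)"
  by (rule dim_subspace_orthogonal_to_vectors) auto
 moreover have "dim (al ` I) = card I"
 proof -
  have "independent (al ` I)" using frame_independent(2)[OF fr(1,2) finA] fr(3)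
   by (meson image_mono independent_mono)
  then have "dim (al ` I) = card (al ` I)" by (rule dim_eq_card_independent)
  also have "\<dots> = card I" using frame_independent(1)[OF fr(1,2) finA] fr(3) by (meson card_image inj_on_subset)
  finally show ?thesis .
 qed
 ultimately have "dim L + card I = 4" by simp
 then show ?thesis unfolding 1 by linarith
qed

text \<open>In a simple polyhedron the faces of codimension \<open>k\<close> correspond to the
  \<open>k\<close>-element subsets of vertex triples, for \<open>k\<close> from 1 to 3.\<close>

definition ksub :: "(nat set \<times> nat) set => nat => nat set set" where
 "ksub Q k = {I. card I = k & (EX T : fst ` Q. I <= T)}"

text \<open>For each face outside \<open>I\<close> there is a vertex on all faces of
  \<open>I\<close> but off that one. The sum of these vertices is strict everywhere outside
  \<open>I\<close>.\<close>

lemma ksub_strict_point: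
 assumes st: "stacked a b c d F Q S" and sh: "shaped F Q al" and I: "I : ksub Q k" "k > 0"
 shows "EX z. strict_point F al I z"
proof -
 obtain T where T: "T : fst ` Q" "I <= T" and k: "card I = k" using I unfolding ksub_def by blast
 have t: "T <= F" "card T = 3" using stacked_tri_card[OF st T(1)] by auto
 then have finT: "finite T" by (metis card.infinite zero_neq_numeral)
 then have finI: "finite I" using T(2) finite_subset by blast
 have finF: "finite F" using stacked_finite[OF st] by blast
 have "EX B. B : fst ` Q & I <= B & u ~: B" if u: "u : F - I" for u
 proof -
  have "card I <= 3" using card_mono[OF finT T(2)] t by simp
  then consider "card I = 1" | "card I = 2" | "card I = 3" using k I(2) by linarith
  then show ?thesis
  proof cases
   case 1
   then obtain s where s: "I = {s}" by (auto simp: card_1_singleton_iff)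
   then have "s : F" "u ~= s" using T t u by auto
   then show ?thesis using stacked_face_avoid[OF st] s by blast
  next
   case 2
   then obtain s s' where s: "I = {s, s'}" "s ~= s'" by (auto simp: card_2_iff)
   then have "nbr Q s s'" using T unfolding nbr_def by blast
   moreover have "u ~: {s, s'}" using u s by blast
   ultimately show ?thesis using stacked_pair_avoid[OF st] s by blast
  next
   case 3
   then have "I = T" using card_subset_eq[OF finT T(2)] t by simp
   then show ?thesis using T u by blast
  qed
 qed
 then obtain B where B: "!!u. u : F - I ==> B u : fst ` Q & I <= B u & u ~: B u" by metis
 have "EX q. vertex_at F al (B u) q" if "u : F - I" for u using B[OF that] sh unfolding shaped_def by blast
 then obtain q where q: "!!u. u : F - I ==> vertex_at F al (B u) (q u)" by metis
 define z where "z = (SUM u:F - I. q u)"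
 have "al s .* z = 0" if "s : I" for s
 proof -
  have "al s .* q u = 0" if "u : F - I" for u
   using vertex_at_zero[OF q[OF that]] B[OF that] \<open>s : I\<close> by blast
  then show ?thesis unfolding z_def by (simp add: inner_sum_right)
 qed
 moreover have "al s .* z < 0" if s: "s : F - I" for s
 proof -
  have le: "al s .* q u <= 0" if "u : F - I" for u
   using vertex_at_zero[OF q[OF that], of s] vertex_at_neg[OF q[OF that], of s] s
   by (cases "s : B u") auto
  have neg: "al s .* q s < 0" using vertex_at_neg[OF q[OF s], of s] B[OF s] s by blast
  have "al s .* z = al s .* q s + (SUM u:(F - I) - {s}. al s .* q u)"
   unfolding z_def inner_sum_right using s finF by (subst sum.remove[of _ s]) auto
  moreover have "(SUM u:(F - I) - {s}. al s .* q u) <= 0" using le by (intro sum_nonpos) auto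
  ultimately show ?thesis using neg by linarith
 qed
 ultimately show ?thesis unfolding strict_point_def by blast
qed

lemma ksub_frame:
 assumes st: "stacked a b c d F Q S" and sh: "shaped F Q al" and I: "I : ksub Q k"
 obtains A where "frame al A" "card A = 4" "finite A" "I <= A"
proof -
 obtain T l where T: "(T, l) : Q" "I <= T" using I unfolding ksub_def by auto
 have t: "l ~: T" "card T = 3" using stacked_tri[OF st T(1)] by auto
 then have finT: "finite T" by (metis card.infinite zero_neq_numeral)
 have "frame al (insert l T)" unfolding frame_def using shaped_frames[OF st sh T(1)] by blast
 then show thesis using that[of "insert l T"] t finT T by auto
qed

lemma ksub_sub:
 assumes st: "stacked a b c d F Q S" and I: "I : ksub Q k"
 shows "I <= F" "finite I" "card I = k"
proof -
 obtain T where T: "T : fst ` Q" "I <= T" using I unfolding ksub_def by blast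
 then show "I <= F" using stacked_tri_card[OF st T(1)] by blast
 then show "finite I" using stacked_finite[OF st] finite_subset by blast
 show "card I = k" using I unfolding ksub_def by blast
qed

lemma flat_face_subset_iff:
 assumes "strict_point F al I z" "J <= F"
 shows "flat_face F al I <= flat_face F al J \<longleftrightarrow> J <= I"
proof
 assume "flat_face F al I <= flat_face F al J"
 then have "z : flat_face F al J" using strict_point_in[OF assms(1)] by blast
 then show "J <= I" using assms unfolding flat_face_def strict_point_def by force
qed (auto simp: flat_face_def)

text \<open>Every face of the cone is cut out by the constraints that vanish on it, and by
  \<open>shaped_active\<close> these lie in a vertex triple. Since the four forms of a simplex are
  independent, their number is the codimension.\<close>

lemma codim_face_iff:
 assumes st: "stacked a b c d F Q S" and sh: "shaped F Q al" and k: "k : {1, 2, 3}"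
 shows "codim_face k (rays_of (poly_cone F al)) f \<longleftrightarrow> (EX I : ksub Q k. f = rays_of (flat_face F al I))"
proof
 let ?C = "poly_cone F al"
 have finF: "finite F" using stacked_finite[OF st] by blast
 have CC: "cone_over (rays_of ?C) = ?C" by (rule cone_over_rays_of[OF conic_poly_cone])
 {
  assume "EX I : ksub Q k. f = rays_of (flat_face F al I)"
  then obtain I where I: "I : ksub Q k" and f: "f = rays_of (flat_face F al I)" by blast
  have k0: "k > 0" using k by auto
  obtain z where z: "strict_point F al I z" using ksub_strict_point[OF st sh I k0] by blast
  obtain A where A: "frame al A" "card A = 4" "finite A" "I <= A" by (rule ksub_frame[OF st sh I])
  have "flat_face F al I face_of ?C" using flat_face_face_of ksub_sub[OF st I] by blast
  moreover have "aff_dim (flat_face F al I) = 4 - int k"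
   using aff_dim_flat_face[OF finF z A(1,2,4,3)] ksub_sub(3)[OF st I] by simp
  moreover have "f <= rays_of ?C" unfolding f rays_of_def flat_face_def by blast
  ultimately show "codim_face k (rays_of ?C) f"
   unfolding codim_face_def CC f cone_over_rays_of[OF conic_flat_face] by blast
 }
 assume cf: "codim_face k (rays_of ?C) f"
 define D where "D = cone_over f"
 have fs: "f <= rays_of ?C" and DF: "D face_of ?C" and dD: "aff_dim D = 4 - int k"
  using cf unfolding codim_face_def CC D_def by auto
 have conD: "conic_set D" unfolding D_def by (rule conic_cone_over)
 have fD: "f = rays_of D" unfolding D_def using rays_of_cone_over[OF fs] by simp
 have DC: "D <= ?C" by (rule face_of_imp_subset[OF DF])
 have cvD: "convex D" by (rule face_of_imp_convex[OF DF])
 have add: "x + y : D" if "x : D" "y : D" for x y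
 proof -
  have "(1/2) *\<^sub>R x + (1/2) *\<^sub>R y : D" using convexD[OF cvD that, of "1/2" "1/2"] by simp
  then have "2 *\<^sub>R ((1/2) *\<^sub>R x + (1/2) *\<^sub>R y) : D" using conD unfolding conic_set_def by (meson zero_less_numeral)
  then show ?thesis by (simp add: scaleR_add_right)
 qed
 have sum: "(SUM u:A. g u) : D" if "finite A" "!!u. u : A ==> g u : D" for A and g :: "nat => real^4"
  using that by (induction A rule: finite_induct) (use conD add in \<open>auto simp: conic_set_def\<close>)
 \<comment> \<open>For each constraint outside \<open>I\<close> some point of \<open>D\<close> is
   strict. The sum of these points is a strict point for \<open>I\<close>, hence relatively interior
   to \<open>flat_face F al I\<close>, and a face that contains such a point contains the whole
   set.\<close>
 define I where "I = {s : F. ALL x:D. al s .* x = 0}"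
 have "EX x:D. al u .* x < 0" if u: "u : F - I" for u
 proof -
  obtain x where "x : D" "al u .* x ~= 0" using u unfolding I_def by blast
  then show ?thesis using DC u unfolding poly_cone_def by force
 qed
 then obtain g where g: "!!u. u : F - I ==> g u : D & al u .* g u < 0" by metis
 define z where "z = (SUM u:F - I. g u)"
 have zD: "z : D" unfolding z_def by (rule sum) (use finF g in auto)
 have zI: "strict_point F al I z"
  unfolding strict_point_def
 proof (intro conjI ballI)
  show "al s .* z = 0" if "s : I" for s using that zD unfolding I_def by blast
  fix s assume s: "s : F - I"
  have le: "al s .* g u <= 0" if "u : F - I" for u using g[OF that] DC s unfolding poly_cone_def by blast
  have "al s .* z = al s .* g s + (SUM u:(F - I) - {s}. al s .* g u)"
   unfolding z_def inner_sum_right using s finF by (subst sum.remove[of _ s]) auto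
  moreover have "(SUM u:(F - I) - {s}. al s .* g u) <= 0" using le by (intro sum_nonpos) auto
  ultimately show "al s .* z < 0" using g[OF s] by linarith
 qed
 have "z ~= 0"
 proof
  assume "z = 0"
  then have FI: "F = I" using zI unfolding strict_point_def I_def by auto
  have "x = 0" if x: "x : D" for x
  proof -
   have "{a, b, c, d} <= F" using stacked_base[OF st] by blast
   obtain T where T: "T : fst ` Q" using stacked_face_tri[OF st, of a] stacked_base[OF st] by blast
   then obtain l where l: "(T, l) : Q" by auto
   have "insert l T <= I" using stacked_tri[OF st l] FI by blast
   then have "ALL s:insert l T. al s .* x = 0" using x unfolding I_def by blast
   then show ?thesis by (rule shaped_frames[OF st sh l])
  qed
  moreover have "0 : D" using conD unfolding conic_set_def by blast
  ultimately have "D = {0}" by blast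
  then show False using dD k by auto
 qed
 moreover have "ALL s:F. al s .* z <= 0" using zD DC unfolding poly_cone_def by blast
 ultimately obtain T where T: "T : fst ` Q" "ALL s:F. al s .* z = 0 --> s : T"
  using shaped_active[OF st sh] by blast
 have IT: "I <= T" using T zI unfolding strict_point_def I_def by blast
 have Ik: "I : ksub Q (card I)" using IT T unfolding ksub_def by blast
 have D: "D = flat_face F al I"
 proof
  show "D <= flat_face F al I" using DC unfolding flat_face_def I_def by blast
  show "flat_face F al I <= D"
  proof (rule subset_of_face_of[OF DF])
   show "flat_face F al I <= ?C" unfolding flat_face_def by blast
   show "D Int rel_interior (flat_face F al I) ~= {}"
    using zD flat_face_hull(2)[OF finF zI] by blast
  qed
 qed
 obtain A where A: "frame al A" "card A = 4" "finite A" "I <= A" by (rule ksub_frame[OF st sh Ik])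
 have "aff_dim D = 4 - int (card I)" unfolding D by (rule aff_dim_flat_face[OF finF zI A(1,2,4,3)])
 then have "card I = k" using dD by linarith
 then show "EX I : ksub Q k. f = rays_of (flat_face F al I)" using Ik fD D by blast
qed

subsection \<open>Marked graphs and configurations\<close>

lemma cycle_degree:
 assumes "is_cycle C"
 shows "C ~= {}" "card {e : C. u : e} : {0, 2}"
proof -
 obtain vs where d: "distinct vs" and L: "length vs >= 3"
  and C: "C = {{vs ! i, vs ! (Suc i mod length vs)} | i. i < length vs}"
  using assms unfolding is_cycle_def by blast
 let ?L = "length vs"
 show "C ~= {}" unfolding C using L by (auto intro!: exI[of _ 0])
 show "card {e : C. u : e} : {0, 2}"
 proof (cases "u : set vs")
  case False
  have "vs ! i ~= u" "vs ! (Suc i mod ?L) ~= u" if "i < ?L" for i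
  proof -
   have "Suc i mod ?L < ?L" using that by (intro mod_less_divisor) auto
   then show "vs ! i ~= u" "vs ! (Suc i mod ?L) ~= u" using False that by (auto simp: in_set_conv_nth)
  qed
  then have *: "{e : C. u : e} = {}" unfolding C by auto
  show ?thesis unfolding * by simp
 next
  case True
  then obtain j where j: "j < ?L" "u = vs ! j" by (auto simp: in_set_conv_nth)
  define p where "p = (if j = 0 then ?L - 1 else j - 1)"
  define s where "s = Suc j mod ?L"
  have p: "p < ?L" "Suc p mod ?L = j" using j L unfolding p_def by auto
  have s: "s < ?L" unfolding s_def using j by (intro mod_less_divisor) auto
  have s': "s = (if Suc j = ?L then 0 else Suc j)" using j unfolding s_def by auto
  have ne: "s ~= j" "p ~= j" "s ~= p" using j L unfolding s' p_def by (auto split: if_splits)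
  have nth: "vs ! x = vs ! y \<longleftrightarrow> x = y" if "x < ?L" "y < ?L" for x y
   using that d by (simp add: nth_eq_iff_index_eq)
  have "{e : C. u : e} = {{vs ! j, vs ! s}, {vs ! p, vs ! j}}"
  proof
   show "{{vs ! j, vs ! s}, {vs ! p, vs ! j}} <= {e : C. u : e}"
    unfolding C j(2) using j(1) p s_def by (auto intro: exI[of _ j] exI[of _ p])
   show "{e : C. u : e} <= {{vs ! j, vs ! s}, {vs ! p, vs ! j}}"
   proof
    fix e assume "e : {e : C. u : e}"
    then obtain i where i: "i < ?L" "e = {vs ! i, vs ! (Suc i mod ?L)}" "u : e" unfolding C by blast
    have "Suc i mod ?L < ?L" using i(1) by (intro mod_less_divisor) auto
    then have "i = j | Suc i mod ?L = j" using i j nth by auto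
    then have "i = j | i = p"
     using i(1) j(1) unfolding p_def by (cases "Suc i = ?L") auto
    then show "e : {{vs ! j, vs ! s}, {vs ! p, vs ! j}}" using i(2) p(2) s_def by auto
   qed
  qed
  moreover have "{vs ! j, vs ! s} ~= {vs ! p, vs ! j}"
   using nth[OF s p(1)] nth[OF s j(1)] ne by (auto simp: doubleton_eq_iff)
  ultimately show ?thesis by simp
 qed
qed

text \<open>Counting incidences in a trivalent graph gives three times the vertices as twice the
  edges, and Euler's formula does the rest. This is the case of equality in
  \<open>ecimahedron_stacked\<close>.\<close>

lemma marked_face_count:
 assumes G: "marked_labelled_ecimahedron G"
 shows "2 * nfaces G = card (verts G) + 4"
proof -
 have mg: "trivalent (verts G) (edges G)" "planar_faces (verts G) (edges G) (nfaces G) (face G)"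
  and ec: "ecimahedron (verts G) (edges G)"
  using G unfolding marked_labelled_ecimahedron_def marked_labelled_graph_def by blast+
 note simp = ecimahedron_simple[OF ec]
 have "(SUM u:verts G. card {e : edges G. u : e}) = (SUM e:edges G. 2)"
 proof (rule sum_multicount_gen)
  show "ALL e:edges G. card {u : verts G. u : e} = 2"
  proof
   fix e assume "e : edges G"
   then have "e <= verts G" "card e = 2" using simp by blast+
   moreover have "{u : verts G. u : e} = e" using \<open>e <= verts G\<close> by blast
   ultimately show "card {u : verts G. u : e} = 2" by simp
  qed
 qed (use simp in auto)
 moreover have "(SUM u:verts G. card {e : edges G. u : e}) = (SUM u:verts G. 3)"
  using mg(1) unfolding trivalent_def by (intro sum.cong) auto
 ultimately have "3 * card (verts G) = 2 * card (edges G)" by simp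
 moreover have "int (card (verts G)) - int (card (edges G)) + int (nfaces G) = 2"
  using mg(2) unfolding planar_faces_def by blast
 ultimately show ?thesis by simp
qed

lemma marked_stacked:
 assumes G: "marked_labelled_ecimahedron G"
 shows "EX a b c d Q S. stacked a b c d {..<nfaces G} Q S &
  realizes_stack (verts G) (edges G) {..<nfaces G} (face G) Q"
proof -
 have mg: "simple_graph (verts G) (edges G)" "trivalent (verts G) (edges G)"
  "planar_faces (verts G) (edges G) (nfaces G) (face G)" and ec: "ecimahedron (verts G) (edges G)"
  using G unfolding marked_labelled_ecimahedron_def marked_labelled_graph_def by blast+
 note simp = ecimahedron_simple[OF ec]
 have ff: "face_family (verts G) (edges G) {..<nfaces G} (face G)"
  unfolding face_family_def
 proof (intro conjI ballI)
  fix i assume i: "i : {..<nfaces G}"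
  then have c: "face G i <= edges G" "is_cycle (face G i)" using mg(3) unfolding planar_faces_def by auto
  show "face G i <= edges G" by (rule c)
  show "face G i ~= {}" by (rule cycle_degree(1)[OF c(2)])
  show "card {e : face G i. u : e} : {0, 2}" for u by (rule cycle_degree(2)[OF c(2)])
 next
  fix e assume "e : edges G"
  then show "card {i : {..<nfaces G}. e : face G i} = 2" using mg(3) unfolding planar_faces_def by simp
 qed simp
 have "2 * card {..<nfaces G} = card (verts G) + 4" using marked_face_count[OF G] by simp
 then show ?thesis using ecimahedron_stacked[OF ec ff] by blast
qed

text \<open>The edge shared by two faces is unique, so the choice is harmless. Faces that share no
  edge get the default 0, which still satisfies the bound in \<open>weights\<close>.\<close>

definition kap :: "'v labelled_graph => nat => nat => real" where
 "kap G s t = (if EX e:edges G. sides {..<nfaces G} (face G) e = {s, t}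
   then 4 * (cos (label G (SOME e. e : edges G & sides {..<nfaces G} (face G) e = {s, t})))\<^sup>2 else 0)"

lemma cos_label:
 assumes "0 < x" "x <= pi / 2"
 shows "0 <= cos x" "cos x < 1" "4 * (cos x)\<^sup>2 < 4" "4 * (cos x)\<^sup>2 = 0 \<longleftrightarrow> x = pi / 2"
proof -
 show c: "0 <= cos x" using assms by (intro cos_ge_zero) auto
 have "cos x < cos 0" using assms by (intro cos_monotone_0_pi) auto
 then show c1: "cos x < 1" by simp
 have "cos x * cos x <= cos x * 1" using c c1 by (intro mult_left_mono) auto
 then show "4 * (cos x)\<^sup>2 < 4" using c1 unfolding power2_eq_square by linarith
 show "4 * (cos x)\<^sup>2 = 0 \<longleftrightarrow> x = pi / 2"
 proof
  assume "4 * (cos x)\<^sup>2 = 0"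
  then have "cos x = 0" by simp
  show "x = pi / 2"
  proof (rule ccontr)
   assume "x ~= pi / 2"
   then have "cos x > 0" using assms by (intro cos_gt_zero) auto
   then show False using \<open>cos x = 0\<close> by simp
  qed
 qed (simp only: cos_pi_half, simp)
qed

definition config_of :: "nat => (nat => real^4) => (nat => real^4) => config" where
 "config_of n al v = (\<lambda>s\<in>{..<n}. (ray (al s), ray (v s)))"

section \<open>Mirror polyhedra with a given graph as shaped cones\<close>

locale stacked_graph =
 fixes G :: "'v labelled_graph" and a b c d :: nat and Q S n
 assumes labels: "!!e. e : edges G ==> 0 < label G e & label G e <= pi / 2"
  and n_def: "n = nfaces G"
  and stk: "stacked a b c d {..<n} Q S"
  and faces: "!!s. s < n ==> face G s <= edges G"
  and real: "realizes_stack (verts G) (edges G) {..<n} (face G) Q"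
begin

abbreviation "sd == sides {..<n} (face G)"
abbreviation "cn == corner (edges G) {..<n} (face G)"

lemma bij_cn: "bij_betw cn (verts G) (fst ` Q)"
 and bij_sd: "bij_betw sd (edges G) {{s, t} | s t. nbr Q s t}"
 and inc: "u : verts G ==> e : edges G ==> u : e \<longleftrightarrow> sd e <= cn u"
 using real unfolding realizes_stack_def by blast+

lemma sd_inj: "e : edges G ==> e' : edges G ==> sd e = sd e' ==> e = e'"
 using bij_sd by (meson bij_betw_imp_inj_on inj_onD)

lemma sd_img: "sd ` edges G = {{s, t} | s t. nbr Q s t}"
 using bij_sd by (rule bij_betw_imp_surj_on)

lemma nbr_edge:
 assumes "nbr Q s t"
 shows "EX e:edges G. sd e = {s, t}"
proof -
 have "{s, t} : sd ` edges G" unfolding sd_img using assms by blast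
 then show ?thesis by (metis imageE)
qed

lemma edge_nbr:
 assumes "e : edges G" "sd e = {s, t}"
 shows "nbr Q s t"
proof -
 have "{s, t} : sd ` edges G" using assms by (metis imageI)
 then obtain s' t' where "{s, t} = {s', t'}" "nbr Q s' t'" unfolding sd_img by blast
 then show ?thesis using nbr_sym by (auto simp: doubleton_eq_iff)
qed

lemma sd_iff: "s : sd e \<longleftrightarrow> s < n & e : face G s"
 unfolding sides_def by auto

lemma edge_pair:
 assumes "e : edges G" "e : face G s" "e : face G t" "s < n" "t < n" "s ~= t"
 shows "sd e = {s, t}"
proof -
 obtain x y where xy: "sd e = {x, y}" using assms(1) sd_img by blast
 have "s : sd e" "t : sd e" using assms by (auto simp: sd_iff)
 then show ?thesis using xy assms(6) by auto
qed

lemma kap_edge: "e : edges G ==> sd e = {s, t} ==> kap G s t = 4 * (cos (label G e))\<^sup>2"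
proof -
 assume e: "e : edges G" "sd e = {s, t}"
 have "(SOME e. e : edges G & sd e = {s, t}) = e"
  using sd_inj e by (intro some_equality) auto
 then show ?thesis using e unfolding kap_def n_def[symmetric] by auto
qed

lemma kap_weights: "weights (kap G)"
 unfolding weights_def
proof (intro allI conjI)
 show "kap G s t = kap G t s" for s t unfolding kap_def by (simp add: insert_commute)
 show "kap G s t < 4" for s t
 proof (cases "EX e:edges G. sd e = {s, t}")
  case True
  then obtain e where e: "e : edges G" "sd e = {s, t}" by blast
  then show ?thesis using kap_edge[OF e] cos_label(3) labels[OF e(1)] by simp
 next
  case False
  then show ?thesis unfolding kap_def n_def[symmetric] by simp
 qed
qed

lemma ksub_iff: "ksub Q 3 = fst ` Q" "ksub Q 2 = {{s, t} | s t. nbr Q s t}" "ksub Q 1 = (%s. {s}) ` {..<n}"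
proof -
 have tri: "T <= {..<n}" "card T = 3" "finite T" if "T : fst ` Q" for T
  using stacked_tri_card[OF stk that] by (auto intro: finite_subset)
 show "ksub Q 3 = fst ` Q"
 proof
  show "ksub Q 3 <= fst ` Q"
  proof
   fix I assume "I : ksub Q 3"
   then obtain T where T: "T : fst ` Q" "I <= T" "card I = 3" unfolding ksub_def by blast
   then have "I = T" using card_subset_eq[OF tri(3)[OF T(1)] T(2)] tri(2)[OF T(1)] by simp
   then show "I : fst ` Q" using T(1) by simp
  qed
  show "fst ` Q <= ksub Q 3" unfolding ksub_def using tri by blast
 qed
 show "ksub Q 2 = {{s, t} | s t. nbr Q s t}"
 proof
  show "ksub Q 2 <= {{s, t} | s t. nbr Q s t}"
  proof
   fix I assume "I : ksub Q 2"
   then obtain T s t where "T : fst ` Q" "I = {s, t}" "s ~= t" "I <= T"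
    unfolding ksub_def by (auto simp: card_2_iff)
   then have "nbr Q s t" unfolding nbr_def by blast
   then show "I : {{s, t} | s t. nbr Q s t}" using \<open>I = {s, t}\<close> by blast
  qed
  show "{{s, t} | s t. nbr Q s t} <= ksub Q 2"
  proof
   fix I assume "I : {{s, t} | s t. nbr Q s t}"
   then obtain s t where "I = {s, t}" "nbr Q s t" by blast
   then show "I : ksub Q 2" unfolding ksub_def nbr_def by auto
  qed
 qed
 show "ksub Q 1 = (%s. {s}) ` {..<n}"
 proof
  show "ksub Q 1 <= (%s. {s}) ` {..<n}"
  proof
   fix I assume "I : ksub Q 1"
   then obtain T s where "T : fst ` Q" "I = {s}" "s : T"
    unfolding ksub_def by (auto simp: card_1_singleton_iff)
   then show "I : (%s. {s}) ` {..<n}" using tri by blast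
  qed
  show "(%s. {s}) ` {..<n} <= ksub Q 1"
  proof
   fix I assume "I : (%s. {s}) ` {..<n}"
   then obtain s where s: "I = {s}" "s : {..<n}" by blast
   then obtain T where "T : fst ` Q" "s : T" using stacked_face_tri[OF stk] by blast
   then show "I : ksub Q 1" using s unfolding ksub_def by auto
  qed
 qed
qed

definition faceset :: "(nat => real^4) => nat set => (real^4) set set" where
 "faceset al I = rays_of (flat_face {..<n} al I)"

lemma faceset_subset_iff:
 assumes sh: "shaped {..<n} Q al" and I: "I : ksub Q k" "k > 0" and J: "J : ksub Q k'"
 shows "faceset al I <= faceset al J \<longleftrightarrow> J <= I"
proof -
 obtain z where z: "strict_point {..<n} al I z" using ksub_strict_point[OF stk sh I] by blast
 have "J <= {..<n}" by (rule ksub_sub(1)[OF stk J])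
 then show ?thesis unfolding faceset_def rays_of_subset_iff[OF conic_flat_face conic_flat_face]
  using flat_face_subset_iff[OF z] by blast
qed

lemma bij_faceset:
 assumes sh: "shaped {..<n} Q al" and k: "k : {1, 2, 3}"
 shows "bij_betw (faceset al) (ksub Q k) {f. codim_face k (cut_out (al ` {..<n})) f}"
proof (rule bij_betw_imageI)
 have k0: "k > 0" using k by auto
 show "inj_on (faceset al) (ksub Q k)"
 proof (rule inj_onI)
  fix I J assume IJ: "I : ksub Q k" "J : ksub Q k" "faceset al I = faceset al J"
  then show "I = J" using faceset_subset_iff[OF sh IJ(1) k0 IJ(2)] faceset_subset_iff[OF sh IJ(2) k0 IJ(1)] by blast
 qed
 show "faceset al ` ksub Q k = {f. codim_face k (cut_out (al ` {..<n})) f}"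
  unfolding cut_out_eq codim_face_iff[OF stk sh k] faceset_def by blast
qed

lemma shaped_polyhedron:
 assumes sh: "shaped {..<n} Q al"
 shows "projective_polyhedron (cut_out (al ` {..<n}))"
proof -
 let ?P = "cut_out (al ` {..<n})"
 let ?C = "poly_cone {..<n} al"
 have P: "?P = rays_of ?C" by (rule cut_out_eq)
 have memP: "ray x : ?P \<longleftrightarrow> x ~= 0 & x : ?C" for x
 proof
  assume "ray x : ?P"
  then obtain y where y: "y ~= 0" "y : ?C" "ray x = ray y" unfolding P rays_of_def by blast
  then obtain r where r: "r > 0" "x = r *\<^sub>R y" using ray_eq_iff[of y x] by auto
  then show "x ~= 0 & x : ?C" using y conic_poly_cone[of "{..<n}" al] unfolding conic_set_def by auto
 qed (auto simp: P rays_of_def)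
 obtain T l where Tl: "(T, l) : Q" using stacked_face_tri[OF stk, of a] stacked_base[OF stk] by auto
 define A where "A = insert l T"
 have A: "A <= {..<n}" "card A = 4" "finite A"
 proof -
  have t: "T <= {..<n}" "l : {..<n}" "l ~: T" "card T = 3" using stacked_tri[OF stk Tl] by blast+
  then have "finite T" by (auto intro: finite_subset)
  then show "A <= {..<n}" "card A = 4" "finite A" unfolding A_def using t by simp_all
 qed
 have fr: "frame al A" unfolding frame_def A_def using shaped_frames[OF stk sh Tl] by blast
 have topP: "topspace proj_space = ray ` (UNIV - {0})"
  unfolding proj_space_def topspace_quot_topology by simp
 have openin_ray: "openin proj_space (ray ` U)" if "open U" "0 ~: U" "!!x c. x : U ==> c > 0 ==> c *\<^sub>R x : U" for U
  unfolding proj_space_def openin_quot_topology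
 proof
  show "ray ` U <= ray ` topspace (top_of_set (UNIV - {0}))" using that(2) by auto
  have "{x : UNIV - {0}. ray x : ray ` U} = U"
  proof
   show "{x : UNIV - {0}. ray x : ray ` U} <= U"
    using that(3) by (auto simp: ray_eq_iff) (metis ray_eq_iff)
  qed (use that(2) in auto)
  then show "openin (top_of_set (UNIV - {0})) {x : topspace (top_of_set (UNIV - {0})). ray x : ray ` U}"
   using that(1,2) by (simp add: openin_open_eq open_Diff subset_iff)
    (metis open_openin openin_subtopology_refl openin_open_trans open_subset subset_UNIV Int_absorb2 openin_open_Int Diff_iff UNIV_I singletonD subsetI)
 qed
 have cl: "closedin proj_space ?P"
 proof -
  define U where "U = - ?C"
  have "?C = (INT s:{..<n}. {x. al s .* x <= 0})" unfolding poly_cone_def by auto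
  then have "closed ?C" by (auto intro!: closed_INT closed_halfspace_le)
  then have oU: "open U" unfolding U_def by (simp add: open_Compl)
  have "0 ~: U" unfolding U_def poly_cone_def by simp
  moreover have "r *\<^sub>R x : U" if "x : U" "r > 0" for x r
   using that unfolding U_def poly_cone_def by (auto simp: mult_le_0_iff)
  ultimately have "openin proj_space (ray ` U)" using openin_ray[OF oU] by blast
  moreover have "topspace proj_space - ?P = ray ` U"
  proof
   show "topspace proj_space - ?P <= ray ` U" unfolding topP using memP U_def by auto
   show "ray ` U <= topspace proj_space - ?P" unfolding topP using memP U_def \<open>0 ~: U\<close> by auto
  qed
  moreover have "?P <= topspace proj_space" unfolding topP P rays_of_def by auto
  ultimately show ?thesis unfolding closedin_def by simp
 qed
 \<comment> \<open>Each form of the frame is nonpositive on the cone and they vanish together only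
   at 0, so minus their sum is positive on the cone and defines the affine chart.\<close>
 define m where "m = - (SUM s:A. al s)"
 have m: "m .* x = (SUM s:A. - (al s .* x))" for x unfolding m_def by (simp add: inner_sum_left sum_negf)
 have nonneg: "0 <= - (al s .* x)" if "x : ?C" "s : A" for x s using that A unfolding poly_cone_def by auto
 have mpos: "m .* x > 0" if x: "x : ?C" "x ~= 0" for x
 proof -
  have "m .* x >= 0" unfolding m using nonneg[OF x(1)] by (intro sum_nonneg) auto
  moreover have "m .* x ~= 0"
  proof
   assume "m .* x = 0"
   then have "ALL s:A. - (al s .* x) = 0"
    unfolding m using sum_nonneg_eq_0_iff[OF A(3), of "%s. - (al s .* x)"] nonneg[OF x(1)] by simp
   then have "ALL s:A. al s .* x = 0" by simp
   then have "x = 0" by (rule frameD[OF fr])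
   then show False using x by simp
  qed
  ultimately show ?thesis by simp
 qed
 obtain z where z: "al s .* z < 0" if "s < n" for s
 proof -
  have "EX q. ALL s<n. al s .* q <= 0 & (s ~: T' --> al s .* q < 0)" if "T' : fst ` Q" for T'
  proof -
   obtain q where "vertex_at {..<n} al T' q" using sh \<open>T' : _\<close> unfolding shaped_def by blast
   then show ?thesis unfolding vertex_at_def by (intro exI[of _ q]) (force simp: less_imp_le)
  qed
  then obtain q where q: "!!T' s. T' : fst ` Q ==> s < n ==> al s .* q T' <= 0 & (s ~: T' --> al s .* q T' < 0)" by metis
  have finK: "finite (fst ` Q)" using stacked_finite[OF stk] by blast
  have "al s .* (SUM T':fst ` Q. q T') < 0" if s: "s < n" for s
  proof -
   obtain t where "t : {..<n}" "t ~= s" using stacked_base[OF stk] by (cases "s = a") auto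
   then obtain T' where T': "T' : fst ` Q" "s ~: T'" using stacked_face_avoid[OF stk, of t s] by auto
   have "al s .* (SUM T':fst ` Q. q T') = al s .* q T' + (SUM T':fst ` Q - {T'}. al s .* q T')"
    unfolding inner_sum_right using finK T' by (subst sum.remove[of _ T']) auto
   moreover have "(SUM T':fst ` Q - {T'}. al s .* q T') <= 0" using q s by (intro sum_nonpos) auto
   ultimately show ?thesis using q[OF T'(1) s] T'(2) by linarith
  qed
  then show thesis using that by blast
 qed
 have "n > 0" using stacked_base[OF stk] by auto
 then have z0: "z ~= 0" using z by force
 have zC: "z : ?C" using z unfolding poly_cone_def by (auto simp: less_imp_le)
 have m0: "m ~= 0" using mpos[OF zC z0] by auto
 have pc: "properly_convex ?P"
  unfolding properly_convex_def
 proof (intro exI[of _ m] conjI)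
  show "m ~= 0" by (rule m0)
  show "?P <= ray ` {x. 0 < m .* x}" unfolding P rays_of_def using mpos by blast
  have eq: "{x. m .* x = 1 & ray x : ?P} = {x. m .* x = 1} Int ?C" unfolding memP by auto
  show "convex {x. m .* x = 1 & ray x : ?P}"
   unfolding eq by (intro convex_Int convex_hyperplane convex_poly_cone)
  have bd: "- 1 <= al s .* x & al s .* x <= 1" if "m .* x = 1" "x : ?C" "s : A" for x s
  proof -
   have "- (al s .* x) <= (SUM s:A. - (al s .* x))"
    using nonneg[OF that(2)] A(3) that(3) by (intro member_le_sum) auto
   then show ?thesis using that(1) nonneg[OF that(2,3)] unfolding m by linarith
  qed
  \<comment> \<open>In the chart all forms of the frame are bounded by 1. Their sum of squares is a
    definite quadratic form, whose minimum on the unit sphere turns this into a bound on the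
    norm.\<close>
  define f where "f x = (SUM s:A. (al s .* x)\<^sup>2)" for x
  have cf: "continuous_on (sphere 0 1) f" unfolding f_def by (intro continuous_intros)
  have "axis 1 1 : sphere (0 :: real^4) 1" by (simp add: norm_axis_1)
  then have "sphere (0 :: real^4) 1 ~= {}" by blast
  then obtain w where w: "w : sphere (0 :: real^4) 1" "!!y. y : sphere 0 1 ==> f w <= f y"
   using continuous_attains_inf[OF compact_sphere _ cf] by blast
  have fw: "f w > 0"
  proof -
   have "f w >= 0" unfolding f_def by (intro sum_nonneg) auto
   moreover have "f w ~= 0"
   proof
    assume "f w = 0"
    then have "ALL s:A. (al s .* w)\<^sup>2 = 0" unfolding f_def using A(3) by (subst (asm) sum_nonneg_eq_0_iff) auto
    then have "w = 0" using frameD[OF fr] by simp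
    then show False using w(1) by simp
   qed
   ultimately show ?thesis by simp
  qed
  have "norm x <= sqrt (4 / f w)" if x: "m .* x = 1" "x : ?C" for x
  proof (cases "x = 0")
   case False
   have "(al s .* x)\<^sup>2 <= 1" if "s : A" for s
    unfolding abs_square_le_1 abs_le_iff using bd[OF x that] by linarith
   then have "f x <= (SUM s:A. 1)" unfolding f_def by (rule sum_mono)
   then have f4: "f x <= 4" using A(2) by simp
   have "f w <= f ((1 / norm x) *\<^sub>R x)" using False by (intro w(2)) simp
   also have "\<dots> = (1 / norm x)\<^sup>2 * f x" unfolding f_def by (simp add: sum_distrib_left power_mult_distrib power_divide)
   finally have "f w * (norm x)\<^sup>2 <= f x" using False by (simp add: field_simps)
   then have "(norm x)\<^sup>2 <= 4 / f w" using f4 fw by (simp add: field_simps)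
   then show ?thesis by (rule real_le_rsqrt)
  qed (use fw in simp)
  then show "bounded {x. m .* x = 1 & ray x : ?P}" unfolding eq bounded_iff by blast
 qed
 have int: "proj_space interior_of ?P ~= {}"
 proof -
  define U where "U = {x. ALL s:{..<n}. al s .* x < 0}"
  have "U = (INT s:{..<n}. {x. al s .* x < 0})" unfolding U_def by auto
  then have oU: "open U" by (auto intro!: open_INT open_halfspace_lt)
  have "0 ~: U" unfolding U_def using \<open>n > 0\<close> by auto
  moreover have "r *\<^sub>R x : U" if "x : U" "r > 0" for x r
   using that unfolding U_def by (auto simp: mult_pos_neg)
  ultimately have "openin proj_space (ray ` U)" using openin_ray[OF oU] by blast
  moreover have "ray ` U <= ?P" unfolding P rays_of_def U_def poly_cone_def using \<open>0 ~: U\<close> U_def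
   by (force simp: less_imp_le)
  moreover have "z : U" unfolding U_def using z by simp
  ultimately have "ray z : proj_space interior_of ?P" unfolding interior_of_def by blast
  then show ?thesis by blast
 qed
 show ?thesis unfolding projective_polyhedron_def using cl pc int by blast
qed

lemma config_realizes:
 assumes sh: "shaped {..<n} Q al" and mi: "mirrored (kap G) {..<n} Q al v"
 shows "config_of n al v : Y_set G"
proof -
 let ?P = "cut_out (al ` {..<n})"
 define FF where "FF s = faceset al {s}" for s
 have bij1: "bij_betw FF {..<n} {f. codim_face 1 ?P f}"
 proof -
  have "bij_betw (%s. {s}) {..<n} (ksub Q 1)" unfolding ksub_iff by (rule bij_betw_imageI) auto
  from bij_betw_trans[OF this bij_faceset[OF sh, of 1]] show ?thesis unfolding FF_def comp_def by simp
 qed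
 have k1: "{s} : ksub Q 1" if "s < n" for s unfolding ksub_iff using that by auto
 have ang: "has_dihedral_angle al v s t (label G e)" if e: "e : edges G" "sd e = {s, t}" for s t e
 proof -
  have "(al s .* v t) * (al t .* v s) = kap G s t" using mi edge_nbr[OF e] unfolding mirrored_def by blast
  then show ?thesis unfolding has_dihedral_angle_def kap_edge[OF e] using labels[OF e(1)] by simp
 qed
 have adj: "nbr Q s t" if st: "s < n" "t < n" "adjacent ?P (FF s) (FF t)" for s t
 proof -
  obtain f where f: "FF s ~= FF t" "codim_face 2 ?P f" "f <= FF s" "f <= FF t" using st(3) unfolding adjacent_def by blast
  have "f : faceset al ` ksub Q 2"
   using bij_betw_imp_surj_on[OF bij_faceset[OF sh, of 2]] f(2) by simp
  then obtain I where I: "I : ksub Q 2" "f = faceset al I" by blast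
  have "{s} <= I" "{t} <= I"
   using faceset_subset_iff[OF sh I(1) _ k1] st f(3,4) I(2) unfolding FF_def by auto
  moreover have "s ~= t" using f(1) by auto
  moreover have "card I = 2" using I(1) unfolding ksub_def by blast
  ultimately have "I = {s, t}" by (auto simp: card_2_iff)
  then show ?thesis using I(1) unfolding ksub_iff by (auto simp: doubleton_eq_iff dest: nbr_sym)
 qed
 have mp: "mirror_polyhedron n ?P FF al v"
  unfolding mirror_polyhedron_def
 proof (intro conjI allI impI ballI)
  show "projective_polyhedron ?P" by (rule shaped_polyhedron[OF sh])
  show "bij_betw FF {..<n} {F. codim_face 1 ?P F}" by (rule bij1)
  show "?P = cut_out (al ` {..<n})" ..
  fix s assume s: "s < n"
  show "al s .* v s = 2" using mi s unfolding mirrored_def by blast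
  have co: "cone_over (FF s) = flat_face {..<n} al {s}"
   unfolding FF_def faceset_def by (rule cone_over_rays_of[OF conic_flat_face])
  show "reflect (al s) (v s) x = x" if "x : cone_over (FF s)" for x
   using that unfolding co flat_face_def reflect_def by simp
  fix t assume t: "t < n" and a: "adjacent ?P (FF s) (FF t)"
  note nb = adj[OF s t a]
  show "0 <= - (al s .* v t)" using mi nb unfolding mirrored_def by simp
  show "al s .* v t = 0 \<longleftrightarrow> al t .* v s = 0"
   using mi nb nbr_sym[OF nb] kap_weights unfolding mirrored_def weights_def by metis
  show "EX th. has_dihedral_angle al v s t th" using nbr_edge[OF nb] ang by blast
 qed
 have re: "realizes G ?P FF al v"
  unfolding realizes_def n_def[symmetric]
 proof (intro conjI allI impI ballI)
  show "EX ph ps. bij_betw ph (verts G) {p. codim_face 3 ?P p} & bij_betw ps (edges G) {e. codim_face 2 ?P e} &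
   (ALL u:verts G. ALL e:edges G. (u : e) = (ph u <= ps e)) &
   (ALL s<n. ALL e:edges G. (e : face G s) = (ps e <= FF s))"
  proof (intro exI[of _ "faceset al \<circ> cn"] exI[of _ "faceset al \<circ> sd"] conjI ballI allI impI)
   show "bij_betw (faceset al \<circ> cn) (verts G) {p. codim_face 3 ?P p}"
    by (rule bij_betw_trans[OF bij_cn]) (use bij_faceset[OF sh, of 3] in \<open>simp add: ksub_iff\<close>)
   show "bij_betw (faceset al \<circ> sd) (edges G) {e. codim_face 2 ?P e}"
    by (rule bij_betw_trans[OF bij_sd]) (use bij_faceset[OF sh, of 2] in \<open>simp add: ksub_iff\<close>)
   have ce: "sd e : ksub Q 2" if "e : edges G" for e unfolding ksub_iff sd_img[symmetric] using that by (rule imageI)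
   have cv: "cn u : ksub Q 3" if "u : verts G" for u using bij_cn that unfolding ksub_iff by (auto simp: bij_betw_def)
   show "u : e \<longleftrightarrow> (faceset al \<circ> cn) u <= (faceset al \<circ> sd) e" if "u : verts G" "e : edges G" for u e
    using faceset_subset_iff[OF sh cv[OF that(1)] _ ce[OF that(2)]] inc[OF that] by simp
   show "e : face G s \<longleftrightarrow> (faceset al \<circ> sd) e <= FF s" if "s < n" "e : edges G" for s e
    using faceset_subset_iff[OF sh ce[OF that(2)] _ k1[OF that(1)]] that(1) unfolding FF_def by (simp add: sd_iff)
  qed
  fix s t e assume st: "s < n" "t < n" "e : face G s Int face G t" "s ~= t"
  have "e : edges G" using faces[OF st(1)] st(3) by blast
  then show "has_dihedral_angle al v s t (label G e)" using ang edge_pair st by blast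
 qed
 show ?thesis unfolding Y_set_def config_of_def n_def[symmetric] using mp re by blast
qed

text \<open>The identification of graphs speaks about faces of the polyhedron, whereas
  \<open>shaped\<close> asks for a ray with an exact list of active constraints. The ray is the cone
  over a vertex, and the list is read off from incidences in the graph.\<close>

lemma Y_set_config:
 assumes "y : Y_set G"
 shows "EX al v. y = config_of n al v & shaped {..<n} Q al & mirrored (kap G) {..<n} Q al v"
proof -
 obtain P FF al v where y: "y = config_of n al v" and mp: "mirror_polyhedron n P FF al v"
  and re: "realizes G P FF al v"
  using assms unfolding Y_set_def config_of_def n_def by blast
 define C where "C = poly_cone {..<n} al"
 have PC: "P = rays_of C" using mp unfolding mirror_polyhedron_def cut_out_eq C_def by blast
 have conC: "conic_set C" unfolding C_def by (rule conic_poly_cone)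
 have CC: "cone_over P = C" unfolding PC by (rule cone_over_rays_of[OF conC])
 have polyC: "polyhedron C" unfolding C_def by (rule polyhedron_poly_cone) simp
 have cvC: "convex C" unfolding C_def by (rule convex_poly_cone)
 have bijF: "bij_betw FF {..<n} {F. codim_face 1 P F}" using mp unfolding mirror_polyhedron_def by blast
 have two: "al s .* v s = 2" if "s < n" for s using mp that unfolding mirror_polyhedron_def by blast
 have a0: "al s ~= 0" if "s < n" for s using two[OF that] by auto
 have F1: "codim_face 1 P (FF s)" if "s < n" for s using bijF that by (auto simp: bij_betw_def)
 have Fz: "al s .* x = 0" if s: "s < n" and x: "x : cone_over (FF s)" for s x
 proof -
  have "reflect (al s) (v s) x = x" using mp s x unfolding mirror_polyhedron_def by blast
  then have "(al s .* x) *\<^sub>R v s = 0" unfolding reflect_def by simp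
  moreover have "v s ~= 0" using two[OF s] by auto
  ultimately show ?thesis by simp
 qed
 note re' = re[unfolded realizes_def n_def[symmetric]]
 obtain ph ps where bp: "bij_betw ph (verts G) {p. codim_face 3 P p}"
  and bq: "bij_betw ps (edges G) {e. codim_face 2 P e}"
  and iv0: "ALL u:verts G. ALL e:edges G. u : e \<longleftrightarrow> ph u <= ps e"
  and ie0: "ALL s<n. ALL e:edges G. e : face G s \<longleftrightarrow> ps e <= FF s"
  using conjunct1[OF re'] by (elim exE conjE)
 have iv: "u : e \<longleftrightarrow> ph u <= ps e" if "u : verts G" "e : edges G" for u e using iv0 that by blast
 have ie: "e : face G s \<longleftrightarrow> ps e <= FF s" if "s < n" "e : edges G" for s e using ie0 that by blast
 have ang: "has_dihedral_angle al v s t (label G e)"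
  if "s < n" "t < n" "e : face G s Int face G t" "s ~= t" for s t e
  using conjunct2[OF re'] that by blast
 have sub: "cone_over A <= cone_over B" if "A <= B" for A B using that unfolding cone_over_def by blast
 \<comment> \<open>The reflection fixes the face pointwise, so \<open>al s\<close> vanishes on it.
   Both sides are then convex of dimension 3 and one is a face of the other.\<close>
 have B: "cone_over (FF s) = C Int {x. al s .* x = 0}" if s: "s < n" for s
 proof (rule ccontr)
  define G' where "G' = C Int {x. al s .* x = 0}"
  have fB: "cone_over (FF s) face_of C" "aff_dim (cone_over (FF s)) = 3"
   using F1[OF s] unfolding codim_face_def CC by auto
  have BG: "cone_over (FF s) <= G'" using face_of_imp_subset[OF fB(1)] Fz[OF s] unfolding G'_def by blast
  have GC: "G' <= C" unfolding G'_def by blast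
  have "cone_over (FF s) face_of G'" by (rule face_of_subset[OF fB(1) BG GC])
  moreover assume "cone_over (FF s) ~= C Int {x. al s .* x = 0}"
  moreover have "convex G'" unfolding G'_def by (intro convex_Int cvC convex_hyperplane)
  ultimately have "aff_dim (cone_over (FF s)) < aff_dim G'"
   unfolding G'_def[symmetric] by (intro face_of_aff_dim_lt) auto
  moreover have "aff_dim G' <= aff_dim {x. al s .* x = 0}" unfolding G'_def by (intro aff_dim_subset) auto
  moreover have "aff_dim {x. al s .* x = 0} = 3" using aff_dim_hyperplane[OF a0[OF s], of 0] by simp
  ultimately show False using fB(2) by linarith
 qed
 have vx: "EX x. vertex_at {..<n} al (cn u) x" if u: "u : verts G" for u
 proof -
  define R where "R = cone_over (ph u)"
  have cf: "codim_face 3 P (ph u)" using bp u by (auto simp: bij_betw_def)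
  have RC: "R face_of C" "aff_dim R = 1" "ph u <= P" using cf unfolding codim_face_def CC R_def by auto
  have conR: "conic_set R" unfolding R_def by (rule conic_cone_over)
  then have R0: "0 : R" unfolding conic_set_def by blast
  have "R ~= {0}" using RC(2) by auto
  then obtain x where x: "x : R" "x ~= 0" using R0 by blast
  have line: "EX r. y = r *\<^sub>R x" if y: "y : R" for y
  proof -
   have "aff_dim R = int (dim R)" by (rule aff_dim_zero) (use R0 in \<open>simp add: hull_inc\<close>)
   then have d1: "dim R = 1" using RC(2) by simp
   have "R <= span {x}"
    by (rule card_ge_dim_independent) (use x d1 in \<open>auto simp: independent_insert\<close>)
   then show ?thesis using y by (auto simp: span_singleton)
  qed
  have xC: "x : C" using x RC(1) face_of_imp_subset by blast
  have "al s .* x = 0" if s: "s : cn u" for s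
  proof -
   obtain e where e: "e : edges G" "u : e" "s < n" "e : face G s"
    using s unfolding corner_def by (auto simp: sd_iff)
   have "ph u <= FF s" using iv[OF u e(1)] ie[OF e(3,1)] e by blast
   then have "x : cone_over (FF s)" using sub x(1) unfolding R_def by blast
   then show ?thesis by (rule Fz[OF e(3)])
  qed
  \<comment> \<open>If \<open>al s\<close> vanished at the vertex, the vertex would lie in the face
    \<open>s\<close> and hence in one of its facets, an edge of \<open>P\<close>. The identification
    translates this into an edge of the graph at \<open>u\<close> on the boundary of
    \<open>s\<close>, so \<open>s\<close> would belong to \<open>cn u\<close>.\<close>
  moreover have "al s .* x < 0" if s: "s < n" "s ~: cn u" for s
  proof (rule ccontr)
   assume "~ al s .* x < 0"
   then have sx: "al s .* x = 0" using xC s(1) unfolding C_def poly_cone_def by force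
   define D where "D = cone_over (FF s)"
   have DC: "D face_of C" "aff_dim D = 3" "FF s <= P" using F1[OF s(1)] unfolding codim_face_def CC D_def by auto
   have "R <= D"
   proof
    fix y assume y: "y : R"
    then obtain r where "y = r *\<^sub>R x" using line by blast
    then have "al s .* y = 0" using sx by simp
    then show "y : D" unfolding D_def B[OF s(1)] using y RC(1) face_of_imp_subset by blast
   qed
   then have "R face_of D" using face_of_subset[OF RC(1)] DC(1) face_of_imp_subset by blast
   moreover have "R ~= D" using RC(2) DC(2) by auto
   moreover have "polyhedron D" using face_of_polyhedron_polyhedron[OF polyC DC(1)] .
   ultimately obtain f where f: "f facet_of D" "R <= f"
    using face_of_polyhedron_subset_facet R0 by blast
   then have fD: "f face_of D" "aff_dim f = 2" using DC(2) unfolding facet_of_def by auto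
   have fC: "f face_of C" by (rule face_of_trans[OF fD(1) DC(1)])
   have f0: "0 : f" using f(2) R0 by blast
   have conf: "conic_set f" by (rule face_conic[OF fC conC f0])
   have cof: "cone_over (rays_of f) = f" by (rule cone_over_rays_of[OF conf])
   have "rays_of f <= P" unfolding PC rays_of_def using face_of_imp_subset[OF fC] by blast
   then have "codim_face 2 P (rays_of f)" unfolding codim_face_def cof CC using fC fD by simp
   then obtain e where e: "e : edges G" "ps e = rays_of f"
    using bij_betw_imp_surj_on[OF bq] by (metis (mono_tags, lifting) imageE mem_Collect_eq)
   have "ph u = rays_of R" unfolding R_def using rays_of_cone_over[of "ph u" C] RC(3) unfolding PC by simp
   then have "ph u <= ps e" unfolding e(2) using f(2) unfolding rays_of_def by blast
   then have ue: "u : e" using iv[OF u e(1)] by blast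
   have "FF s = rays_of D" unfolding D_def using rays_of_cone_over[of "FF s" C] DC(3) unfolding PC by simp
   then have "ps e <= FF s" unfolding e(2) using face_of_imp_subset[OF fD(1)] unfolding rays_of_def by blast
   then have "e : face G s" using ie[OF s(1) e(1)] by blast
   then have "s : cn u" unfolding corner_def using e(1) ue s(1) by (auto simp: sd_iff)
   then show False using s(2) by blast
  qed
  ultimately show ?thesis unfolding vertex_at_def by (intro exI[of _ x]) auto
 qed
 have sh: "shaped {..<n} Q al"
  unfolding shaped_def
 proof
  fix T assume "T : fst ` Q"
  then obtain u where "u : verts G" "T = cn u" using bij_betw_imp_surj_on[OF bij_cn] by blast
  then show "EX q. vertex_at {..<n} al T q" using vx by blast
 qed
 have "mirrored (kap G) {..<n} Q al v"
  unfolding mirrored_def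
 proof (intro conjI ballI allI impI)
  show "al s .* v s = 2" if "s : {..<n}" for s using two that by simp
  fix s t assume nb: "nbr Q s t"
  have st: "s < n" "t < n" "s ~= t" using nbr_in[OF stk nb] by auto
  obtain e where e: "e : edges G" "sd e = {s, t}" using nbr_edge[OF nb] by blast
  then have ef: "e : face G s" "e : face G t" using sd_iff by blast+
  have "codim_face 2 P (ps e)" using bq e(1) by (auto simp: bij_betw_def)
  moreover have "ps e <= FF s" "ps e <= FF t" using ie st e ef by blast+
  moreover have "FF s ~= FF t" using bijF st unfolding bij_betw_def inj_on_def by blast
  ultimately have "adjacent P (FF s) (FF t)" unfolding adjacent_def by blast
  then have le: "- (al s .* v t) >= 0" "al s .* v t = 0 \<longleftrightarrow> al t .* v s = 0"
   using mp st unfolding mirror_polyhedron_def by blast+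
  have "(al s .* v t) * (al t .* v s) = 4 * (cos (label G e))\<^sup>2"
   using ang[OF st(1,2) _ st(3)] ef unfolding has_dihedral_angle_def by blast
  then show pr: "(al s .* v t) * (al t .* v s) = kap G s t" unfolding kap_edge[OF e] .
  show "al s .* v t <= 0" using le by simp
  show "al s .* v t = 0 \<longleftrightarrow> kap G s t = 0" unfolding pr[symmetric] using le(2) by auto
 qed
 then show ?thesis using y sh by blast
qed

lemma Y_set_eq:
 "Y_set G = {config_of n al v | al v. shaped {..<n} Q al & mirrored (kap G) {..<n} Q al v}"
 using Y_set_config config_realizes by blast

end

subsection \<open>Coordinate spaces\<close>

definition supported :: "'i set => ('i => real) set" where
 "supported J = {y. ALL i. i ~: J --> y i = 0}"

text \<open>Gaussian elimination: a coordinate complement \<open>J\<close> of the span of finitely many vectors, with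
 the projection along that span.\<close>

lemma elimination:
 fixes w :: "nat => 'i => real"
 assumes "finite F" "finite I" and w: "ALL s:F. w s : supported I"
 shows "EX J c. J <= I &
  (ALL y : supported I. (%i. SUM j:I. c i j * y j) : supported J) &
  (ALL y : supported I. EX h. ALL i. (SUM j:I. c i j * y j) = y i + (SUM s:F. h s * w s i)) &
  (ALL h i. (SUM j:I. c i j * (SUM s:F. h s * w s j)) = 0) &
  (ALL y : supported J. ALL i. (SUM j:I. c i j * y j) = y i)"
 using assms(1) w
proof (induction F rule: finite_induct)
 case empty
 define c :: "'i => 'i => real" where "c i j = (if i = j then 1 else 0)" for i j
 have c: "(SUM j:I. c i j * y j) = y i" if "y : supported I" for y i
 proof (cases "i : I")
  case True
  have "(SUM j:I. c i j * y j) = (SUM j:I. if i = j then y j else 0)" unfolding c_def by (intro sum.cong) auto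
  then show ?thesis using True assms(2) by simp
 next
  case False
  have "(SUM j:I. c i j * y j) = 0" unfolding c_def using False by (intro sum.neutral) auto
  then show ?thesis using that False unfolding supported_def by simp
 qed
 show ?case
  by (intro exI[of _ I] exI[of _ c]) (auto simp: c)
next
 case (insert s F)
 have wF: "ALL s:F. w s : supported I" using insert.prems by blast
 obtain J c where J: "J <= I"
  and sup0: "ALL y : supported I. (%i. SUM j:I. c i j * y j) : supported J"
  and ex0: "ALL y : supported I. EX h. ALL i. (SUM j:I. c i j * y j) = y i + (SUM s:F. h s * w s i)"
  and ker: "ALL h i. (SUM j:I. c i j * (SUM s:F. h s * w s j)) = 0"
  and fix0: "ALL y : supported J. ALL i. (SUM j:I. c i j * y j) = y i"
  using insert.IH[OF wF] by (elim exE conjE)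
 note sup = bspec[OF sup0] and ex = bspec[OF ex0] and fixJ = bspec[OF fix0, THEN spec]
 define pp where "pp y i = (SUM j:I. c i j * y j)" for y i
 have padd: "pp (%i. x i + r * y i) i = pp x i + r * pp y i" for x y r i
  unfolding pp_def by (simp add: algebra_simps sum.distrib sum_distrib_left)
 define W where "W = pp (w s)"
 have ws: "w s : supported I" using insert.prems by simp
 have WJ: "W : supported J" unfolding W_def pp_def using sup[OF ws] .
 have pker: "pp (%j. SUM u:insert s F. h u * w u j) i = h s * W i" for h i
 proof -
  have "(%j. SUM u:insert s F. h u * w u j) = (%j. (SUM u:F. h u * w u j) + h s * w s j)"
   using insert.hyps by (auto simp: add.commute)
  then have "pp (%j. SUM u:insert s F. h u * w u j) i = pp (%j. SUM u:F. h u * w u j) i + h s * W i"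
   unfolding W_def using padd by simp
  then show ?thesis using ker unfolding pp_def by simp
 qed
 show ?case
 \<comment> \<open>If \<open>w s\<close> projects to zero it lies in the span of the earlier vectors
   and nothing changes. Otherwise a coordinate \<open>j\<close> where the projection is nonzero
   serves as pivot and leaves \<open>J\<close>.\<close>
 proof (cases "W = (%_. 0)")
  case True
  have "EX h. ALL i. pp y i = y i + (SUM u:insert s F. h u * w u i)" if y: "y : supported I" for y
  proof -
   obtain h where h: "ALL i. pp y i = y i + (SUM u:F. h u * w u i)" using ex[OF y] unfolding pp_def by blast
   have "(SUM u:insert s F. (h(s := 0)) u * w u i) = (SUM u:F. h u * w u i)" for i
    using insert.hyps by (simp, intro sum.cong) auto
   then show ?thesis using h by (intro exI[of _ "h(s := 0)"]) simp
  qed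
  moreover have "pp (%j. SUM u:insert s F. h u * w u j) i = 0" for h i unfolding pker True by simp
  ultimately show ?thesis
   using J sup0 fix0 unfolding pp_def by (intro exI[of _ J] exI[of _ c] conjI) (assumption | blast)+
 next
  case False
  then obtain j where j: "W j ~= 0" by auto
  then have jJ: "j : J" using WJ unfolding supported_def by blast
  define c' where "c' i k = c i k - W i / W j * c j k" for i k
  have c': "(SUM k:I. c' i k * y k) = pp y i - W i / W j * pp y j" for y i
   unfolding c'_def pp_def by (simp add: algebra_simps sum_subtractf sum_distrib_left)
  show ?thesis
  proof (intro exI[of _ "J - {j}"] exI[of _ c'] conjI ballI allI)
   show "J - {j} <= I" using J by blast
   fix y assume y: "y : supported I"
   have "pp y : supported J" using sup[OF y] unfolding pp_def .
   then show "(%i. SUM k:I. c' i k * y k) : supported (J - {j})"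
    unfolding c' supported_def using WJ j by (auto simp: supported_def)
   obtain h where h: "ALL i. pp y i = y i + (SUM u:F. h u * w u i)" using ex[OF y] unfolding pp_def by blast
   obtain h' where h': "ALL i. W i = w s i + (SUM u:F. h' u * w u i)" using ex[OF ws] unfolding W_def pp_def by blast
   define r where "r = pp y j / W j"
   define g where "g = (%u. if u = s then - r else h u - r * h' u)"
   have "(SUM k:I. c' i k * y k) = y i + (SUM u:insert s F. g u * w u i)" for i
   proof -
    have "(SUM u:insert s F. g u * w u i) = - r * w s i + (SUM u:F. (h u - r * h' u) * w u i)"
     unfolding g_def using insert.hyps by (simp, intro sum.cong) auto
    also have "(SUM u:F. (h u - r * h' u) * w u i) = (SUM u:F. h u * w u i) - r * (SUM u:F. h' u * w u i)"
     by (simp add: algebra_simps sum_subtractf sum_distrib_left)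
    finally have e: "(SUM u:insert s F. g u * w u i) =
     - r * w s i + ((SUM u:F. h u * w u i) - r * (SUM u:F. h' u * w u i))" .
    have "W i / W j * pp y j = r * W i" unfolding r_def by simp
    then show ?thesis
     unfolding c' e using h[rule_format, of i] h'[rule_format, of i] by (simp add: algebra_simps)
   qed
   then show "EX h. ALL i. (SUM k:I. c' i k * y k) = y i + (SUM u:insert s F. h u * w u i)" by blast
  next
   fix h i
   show "(SUM k:I. c' i k * (SUM u:insert s F. h u * w u k)) = 0"
    unfolding c' pker using j by simp
  next
   fix y i assume y: "y : supported (J - {j})"
   then have "y : supported J" "y j = 0" unfolding supported_def by auto
   then show "(SUM k:I. c' i k * y k) = y i" unfolding c' using fixJ unfolding pp_def by simp
  qed
 qed
qed

lemma continuous_on_coords: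
 fixes f :: "'a::topological_space => 'i => real"
 assumes "!!i. continuous_on S (%x. f x i)"
 shows "continuous_on S f"
 using assms by (rule continuous_on_coordinatewise_then_product)

lemma continuous_on_coord: "continuous_on S (%x :: 'i => 'b::topological_space. x i)"
 by (rule continuous_on_subset[OF continuous_on_product_coordinates]) simp

text \<open>Radial rescaling by \<open>1 / (1 - rh x)\<close>, with inverse
  \<open>1 / (1 + rh x)\<close>, stretches the open unit body of the gauge \<open>rh\<close> onto
  the whole space. The gauge may vanish on nonzero vectors, so unbounded bodies are covered.\<close>

lemma star_homeomorphic:
 fixes V :: "('i => real) set" and rh :: "('i => real) => real"
 assumes V: "!!x c. x : V ==> (%i. c * x i) : V"
  and cont: "continuous_on V rh" and pos: "!!x. x : V ==> rh x >= 0"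
  and hom: "!!x c. x : V ==> c >= 0 ==> rh (%i. c * x i) = c * rh x"
 shows "top_of_set {x : V. rh x < 1} homeomorphic_space top_of_set V"
proof -
 define f where "f x = (%i. (1 / (1 - rh x)) * x i)" for x
 define g where "g x = (%i. (1 / (1 + rh x)) * x i)" for x
 let ?A = "{x : V. rh x < 1}"
 have cA: "continuous_on ?A rh" by (rule continuous_on_subset[OF cont]) auto
 have cf: "continuous_on ?A f" unfolding f_def
  by (intro continuous_on_coords continuous_intros cA continuous_on_coord) auto
 have cg: "continuous_on V g" unfolding g_def
  by (intro continuous_on_coords continuous_intros cont continuous_on_coord)
   (use pos in \<open>force simp: add_nonneg_eq_0_iff\<close>)
 have fV: "f x : V" if "x : ?A" for x unfolding f_def by (rule V) (use that in simp)
 have rf: "rh (f x) = rh x / (1 - rh x)" if "x : ?A" for x unfolding f_def using that by (subst hom) auto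
 have rg: "rh (g x) = rh x / (1 + rh x)" if "x : V" for x unfolding g_def using that pos[OF that] by (subst hom) auto
 have gA: "g x : ?A" if "x : V" for x
 proof -
  have "g x : V" unfolding g_def by (rule V[OF that])
  moreover have "rh (g x) < 1" unfolding rg[OF that] using pos[OF that] by simp
  ultimately show ?thesis by simp
 qed
 have gf: "g (f x) = x" if "x : ?A" for x
 proof
  fix i
  have r: "0 <= rh x" "rh x < 1" using that pos by auto
  have "1 + rh x / (1 - rh x) = 1 / (1 - rh x)" using r by (simp add: field_simps)
  then show "g (f x) i = x i" unfolding g_def rf[OF that] unfolding f_def using r by simp
 qed
 have fg: "f (g x) = x" if "x : V" for x
 proof
  fix i
  have r: "0 <= rh x" using that pos by auto
  then have "1 - rh x / (1 + rh x) = 1 / (1 + rh x)" by (simp add: field_simps)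
  then show "f (g x) i = x i" unfolding f_def rg[OF that] unfolding g_def using r by simp
 qed
 have "homeomorphic_maps (top_of_set ?A) (top_of_set V) f g"
  unfolding homeomorphic_maps_def using cf cg fV gA gf fg by auto
 then show ?thesis unfolding homeomorphic_space_def by blast
qed

lemma Euclidean_space_top_of_set: "Euclidean_space d = top_of_set (supported {..<d})"
 unfolding Euclidean_space_def supported_def euclidean_product_topology by (simp add: not_less)

lemma supported_homeomorphic_Euclidean:
 assumes "finite J"
 shows "top_of_set (supported J) homeomorphic_space Euclidean_space (card J)"
proof -
 obtain b where b: "bij_betw b {..<card J} J" using ex_bij_betw_nat_finite[OF assms] by (auto simp: atLeast0LessThan)
 define b' where "b' = inv_into {..<card J} b"
 have bb: "b' (b k) = k" if "k < card J" for k
  unfolding b'_def using b that by (simp add: bij_betw_inv_into_left)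
 have bb': "b (b' i) = i" "b' i < card J" if "i : J" for i
  unfolding b'_def using b that
  by (simp add: bij_betw_inv_into_right) (metis b bij_betw_imp_surj_on inv_into_into lessThan_iff that)
 have bJ: "b k : J" if "k < card J" for k using b that by (auto simp: bij_betw_def)
 define f :: "(_ => real) => nat => real" where "f y = (%k. if k < card J then y (b k) else 0)" for y
 define g :: "(nat => real) => _ => real" where "g y = (%i. if i : J then y (b' i) else 0)" for y
 have cf: "continuous_on (supported J) f" unfolding f_def
 proof (rule continuous_on_coords)
  show "continuous_on (supported J) (%x. if k < card J then x (b k) else 0)" for k
   by (cases "k < card J") (simp_all add: continuous_on_coord)
 qed
 have cg: "continuous_on (supported {..<card J}) g" unfolding g_def
 proof (rule continuous_on_coords)
  show "continuous_on (supported {..<card J}) (%x. if i : J then x (b' i) else 0)" for i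
   by (cases "i : J") (simp_all add: continuous_on_coord)
 qed
 have gf: "g (f y) = y" if "y : supported J" for y
  using that bb' unfolding f_def g_def supported_def by (auto intro!: ext)
 have fg: "f (g y) = y" if "y : supported {..<card J}" for y
  using that bb bJ unfolding f_def g_def supported_def by (auto intro!: ext)
 have "homeomorphic_maps (top_of_set (supported J)) (top_of_set (supported {..<card J})) f g"
  unfolding homeomorphic_maps_def using cf cg gf fg by (auto simp: f_def g_def supported_def)
 then show ?thesis unfolding Euclidean_space_top_of_set homeomorphic_space_def by blast
qed

lemma ball_space_homeomorphic: "ball_space d homeomorphic_space Euclidean_space d"
proof -
 define rh :: "(nat => real) => real" where "rh x = sqrt (\<Sum>i<d. (x i)\<^sup>2)" for x
 have c: "continuous_on (supported {..<d}) rh" unfolding rh_def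
  by (intro continuous_intros continuous_on_coord)
 have "rh (%i. r * x i) = r * rh x" if "r >= 0" for r x
  unfolding rh_def using that
  by (simp add: power_mult_distrib sum_distrib_left[symmetric] real_sqrt_mult)
 moreover have "ball_space d = top_of_set {x : supported {..<d}. rh x < 1}"
 proof -
  have "supported {..<d} Int {x. (\<Sum>i<d. (x i)\<^sup>2) < 1} = {x : supported {..<d}. rh x < 1}"
   unfolding rh_def by auto
  then show ?thesis unfolding ball_space_def Euclidean_space_top_of_set subtopology_subtopology by simp
 qed
 ultimately show ?thesis
  unfolding Euclidean_space_top_of_set
  by (simp only:) (intro star_homeomorphic c, auto simp: supported_def rh_def sum_nonneg)
qed

definition linform :: "'i set => (('i => real) => real) => bool" where
 "linform I f \<longleftrightarrow> (EX c. ALL y. f y = (SUM i:I. c i * y i))"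

lemma linform_props:
 assumes "linform I f"
 shows "f (%i. x i + y i) = f x + f y" "f (%i. r * x i) = r * f x" "continuous_on S f"
  "f (%i. x i - y i) = f x - f y"
proof -
 obtain c where c: "!!y. f y = (SUM i:I. c i * y i)" using assms unfolding linform_def by blast
 show "f (%i. x i + y i) = f x + f y" "f (%i. r * x i) = r * f x" "f (%i. x i - y i) = f x - f y"
  unfolding c by (simp_all add: algebra_simps sum.distrib sum_distrib_left sum_subtractf)
 show "continuous_on S f" unfolding c by (intro continuous_intros continuous_on_coord)
qed

text \<open>After moving \<open>p\<close> to the origin each condition reads
  \<open>- f r x / (f r p - t r) < 1\<close>. The maximum of these linear forms and 0 is the gauge
  to which \<open>star_homeomorphic\<close> applies.\<close>

lemma halfspaces_homeomorphic:
 fixes f :: "'r => ('i => real) => real"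
 assumes "finite R" and lin: "!!r. r : R ==> linform I (f r)" and p: "p : supported J" "!!r. r : R ==> f r p > t r"
 shows "top_of_set {x : supported J. ALL r:R. f r x > t r} homeomorphic_space top_of_set (supported J)"
proof -
 let ?V = "supported J"
 define g where "g r x = - f r x / (f r p - t r)" for r x
 define rh where "rh x = Max (insert 0 ((%r. g r x) ` R))" for x
 have pos: "rh x >= 0" for x unfolding rh_def using assms(1) by simp
 have hom: "rh (%i. k * x i) = k * rh x" if "k >= 0" for k x
 proof -
  have "g r (%i. k * x i) = k * g r x" if "r : R" for r unfolding g_def by (simp add: linform_props(2)[OF lin[OF that]])
  then have "insert 0 ((%r. g r (%i. k * x i)) ` R) = (%u. k * u) ` insert 0 ((%r. g r x) ` R)"
   by (auto simp: image_image)
  moreover have "Max ((%u. k * u) ` insert 0 ((%r. g r x) ` R)) = k * Max (insert 0 ((%r. g r x) ` R))"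
   using assms(1) that by (subst mono_Max_commute[symmetric]) (auto intro: monoI mult_left_mono)
  ultimately show ?thesis unfolding rh_def by simp
 qed
 have contg: "continuous_on ?V (g r)" if "r : R" for r
  unfolding g_def by (intro continuous_intros linform_props(3)[OF lin[OF that]]) (use p(2)[OF that] in auto)
 have cont: "continuous_on ?V rh"
 proof -
  have "continuous_on ?V (%x. Max (insert 0 ((%r. g r x) ` R')))" if "R' <= R" "finite R'" for R'
   using that(2,1)
  proof (induction R' rule: finite_induct)
   case empty
   then show ?case by simp
  next
   case (insert r R')
   have "Max (insert 0 ((%r. g r x) ` insert r R')) = max (g r x) (Max (insert 0 ((%r. g r x) ` R')))" for x
    unfolding image_insert insert_commute[of 0] by (rule Max_insert) (use insert.hyps in auto)
   then show ?case using insert contg by (simp only:) (intro continuous_on_max, auto)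
  qed
  then show ?thesis unfolding rh_def using assms(1) by blast
 qed
 have iff: "rh x < 1 \<longleftrightarrow> (ALL r:R. f r (%i. p i + x i) > t r)" for x
 proof -
  have "rh x < 1 \<longleftrightarrow> (ALL r:R. g r x < 1)" unfolding rh_def using assms(1) by simp
  also have "\<dots> \<longleftrightarrow> (ALL r:R. f r (%i. p i + x i) > t r)"
  proof (rule ball_cong[OF refl])
   fix r assume r: "r : R"
   have "f r p - t r > 0" using p(2)[OF r] by simp
   then show "g r x < 1 \<longleftrightarrow> f r (%i. p i + x i) > t r"
    unfolding g_def linform_props(1)[OF lin[OF r]] by (simp add: field_simps)
  qed
  finally show ?thesis .
 qed
 have "top_of_set {x : ?V. rh x < 1} homeomorphic_space top_of_set ?V"
  by (rule star_homeomorphic) (use cont pos hom in \<open>auto simp: supported_def\<close>)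
 moreover have "top_of_set {x : ?V. ALL r:R. f r x > t r} homeomorphic_space top_of_set {x : ?V. rh x < 1}"
 proof -
  let ?f = "%x i. x i - p i" and ?g = "%x i. p i + x i"
  have "homeomorphic_maps (top_of_set {x : ?V. ALL r:R. f r x > t r}) (top_of_set {x : ?V. rh x < 1}) ?f ?g"
   unfolding homeomorphic_maps_def iff
   using p(1) by (auto simp: supported_def intro!: continuous_on_coords continuous_intros continuous_on_coord)
  then show ?thesis unfolding homeomorphic_space_def by blast
 qed
 ultimately show ?thesis using homeomorphic_space_trans by blast
qed

lemma convex_halfspaces_connected:
 fixes f :: "'r => ('i => real) => real"
 assumes lin: "!!r. r : R ==> linform I (f r)"
 shows "connected {x : supported J. ALL r:R. f r x > t r}"
 unfolding connected_iff_connected_component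
proof (intro ballI)
 let ?A = "{x : supported J. ALL r:R. f r x > t r}"
 fix x y assume xy: "x : ?A" "y : ?A"
 define p where "p = (%ta::real. (%i. (1 - ta) * x i + ta * y i))"
 have cp: "continuous_on {0..1} p" unfolding p_def
  by (intro continuous_on_coords continuous_intros)
 have "p ta : ?A" if "ta : {0..1}" for ta
 proof -
  have "f r (p ta) > t r" if r: "r : R" for r
  proof -
   have e: "f r (p ta) = (1 - ta) * f r x + ta * f r y"
    unfolding p_def linform_props(1)[OF lin[OF r]] linform_props(2)[OF lin[OF r]] ..
   have "f r x > t r" "f r y > t r" using xy r by auto
   then have "(1 - ta) * (f r x - t r) + ta * (f r y - t r) > 0"
    using \<open>ta : {0..1}\<close> by (cases "ta = 0") (auto intro!: add_nonneg_pos)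
   then show ?thesis unfolding e by (simp add: algebra_simps)
  qed
  moreover have "p ta : supported J" using xy unfolding p_def supported_def by auto
  ultimately show ?thesis by blast
 qed
 then have "p ` {0..1} <= ?A" by blast
 moreover have "connected (p ` {0..1})" by (rule connected_continuous_image[OF cp connected_Icc])
 moreover have "x : p ` {0..1}" "y : p ` {0..1}"
 proof -
  have "p 0 = x" "p 1 = y" unfolding p_def by auto
  then show "x : p ` {0..1}" "y : p ` {0..1}" by force+
 qed
 ultimately show "connected_component ?A x y" unfolding connected_component_def by blast
qed

text \<open>A negative \<open>t r\<close> imposes no condition, while \<open>t r = 0\<close> removes
  only a hyperplane.\<close>

definition slabs :: "'i set => 'r set => ('r => ('i => real) => real) => ('r => real) => ('i => real) set" where
 "slabs J R f t = {x : supported J. ALL r:R. \<bar>f r x\<bar> > t r}"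

text \<open>Where \<open>t r\<close> is nonnegative, \<open>f r\<close> has a constant sign on a
  connected set. The set \<open>E\<close> records the positive signs, and the nonempty
  \<open>A E\<close> are the components: they are open, pairwise disjoint, and intersections of
  half-spaces.\<close>

lemma slabs_structure:
 fixes f :: "'r => ('i => real) => real"
 assumes J: "finite J" and R: "finite R" and lin: "!!r. r : R ==> linform I (f r)"
  and X: "X homeomorphic_space top_of_set (slabs J R f t)"
 shows "topological_manifold (card J) X & finite (connected_components_of X) &
  (ALL C : connected_components_of X. subtopology X C homeomorphic_space ball_space (card J))"
proof -
 let ?L = "slabs J R f t"
 let ?T = "top_of_set ?L"
 define R' where "R' = {r : R. t r >= 0}"
 define g where "g E r x = (if r : E then f r x else - f r x)" for E r x
 define A where "A E = {x : supported J. ALL r:R'. g E r x > t r}" for E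
 have R': "finite R'" "R' <= R" using R unfolding R'_def by auto
 have ling: "linform I (g E r)" if r: "r : R'" for E r
 proof (cases "r : E")
  case True
  then have "g E r = f r" unfolding g_def by auto
  then show ?thesis using lin r R' by auto
 next
  case False
  obtain c where c: "ALL y. f r y = (SUM i:I. c i * y i)" using lin r R' unfolding linform_def by blast
  have "g E r y = (SUM i:I. (- c i) * y i)" for y unfolding g_def using False c by (simp add: sum_negf)
  then show ?thesis unfolding linform_def by (intro exI[of _ "%i. - c i"] allI)
 qed
 have sub: "A E <= ?L" for E
 proof
  fix x assume x: "x : A E"
  have "\<bar>f r x\<bar> > t r" if "r : R" for r
  proof (cases "r : R'")
   case True
   then have "g E r x > t r" using x unfolding A_def by blast
   then show ?thesis unfolding g_def by (auto split: if_splits)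
  next
   case False
   then show ?thesis using that unfolding R'_def by (simp add: less_le_trans)
  qed
  then show "x : ?L" using x unfolding A_def slabs_def by blast
 qed
 have cover: "EX E. E <= R' & x : A E" if x: "x : ?L" for x
 proof -
  define E where "E = {r : R'. f r x > 0}"
  have "g E r x > t r" if r: "r : R'" for r
  proof -
   have "\<bar>f r x\<bar> > t r" "t r >= 0" using x r unfolding slabs_def R'_def by auto
   then show ?thesis using r unfolding g_def E_def by (auto split: if_splits)
  qed
  then show ?thesis using x unfolding A_def slabs_def E_def by (intro exI[of _ E]) (auto simp: E_def)
 qed
 have disj: "E = E'" if "E <= R'" "E' <= R'" "x : A E" "x : A E'" for E E' x
 proof -
  have "r : E \<longleftrightarrow> r : E'" if r: "r : R'" for r
  proof -
   have "g E r x > t r" "g E' r x > t r" "t r >= 0" using \<open>x : A E\<close> \<open>x : A E'\<close> r unfolding A_def R'_def by auto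
   then show ?thesis unfolding g_def by (auto split: if_splits)
  qed
  then show ?thesis using that by blast
 qed
 have opA: "openin (top_of_set (supported J)) (A E)" for E
 proof -
  have "A E = (INT r:R'. {x : supported J. g E r x : {t r<..}}) Int supported J" unfolding A_def by auto
  moreover have "openin (top_of_set (supported J)) {x : supported J. g E r x : {t r<..}}" if "r : R'" for r
   using continuous_openin_preimage_gen[OF linform_props(3)[OF ling[OF that]], of "{t r<..}" "supported J"]
   by (simp add: vimage_def Int_def conj_commute)
  ultimately show ?thesis using R'(1)
   by (cases "R' = {}") (auto intro!: openin_Int openin_INT2)
 qed
 have opL: "openin (top_of_set (supported J)) ?L"
 proof -
  have "?L = \<Union>(A ` Pow R')"
  proof
   show "?L <= \<Union>(A ` Pow R')" using cover by (intro subsetI) (metis PowI UN_I)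
   show "\<Union>(A ` Pow R') <= ?L" using sub by (rule UN_least)
  qed
  then show ?thesis using opA by (metis (no_types, lifting) imageE openin_Union)
 qed
 have opAL: "openin ?T (A E)" for E
  using opA[of E] sub[of E] by (meson openin_subset_trans openin_imp_subset opL)
 have conn: "connectedin ?T (A E)" for E
  unfolding connectedin_subtopology connectedin_iff_connected
  using sub[of E] convex_halfspaces_connected[where f = "g E" and R = R' and J = J and t = t, OF ling]
  unfolding A_def by simp
 have comp: "EX E. E <= R' & C = A E & A E ~= {}" if C: "C : connected_components_of ?T" for C
 proof -
  obtain x where x: "x : C" using nonempty_connected_components_of[OF C] by blast
  then have xL: "x : ?L" using connected_components_of_subset[OF C] by auto
  then obtain E where E: "E <= R'" "x : A E" using cover by blast
  have "A E <= C"
   using connected_components_of_maximal[OF C conn] x E(2) unfolding disjnt_def by blast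
  moreover have "C <= A E"
  proof -
   have eq: "?L - A E = \<Union>(A ` (Pow R' - {E}))"
   proof
    show "?L - A E <= \<Union>(A ` (Pow R' - {E}))"
    proof
     fix y assume y: "y : ?L - A E"
     then obtain E' where "E' <= R'" "y : A E'" using cover by blast
     then show "y : \<Union>(A ` (Pow R' - {E}))" using y by blast
    qed
    show "\<Union>(A ` (Pow R' - {E})) <= ?L - A E" using sub disj[OF E(1)] by blast
   qed
   have "openin ?T (?L - A E)" unfolding eq using opAL by blast
   then have "closedin ?T (A E)" using sub[of E] by (simp add: closedin_def)
   moreover have "connectedin ?T C" by (rule connectedin_connected_components_of[OF C])
   ultimately have "C <= A E | disjnt C (A E)" using connectedin_clopen_cases opAL[of E] by blast
   then show ?thesis using x E(2) unfolding disjnt_def by blast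
  qed
  ultimately have "C = A E" by blast
  then show ?thesis using E by blast
 qed
 have homA: "top_of_set (A E) homeomorphic_space ball_space (card J)" if ne: "A E ~= {}" for E
 proof -
  obtain p where p: "p : A E" using ne by blast
  have "top_of_set (A E) homeomorphic_space top_of_set (supported J)"
   unfolding A_def by (rule halfspaces_homeomorphic[OF R'(1) ling]) (use p in \<open>auto simp: A_def\<close>)
  then show ?thesis
   using homeomorphic_space_trans supported_homeomorphic_Euclidean[OF J] ball_space_homeomorphic homeomorphic_space_sym by metis
 qed
 have eu: "top_of_set (supported J) homeomorphic_space Euclidean_space (card J)"
  by (rule supported_homeomorphic_Euclidean[OF J])
 obtain F G where FG: "homeomorphic_maps X ?T F G" using X unfolding homeomorphic_space_def by blast
 then have Fm: "homeomorphic_map X ?T F" using homeomorphic_map_maps by blast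
 have man: "topological_manifold (card J) X"
  unfolding topological_manifold_def
 proof (intro conjI ballI)
  have "Hausdorff_space (euclidean :: ('i => real) topology)"
   unfolding euclidean_product_topology[symmetric] by (simp add: Hausdorff_space_product_topology)
  then have "Hausdorff_space ?T" by (rule Hausdorff_space_subtopology)
  then show "Hausdorff_space X" using homeomorphic_Hausdorff_space X by blast
  obtain H K where HK: "homeomorphic_maps (top_of_set (supported J)) (Euclidean_space (card J)) H K"
   using eu unfolding homeomorphic_space_def by blast
  define V where "V = H ` ?L"
  have Hm: "homeomorphic_map (top_of_set (supported J)) (Euclidean_space (card J)) H"
   using HK homeomorphic_map_maps by blast
  have opV: "openin (Euclidean_space (card J)) V"
   unfolding V_def using homeomorphic_map_openness_eq[OF Hm] opL openin_imp_subset by blast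
  have "homeomorphic_map (subtopology (top_of_set (supported J)) ?L) (subtopology (Euclidean_space (card J)) V) H"
  proof (rule homeomorphic_map_subtopologies[OF Hm])
   have "supported J Int ?L = ?L" using openin_imp_subset[OF opL] by blast
   moreover have "topspace (Euclidean_space (card J)) Int V = V" using openin_subset[OF opV] by blast
   ultimately show "H ` (topspace (top_of_set (supported J)) Int ?L) = topspace (Euclidean_space (card J)) Int V"
    unfolding V_def by simp
  qed
  moreover have "subtopology (top_of_set (supported J)) ?L = ?T"
   using openin_imp_subset[OF opL] by (simp add: subtopology_subtopology inf.absorb2)
  ultimately have TV: "?T homeomorphic_space subtopology (Euclidean_space (card J)) V"
   using homeomorphic_map_imp_homeomorphic_space by metis
  have "second_countable (euclidean :: (nat => real) topology)"
  proof -
   obtain B :: "(nat => real) set set" where B: "countable B" "topological_basis B"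
    using ex_countable_basis by blast
   have "EX V:B. x : V & V <= U" if "open U" "x : U" for U x
    using topological_basisE[OF B(2) that] by metis
   then show ?thesis unfolding second_countable_def
    using B topological_basis_open[OF B(2)] by (intro exI[of _ B]) auto
  qed
  then have "second_countable (subtopology (Euclidean_space (card J)) V)"
   unfolding Euclidean_space_top_of_set by (intro second_countable_subtopology)
  then show "second_countable X"
   using homeomorphic_space_second_countability homeomorphic_space_trans[OF X TV] by blast
  fix x assume "x : topspace X"
  then show "EX U V. openin X U & x : U & openin (Euclidean_space (card J)) V &
    subtopology X U homeomorphic_space subtopology (Euclidean_space (card J)) V"
   using opV homeomorphic_space_trans[OF X TV]
   by (intro exI[of _ "topspace X"] exI[of _ V]) (auto simp: subtopology_topspace)
 qed
 have fin: "finite (connected_components_of ?T)"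
 proof (rule finite_subset)
  show "connected_components_of ?T <= A ` Pow R'" using comp by blast
 qed (use R' in simp)
 have img: "connected_components_of ?T = (image F) ` (connected_components_of X)"
  by (rule homeomorphic_map_connected_components_of[OF Fm])
 have injF: "inj_on F (topspace X)" using Fm homeomorphic_imp_injective_map by blast
 have inj: "inj_on (image F) (connected_components_of X)"
  by (rule inj_on_subset[OF inj_on_image_Pow[OF injF]]) (use connected_components_of_subset in blast)
 have "finite (connected_components_of X)" using fin inj unfolding img by (simp add: finite_image_iff)
 moreover have "subtopology X C homeomorphic_space ball_space (card J)" if C: "C : connected_components_of X" for C
 proof -
  have "F ` C : connected_components_of ?T" unfolding img using C by blast
  then obtain E where E: "F ` C = A E" "A E ~= {}" using comp by blast
  have CX: "C <= topspace X" by (rule connected_components_of_subset[OF C])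
  have "subtopology X C homeomorphic_space subtopology ?T (F ` C)"
   using homeomorphic_map_subtopologies[OF Fm, of C "F ` C"] CX Fm homeomorphic_imp_surjective_map[OF Fm]
   by (metis homeomorphic_map_imp_homeomorphic_space inf.absorb2 image_mono)
  moreover have "subtopology ?T (F ` C) = top_of_set (A E)"
   unfolding E(1) using sub[of E] by (simp add: subtopology_subtopology inf.absorb2)
  ultimately show ?thesis using homA[OF E(2)] homeomorphic_space_trans by metis
 qed
 ultimately show ?thesis using man by blast
qed

subsection \<open>Solving linear equations continuously\<close>

definition rows4 :: "real^4 => real^4 => real^4 => real^4 => real^4^4" where
 "rows4 p1 p2 p3 p4 = (\<chi> i. if i = 4 then p4 else if i = 1 then p1 else if i = 2 then p2 else p3)"

lemma rows4_nth: "rows4 p1 p2 p3 p4 $ 1 = p1" "rows4 p1 p2 p3 p4 $ 2 = p2"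
  "rows4 p1 p2 p3 p4 $ 3 = p3" "rows4 p1 p2 p3 p4 $ 4 = p4"
 unfolding rows4_def by simp_all

lemma rows4_mult: "(rows4 p1 p2 p3 p4 *v x) $ 1 = p1 .* x" "(rows4 p1 p2 p3 p4 *v x) $ 2 = p2 .* x"
  "(rows4 p1 p2 p3 p4 *v x) $ 3 = p3 .* x" "(rows4 p1 p2 p3 p4 *v x) $ 4 = p4 .* x"
 by (simp_all add: matrix_vector_mul_component rows4_nth)

lemma rows4_det:
 assumes "!!x. p1 .* x = 0 ==> p2 .* x = 0 ==> p3 .* x = 0 ==> p4 .* x = 0 ==> x = 0"
 shows "det (rows4 p1 p2 p3 p4) ~= 0"
proof -
 have "x = 0" if "rows4 p1 p2 p3 p4 *v x = 0" for x
 proof -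
  have "(rows4 p1 p2 p3 p4 *v x) $ i = 0" for i unfolding that by simp
  then show ?thesis using assms[of x] rows4_mult by metis
 qed
 then have "EX B. B ** rows4 p1 p2 p3 p4 = mat 1" unfolding matrix_left_invertible_ker by blast
 then show ?thesis using invertible_det_nz invertible_left_inverse by blast
qed

lemma det_rows4_linear:
 "det (rows4 p1 p2 p3 (x + y)) = det (rows4 p1 p2 p3 x) + det (rows4 p1 p2 p3 y)"
 "det (rows4 p1 p2 p3 (c *\<^sub>R x)) = c * det (rows4 p1 p2 p3 x)"
proof -
 show "det (rows4 p1 p2 p3 (x + y)) = det (rows4 p1 p2 p3 x) + det (rows4 p1 p2 p3 y)"
  unfolding rows4_def by (rule det_row_add)
 show "det (rows4 p1 p2 p3 (c *\<^sub>R x)) = c * det (rows4 p1 p2 p3 x)"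
  unfolding rows4_def
  by (rule det_row_mul[of 4 c "%_. x" "%i. if i = 1 then p1 else if i = 2 then p2 else p3",
    unfolded scalar_mult_eq_scaleR])
qed

lemma det_rows4_repeat:
 "det (rows4 p1 p2 p3 p1) = 0" "det (rows4 p1 p2 p3 p2) = 0" "det (rows4 p1 p2 p3 p3) = 0"
 by (rule det_identical_rows[of 1 4], simp, simp add: row_def rows4_nth)
  (rule det_identical_rows[of 2 4], simp, simp add: row_def rows4_nth,
   rule det_identical_rows[of 3 4], simp, simp add: row_def rows4_nth)

text \<open>The coefficient \<open>Z\<close> of a relation thus becomes a ratio of two determinants,
  which shows that it depends continuously on the forms.\<close>

lemma det_rows4_relation:
 "det (rows4 p1 p2 p3 (e1 *\<^sub>R p1 + e2 *\<^sub>R p2 + e3 *\<^sub>R p3 - Z *\<^sub>R p4)) = - Z * det (rows4 p1 p2 p3 p4)"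
proof -
 have "e1 *\<^sub>R p1 + e2 *\<^sub>R p2 + e3 *\<^sub>R p3 - Z *\<^sub>R p4 = e1 *\<^sub>R p1 + (e2 *\<^sub>R p2 + (e3 *\<^sub>R p3 + (- Z) *\<^sub>R p4))"
  by simp
 then show ?thesis by (simp only: det_rows4_linear det_rows4_repeat mult_zero_right add_0_left)
qed

text \<open>Cramer's formula instead of an arbitrary solution, so that the solution visibly depends
  continuously on the equations.\<close>

definition solve4 :: "real^4 => real^4 => real^4 => real^4 => real^4 => real^4" where
 "solve4 p1 p2 p3 p4 w = (\<chi> k. det (\<chi> i j. if j = k then w $ i else rows4 p1 p2 p3 p4 $ i $ j) /
   det (rows4 p1 p2 p3 p4))"

lemma solve4:
 assumes "!!x. p1 .* x = 0 ==> p2 .* x = 0 ==> p3 .* x = 0 ==> p4 .* x = 0 ==> x = 0"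
 shows "p1 .* solve4 p1 p2 p3 p4 w = w $ 1" "p2 .* solve4 p1 p2 p3 p4 w = w $ 2"
  "p3 .* solve4 p1 p2 p3 p4 w = w $ 3" "p4 .* solve4 p1 p2 p3 p4 w = w $ 4"
proof -
 have "rows4 p1 p2 p3 p4 *v solve4 p1 p2 p3 p4 w = w"
  using cramer[OF rows4_det[OF assms]] unfolding solve4_def by blast
 then show "p1 .* solve4 p1 p2 p3 p4 w = w $ 1" "p2 .* solve4 p1 p2 p3 p4 w = w $ 2"
  "p3 .* solve4 p1 p2 p3 p4 w = w $ 3" "p4 .* solve4 p1 p2 p3 p4 w = w $ 4"
  by (metis rows4_mult)+
qed

lemma continuous_on_vec:
 assumes "!!i. continuous_on S (%x. f x $ i)"
 shows "continuous_on S (f :: 'a::topological_space => 'b::topological_space^'n)"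
 using assms unfolding continuous_on_def by (auto intro: vec_tendstoI)

lemma continuous_on_det4:
 fixes A :: "'a::topological_space => real^4^4"
 assumes "!!i j. continuous_on S (%x. A x $ i $ j)"
 shows "continuous_on S (%x. det (A x))"
 unfolding det_def by (intro continuous_intros assms)

lemma continuous_on_rows4:
 assumes "continuous_on S p1" "continuous_on S p2" "continuous_on S p3" "continuous_on S p4"
 shows "continuous_on S (%x. rows4 (p1 x) (p2 x) (p3 x) (p4 x) $ i $ j)"
 using exhaust_4[of i] by (elim disjE) (simp_all add: rows4_nth assms continuous_on_component)

lemma continuous_on_det_rows4:
 assumes "continuous_on S p1" "continuous_on S p2" "continuous_on S p3" "continuous_on S p4"
 shows "continuous_on S (%x. det (rows4 (p1 x) (p2 x) (p3 x) (p4 x)))"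
 by (intro continuous_on_det4 continuous_on_rows4 assms)

lemma continuous_on_solve4:
 assumes "continuous_on S p1" "continuous_on S p2" "continuous_on S p3" "continuous_on S p4"
  and w: "!!i. continuous_on S (%x. w x $ i)"
  and nz: "!!x. x : S ==> det (rows4 (p1 x) (p2 x) (p3 x) (p4 x)) ~= 0"
 shows "continuous_on S (%x. solve4 (p1 x) (p2 x) (p3 x) (p4 x) (w x))"
proof (rule continuous_on_vec)
 fix k
 have "continuous_on S (%x. det (\<chi> i j. if j = k then w x $ i else rows4 (p1 x) (p2 x) (p3 x) (p4 x) $ i $ j))"
 proof (rule continuous_on_det4)
  fix i j
  show "continuous_on S (%x. (\<chi> i j. if j = k then w x $ i else rows4 (p1 x) (p2 x) (p3 x) (p4 x) $ i $ j) $ i $ j)"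
   by (cases "j = k") (simp_all add: w continuous_on_rows4 assms)
 qed
 then have "continuous_on S (%x. det (\<chi> i j. if j = k then w x $ i else rows4 (p1 x) (p2 x) (p3 x) (p4 x) $ i $ j) /
   det (rows4 (p1 x) (p2 x) (p3 x) (p4 x)))"
  by (rule continuous_on_divide[OF _ continuous_on_det_rows4[OF assms(1-4)]]) (use nz in blast)
 then show "continuous_on S (%x. solve4 (p1 x) (p2 x) (p3 x) (p4 x) (w x) $ k)"
  unfolding solve4_def by simp
qed

subsection \<open>Uniqueness\<close>

definition related :: "(nat \<times> nat \<times> nat \<times> nat \<times> nat) set => (nat => real^4) =>
  (nat \<times> nat \<times> nat \<times> nat \<times> nat => real) => (nat \<times> nat \<times> nat \<times> nat \<times> nat => real \<times> real \<times> real) => bool" where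
 "related S al Z e \<longleftrightarrow> (ALL i j k l m. (i, j, k, l, m) : S --> Z (i, j, k, l, m) ~= 0 &
   al m = fst (e (i, j, k, l, m)) *\<^sub>R al i + fst (snd (e (i, j, k, l, m))) *\<^sub>R al j +
    snd (snd (e (i, j, k, l, m))) *\<^sub>R al k - Z (i, j, k, l, m) *\<^sub>R al l)"

lemma relation_frame:
 assumes fr: "frame al {i, j, k, l}" and Z: "Z ~= 0"
  and am: "al m = comb al e1 e2 e3 i j k - Z *\<^sub>R al l"
 shows "frame al {i, j, k, m}"
 unfolding frame_def
proof (intro allI impI)
 fix x assume x: "ALL s:{i, j, k, m}. al s .* x = 0"
 have "al m .* x = e1 * (al i .* x) + e2 * (al j .* x) + e3 * (al k .* x) - Z * (al l .* x)"
  unfolding am by (simp add: inner_add_left inner_diff_left)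
 moreover have "al i .* x = 0" "al j .* x = 0" "al k .* x = 0" "al m .* x = 0" using x by blast+
 ultimately have "al l .* x = 0" using Z by simp
 then have "ALL s:{i, j, k, l}. al s .* x = 0" using x by simp
 then show "x = 0" by (rule frameD[OF fr])
qed

lemma related_frames:
 "stacked a b c d F Q S ==> related S al Z e ==> frame al {a, b, c, d} ==> (T, l) : Q ==> frame al (insert l T)"
proof (induction arbitrary: T l rule: stacked.induct)
 case base
 have "insert l T = {a, b, c, d}" using base.prems(3) by auto
 then show ?case using base.prems(2) by simp
next
 case (step F Q S i j k l0 m T l)
 have rS: "related S al Z e" using step.prems(1) unfolding related_def by blast
 have fr: "frame al {i, j, k, l0}"
  using step.IH[OF rS step.prems(2) step(2)] by (simp add: insert_commute)
 have Z: "Z (i, j, k, l0, m) ~= 0"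
  and am: "al m = fst (e (i, j, k, l0, m)) *\<^sub>R al i + fst (snd (e (i, j, k, l0, m))) *\<^sub>R al j +
    snd (snd (e (i, j, k, l0, m))) *\<^sub>R al k - Z (i, j, k, l0, m) *\<^sub>R al l0"
  using step.prems(1) unfolding related_def by blast+
 have frm: "frame al {i, j, k, m}" by (rule relation_frame[OF fr Z am])
 show ?case
 proof (cases "(T, l) : Q")
  case True
  then show ?thesis by (rule step.IH[OF rS step.prems(2)])
 next
  case False
  then have "insert l T = {i, j, k, m}" using step.prems(3) by auto
  then show ?thesis using frm by simp
 qed
qed

lemma matrix_inv_props:
 fixes A :: "real^'n^'n"
 assumes "invertible A"
 shows "A ** matrix_inv A = mat 1" "matrix_inv A ** A = mat 1"
proof -
 have "A ** matrix_inv A = mat 1 & matrix_inv A ** A = mat 1"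
  unfolding matrix_inv_def by (rule someI_ex) (use assms in \<open>simp add: invertible_def\<close>)
 then show "A ** matrix_inv A = mat 1" "matrix_inv A ** A = mat 1" by blast+
qed

lemma base_transport:
 fixes al al' :: "nat => real^4"
 assumes fr: "frame al {a, b, c, d}" and fr': "frame al' {a, b, c, d}"
 shows "EX g :: real^4^4. invertible g & (ALL s:{a, b, c, d}. ALL x. al' s .* (g *v x) = al s .* x)"
proof -
 define M where "M = rows4 (al a) (al b) (al c) (al d)"
 define M' where "M' = rows4 (al' a) (al' b) (al' c) (al' d)"
 have "det M ~= 0" unfolding M_def by (rule rows4_det) (rule frameD[OF fr], simp)
 then have iM: "invertible M" by (simp add: invertible_det_nz)
 have "det M' ~= 0" unfolding M'_def by (rule rows4_det) (rule frameD[OF fr'], simp)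
 then have iM': "invertible M'" by (simp add: invertible_det_nz)
 define g where "g = matrix_inv M' ** M"
 have "invertible (matrix_inv M')"
  unfolding invertible_def using matrix_inv_props[OF iM'] by blast
 then have "invertible g" unfolding g_def using iM by (rule invertible_mult)
 have "M' *v (g *v x) = M *v x" for x
  unfolding g_def by (simp add: matrix_vector_mul_assoc matrix_mul_assoc matrix_inv_props(1)[OF iM'] matrix_mul_lid)
 then have "ALL s:{a, b, c, d}. ALL x. al' s .* (g *v x) = al s .* x"
  unfolding M_def M'_def by (metis (no_types, lifting) rows4_mult insertE emptyE)
 with \<open>invertible g\<close> show ?thesis by blast
qed

text \<open>The four forms of the first simplex determine \<open>g\<close>, the relations transport
  it to every later form, and each pole is known from its pairings with a frame of faces adjacent to
  its own, together with the normalization 2.\<close>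

lemma configuration_unique:
 assumes "stacked a b c d F Q S" and "related S al Z e" and "related S al' Z e"
  and "frame al {a, b, c, d}" and "frame al' {a, b, c, d}"
  and "ALL s:F. al s .* v s = 2 & al' s .* v' s = 2"
  and "ALL s t. nbr Q s t --> al s .* v t = al' s .* v' t"
 shows "EX g :: real^4^4. invertible g & (ALL s:F. (ALL x. al' s .* (g *v x) = al s .* x) & v' s = g *v v s)"
 using assms
proof (induction rule: stacked.induct)
 case base
 obtain g :: "real^4^4" where g: "invertible g" "ALL s:{a, b, c, d}. ALL x. al' s .* (g *v x) = al s .* x"
  using base_transport[OF base.prems(3,4)] by blast
 have "v' t = g *v v t" if t: "t : {a, b, c, d}" for t
 proof -
  have "ALL s:{a, b, c, d}. al' s .* (v' t - g *v v t) = 0"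
  proof
   fix s assume s: "s : {a, b, c, d}"
   have "al s .* v t = al' s .* v' t"
   proof (cases "s = t")
    case True
    then show ?thesis using base.prems(5)[rule_format, OF t] by simp
   next
    case False
    then have "nbr (tetra a b c d) s t"
     unfolding nbr_base[OF base(1)] using s t by blast
    then show ?thesis using base.prems(6) by blast
   qed
   then show "al' s .* (v' t - g *v v t) = 0" using g(2)[rule_format, OF s] by (simp add: inner_diff_right)
  qed
  then have "v' t - g *v v t = 0" by (rule frameD[OF base.prems(4)])
  then show ?thesis by simp
 qed
 then show ?case using g by blast
next
 case (step F Q S i j k l m)
 have rel: "related S al Z e" "related S al' Z e" using step.prems(1,2) unfolding related_def by blast+
 note nb = nbr_step[OF step(1,2,4,3)]
 obtain g :: "real^4^4" where g: "invertible g"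
  "!!s x. s : F ==> al' s .* (g *v x) = al s .* x" "!!s. s : F ==> v' s = g *v v s"
  using step.IH[OF rel step.prems(3,4)] step.prems(5,6) unfolding nb by blast
 have in_F: "i : F" "j : F" "k : F" "l : F" using stacked_tri[OF step(1,2)] by auto
 have Z: "Z (i, j, k, l, m) ~= 0"
  and am: "al m = fst (e (i, j, k, l, m)) *\<^sub>R al i + fst (snd (e (i, j, k, l, m))) *\<^sub>R al j +
    snd (snd (e (i, j, k, l, m))) *\<^sub>R al k - Z (i, j, k, l, m) *\<^sub>R al l"
  using step.prems(1) unfolding related_def by blast+
 have am': "al' m = fst (e (i, j, k, l, m)) *\<^sub>R al' i + fst (snd (e (i, j, k, l, m))) *\<^sub>R al' j +
    snd (snd (e (i, j, k, l, m))) *\<^sub>R al' k - Z (i, j, k, l, m) *\<^sub>R al' l"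
  using step.prems(2) unfolding related_def by blast
 have gm: "al' m .* (g *v x) = al m .* x" for x
  unfolding am am' using g(2) in_F by (simp add: inner_add_left inner_diff_left)
 have fr: "frame al' {i, j, k, l}"
  using related_frames[OF step(1) rel(2) step.prems(4) step(2)] by (simp add: insert_commute)
 have frm: "frame al' {i, j, k, m}" by (rule relation_frame[OF fr Z am'])
 have "ALL s:{i, j, k, m}. al' s .* (v' m - g *v v m) = 0"
 proof
  fix s assume s: "s : {i, j, k, m}"
  have "al' s .* (g *v v m) = al s .* v m" using s g(2) in_F gm by blast
  moreover have "al s .* v m = al' s .* v' m"
  proof (cases "s = m")
   case True
   then show ?thesis using step.prems(5) by (metis insertI1)
  next
   case False
   then show ?thesis using step.prems(6) s unfolding nb by blast
  qed
  ultimately show "al' s .* (v' m - g *v v m) = 0" by (simp add: inner_diff_right)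
 qed
 then have "v' m - g *v v m = 0" by (rule frameD[OF frm])
 then have vm: "v' m = g *v v m" by simp
 show ?case
 proof (intro exI[of _ g] conjI ballI)
  show "invertible g" by (rule g(1))
  fix s assume "s : insert m F"
  then show "ALL x. al' s .* (g *v x) = al s .* x" "v' s = g *v v s" using g(2,3) gm vm by blast+
 qed
qed

subsection \<open>Reconstruction\<close>

definition md3 :: "(nat => nat => real) => nat => nat => nat => real" where
 "md3 M i j k = 8 + M i j * M j k * M k i + M i k * M k j * M j i
   - 2 * (M i j * M j i + M j k * M k j + M i k * M k i)"

lemma det3_md3: "det3 al v = md3 (%s t. al s .* v t)"
 unfolding det3_def md3_def by (intro ext) simp

definition row_coef :: "(nat => nat => real) => nat => nat => nat => (nat => real) => real \<times> real \<times> real" where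
 "row_coef M i j k w =
  ((w i * (4 - M j k * M k j) + w j * (M j k * M k i - 2 * M j i) + w k * (M j i * M k j - 2 * M k i)) / md3 M i j k,
   (w i * (M i k * M k j - 2 * M i j) + w j * (4 - M i k * M k i) + w k * (M i j * M k i - 2 * M k j)) / md3 M i j k,
   (w i * (M i j * M j k - 2 * M i k) + w j * (M i k * M j i - 2 * M j k) + w k * (4 - M i j * M j i)) / md3 M i j k)"

lemma row_coef_eqI:
 assumes D: "md3 M i j k ~= 0"
  and e: "2 * e1 + M j i * e2 + M k i * e3 = w i" "M i j * e1 + 2 * e2 + M k j * e3 = w j"
   "M i k * e1 + M j k * e2 + 2 * e3 = w k"
 shows "row_coef M i j k w = (e1, e2, e3)"
proof -
 note c = cofactor_solution[OF e]
 have md: "md3 M i j k = 8 + M i j * M j k * M k i + M i k * M k j * M j i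
   - 2 * (M i j * M j i + M j k * M k j + M i k * M k i)" by (rule md3_def)
 show ?thesis unfolding row_coef_def c[symmetric, folded md] using D by simp
qed

lemma row_coef:
 assumes D: "md3 M i j k ~= 0" and e: "row_coef M i j k w = (e1, e2, e3)"
 shows "2 * e1 + M j i * e2 + M k i * e3 = w i" "M i j * e1 + 2 * e2 + M k j * e3 = w j"
   "M i k * e1 + M j k * e2 + 2 * e3 = w k"
proof -
 obtain d1 d2 d3 where d: "2 * d1 + M j i * d2 + M k i * d3 = w i" "M i j * d1 + 2 * d2 + M k j * d3 = w j"
   "M i k * d1 + M j k * d2 + 2 * d3 = w k"
  using cofactor_exists[OF D[unfolded md3_def], of "w i" "w j" "w k"] by blast
 have "d1 = e1" "d2 = e2" "d3 = e3" using row_coef_eqI[OF D d] e by simp_all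
 then show "2 * e1 + M j i * e2 + M k i * e3 = w i" "M i j * e1 + 2 * e2 + M k j * e3 = w j"
   "M i k * e1 + M j k * e2 + 2 * e3 = w k" using d by blast+
qed

text \<open>Pairing the relation for \<open>m\<close> with \<open>v i\<close>, \<open>v j\<close>,
  \<open>v k\<close> gives a linear system for its three positive-side coefficients, with right-hand
  side \<open>M m s + z m * M l s\<close>.\<close>

definition step_coef :: "(nat => nat => real) => (nat => real) => nat \<times> nat \<times> nat \<times> nat \<times> nat => real \<times> real \<times> real" where
 "step_coef M z = (%(i, j, k, l, m). row_coef M i j k (%s. M m s + z m * M l s))"

definition step_scale :: "(nat => real) => nat \<times> nat \<times> nat \<times> nat \<times> nat => real" where
 "step_scale z = (%(i, j, k, l, m). z m)"

definition base_coord :: "nat => nat => nat => nat => 4 => nat" where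
 "base_coord a b c d r = (if r = 1 then a else if r = 2 then b else if r = 3 then c else d)"

lemma reconstruction_base:
 assumes d: "distinct [a, b, c, d]" and M: "!!s t. continuous_on Om (%y. M y s t)"
  and M2: "!!y s. y : Om ==> M y s s = (2 :: real)"
 shows "EX al v. (ALL s. continuous_on Om (%y. al y s :: real^4) & continuous_on Om (%y. v y s :: real^4)) &
  (ALL y:Om. shaped {a, b, c, d} (tetra a b c d) (al y) &
   (ALL s:{a, b, c, d}. ALL t. al y s .* v y t = M y s t))"
proof -
 define be :: "nat => real^4" where "be s = (if s = a then - axis 1 1 else if s = b then - axis 2 1 else
  if s = c then - axis 3 1 else - axis 4 1)" for s
 define v where "v y t = (\<chi> r. - M y (base_coord a b c d r) t)" for y t
 have ne: "a ~= b" "a ~= c" "a ~= d" "b ~= c" "b ~= d" "c ~= d" using d by auto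
 have n4: "(4::4) ~= 1" "(4::4) ~= 2" "(4::4) ~= 3" "(1::4) ~= 2" "(1::4) ~= 3" "(2::4) ~= 3" by simp_all
 have b: "be a .* x = - x $ 1" "be b .* x = - x $ 2" "be c .* x = - x $ 3" "be d .* x = - x $ 4" for x
  unfolding be_def using ne by (simp_all add: inner_axis' )
 have pair: "ALL s:{a, b, c, d}. ALL t. be s .* v y t = M y s t" for y
  by (simp add: b v_def base_coord_def)
 have cv: "continuous_on Om (%y. v y t)" for t
  by (rule continuous_on_vec) (simp add: v_def, intro continuous_intros M)
 have "vertex_at {a, b, c, d} be {b, c, d} (axis 1 1)" "vertex_at {a, b, c, d} be {a, c, d} (axis 2 1)"
  "vertex_at {a, b, c, d} be {a, b, d} (axis 3 1)" "vertex_at {a, b, c, d} be {a, b, c} (axis 4 1)"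
  unfolding vertex_at_def by (auto simp: b axis_def)
 then have "shaped {a, b, c, d} (tetra a b c d) be"
  unfolding shaped_def image_insert image_empty fst_conv ball_simps by blast
 then show ?thesis using pair cv by - (rule exI[of _ "%_. be"], rule exI[of _ v], simp)
qed

text \<open>At each step the new form is the combination dictated by \<open>step_coef\<close>, and
  the new pole solves four linear equations. All formulas are rational with nonvanishing
  denominators, hence continuous in the parameter.\<close>

lemma reconstruction:
 assumes "stacked a b c d F Q S"
  and M: "!!s t. continuous_on Om (%y. M y s t)" and M2: "!!y s. y : Om ==> M y s s = 2"
  and z: "!!m. continuous_on Om (%y. z y m)" and z0: "!!y m. y : Om ==> z y m ~= 0"
  and "ALL (i, j, k, l, m) : S. ALL y:Om. md3 (M y) i j k ~= 0"
 shows "EX al v. (ALL s:F. continuous_on Om (%y. al y s :: real^4) & continuous_on Om (%y. v y s :: real^4)) &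
  (ALL y:Om. shaped {a, b, c, d} (tetra a b c d) (al y) &
   (ALL s:F. al y s .* v y s = 2) & (ALL s t. nbr Q s t --> al y s .* v y t = M y s t) &
   related S (al y) (step_scale (z y)) (step_coef (M y) (z y)))"
 using assms(1) assms(6)
proof (induction rule: stacked.induct)
 case base
 obtain al v where av: "ALL s. continuous_on Om (%y. al y s :: real^4) & continuous_on Om (%y. v y s :: real^4)"
  and h: "ALL y:Om. shaped {a, b, c, d} (tetra a b c d) (al y) &
   (ALL s:{a, b, c, d}. ALL t. al y s .* v y t = M y s t)"
  using reconstruction_base[where M = M and Om = Om, OF base(1) M M2] by blast
 show ?case
 proof (rule exI[of _ al], rule exI[of _ v], intro conjI ballI allI impI)
  fix y s t assume "y : Om" "nbr (tetra a b c d) s t"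
  then show "al y s .* v y t = M y s t" using h unfolding nbr_base[OF base(1)] by blast
 next
  fix y s assume y: "y : Om" "s : {a, b, c, d}"
  then have "al y s .* v y s = M y s s" using h by blast
  then show "al y s .* v y s = 2" using M2[OF y(1)] by simp
 qed (use av h M2 in \<open>simp_all add: related_def\<close>)
next
 case (step F Q S i j k l m)
 have D: "md3 (M y) i j k ~= 0" if "y : Om" for y using step.prems that by blast
 obtain al v where av: "ALL s:F. continuous_on Om (%y. al y s :: real^4) & continuous_on Om (%y. v y s :: real^4)"
  and h: "ALL y:Om. shaped {a, b, c, d} (tetra a b c d) (al y) &
   (ALL s:F. al y s .* v y s = 2) & (ALL s t. nbr Q s t --> al y s .* v y t = M y s t) &
   related S (al y) (step_scale (z y)) (step_coef (M y) (z y))"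
  using step.IH step.prems by blast
 note tri = stacked_tri[OF step(1,2)]
 note nb = nbr_step[OF step(1,2,4,3)]
 have in_F: "i : F" "j : F" "k : F" "l : F" using tri by auto
 have nm: "i ~= m" "j ~= m" "k ~= m" "l ~= m" using in_F step(4) by auto
 have nin: "m ~: {a, b, c, d}" using stacked_base[OF step(1)] step(4) by blast
 define e where "e y = step_coef (M y) (z y) (i, j, k, l, m)" for y
 define e1 where "e1 y = fst (e y)" for y
 define e2 where "e2 y = fst (snd (e y))" for y
 define e3 where "e3 y = snd (snd (e y))" for y
 have ce: "continuous_on Om e1" "continuous_on Om e2" "continuous_on Om e3"
  unfolding e1_def e2_def e3_def e_def step_coef_def row_coef_def prod.case fst_conv snd_conv
  by (intro continuous_on_divide, intro continuous_intros M z, unfold md3_def, intro continuous_intros M,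
    fold md3_def, use D in blast)+
 have eq: "2 * e1 y + M y j i * e2 y + M y k i * e3 y = M y m i + z y m * M y l i"
   "M y i j * e1 y + 2 * e2 y + M y k j * e3 y = M y m j + z y m * M y l j"
   "M y i k * e1 y + M y j k * e2 y + 2 * e3 y = M y m k + z y m * M y l k" if y: "y : Om" for y
 proof -
  have "row_coef (M y) i j k (%s. M y m s + z y m * M y l s) = (e1 y, e2 y, e3 y)"
   unfolding e1_def e2_def e3_def e_def step_coef_def by simp
  note r = row_coef[OF D[OF y] this]
  show "2 * e1 y + M y j i * e2 y + M y k i * e3 y = M y m i + z y m * M y l i"
   "M y i j * e1 y + 2 * e2 y + M y k j * e3 y = M y m j + z y m * M y l j"
   "M y i k * e1 y + M y j k * e2 y + 2 * e3 y = M y m k + z y m * M y l k" using r by simp_all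
 qed
 \<comment> \<open>The first three entries are prescribed pairings with the new pole. The fourth,
   the pairing with \<open>al l\<close>, is the value for which the new form and the new pole pair
   to 2.\<close>
 define w :: "'a => real^4" where "w y = (\<chi> r. if r = 1 then M y i m else if r = 2 then M y j m else
  if r = 3 then M y k m else (e1 y * M y i m + e2 y * M y j m + e3 y * M y k m - 2) / z y m)" for y
 define am where "am y = e1 y *\<^sub>R al y i + e2 y *\<^sub>R al y j + e3 y *\<^sub>R al y k - z y m *\<^sub>R al y l" for y
 define vm where "vm y = solve4 (al y i) (al y j) (al y k) (al y l) (w y)" for y
 define al' where "al' y = (al y)(m := am y)" for y
 define v' where "v' y = (v y)(m := vm y)" for y
 have fr: "al y i .* x = 0 ==> al y j .* x = 0 ==> al y k .* x = 0 ==> al y l .* x = 0 ==> x = 0" if y: "y : Om" for y x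
 proof -
  assume x: "al y i .* x = 0" "al y j .* x = 0" "al y k .* x = 0" "al y l .* x = 0"
  have "frame (al y) {a, b, c, d}" unfolding frame_def
   using shaped_base_frame[of a b c d "al y"] h y stacked_base[OF step(1)] by blast
  then have "frame (al y) (insert l {i, j, k})" using related_frames[OF step(1) _ _ step(2)] h y by blast
  then show "x = 0" by (rule frameD) (use x in simp)
 qed
 have sv: "al y i .* vm y = M y i m" "al y j .* vm y = M y j m" "al y k .* vm y = M y k m"
  "al y l .* vm y = (e1 y * M y i m + e2 y * M y j m + e3 y * M y k m - 2) / z y m" if y: "y : Om" for y
 proof -
  have "al y i .* vm y = w y $ 1" "al y j .* vm y = w y $ 2" "al y k .* vm y = w y $ 3" "al y l .* vm y = w y $ 4"
   unfolding vm_def by (rule solve4, rule fr[OF y], assumption+)+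
  then show "al y i .* vm y = M y i m" "al y j .* vm y = M y j m" "al y k .* vm y = M y k m"
   "al y l .* vm y = (e1 y * M y i m + e2 y * M y j m + e3 y * M y k m - 2) / z y m"
   unfolding w_def by simp_all
 qed
 have "continuous_on Om (%y. (e1 y * M y i m + e2 y * M y j m + e3 y * M y k m - 2) / z y m)"
  by (intro continuous_intros M z ce) (use z0 in blast)
 then have cw: "continuous_on Om (%y. w y $ r)" for r
  using exhaust_4[of r] by (elim disjE) (simp_all add: w_def M)
 have c_am: "continuous_on Om am" unfolding am_def
  by (intro continuous_intros ce z) (use av in_F in blast)+
 have c_vm: "continuous_on Om vm" unfolding vm_def
  by (rule continuous_on_solve4) (use av in_F cw in blast, use av in_F in blast, use av in_F in blast,
   use av in_F in blast, rule cw, rule rows4_det, use fr in blast)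
 have amv: "am y .* x = e1 y * (al y i .* x) + e2 y * (al y j .* x) + e3 y * (al y k .* x) - z y m * (al y l .* x)" for y x
  unfolding am_def by (simp add: inner_add_left inner_diff_left)
 have old: "al' y s = al y s" "v' y s = v y s" if "s : F" for y s
  using that step(4) unfolding al'_def v'_def by auto
 have new: "al' y m = am y" "v' y m = vm y" for y unfolding al'_def v'_def by simp_all
 show ?case
 proof (rule exI[of _ al'], rule exI[of _ v'], intro conjI ballI)
  fix s assume s: "s : insert m F"
  show "continuous_on Om (%y. al' y s)"
   by (cases "s = m") (use s c_am av old new in \<open>simp_all\<close>)
  show "continuous_on Om (%y. v' y s)"
   by (cases "s = m") (use s c_vm av old new in \<open>simp_all\<close>)
 next
  fix y assume y: "y : Om"
  note hy = h[rule_format, OF y]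
  have "al' y s = al y s" if "s : {a, b, c, d}" for s using that nin unfolding al'_def by auto
  then have "vertex_at {a, b, c, d} (al' y) T = vertex_at {a, b, c, d} (al y) T" if "T <= {a, b, c, d}" for T
   using that unfolding vertex_at_def by (intro ext) (metis DiffD1 subsetD)
  then show "shaped {a, b, c, d} (tetra a b c d) (al' y)"
   using conjunct1[OF hy] unfolding shaped_def image_insert image_empty fst_conv ball_simps by simp
  have amvm: "am y .* vm y = 2" unfolding amv sv[OF y] using z0[OF y] by simp
  show "al' y s .* v' y s = 2" if "s : insert m F" for s
   by (cases "s = m") (use that hy old new amvm in \<open>simp_all\<close>)
  have old_nb: "al y s .* v y t = M y s t" if "nbr Q s t" for s t using hy that by blast
  have tn: "nbr Q s t" if "s : {l, i, j, k}" "t : {l, i, j, k}" "s ~= t" for s t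
   using stacked_tetra_nbr[OF step(1,2)] that by blast
  have ams: "am y .* v y s = M y m s" if s: "s : {i, j, k}" for s
  proof -
   have d: "al y i .* v y i = 2" "al y j .* v y j = 2" "al y k .* v y k = 2" using hy in_F by blast+
   have ijk: "i ~= j" "i ~= k" "j ~= k" "l ~= i" "l ~= j" "l ~= k" using step(3) tri by auto
   have o: "al y i .* v y j = M y i j" "al y i .* v y k = M y i k" "al y j .* v y i = M y j i"
    "al y j .* v y k = M y j k" "al y k .* v y i = M y k i" "al y k .* v y j = M y k j"
    "al y l .* v y i = M y l i" "al y l .* v y j = M y l j" "al y l .* v y k = M y l k"
    by (rule old_nb, rule tn; use ijk in simp)+
   have "s = i | s = j | s = k" using s by blast
   then show ?thesis unfolding amv using eq[OF y] by (elim disjE) (simp_all add: d o algebra_simps)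
  qed
  show "ALL s t. nbr (cut Q i j k l m) s t --> al' y s .* v' y t = M y s t"
  proof (intro allI impI)
   fix s t assume "nbr (cut Q i j k l m) s t"
   then have "nbr Q s t | (s = m & t : {i, j, k}) | (t = m & s : {i, j, k})" unfolding nb .
   then show "al' y s .* v' y t = M y s t"
   proof (elim disjE conjE)
    assume st: "nbr Q s t"
    then have "s : F" "t : F" using nbr_in[OF step(1)] by blast+
    then show ?thesis using old old_nb[OF st] by simp
   next
    assume st: "s = m" "t : {i, j, k}"
    then have "t : F" using in_F by blast
    then show ?thesis using old new ams[OF st(2)] st(1) by simp
   next
    assume st: "t = m" "s : {i, j, k}"
    then have sF: "s : F" using in_F by blast
    have "al y s .* vm y = M y s m" using st(2) sv[OF y] by blast
    then show ?thesis using old[OF sF] new st(1) by simp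
   qed
  qed
  have "related S (al' y) (step_scale (z y)) (step_coef (M y) (z y))"
   unfolding related_def
  proof (intro allI impI)
   fix i' j' k' l' m' assume s: "(i', j', k', l', m') : S"
   have "{i', j', k', l', m'} <= F" using stacked_steps[OF step(1) s] by blast
   then have o: "al' y i' = al y i'" "al' y j' = al y j'" "al' y k' = al y k'" "al' y l' = al y l'" "al' y m' = al y m'"
    using old by blast+
   show "step_scale (z y) (i', j', k', l', m') ~= 0 & al' y m' =
    fst (step_coef (M y) (z y) (i', j', k', l', m')) *\<^sub>R al' y i' +
    fst (snd (step_coef (M y) (z y) (i', j', k', l', m'))) *\<^sub>R al' y j' +
    snd (snd (step_coef (M y) (z y) (i', j', k', l', m'))) *\<^sub>R al' y k' -
    step_scale (z y) (i', j', k', l', m') *\<^sub>R al' y l'"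
    unfolding o using hy s unfolding related_def by blast
  qed
  moreover have "step_scale (z y) (i, j, k, l, m) ~= 0" unfolding step_scale_def using z0[OF y] by simp
  moreover have "al' y m = fst (step_coef (M y) (z y) (i, j, k, l, m)) *\<^sub>R al' y i +
    fst (snd (step_coef (M y) (z y) (i, j, k, l, m))) *\<^sub>R al' y j +
    snd (snd (step_coef (M y) (z y) (i, j, k, l, m))) *\<^sub>R al' y k -
    step_scale (z y) (i, j, k, l, m) *\<^sub>R al' y l"
   unfolding new old(1)[OF in_F(1)] old(1)[OF in_F(2)] old(1)[OF in_F(3)] old(1)[OF in_F(4)]
    am_def e1_def e2_def e3_def e_def step_scale_def by simp
  ultimately show "related (insert (i, j, k, l, m) S) (al' y) (step_scale (z y)) (step_coef (M y) (z y))"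
   unfolding related_def by (metis insertE prod.inject)
 qed
qed

lemma relation_step_coef:
 assumes D: "det3 al v i j k ~= 0" and d: "al i .* v i = 2" "al j .* v j = 2" "al k .* v k = 2"
  and am: "al m = comb al e1 e2 e3 i j k - z m *\<^sub>R al l"
  and M: "ALL s:{i, j, k, l, m}. ALL t:{i, j, k}. s ~= t --> M s t = al s .* v t" and n: "distinct [i, j, k, l, m]"
 shows "step_coef M z (i, j, k, l, m) = (e1, e2, e3)"
proof -
 have ne: "i ~= j" "i ~= k" "j ~= k" "l ~= i" "l ~= j" "l ~= k" "m ~= i" "m ~= j" "m ~= k" using n by auto
 have o: "M i j = al i .* v j" "M i k = al i .* v k" "M j i = al j .* v i" "M j k = al j .* v k" "M k i = al k .* v i"
  "M k j = al k .* v j" "M l i = al l .* v i" "M l j = al l .* v j" "M l k = al l .* v k"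
  "M m i = al m .* v i" "M m j = al m .* v j" "M m k = al m .* v k"
  using M ne ne[symmetric] by simp_all
 have D': "md3 M i j k ~= 0" using D unfolding det3_md3 md3_def o .
 have amv: "al m .* x = e1 * (al i .* x) + e2 * (al j .* x) + e3 * (al k .* x) - z m * (al l .* x)" for x
  unfolding am by (simp add: inner_add_left inner_diff_left)
 show ?thesis
  unfolding step_coef_def prod.case
  by (rule row_coef_eqI[OF D']) (simp_all only: o amv d, simp_all add: algebra_simps)
qed

subsection \<open>Logarithmic coordinates\<close>

lemma steps_frame:
 "stacked a b c d F Q S ==> shaped F Q al ==> (i, j, k, l, m) : S ==> frame al {i, j, k, l}"
proof (induction arbitrary: i j k l m rule: stacked.induct)
 case base
 then show ?case by simp
next
 case (step F Q S i0 j0 k0 l0 m0 i j k l m)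
 have sh: "shaped F Q al" by (rule shaped_truncation[OF step(1-4) step.prems(1)])
 show ?case
 proof (cases "(i, j, k, l, m) : S")
  case True
  then show ?thesis using step.IH[OF sh] by blast
 next
  case False
  then have "insert l0 {i0, j0, k0} = {i, j, k, l}" using step.prems(2) by auto
  moreover have "frame al (insert l0 {i0, j0, k0})"
   unfolding frame_def using shaped_frames[OF step(1) sh step(2)] by blast
  ultimately show ?thesis by simp
 qed
qed

lemma neg_sqrt_exp:
 assumes "p < 0" "q < 0"
 shows "- sqrt (p * q) * exp (ln (p / q) / 2) = (p :: real)"
proof -
 have r: "p / q > 0" using assms by (simp add: divide_neg_neg)
 have "exp (ln (p / q) / 2) = sqrt (p / q)"
 proof (rule real_sqrt_unique[symmetric])
  have "exp (ln (p / q) / 2) ^ 2 = exp (ln (p / q))" by (simp add: exp_double[symmetric])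
  then show "(exp (ln (p / q) / 2))\<^sup>2 = p / q" using r by simp
 qed simp
 moreover have "sqrt (p * q) * sqrt (p / q) = - p"
 proof -
  have "p * q * (p / q) = p\<^sup>2" using assms by (simp add: power2_eq_square)
  then have "sqrt (p * q) * sqrt (p / q) = sqrt (p\<^sup>2)" by (simp only: real_sqrt_mult[symmetric])
  then show ?thesis using assms by simp
 qed
 ultimately show ?thesis by simp
qed

context stacked_graph
begin

abbreviation "ka == kap G"

lemma kap_sym: "ka s t = ka t s" and kap_less: "ka s t < 4"
 using kap_weights unfolding weights_def by blast+

lemma kap_nonneg: "ka s t >= 0"
 unfolding kap_def by simp

definition good :: "(nat => real^4) => (nat => real^4) => bool" where
 "good al v \<longleftrightarrow> shaped {..<n} Q al & mirrored ka {..<n} Q al v"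

lemma good_mirrored:
 assumes "good al v"
 shows "s < n ==> al s .* v s = 2" "nbr Q s t ==> al s .* v t <= 0" "nbr Q s t ==> al s .* v t = 0 \<longleftrightarrow> ka s t = 0"
  "nbr Q s t ==> (al s .* v t) * (al t .* v s) = ka s t"
 using assms unfolding good_def mirrored_def by blast+

definition coords :: "(nat \<times> nat) set" where
 "coords = {(s, t). s < t & nbr Q s t & ka s t ~= 0} Un (%(i, j, k, l, m). (m, m)) ` S"

lemma nbr_less: "nbr Q s t ==> s < n & t < n & s ~= t"
 using nbr_in[OF stk] by blast

lemma step_less:
 assumes "(i, j, k, l, m) : S"
 shows "i < n" "j < n" "k < n" "l < n" "m < n"
proof -
 have "{i, j, k, l, m} <= {..<n}" using stacked_steps[OF stk assms] by blast
 then show "i < n" "j < n" "k < n" "l < n" "m < n" by simp_all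
qed

lemma finite_coords: "finite coords"
proof (rule finite_subset)
 show "coords <= {..<n} \<times> {..<n}"
  unfolding coords_def using nbr_less step_less by fastforce
qed simp

lemma step_coords: "(i, j, k, l, m) : S ==> (m, m) : coords"
 unfolding coords_def by force

lemma edge_coords: "s ~= t ==> (s, t) : coords \<longleftrightarrow> s < t & nbr Q s t & ka s t ~= 0"
 unfolding coords_def by auto

lemma coords_cases:
 assumes "x : coords"
 shows "(EX s t. x = (s, t) & s < t & nbr Q s t & ka s t ~= 0) | (EX i j k l m. x = (m, m) & (i, j, k, l, m) : S)"
 using assms unfolding coords_def by auto

definition before :: "nat => nat \<times> nat \<times> nat \<times> nat" where
 "before m = (SOME p. (fst p, fst (snd p), fst (snd (snd p)), snd (snd (snd p)), m) : S)"

lemma before_eq: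
 assumes "(i, j, k, l, m) : S"
 shows "before m = (i, j, k, l)"
 unfolding before_def
proof (rule some_equality)
 fix p assume "(fst p, fst (snd p), fst (snd (snd p)), snd (snd (snd p)), m) : S"
 then show "p = (i, j, k, l)" using stacked_step_unique[OF stk assms] by (metis prod.collapse)
qed (use assms in simp)

text \<open>The product of two opposite entries is fixed at \<open>ka s t\<close>. What remains free
  is half the logarithm of their ratio, stored once at the ordered pair and negated for the other
  entry.\<close>

definition ent :: "(nat \<times> nat => real) => nat => nat => real" where
 "ent y s t = (if s = t then 2 else if ka s t = 0 then 0 else
   - sqrt (ka s t) * exp (if s < t then y (s, t) else - y (t, s)))"

lemma ent:
 assumes "s ~= t"
 shows "ent y s t <= 0" "ent y s t = 0 \<longleftrightarrow> ka s t = 0" "ent y s t * ent y t s = ka s t"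
proof -
 show "ent y s t <= 0" "ent y s t = 0 \<longleftrightarrow> ka s t = 0"
  unfolding ent_def using assms kap_nonneg[of s t] by simp_all
 have e: "exp x * exp (- x) = 1" "exp (- x) * exp x = 1" for x :: real by (simp_all add: exp_add[symmetric])
 have k: "sqrt (ka s t) * sqrt (ka s t) = ka s t" using kap_nonneg[of s t] by simp
 have "sqrt (ka s t) * A * (sqrt (ka s t) * B) = sqrt (ka s t) * sqrt (ka s t) * (A * B)" for A B by simp
 then have pe: "sqrt (ka s t) * exp x * (sqrt (ka s t) * exp (- x)) = ka s t"
  "sqrt (ka s t) * exp (- x) * (sqrt (ka s t) * exp x) = ka s t" for x by (simp_all only: k e mult_1_right)
 show "ent y s t * ent y t s = ka s t"
  unfolding ent_def kap_sym[of t s] using assms by (auto simp: pe)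
qed

lemma continuous_on_ent: "continuous_on X (%y. ent y s t)"
 unfolding ent_def
 by (cases "s = t"; cases "ka s t = 0"; cases "s < t"; simp; intro continuous_intros continuous_on_coord)

text \<open>By \<open>det_rows4_relation\<close> the diagonal value is \<open>ln Z\<close> for the
  truncation by that face; off the diagonal the value inverts \<open>ent\<close>.\<close>

definition logdata :: "(nat => real^4) => (nat => real^4) => nat \<times> nat => real" where
 "logdata al v x = (if x ~: coords then 0 else if fst x = snd x
   then (case before (fst x) of (i, j, k, l) =>
    ln (- det (rows4 (al i) (al j) (al k) (al (fst x))) / det (rows4 (al i) (al j) (al k) (al l))))
   else ln ((al (fst x) .* v (snd x)) / (al (snd x) .* v (fst x))) / 2)"

lemma logdata_supported: "logdata al v : supported coords"
 unfolding supported_def logdata_def by simp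

lemma good_frame: "good al v ==> (i, j, k, l, m) : S ==> det (rows4 (al i) (al j) (al k) (al l)) ~= 0"
proof (rule rows4_det)
 fix x assume g: "good al v" "(i, j, k, l, m) : S" and x: "al i .* x = 0" "al j .* x = 0" "al k .* x = 0" "al l .* x = 0"
 have "frame al {i, j, k, l}" using steps_frame[OF stk _ g(2)] g(1) unfolding good_def by blast
 then show "x = 0" by (rule frameD) (use x in simp)
qed

lemma logdata_step:
 assumes g: "good al v" and S: "(i, j, k, l, m) : S"
  and am: "al m = comb al e1 e2 e3 i j k - Z *\<^sub>R al l"
 shows "logdata al v (m, m) = ln Z"
 unfolding logdata_def using step_coords[OF S] good_frame[OF g S]
 by (simp add: before_eq[OF S] am det_rows4_relation)

lemma good_step:
 assumes g: "good al v" and S: "(i, j, k, l, m) : S"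
 shows "EX e1 e2 e3. e1 > 0 & e2 > 0 & e3 > 0 &
  al m = comb al e1 e2 e3 i j k - exp (logdata al v (m, m)) *\<^sub>R al l"
proof -
 obtain Z e1 e2 e3 where e: "Z > 0" "e1 > 0" "e2 > 0" "e3 > 0"
  "al m = comb al e1 e2 e3 i j k - Z *\<^sub>R al l"
  using steps_relation[OF stk _ S, of al] g unfolding good_def by blast
 have "exp (logdata al v (m, m)) = Z" unfolding logdata_step[OF g S e(5)] using e(1) by simp
 then show ?thesis using e by blast
qed

lemma logdata_edge: "(s, t) : coords ==> s ~= t ==> logdata al v (s, t) = ln ((al s .* v t) / (al t .* v s)) / 2"
 unfolding logdata_def by simp

lemma good_ent:
 assumes g: "good al v" and st: "nbr Q s t"
 shows "al s .* v t = ent (logdata al v) s t"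
proof (cases "ka s t = 0")
 case True
 then show ?thesis using good_mirrored(3)[OF g st] nbr_less[OF st] unfolding ent_def by simp
next
 case False
 have ts: "nbr Q t s" by (rule nbr_sym[OF st])
 have neg: "al s .* v t < 0" "al t .* v s < 0"
  using good_mirrored(2,3)[OF g st] good_mirrored(2,3)[OF g ts] False kap_sym[of s t] by linarith+
 have k: "ka s t = (al s .* v t) * (al t .* v s)" using good_mirrored(4)[OF g st] by simp
 show ?thesis
 proof (cases "s < t")
  case True
  then have "(s, t) : coords" using edge_coords[of s t] st False by simp
  then have c: "logdata al v (s, t) = ln ((al s .* v t) / (al t .* v s)) / 2" using logdata_edge True by simp
  have "ent (logdata al v) s t = - sqrt (ka s t) * exp (logdata al v (s, t))"
   unfolding ent_def using True False by simp
  then show ?thesis unfolding c k using neg_sqrt_exp[OF neg] by simp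
 next
  case ge: False
  then have lt: "t < s" "s ~= t" using nbr_less[OF st] by auto
  then have "(t, s) : coords" using edge_coords[of t s] ts False kap_sym by metis
  then have c: "logdata al v (t, s) = ln ((al t .* v s) / (al s .* v t)) / 2" using logdata_edge lt by simp
  have "(al s .* v t) / (al t .* v s) > 0" using neg by (simp add: divide_neg_neg)
  then have "ln (inverse ((al s .* v t) / (al t .* v s))) = - ln ((al s .* v t) / (al t .* v s))" using ln_inverse by blast
  then have c': "- logdata al v (t, s) = ln ((al s .* v t) / (al t .* v s)) / 2" unfolding c inverse_divide by simp
  have "ent (logdata al v) s t = - sqrt (ka s t) * exp (- logdata al v (t, s))"
   unfolding ent_def using lt ge False by simp
  then show ?thesis unfolding c' k using neg_sqrt_exp[OF neg] by simp
 qed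
qed

lemma step_nbr:
 assumes "(i, j, k, l, m) : S"
 shows "s : {i, j, k, l, m} ==> t : {i, j, k} ==> s ~= t ==> nbr Q s t" "distinct [i, j, k, l, m]"
 using stacked_steps[OF stk assms] by blast+

lemma good_det3:
 assumes g: "good al v" and S: "(i, j, k, l, m) : S"
 shows "det3 al v i j k = md3 (ent (logdata al v)) i j k"
proof -
 have n: "i ~= j" "i ~= k" "j ~= k" using step_nbr(2)[OF S] by auto
 have "al s .* v t = ent (logdata al v) s t" if "s : {i, j, k}" "t : {i, j, k}" "s ~= t" for s t
  by (rule good_ent[OF g], rule step_nbr(1)[OF S]) (use that in blast)+
 then show ?thesis unfolding det3_md3 md3_def using n by auto
qed

subsection \<open>Gauge and linear transformations\<close>

text \<open>The effect of multiplying \<open>al s\<close> by \<open>exp (h s)\<close> and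
  \<open>v s\<close> by \<open>exp (- h s)\<close>. The nested projection of \<open>before\<close>
  is the face \<open>l\<close>, since rescaling multiplies \<open>Z\<close> by
  \<open>exp (h m - h l)\<close>.\<close>

definition shift :: "(nat => real) => nat \<times> nat => real" where
 "shift h x = (if x ~: coords then 0 else if fst x = snd x
   then h (fst x) - h (snd (snd (snd (before (fst x))))) else h (fst x) - h (snd x))"

lemma logdata_eqI:
 assumes "!!s t. s < t ==> nbr Q s t ==> ka s t ~= 0 ==> logdata al v (s, t) = y (s, t)"
  and "!!i j k l m. (i, j, k, l, m) : S ==> logdata al v (m, m) = y (m, m)" and "y : supported coords"
 shows "logdata al v = y"
proof
 fix x
 show "logdata al v x = y x"
 proof (cases "x : coords")
  case True
  then show ?thesis using coords_cases[OF True] assms(1,2) by blast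
 next
  case False
  then show ?thesis using logdata_supported[of al v] assms(3) unfolding supported_def by (cases x) simp
 qed
qed

lemma logdata_gauge:
 fixes h :: "nat => real"
 assumes g: "good al v"
 defines "al' == %s. exp (h s) *\<^sub>R al s" and "v' == %s. exp (- h s) *\<^sub>R v s"
 shows "good al' v'" "logdata al' v' = (%x. logdata al v x + shift h x)"
proof -
 have pr: "al' s .* v' t = exp (h s - h t) * (al s .* v t)" for s t
  unfolding al'_def v'_def by (simp add: exp_diff exp_minus divide_inverse)
 have ee: "exp (h s - h t) * A * (exp (h t - h s) * B) = A * B" for s t A B
 proof -
  have "exp (h s - h t) * exp (h t - h s) = 1" by (simp add: exp_add[symmetric])
  then show ?thesis by algebra
 qed
 show g': "good al' v'"
  unfolding good_def
 proof
  have "vertex_at {..<n} al' T q" if "vertex_at {..<n} al T q" for T q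
   using that unfolding vertex_at_def al'_def by (simp add: mult_pos_neg)
  then show "shaped {..<n} Q al'" using g unfolding good_def shaped_def by blast
  show "mirrored ka {..<n} Q al' v'"
   unfolding mirrored_def pr ee using good_mirrored[OF g] by (simp add: mult_nonneg_nonpos)
 qed
 show "logdata al' v' = (%x. logdata al v x + shift h x)"
 proof (rule logdata_eqI)
  fix s t assume st: "s < t" "nbr Q s t" "ka s t ~= 0"
  then have c: "(s, t) : coords" "s ~= t" using edge_coords by auto
  have ts: "nbr Q t s" by (rule nbr_sym[OF st(2)])
  have neg: "al s .* v t < 0" "al t .* v s < 0"
   using good_mirrored(2,3)[OF g st(2)] good_mirrored(2,3)[OF g ts] st(3) kap_sym[of s t] by linarith+
  have r: "(al s .* v t) / (al t .* v s) > 0" using neg by (simp add: divide_neg_neg)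
  have "exp (h s - h t) = exp (2 * (h s - h t)) * exp (h t - h s)" by (simp add: exp_add[symmetric])
  then have "(al' s .* v' t) / (al' t .* v' s) = exp (2 * (h s - h t)) * ((al s .* v t) / (al t .* v s))"
   unfolding pr by simp
  then have "ln ((al' s .* v' t) / (al' t .* v' s)) = 2 * (h s - h t) + ln ((al s .* v t) / (al t .* v s))"
   using r by (simp only: ln_mult_pos exp_gt_zero ln_exp)
  then show "logdata al' v' (s, t) = logdata al v (s, t) + shift h (s, t)"
   unfolding logdata_edge[OF c] shift_def using c by simp
 next
  fix i j k l m assume S: "(i, j, k, l, m) : S"
  obtain e1 e2 e3 where e: "al m = comb al e1 e2 e3 i j k - exp (logdata al v (m, m)) *\<^sub>R al l"
   using good_step[OF g S] by blast
  have ex: "exp (h m) * c = exp (h m - h s) * c * exp (h s)" for c s by (simp add: exp_diff)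
  have "al' m = (exp (h m - h i) * e1) *\<^sub>R al' i + (exp (h m - h j) * e2) *\<^sub>R al' j + (exp (h m - h k) * e3) *\<^sub>R al' k
    - exp (logdata al v (m, m) + (h m - h l)) *\<^sub>R al' l"
   unfolding al'_def by (subst e) (simp add: scaleR_add_right scaleR_diff_right exp_add exp_diff)
  then have "logdata al' v' (m, m) = ln (exp (logdata al v (m, m) + (h m - h l)))"
   by (rule logdata_step[OF g' S])
  then show "logdata al' v' (m, m) = logdata al v (m, m) + shift h (m, m)"
   unfolding shift_def using step_coords[OF S] before_eq[OF S] by simp
 next
  show "(%x. logdata al v x + shift h x) : supported coords"
   using logdata_supported[of al v] unfolding supported_def shift_def by simp
 qed
qed

text \<open>All invertible matrices are allowed, because positive scalars act trivially on rays.
  \<open>orbit_config\<close> shows that the orbits are those of matrices of determinant 1 or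
  -1.\<close>

definition linked :: "(nat => real^4) => (nat => real^4) => (nat => real^4) => (nat => real^4) => bool" where
 "linked al v al' v' \<longleftrightarrow> (EX g :: real^4^4. invertible g & (ALL s<n. (ALL x. al' s .* (g *v x) = al s .* x) & v' s = g *v v s))"

lemma linked_cong:
 assumes "!!s. s < n ==> al' s = al s & v' s = v s"
 shows "linked al v al' v'"
proof -
 have "invertible (mat 1 :: real^4^4)" by (simp add: invertible_det_nz)
 then show ?thesis unfolding linked_def using assms by (intro exI[of _ "mat 1"]) simp
qed

lemma linked_sym:
 assumes "linked al v al' v'"
 shows "linked al' v' al v"
proof -
 obtain g :: "real^4^4" where g: "invertible g" "ALL s<n. (ALL x. al' s .* (g *v x) = al s .* x) & v' s = g *v v s"
  using assms unfolding linked_def by blast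
 have i: "g *v (matrix_inv g *v x) = x" "matrix_inv g *v (g *v x) = x" for x
  by (simp_all add: matrix_vector_mul_assoc matrix_inv_props[OF g(1)])
 have "invertible (matrix_inv g)" unfolding invertible_def using matrix_inv_props[OF g(1)] by blast
 moreover have "al s .* (matrix_inv g *v x) = al' s .* x" "v s = matrix_inv g *v v' s" if "s < n" for s x
  using g(2) that i by metis+
 ultimately show ?thesis unfolding linked_def by blast
qed

lemma linked_trans:
 assumes "linked al v al' v'" "linked al' v' al'' v''"
 shows "linked al v al'' v''"
proof -
 obtain g :: "real^4^4" where g: "invertible g" "ALL s<n. (ALL x. al' s .* (g *v x) = al s .* x) & v' s = g *v v s"
  using assms(1) unfolding linked_def by blast
 obtain g' :: "real^4^4" where g': "invertible g'" "ALL s<n. (ALL x. al'' s .* (g' *v x) = al' s .* x) & v'' s = g' *v v' s"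
  using assms(2) unfolding linked_def by blast
 have "invertible (g' ** g)" using g'(1) g(1) by (rule invertible_mult)
 then show ?thesis unfolding linked_def using g(2) g'(2)
  by (intro exI[of _ "g' ** g"]) (simp add: matrix_vector_mul_assoc[symmetric])
qed

lemma linked_pairing: "linked al v al' v' ==> s < n ==> t < n ==> al' s .* v' t = al s .* v t"
 unfolding linked_def by fastforce

lemma linked_good:
 assumes g: "good al v" and l: "linked al v al' v'"
 shows "good al' v'" "logdata al' v' = logdata al v"
proof -
 obtain f :: "real^4^4" where f: "invertible f" "!!s x. s < n ==> al' s .* (f *v x) = al s .* x" "!!s. s < n ==> v' s = f *v v s"
  using l unfolding linked_def by blast
 have "vertex_at {..<n} al' T (f *v q)" if "vertex_at {..<n} al T q" "T <= {..<n}" for T q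
  using that f(2) unfolding vertex_at_def by (auto simp: subset_iff)
 moreover have "T <= {..<n}" if "T : fst ` Q" for T using stacked_tri_card[OF stk that] by blast
 ultimately have sh: "shaped {..<n} Q al'" using g unfolding good_def shaped_def by metis
 have p: "al' s .* v' t = al s .* v t" if "s < n" "t < n" for s t by (rule linked_pairing[OF l that])
 have "mirrored ka {..<n} Q al' v'"
  unfolding mirrored_def using good_mirrored[OF g] p nbr_less nbr_sym by simp
 then show g': "good al' v'" using sh unfolding good_def by blast
 show "logdata al' v' = logdata al v"
 proof (rule logdata_eqI)
  fix s t assume "s < t" "nbr Q s t" "ka s t ~= 0"
  then have "(s, t) : coords" "s ~= t" "s < n" "t < n" using edge_coords nbr_less by auto
  then show "logdata al' v' (s, t) = logdata al v (s, t)" by (simp add: logdata_edge p)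
 next
  fix i j k l m assume S: "(i, j, k, l, m) : S"
  obtain e1 e2 e3 where e: "al m = comb al e1 e2 e3 i j k - exp (logdata al v (m, m)) *\<^sub>R al l"
   using good_step[OF g S] by blast
  have "al' m .* x = (comb al' e1 e2 e3 i j k - exp (logdata al v (m, m)) *\<^sub>R al' l) .* x" for x
  proof -
   have x: "x = f *v (matrix_inv f *v x)" by (simp add: matrix_vector_mul_assoc matrix_inv_props[OF f(1)])
   show ?thesis
    by (subst (1 2) x) (simp add: f(2) step_less[OF S] inner_add_left inner_diff_left, simp add: e inner_add_left inner_diff_left)
  qed
  then have "al' m = comb al' e1 e2 e3 i j k - exp (logdata al v (m, m)) *\<^sub>R al' l"
   using vector_eq_rdot by blast
  then show "logdata al' v' (m, m) = logdata al v (m, m)" using logdata_step[OF g' S] by simp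
 qed (rule logdata_supported)
qed

lemma good_related:
 assumes g: "good al v" and D: "ALL (i, j, k, l, m) : S. md3 (ent (logdata al v)) i j k ~= 0"
 shows "related S al (step_scale (%m. exp (logdata al v (m, m)))) (step_coef (ent (logdata al v)) (%m. exp (logdata al v (m, m))))"
 unfolding related_def
proof (intro allI impI)
 fix i j k l m assume S: "(i, j, k, l, m) : S"
 obtain e1 e2 e3 where e: "al m = comb al e1 e2 e3 i j k - exp (logdata al v (m, m)) *\<^sub>R al l"
  using good_step[OF g S] by blast
 have d3: "det3 al v i j k ~= 0" using D S good_det3[OF g S] by auto
 have two: "al i .* v i = 2" "al j .* v j = 2" "al k .* v k = 2" using good_mirrored(1)[OF g] step_less[OF S] by blast+
 have M: "ALL s:{i, j, k, l, m}. ALL t:{i, j, k}. s ~= t --> ent (logdata al v) s t = al s .* v t"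
  using good_ent[OF g] step_nbr(1)[OF S] by metis
 have "step_coef (ent (logdata al v)) (%m. exp (logdata al v (m, m))) (i, j, k, l, m) = (e1, e2, e3)"
  by (rule relation_step_coef[where z = "%m. exp (logdata al v (m, m))", OF d3 two e M step_nbr(2)[OF S]])
 then show "step_scale (%m. exp (logdata al v (m, m))) (i, j, k, l, m) ~= 0 & al m =
    fst (step_coef (ent (logdata al v)) (%m. exp (logdata al v (m, m))) (i, j, k, l, m)) *\<^sub>R al i +
    fst (snd (step_coef (ent (logdata al v)) (%m. exp (logdata al v (m, m))) (i, j, k, l, m))) *\<^sub>R al j +
    snd (snd (step_coef (ent (logdata al v)) (%m. exp (logdata al v (m, m))) (i, j, k, l, m))) *\<^sub>R al k -
    step_scale (%m. exp (logdata al v (m, m))) (i, j, k, l, m) *\<^sub>R al l"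
  unfolding step_scale_def using e by simp
qed

lemma good_base_frame: "good al v ==> frame al {a, b, c, d}"
proof -
 have "shaped F Q al ==> frame al {a, b, c, d}" if "stacked a b c d F Q S" for F Q S
  using that
 proof (induction rule: stacked.induct)
  case base
  then show ?case unfolding frame_def using shaped_base_frame by blast
 next
  case (step F Q S i j k l m)
  then show ?case using shaped_truncation by blast
 qed
 then show "good al v ==> frame al {a, b, c, d}" using stk unfolding good_def by blast
qed

lemma linkedI:
 assumes "related S al Z e" "related S al' Z e" "good al v" "good al' v'"
  and "ALL s t. nbr Q s t --> al s .* v t = al' s .* v' t"
 shows "linked al v al' v'"
proof -
 have "ALL s:{..<n}. al s .* v s = 2 & al' s .* v' s = 2" using good_mirrored(1) assms(3,4) by simp
 from configuration_unique[OF stk assms(1,2) good_base_frame[OF assms(3)] good_base_frame[OF assms(4)] this assms(5)]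
 show ?thesis unfolding linked_def Ball_def lessThan_iff .
qed

lemma logdata_linked:
 assumes g: "good al v" "good al' v'" and L: "logdata al v = logdata al' v'"
  and D: "ALL (i, j, k, l, m) : S. md3 (ent (logdata al v)) i j k ~= 0"
 shows "linked al v al' v'"
 by (rule linkedI[OF good_related[OF g(1) D] _ g]) (use good_related[OF g(2)] D L good_ent[OF g(1)] good_ent[OF g(2)] in simp_all)

lemma ray_image_linear:
 assumes "linear f"
 shows "f ` ray x = ray (f x)"
 unfolding ray_def using linear_scale[OF assms] by (force simp: image_iff)

lemma act_config:
 assumes "invertible g" and "ALL s<n. (ALL x. al' s .* (g *v x) = al s .* x) & v' s = g *v v s"
 shows "act n g (config_of n al v) = config_of n al' v'"
proof
 fix s
 show "act n g (config_of n al v) s = config_of n al' v' s"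
 proof (cases "s < n")
  case True
  have "linear (%a. a v* matrix_inv g)" "linear ((*v) g)"
   by (simp_all add: linear_iff vector_matrix_left_distrib scaleR_vector_matrix_assoc
    matrix_vector_right_distrib matrix_vector_mult_scaleR)
  note im = ray_image_linear[OF this(1)] ray_image_linear[OF this(2)]
  have "(al s v* matrix_inv g) .* x = al' s .* x" for x
  proof -
   have "al' s .* x = al' s .* (g *v (matrix_inv g *v x))"
    by (simp add: matrix_vector_mul_assoc matrix_inv_props[OF assms(1)])
   also have "\<dots> = al s .* (matrix_inv g *v x)" using assms(2) True by blast
   finally show ?thesis by (simp add: dot_lmul_matrix)
  qed
  then have "al s v* matrix_inv g = al' s" using vector_eq_rdot by blast
  then show ?thesis using True assms(2) unfolding act_def config_of_def by (simp add: im)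
 qed (simp add: act_def config_of_def)
qed

lemma orbit_config: "orbit n (config_of n al v) = {config_of n al' v' | al' v'. linked al v al' v'}"
proof (intro equalityI subsetI)
 fix z assume "z : orbit n (config_of n al v)"
 then obtain g :: "real^4^4" where g: "z = act n g (config_of n al v)" "det g = 1 | det g = - 1" unfolding orbit_def by blast
 have inv: "invertible g" unfolding invertible_det_nz using g(2) by auto
 have l: "ALL s<n. (ALL x. (al s v* matrix_inv g) .* (g *v x) = al s .* x) & g *v v s = g *v v s"
  by (simp add: dot_lmul_matrix matrix_vector_mul_assoc matrix_inv_props[OF inv])
 then have "z = config_of n (%s. al s v* matrix_inv g) (%s. g *v v s)"
  unfolding g(1) using act_config[OF inv, of "%s. al s v* matrix_inv g" al "%s. g *v v s" v] by blast
 moreover have "linked al v (%s. al s v* matrix_inv g) (%s. g *v v s)" unfolding linked_def using inv l by blast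
 ultimately show "z : {config_of n al' v' | al' v'. linked al v al' v'}" by blast
next
 fix z assume "z : {config_of n al' v' | al' v'. linked al v al' v'}"
 then obtain al' v' and g :: "real^4^4" where z: "z = config_of n al' v'" and g: "invertible g"
  "ALL s<n. (ALL x. al' s .* (g *v x) = al s .* x) & v' s = g *v v s" unfolding linked_def by blast
 \<comment> \<open>Scaling \<open>g\<close> by \<open>r\<close> multiplies its determinant by
   \<open>r ^ 4\<close> and leaves all rays unchanged.\<close>
 define r where "r = root 4 (1 / \<bar>det g\<bar>)"
 have dg: "det g ~= 0" using g(1) invertible_det_nz by blast
 then have r: "r > 0" "r ^ 4 = 1 / \<bar>det g\<bar>" unfolding r_def by simp_all
 define g' where "g' = r *\<^sub>R g"
 have "det g' = r ^ 4 * det g"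
 proof -
  have "g' = matrix (%x. r *\<^sub>R x) ** g"
   unfolding g'_def by (simp add: matrix_eq matrix_vector_mul_assoc[symmetric] scaleR_matrix_vector_assoc[symmetric] matrix_works linear_scaleR)
  moreover have "det (matrix (%x::real^4. r *\<^sub>R x)) = r ^ 4"
   using det_matrix_scaleR[of r, where 'n = 4] by simp
  ultimately show ?thesis by (simp add: det_mul)
 qed
 then have d: "det g' = 1 | det g' = - 1" using r(2) dg by (simp add: abs_if)
 then have i: "invertible g'" unfolding invertible_det_nz by auto
 have "act n g' (config_of n al v) = config_of n (%s. (1 / r) *\<^sub>R al' s) (%s. r *\<^sub>R v' s)"
  by (rule act_config[OF i]) (use g(2) r(1) in \<open>simp add: g'_def scaleR_matrix_vector_assoc[symmetric]\<close>)
 also have "\<dots> = z"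
 proof -
  have "ray ((1 / r) *\<^sub>R x) = ray x" "ray (r *\<^sub>R x) = ray x" for x
   using r(1) ray_eq_iff[of x "(1 / r) *\<^sub>R x"] ray_eq_iff[of x "r *\<^sub>R x"] by (metis zero_less_divide_1_iff)+
  then show ?thesis unfolding z config_of_def by simp
 qed
 finally show "z : orbit n (config_of n al v)" unfolding orbit_def using d by blast
qed

text \<open>The rays leave two positive factors open at each face, one for the form and one for the
  pole. The normalization \<open>al s .* v s = 2\<close> makes them inverse to each other.\<close>

lemma config_gauge:
 assumes g: "good al v" "good al' v'" and eq: "config_of n al v = config_of n al' v'"
 shows "EX h. linked (grown h al) (shrunk h v) al' v'"
proof -
 have "EX h. al' s = exp h *\<^sub>R al s & v' s = exp (- h) *\<^sub>R v s" if s: "s < n" for s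
 proof -
  have "ray (al s) = ray (al' s)" "ray (v s) = ray (v' s)"
   using fun_cong[OF eq, of s] s unfolding config_of_def by auto
  then obtain x y where xy: "x > 0" "al' s = x *\<^sub>R al s" "y > 0" "v' s = y *\<^sub>R v s" unfolding ray_eq_iff by blast
  have "x * y * 2 = 2" using good_mirrored(1)[OF g(1) s] good_mirrored(1)[OF g(2) s] unfolding xy by (simp add: mult.commute)
  then have "y = exp (- ln x)" using xy(1) by (simp add: exp_minus field_simps)
  then show ?thesis using xy by (intro exI[of _ "ln x"]) simp
 qed
 then obtain h where "ALL s<n. al' s = exp (h s) *\<^sub>R al s & v' s = exp (- h s) *\<^sub>R v s" by metis
 then show ?thesis by (intro exI[of _ h] linked_cong) auto
qed

lemma Y_good: "Y_set G = {config_of n al v | al v. good al v}"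
 unfolding Y_set_eq good_def ..

lemma config_gauge_eq: "config_of n (grown h al) (shrunk h v) = config_of n al v"
proof -
 have "ray (exp x *\<^sub>R y) = ray y" for x y using ray_eq_iff[of y "exp x *\<^sub>R y"] by (metis exp_gt_zero)
 then show ?thesis unfolding config_of_def by simp
qed

lemma orbit_eq_iff:
 assumes g: "good al v" "good al' v'"
 shows "orbit n (config_of n al v) = orbit n (config_of n al' v') \<longleftrightarrow>
  (EX h. linked (grown h al) (shrunk h v) al' v')"
proof
 assume eq: "orbit n (config_of n al v) = orbit n (config_of n al' v')"
 have "config_of n al' v' : orbit n (config_of n al v)"
 proof -
  have l: "linked al' v' al' v'" by (rule linked_cong) simp
  show ?thesis
   by (subst eq, unfold orbit_config mem_Collect_eq, rule exI[of _ al'], rule exI[of _ v'], rule conjI[OF refl l])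
 qed
 then obtain be u where b: "config_of n al' v' = config_of n be u" "linked al v be u" unfolding orbit_config by blast
 obtain h where h: "linked (%s. exp (h s) *\<^sub>R be s) (%s. exp (- h s) *\<^sub>R u s) al' v'"
  using config_gauge[OF linked_good(1)[OF g(1) b(2)] g(2) b(1)[symmetric]] by blast
 have "linked (grown h al) (shrunk h v) (%s. exp (h s) *\<^sub>R be s) (%s. exp (- h s) *\<^sub>R u s)"
  using b(2) unfolding linked_def by (simp add: matrix_vector_mult_scaleR)
 then show "EX h. linked (grown h al) (shrunk h v) al' v'" using h linked_trans by blast
next
 assume "EX h. linked (grown h al) (shrunk h v) al' v'"
 then obtain h where h: "linked (grown h al) (shrunk h v) al' v'" by blast
 show "orbit n (config_of n al v) = orbit n (config_of n al' v')"
  unfolding config_gauge_eq[of h al v, symmetric] orbit_config using h linked_sym linked_trans by blast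
qed

end

subsection \<open>Slices\<close>

text \<open>A continuous complete invariant with a continuous section identifies the quotient; the
  section shows that the induced bijection has a continuous inverse.\<close>

lemma slice_homeomorphic:
 assumes q: "quotient_map Y X q" and f: "continuous_map Y Z f"
  and eq: "!!y y'. y : topspace Y ==> y' : topspace Y ==> q y = q y' \<longleftrightarrow> f y = f y'"
  and s: "continuous_map Z Y si" and fs: "!!z. z : topspace Z ==> f (si z) = z"
 shows "X homeomorphic_space Z"
proof -
 obtain g where g: "continuous_map X Z g" "!!y. y : topspace Y ==> g (q y) = f y"
  using quotient_map_lift_exists[OF q f] eq by metis
 have sY: "si z : topspace Y" if "z : topspace Z" for z
  using s that unfolding continuous_map_def by blast
 have fZ: "f y : topspace Z" if "y : topspace Y" for y
  using f that unfolding continuous_map_def by blast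
 have "homeomorphic_maps X Z g (q \<circ> si)"
  unfolding homeomorphic_maps_def
 proof (intro conjI ballI)
  show "continuous_map Z X (q \<circ> si)"
   by (rule continuous_map_compose[OF s quotient_imp_continuous_map[OF q]])
  show "g ((q \<circ> si) z) = z" if "z : topspace Z" for z using g(2)[OF sY[OF that]] fs[OF that] by simp
  fix x assume "x : topspace X"
  then obtain y where y: "y : topspace Y" "x = q y" using quotient_imp_surjective_map[OF q] by blast
  have "f (si (f y)) = f y" by (rule fs[OF fZ[OF y(1)]])
  then have "q (si (f y)) = q y" using eq[OF sY[OF fZ[OF y(1)]] y(1)] by blast
  then show "(q \<circ> si) (g x) = x" using g(2)[OF y(1)] y(2) by simp
 qed (rule g)
 then show ?thesis unfolding homeomorphic_space_def by blast
qed

text \<open>The unit vector is a continuous choice of a representative for each ray, so functions of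
  vectors can be evaluated continuously on configurations.\<close>

definition unit_of :: "(real^4) set => real^4" where
 "unit_of R = (SOME x. x : R & norm x = 1)"

lemma unit_of_ray:
 assumes "x ~= 0"
 shows "unit_of (ray x) = (1 / norm x) *\<^sub>R x"
 unfolding unit_of_def
proof (rule some_equality)
 show "(1 / norm x) *\<^sub>R x : ray x & norm ((1 / norm x) *\<^sub>R x) = 1"
  unfolding ray_def using assms by (auto intro!: exI[of _ "1 / norm x"])
 fix y assume "y : ray x & norm y = 1"
 then obtain r where r: "r > 0" "y = r *\<^sub>R x" "norm y = 1" unfolding ray_def by blast
 then have "r * norm x = 1" by simp
 then have "r = 1 / norm x" using assms by (simp add: field_simps)
 then show "y = (1 / norm x) *\<^sub>R x" using r(2) by simp
qed

lemma quotient_map_ray: "quotient_map (top_of_set (UNIV - {0})) proj_space ray"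
 unfolding proj_space_def by (rule quotient_map_quot_topology)

lemma continuous_map_unit_of: "continuous_map proj_space euclidean unit_of"
proof (rule continuous_compose_quotient_map[OF quotient_map_ray])
 have "continuous_on (UNIV - {0}) (%x :: real^4. (1 / norm x) *\<^sub>R x)" by (intro continuous_intros) auto
 then have "continuous_on (UNIV - {0}) (unit_of \<circ> ray)"
  by (rule continuous_on_eq) (simp add: unit_of_ray)
 then show "continuous_map (top_of_set (UNIV - {0})) euclidean (unit_of \<circ> ray)" by simp
qed

section \<open>Continuous representatives of configurations by vectors\<close>

context stacked_graph
begin

definition unit_rep :: "config => nat \<times> bool => real^4" where
 "unit_rep y p = (if fst p < n then unit_of (if snd p then fst (y (fst p)) else snd (y (fst p))) else 0)"

lemma continuous_map_unit_rep: "continuous_map (Y_space G) euclidean unit_rep"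
 unfolding euclidean_product_topology[symmetric] continuous_map_componentwise_UNIV
proof
 fix p :: "nat \<times> bool"
 show "continuous_map (Y_space G) euclidean (%y. unit_rep y p)"
 proof (cases "fst p < n")
  case True
  have pr: "continuous_map (Y_space G) (prod_topology proj_space proj_space) (%y. y (fst p))"
   unfolding Y_space_def using True n_def
   by (intro continuous_map_from_subtopology continuous_map_product_projection) simp
  have "continuous_map (Y_space G) euclidean (unit_of \<circ> (fst \<circ> (%y. y (fst p))))"
   "continuous_map (Y_space G) euclidean (unit_of \<circ> (snd \<circ> (%y. y (fst p))))"
   by (rule continuous_map_compose[OF continuous_map_fst_of[OF pr] continuous_map_unit_of],
    rule continuous_map_compose[OF continuous_map_snd_of[OF pr] continuous_map_unit_of])
  then show ?thesis unfolding unit_rep_def using True by (cases "snd p") (simp_all add: o_def)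
 qed (simp add: unit_rep_def)
qed

definition form_rep :: "(nat \<times> bool => real^4) => nat => real^4" where
 "form_rep r s = r (s, True)"

text \<open>The factor restores the normalization 2, which unit vectors do not satisfy.\<close>

definition pole_rep :: "(nat \<times> bool => real^4) => nat => real^4" where
 "pole_rep r s = (2 / (r (s, True) .* r (s, False))) *\<^sub>R r (s, False)"

definition good_reps :: "(nat \<times> bool => real^4) set" where
 "good_reps = {r. good (form_rep r) (pole_rep r)}"

lemma good_nonzero: "good al v ==> s < n ==> al s ~= 0 & v s ~= 0"
 using good_mirrored(1)[of al v s] by auto

lemma rep_config:
 assumes g: "good al v"
 shows "EX h. linked (grown h al) (shrunk h v)
  (form_rep (unit_rep (config_of n al v))) (pole_rep (unit_rep (config_of n al v)))"
proof (intro exI[of _ "%s. - ln (norm (al s))"] linked_cong conjI)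
 fix s assume s: "s < n"
 note nz = good_nonzero[OF g s]
 have u: "unit_rep (config_of n al v) (s, True) = (1 / norm (al s)) *\<^sub>R al s"
  "unit_rep (config_of n al v) (s, False) = (1 / norm (v s)) *\<^sub>R v s"
  unfolding unit_rep_def config_of_def using s nz by (simp_all add: unit_of_ray)
 show "form_rep (unit_rep (config_of n al v)) s = exp (- ln (norm (al s))) *\<^sub>R al s"
  unfolding form_rep_def u using nz by (simp add: exp_minus divide_inverse)
 show "pole_rep (unit_rep (config_of n al v)) s = exp (- (- ln (norm (al s)))) *\<^sub>R v s"
  unfolding pole_rep_def u using nz good_mirrored(1)[OF g s] by simp
qed

lemma rep_good:
 assumes g: "good al v"
 shows "unit_rep (config_of n al v) : good_reps"
  "EX h. logdata (form_rep (unit_rep (config_of n al v))) (pole_rep (unit_rep (config_of n al v))) =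
   (%x. logdata al v x + shift h x)"
proof -
 obtain h where l: "linked (grown h al) (shrunk h v)
  (form_rep (unit_rep (config_of n al v))) (pole_rep (unit_rep (config_of n al v)))" using rep_config[OF g] ..
 note gl = linked_good[OF logdata_gauge(1)[OF g] l]
 show "unit_rep (config_of n al v) : good_reps" unfolding good_reps_def using gl(1) by simp
 show "EX h. logdata (form_rep (unit_rep (config_of n al v))) (pole_rep (unit_rep (config_of n al v))) =
   (%x. logdata al v x + shift h x)"
  unfolding gl(2) logdata_gauge(2)[OF g] by (rule exI, rule refl)
qed

lemma continuous_on_pairing:
 assumes "s < n" "t < n"
 shows "continuous_on good_reps (%r. form_rep r s .* pole_rep r t)"
proof -
 have nz: "r (t, True) .* r (t, False) ~= 0" if "r : good_reps" for r
 proof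
  assume 0: "r (t, True) .* r (t, False) = 0"
  have "form_rep r t .* pole_rep r t = 2" using that good_mirrored(1) assms(2) unfolding good_reps_def by blast
  then show False unfolding form_rep_def pole_rep_def using 0 by simp
 qed
 show ?thesis unfolding form_rep_def pole_rep_def
  by (intro continuous_intros continuous_on_coord) (use nz in blast)
qed

lemma continuous_on_logdata: "continuous_on good_reps (%r. logdata (form_rep r) (pole_rep r))"
proof (rule continuous_on_coords)
 fix x
 have gd: "good (form_rep r) (pole_rep r)" if "r : good_reps" for r using that unfolding good_reps_def by blast
 show "continuous_on good_reps (%r. logdata (form_rep r) (pole_rep r) x)"
 proof (cases "x : coords")
  case False
  then show ?thesis unfolding logdata_def by simp
 next
  case True
  from coords_cases[OF True] show ?thesis
  proof (elim disjE exE conjE)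
   fix s t assume x: "x = (s, t)" and st: "s < t" "nbr Q s t" "ka s t ~= 0"
   have n: "s < n" "t < n" using nbr_less st by blast+
   have nz: "form_rep r s .* pole_rep r t ~= 0" "form_rep r t .* pole_rep r s ~= 0" if "r : good_reps" for r
    using good_mirrored(3)[OF gd[OF that]] st nbr_sym[OF st(2)] kap_sym[of s t] by auto
   have "continuous_on good_reps (%r. ln ((form_rep r s .* pole_rep r t) / (form_rep r t .* pole_rep r s)) / 2)"
    by (intro continuous_on_divide continuous_on_ln continuous_on_pairing n continuous_on_const) (use nz in auto)
   moreover have "logdata (form_rep r) (pole_rep r) (s, t) =
     ln ((form_rep r s .* pole_rep r t) / (form_rep r t .* pole_rep r s)) / 2" for r
    by (rule logdata_edge) (use True x st(1) in auto)
   ultimately show ?thesis unfolding x by (simp only:)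
  next
   fix i j k l m assume x: "x = (m, m)" and S: "(i, j, k, l, m) : S"
   have c: "continuous_on good_reps (%r. form_rep r s)" for s unfolding form_rep_def by (rule continuous_on_coord)
   have nz: "det (rows4 (form_rep r i) (form_rep r j) (form_rep r k) (form_rep r l)) ~= 0"
    "- det (rows4 (form_rep r i) (form_rep r j) (form_rep r k) (form_rep r m)) ~= 0" if r: "r : good_reps" for r
   proof -
    show d: "det (rows4 (form_rep r i) (form_rep r j) (form_rep r k) (form_rep r l)) ~= 0"
     by (rule good_frame[OF gd[OF r] S])
    obtain e1 e2 e3 where e: "form_rep r m = e1 *\<^sub>R form_rep r i + e2 *\<^sub>R form_rep r j + e3 *\<^sub>R form_rep r k -
      exp (logdata (form_rep r) (pole_rep r) (m, m)) *\<^sub>R form_rep r l"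
     using good_step[OF gd[OF r] S] by blast
    show "- det (rows4 (form_rep r i) (form_rep r j) (form_rep r k) (form_rep r m)) ~= 0"
     unfolding e det_rows4_relation using d by simp
   qed
   have "continuous_on good_reps (%r. ln (- det (rows4 (form_rep r i) (form_rep r j) (form_rep r k) (form_rep r m)) /
     det (rows4 (form_rep r i) (form_rep r j) (form_rep r k) (form_rep r l))))"
    by (intro continuous_on_ln continuous_on_divide continuous_on_minus continuous_on_det_rows4 c) (use nz in auto)
   then show ?thesis unfolding x using before_eq[OF S] True x by (simp add: logdata_def)
  qed
 qed
qed

lemma topspace_Y: "topspace (Y_space G) = Y_set G"
proof -
 have "Y_set G <= topspace (product_topology (%s. prod_topology proj_space proj_space) {..<nfaces G})"
 proof
  fix y assume "y : Y_set G"
  then obtain al v where y: "y = config_of n al v" and g: "good al v" unfolding Y_good by blast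
  have "(ray (al s), ray (v s)) : topspace (prod_topology proj_space proj_space)" if "s < n" for s
   using good_nonzero[OF g that] unfolding proj_space_def topspace_prod_topology topspace_quot_topology by auto
  then show "y : topspace (product_topology (%s. prod_topology proj_space proj_space) {..<nfaces G})"
   unfolding y config_of_def n_def[symmetric] topspace_product_topology by auto
 qed
 then show ?thesis unfolding Y_space_def by auto
qed

lemma quotient_X: "quotient_map (Y_space G) (X_space G) (orbit n)"
 unfolding X_space_def n_def by (rule quotient_map_quot_topology)

lemma X_empty_iff: "topspace (X_space G) = {} \<longleftrightarrow> (\<nexists>al v. good al v)"
proof -
 have "topspace (X_space G) = orbit n ` Y_set G"
  using quotient_imp_surjective_map[OF quotient_X] topspace_Y by simp
 then show ?thesis unfolding Y_good by auto
qed

lemma continuous_map_config: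
 assumes c: "!!s. s < n ==> continuous_on L (%y. al y s) & continuous_on L (%y. v y s)"
  and g: "!!y. y : L ==> good (al y) (v y)"
 shows "continuous_map (top_of_set L) (Y_space G) (%y. config_of n (al y) (v y))"
 unfolding Y_space_def continuous_map_in_subtopology
proof
 show "(%y. config_of n (al y) (v y)) : topspace (top_of_set L) \<rightarrow> Y_set G"
  unfolding Y_good using g by auto
 have ray: "continuous_map (top_of_set L) proj_space (%y. ray (f y))"
  if "continuous_on L f" "!!y. y : L ==> f y ~= 0" for f
 proof -
  have "continuous_map (top_of_set L) (top_of_set (UNIV - {0})) f" using that by auto
  from continuous_map_compose[OF this quotient_imp_continuous_map[OF quotient_map_ray]]
  show ?thesis by (simp add: o_def)
 qed
 show "continuous_map (top_of_set L) (product_topology (%s. prod_topology proj_space proj_space) {..<nfaces G})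
   (%y. config_of n (al y) (v y))"
  unfolding continuous_map_componentwise n_def[symmetric]
 proof (intro conjI ballI)
  show "(%y. config_of n (al y) (v y)) ` topspace (top_of_set L) <= extensional {..<n}"
   unfolding config_of_def by auto
  fix s assume "s : {..<n}"
  then have s: "s < n" by simp
  have "continuous_map (top_of_set L) (prod_topology proj_space proj_space) (%y. (ray (al y s), ray (v y s)))"
   by (intro continuous_map_pairedI ray) (use c[OF s] good_nonzero[OF g s] in auto)
  then show "continuous_map (top_of_set L) (prod_topology proj_space proj_space) (%y. config_of n (al y) (v y) s)"
   unfolding config_of_def using s by simp
 qed
qed

subsection \<open>Moduli away from the exceptional prism\<close>

definition turn :: "(nat \<times> nat => real) => nat => nat => real" where
 "turn y s t = (if s < t then y (s, t) else - y (t, s))"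

text \<open>Half the logarithm of the ratio of the two cyclic products of Cartan entries around the
  circuit, as long as these are nonzero. It is unchanged by rescaling.\<close>

definition twist :: "nat \<times> nat \<times> nat \<times> nat \<times> nat => (nat \<times> nat => real) => real" where
 "twist = (%(i, j, k, l, m) y. turn y i j + turn y j k + turn y k i)"

text \<open>The two cyclic products have the common modulus
  \<open>sqrt (ka i j * ka j k * ka k i)\<close> up to factors that are inverse to each other, so
  the determinant depends on the coordinates only through \<open>twist\<close>.\<close>

lemma md3_ent:
 assumes "distinct [i, j, k]"
 shows "md3 (ent y) i j k = 8 - 2 * (ka i j + ka j k + ka k i) -
  sqrt (ka i j * ka j k * ka k i) * (exp (twist (i, j, k, l, m) y) + exp (- twist (i, j, k, l, m) y))"
proof -
 have ne: "i ~= j" "i ~= k" "j ~= k" using assms by auto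
 have e: "ent y s t = - sqrt (ka s t) * exp (turn y s t)" if "s ~= t" for s t
  unfolding ent_def turn_def using that by simp
 have sw: "turn y t s = - turn y s t" if "s ~= t" for s t unfolding turn_def using that by auto
 have p1: "ent y i j * ent y j k * ent y k i = - (sqrt (ka i j * ka j k * ka k i) * exp (twist (i, j, k, l, m) y))"
  unfolding twist_def prod.case e[OF ne(1)] e[OF ne(3)] e[OF ne(2)[symmetric]] exp_add real_sqrt_mult by simp
 have p2: "ent y i k * ent y k j * ent y j i = - (sqrt (ka i j * ka j k * ka k i) * exp (- twist (i, j, k, l, m) y))"
  unfolding twist_def prod.case e[OF ne(2)] e[OF ne(3)[symmetric]] e[OF ne(1)[symmetric]]
   sw[OF ne(1)] sw[OF ne(3)] sw[OF ne(2)[symmetric]] kap_sym[of j i] kap_sym[of k j] kap_sym[of i k]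
   minus_add_distrib exp_add real_sqrt_mult by simp
 show ?thesis
  unfolding md3_def p1 p2 ent(3)[OF ne(1)] ent(3)[OF ne(2)] ent(3)[OF ne(3)] kap_sym[of i k]
  by (simp add: algebra_simps)
qed

text \<open>If an entry of the circuit vanishes, the determinant is the constant
  \<open>8 - 2 * (ka i j + ka j k + ka k i)\<close>; the condition says that it is negative.\<close>

definition admissible :: bool where
 "admissible \<longleftrightarrow> (ALL (i, j, k, l, m) : S. ka i j * ka j k * ka k i = 0 --> 4 < ka i j + ka j k + ka k i)"

text \<open>The left side is \<open>2 * P * cosh x\<close>, so the threshold is an
  \<open>arcosh\<close>. Since \<open>cosh\<close> is at least 1, a bound below 1 is no condition at
  all, which the value \<open>-1\<close> for \<open>t\<close> records.\<close>

lemma cosh_threshold: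
 assumes P: "P > (0 :: real)"
 shows "EX t. ALL x. P * (exp x + exp (- x)) > H \<longleftrightarrow> \<bar>x\<bar> > t"
proof -
 have c: "P * (exp x + exp (- x)) > H \<longleftrightarrow> cosh x > H / (2 * P)" for x
 proof -
  have "P * (exp x + exp (- x)) = 2 * P * cosh x" by (simp add: cosh_def)
  then show ?thesis using P by (simp add: field_simps)
 qed
 show ?thesis
 proof (cases "H / (2 * P) < 1")
  case True
  have "cosh x > H / (2 * P)" for x using cosh_real_ge_1[of x] True by linarith
  then show ?thesis unfolding c by (intro exI[of _ "-1"]) (simp add: less_le_trans[of "-1" 0])
 next
  case False
  then have h: "H / (2 * P) >= 1" by simp
  have "cosh x > H / (2 * P) \<longleftrightarrow> \<bar>x\<bar> > arcosh (H / (2 * P))" for x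
  proof -
   have "cosh x > H / (2 * P) \<longleftrightarrow> cosh (arcosh (H / (2 * P))) < cosh \<bar>x\<bar>" using h by simp
   also have "\<dots> \<longleftrightarrow> arcosh (H / (2 * P)) < \<bar>x\<bar>" by (rule cosh_real_nonneg_less_iff) (use h in simp_all)
   finally show ?thesis .
  qed
  then show ?thesis unfolding c by blast
 qed
qed

lemma twist_linform:
 assumes S: "(i, j, k, l, m) : S" and nz: "ka i j * ka j k * ka k i ~= 0"
 shows "linform coords (twist (i, j, k, l, m))"
proof -
 have d: "i ~= j" "j ~= k" "k ~= i" using step_nbr(2)[OF S] by auto
 have nb: "nbr Q i j" "nbr Q j k" "nbr Q k i" using step_nbr(1)[OF S] d by blast+
 have ex: "EX c. ALL y. turn y s t = (SUM x:coords. c x * y x)" if st: "nbr Q s t" "ka s t ~= 0" for s t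
 proof (cases "s < t")
  case True
  then have "(s, t) : coords" using edge_coords[of s t] st by simp
  then have "turn y s t = (SUM x:coords. (if x = (s, t) then 1 else 0) * y x)" for y
   unfolding turn_def using True finite_coords by (simp add: if_distrib[of "%u. u * _"] cong: if_cong)
  then show ?thesis by (intro exI[of _ "%x. if x = (s, t) then 1 else 0"] allI)
 next
  case False
  then have "t < s" using nbr_less[OF st(1)] by simp
  then have "(t, s) : coords" using edge_coords[of t s] st nbr_sym[OF st(1)] kap_sym[of s t] by simp
  then have "turn y s t = (SUM x:coords. (if x = (t, s) then -1 else 0) * y x)" for y
   unfolding turn_def using False finite_coords by (simp add: if_distrib[of "%u. u * _"] cong: if_cong)
  then show ?thesis by (intro exI[of _ "%x. if x = (t, s) then -1 else 0"] allI)
 qed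
 have nzs: "ka i j ~= 0" "ka j k ~= 0" "ka k i ~= 0" using nz by simp_all
 obtain c1 where c1: "ALL y. turn y i j = (SUM x:coords. c1 x * y x)" using ex[OF nb(1) nzs(1)] ..
 obtain c2 where c2: "ALL y. turn y j k = (SUM x:coords. c2 x * y x)" using ex[OF nb(2) nzs(2)] ..
 obtain c3 where c3: "ALL y. turn y k i = (SUM x:coords. c3 x * y x)" using ex[OF nb(3) nzs(3)] ..
 have "twist (i, j, k, l, m) y = (SUM x:coords. (c1 x + c2 x + c3 x) * y x)" for y
  unfolding twist_def prod.case c1[rule_format] c2[rule_format] c3[rule_format]
  by (simp add: algebra_simps sum.distrib)
 then show ?thesis unfolding linform_def by (intro exI[of _ "%x. c1 x + c2 x + c3 x"] allI)
qed

definition negative_coords :: "(nat \<times> nat => real) set" where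
 "negative_coords = {y : supported coords. ALL (i, j, k, l, m) : S. md3 (ent y) i j k < 0}"

text \<open>A circuit with a right angle has a constant determinant, negative by admissibility. Only
  the remaining circuits, collected in \<open>R\<close>, contribute a slab.\<close>

lemma negative_slabs:
 assumes adm: "admissible" and J: "J <= coords"
 shows "EX R t. finite R & (ALL r:R. linform coords (twist r)) & R <= S &
  (ALL (i, j, k, l, m) : R. ka i j * ka j k * ka k i ~= 0) &
  {y : supported J. y : negative_coords} = slabs J R twist t"
proof -
 define R where "R = {r : S. case r of (i, j, k, l, m) => ka i j * ka j k * ka k i ~= 0}"
 have "EX t. ALL y. md3 (ent y) i j k < 0 \<longleftrightarrow> \<bar>twist (i, j, k, l, m) y\<bar> > t" if "(i, j, k, l, m) : R" for i j k l m
 proof -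
  have S: "(i, j, k, l, m) : S" and nz: "ka i j * ka j k * ka k i ~= 0" using that unfolding R_def by auto
  have d: "distinct [i, j, k]" using step_nbr(2)[OF S] by simp
  have "ka i j * ka j k * ka k i > 0" using nz kap_nonneg by (simp add: less_le)
  then have "sqrt (ka i j * ka j k * ka k i) > 0" by simp
  then obtain t where t: "ALL x. sqrt (ka i j * ka j k * ka k i) * (exp x + exp (- x)) > 8 - 2 * (ka i j + ka j k + ka k i) \<longleftrightarrow> \<bar>x\<bar> > t"
   using cosh_threshold by blast
  have "md3 (ent y) i j k < 0 \<longleftrightarrow> \<bar>twist (i, j, k, l, m) y\<bar> > t" for y
   unfolding md3_ent[OF d, of y l m] t[rule_format, symmetric] by (simp only: diff_less_0_iff_less)
  then show ?thesis by blast
 qed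
 then have "ALL r:R. EX t. ALL y. (case r of (i, j, k, l, m) => md3 (ent y) i j k < 0) \<longleftrightarrow> \<bar>twist r y\<bar> > t" by auto
 then obtain t where t: "ALL r:R. ALL y. (case r of (i, j, k, l, m) => md3 (ent y) i j k < 0) \<longleftrightarrow> \<bar>twist r y\<bar> > t r"
  by metis
 have z: "md3 (ent y) i j k < 0" if S: "(i, j, k, l, m) : S" and "(i, j, k, l, m) ~: R" for i j k l m y
 proof -
  have 0: "ka i j * ka j k * ka k i = 0" using that unfolding R_def by auto
  have "4 < ka i j + ka j k + ka k i" using adm S 0 unfolding admissible_def by blast
  moreover have "distinct [i, j, k]" using step_nbr(2)[OF S] by simp
  ultimately show ?thesis using md3_ent[of i j k y l m] 0 by simp
 qed
 have iff: "(ALL (i, j, k, l, m) : S. md3 (ent y) i j k < 0) \<longleftrightarrow> (ALL r:R. \<bar>twist r y\<bar> > t r)" for y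
 proof
  assume h: "ALL (i, j, k, l, m) : S. md3 (ent y) i j k < 0"
  show "ALL r:R. \<bar>twist r y\<bar> > t r"
  proof
   fix r assume r: "r : R"
   then have "r : S" unfolding R_def by blast
   then have "case r of (i, j, k, l, m) => md3 (ent y) i j k < 0" using h by blast
   then show "\<bar>twist r y\<bar> > t r" using t r by blast
  qed
 next
  assume h: "ALL r:R. \<bar>twist r y\<bar> > t r"
  show "ALL (i, j, k, l, m) : S. md3 (ent y) i j k < 0"
  proof
   fix r assume r: "r : S"
   show "case r of (i, j, k, l, m) => md3 (ent y) i j k < 0"
   proof (cases "r : R")
    case True
    then show ?thesis using t h by blast
   next
    case False
    then show ?thesis using z r by (cases r) auto
   qed
  qed
 qed
 have sub: "supported J <= supported coords" using J unfolding supported_def by blast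
 show ?thesis
 proof (intro exI[of _ R] exI[of _ t] conjI)
  show "R <= S" "ALL (i, j, k, l, m) : R. ka i j * ka j k * ka k i ~= 0" unfolding R_def by auto
  show "finite R" unfolding R_def using stacked_finite[OF stk] by simp
  show "ALL r:R. linform coords (twist r)" unfolding R_def using twist_linform by auto
  show "{y : supported J. y : negative_coords} = slabs J R twist t"
   unfolding slabs_def negative_coords_def iff using sub by blast
 qed
qed

text \<open>Provides the continuous section for \<open>slice_homeomorphic\<close>. The hypothesis
  \<open>nz\<close> is the nondegeneracy that the cap argument asks for at every truncation.\<close>

lemma reconstruct_good:
 assumes nz: "ALL (i, j, k, l, m) : S. EX s:{i, j, k}. ka l s ~= 0 | ka m s ~= 0"
 shows "EX al v. (ALL s<n. continuous_on negative_coords (%y. al y s) & continuous_on negative_coords (%y. v y s)) &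
  (ALL y:negative_coords. good (al y) (v y) & logdata (al y) (v y) = y)"
proof -
 define z where "z y m = exp (y (m, m))" for y :: "nat \<times> nat => real" and m :: nat
 have D: "ALL (i, j, k, l, m) : S. ALL y:negative_coords. md3 (ent y) i j k ~= 0"
  unfolding negative_coords_def by fastforce
 have cz: "continuous_on negative_coords (%y. z y m)" for m
  unfolding z_def by (intro continuous_intros continuous_on_coord)
 have ent2: "ent y s s = 2" for y s unfolding ent_def by simp
 have z0: "z y m ~= 0" for y m unfolding z_def by simp
 obtain al v where c: "ALL s:{..<n}. continuous_on negative_coords (%y. al y s :: real^4) & continuous_on negative_coords (%y. v y s :: real^4)"
  and h: "ALL y:negative_coords. shaped {a, b, c, d} (tetra a b c d) (al y) &
   (ALL s:{..<n}. al y s .* v y s = 2) & (ALL s t. nbr Q s t --> al y s .* v y t = ent y s t) &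
   related S (al y) (step_scale (z y)) (step_coef (ent y) (z y))"
  using reconstruction[where M = ent and z = z, OF stk continuous_on_ent ent2 cz z0 D] by blast
 have "good (al y) (v y) & logdata (al y) (v y) = y" if y: "y : negative_coords" for y
 proof -
  note hy = h[rule_format, OF y]
  have pr: "nbr Q s t ==> al y s .* v y t = ent y s t" for s t using hy by blast
  have mi: "mirrored ka {..<n} Q (al y) (v y)"
   unfolding mirrored_def
  proof (intro conjI allI impI)
   show "ALL s:{..<n}. al y s .* v y s = 2" using hy by blast
   fix s t assume st: "nbr Q s t"
   have "s ~= t" using nbr_less[OF st] by blast
   then show "al y s .* v y t <= 0" "al y s .* v y t = 0 \<longleftrightarrow> ka s t = 0" "(al y s .* v y t) * (al y t .* v y s) = ka s t"
    unfolding pr[OF st] pr[OF nbr_sym[OF st]] using ent by blast+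
  qed
  have rel: "al y m = fst (step_coef (ent y) (z y) (i, j, k, l, m)) *\<^sub>R al y i +
    fst (snd (step_coef (ent y) (z y) (i, j, k, l, m))) *\<^sub>R al y j +
    snd (snd (step_coef (ent y) (z y) (i, j, k, l, m))) *\<^sub>R al y k - z y m *\<^sub>R al y l"
   if "(i, j, k, l, m) : S" for i j k l m
  proof -
   have "related S (al y) (step_scale (z y)) (step_coef (ent y) (z y))" using hy by blast
   then show ?thesis using that unfolding related_def step_scale_def prod.case by blast
  qed
  have "shaped {..<n} Q (al y) & caps_ok {..<n} Q (al y) (v y)"
  proof (rule shaped_from_relations[OF stk kap_weights mi conjunct1[OF hy]])
   fix i j k l m assume S: "(i, j, k, l, m) : S"
   have n: "i ~= j" "i ~= k" "j ~= k" using step_nbr(2)[OF S] by auto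
   have "al y s .* v y t = ent y s t" if "s : {i, j, k}" "t : {i, j, k}" "s ~= t" for s t
    by (rule pr, rule step_nbr(1)[OF S]) (use that in blast)+
   then have "det3 (al y) (v y) i j k = md3 (ent y) i j k" unfolding det3_md3 md3_def using n by auto
   moreover have "md3 (ent y) i j k < 0" using y S unfolding negative_coords_def by blast
   moreover have "z y m > 0" unfolding z_def by simp
   ultimately show "det3 (al y) (v y) i j k < 0 &
    (EX Z e1 e2 e3. Z > 0 & al y m = e1 *\<^sub>R al y i + e2 *\<^sub>R al y j + e3 *\<^sub>R al y k - Z *\<^sub>R al y l) &
    (EX s:{i, j, k}. ka l s ~= 0 | ka m s ~= 0)"
    using rel[OF S] nz S by (intro conjI) (simp, blast, blast)
  qed
  then have g: "good (al y) (v y)" unfolding good_def using mi by blast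
  have "logdata (al y) (v y) = y"
  proof (rule logdata_eqI)
   fix s t assume st: "s < t" "nbr Q s t" "ka s t ~= 0"
   then have co: "(s, t) : coords" "s ~= t" using edge_coords[of s t] by auto
   have k: "sqrt (ka s t) > 0" using st(3) kap_nonneg[of s t] by (simp add: less_le)
   have "ent y s t = - sqrt (ka s t) * exp (y (s, t))" "ent y t s = - sqrt (ka s t) * exp (- y (s, t))"
    unfolding ent_def kap_sym[of t s] using st by simp_all
   then have "ent y s t / ent y t s = exp (y (s, t)) / exp (- y (s, t))" using k by simp
   also have "\<dots> = exp (2 * y (s, t))" by (simp add: exp_diff[symmetric])
   finally show "logdata (al y) (v y) (s, t) = y (s, t)"
    unfolding logdata_edge[OF co] pr[OF st(2)] pr[OF nbr_sym[OF st(2)]] by simp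
  next
   fix i j k l m assume S: "(i, j, k, l, m) : S"
   show "logdata (al y) (v y) (m, m) = y (m, m)"
    unfolding logdata_step[OF g S rel[OF S]] z_def by simp
  next
   show "y : supported coords" using y unfolding negative_coords_def by blast
  qed
  then show ?thesis using g by blast
 qed
 then show ?thesis using c by - (rule exI[of _ al], rule exI[of _ v], simp)
qed

end

context stacked_graph
begin

theorem regular_structure:
 assumes reg: "ALL al v. good al v --> logdata al v : negative_coords"
  and nz: "ALL (i, j, k, l, m) : S. EX s:{i, j, k}. ka l s ~= 0 | ka m s ~= 0" and adm: "admissible"
 shows "cells (X_space G)"
proof -
 \<comment> \<open>These vectors span the translations by which rescaling acts on the coordinates,
   the input for \<open>elimination\<close>.\<close>
 define w where "w s = shift (%u. if u = s then 1 else 0)" for s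
 have ws: "ALL s:{..<n}. w s : supported coords" unfolding w_def supported_def shift_def by simp
 have opp: "snd (snd (snd (before m))) < n" if "(m, m) : coords" for m
  using coords_cases[OF that] before_eq step_less(4) by (metis less_irrefl prod.inject snd_conv)
 have sumw: "(SUM s:{..<n}. h s * w s x) = shift h x" for h x
 proof (cases "x : coords")
  case False
  then show ?thesis unfolding w_def shift_def by simp
 next
  case True
  have delta: "(\<Sum>s<n. h s * (if u = s then 1 else 0)) = h u" if "u < n" for u
   using that by (simp add: if_distrib[of "%r. _ * r"] cong: if_cong)
  obtain p q where x: "x = (p, q)" by (cases x)
  show ?thesis
  proof (cases "p = q")
   case True
   have "p < n" using \<open>x : coords\<close> coords_cases[OF \<open>x : coords\<close>] step_less(5) unfolding x True by auto
   then show ?thesis unfolding w_def shift_def using \<open>x : coords\<close> opp[of p] True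
    by (simp add: x right_diff_distrib sum_subtractf delta)
  next
   case False
   then have "p < n" "q < n" using edge_coords[OF False] \<open>x : coords\<close> nbr_less unfolding x by blast+
   then show ?thesis unfolding w_def shift_def using \<open>x : coords\<close> False
    by (simp add: x right_diff_distrib sum_subtractf delta)
  qed
 qed
 obtain J cc where J: "J <= coords"
  and P1: "ALL y : supported coords. (%i. SUM j:coords. cc i j * y j) : supported J"
  and P2: "ALL y : supported coords. EX h. ALL i. (SUM j:coords. cc i j * y j) = y i + (SUM s:{..<n}. h s * w s i)"
  and P3: "ALL h i. (SUM j:coords. cc i j * (SUM s:{..<n}. h s * w s j)) = 0"
  and P4: "ALL y : supported J. ALL i. (SUM j:coords. cc i j * y j) = y i"
  using elimination[OF _ finite_coords ws] by (auto simp: finite_lessThan)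
 define P where "P y = (%i. SUM j:coords. cc i j * y j)" for y :: "nat \<times> nat => real"
 have PJ: "P y : supported J" if "y : supported coords" for y using P1 that unfolding P_def by blast
 have Psh: "EX h. P y = (%x. y x + shift h x)" if "y : supported coords" for y
  using P2 that unfolding P_def sumw by blast
 have Pgauge: "P (%x. y x + shift h x) = P y" for y h
 proof
  fix i
  have "P (%x. y x + shift h x) i = P y i + (SUM j:coords. cc i j * shift h j)"
   unfolding P_def by (simp add: distrib_left sum.distrib)
  moreover have "(SUM j:coords. cc i j * shift h j) = 0" using P3[rule_format, of i h] unfolding sumw .
  ultimately show "P (%x. y x + shift h x) i = P y i" by simp
 qed
 have PJid: "P y = y" if "y : supported J" for y using P4 that unfolding P_def by blast
 have cP: "continuous_on A P" for A
  unfolding P_def by (intro continuous_on_coords continuous_intros continuous_on_coord)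
 define L where "L = {y : supported J. y : negative_coords}"
 obtain R t where RT: "finite R" "ALL r:R. linform coords (twist r)" "L = slabs J R twist t"
  using negative_slabs[OF adm J] unfolding L_def by blast
 define f where "f y = P (logdata (form_rep (unit_rep y)) (pole_rep (unit_rep y)))" for y
 have f_config: "f (config_of n al v) = P (logdata al v)" if "good al v" for al v
  using rep_good(2)[OF that] Pgauge unfolding f_def by metis
 \<comment> \<open>The projection changes the coordinates by some \<open>shift h\<close>, so its
   value is the \<open>logdata\<close> of a rescaled configuration, and \<open>reg\<close> applies
   to that one.\<close>
 have fL: "P (logdata al v) : L" if g: "good al v" for al v
 proof -
  obtain h where "P (logdata al v) = (%x. logdata al v x + shift h x)" using Psh[OF logdata_supported] by blast
  then have "P (logdata al v) = logdata (grown h al) (shrunk h v)"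
   using logdata_gauge(2)[OF g] by simp
  then have "P (logdata al v) : negative_coords" using reg logdata_gauge(1)[OF g] by metis
  then show ?thesis unfolding L_def using PJ[OF logdata_supported] by blast
 qed
 have cf: "continuous_map (Y_space G) (top_of_set L) f"
  unfolding continuous_map_in_subtopology
 proof
  have "continuous_map (Y_space G) (top_of_set good_reps) unit_rep"
   unfolding continuous_map_in_subtopology
   using continuous_map_unit_rep rep_good(1) unfolding topspace_Y Y_good by auto
  moreover have "continuous_map (top_of_set good_reps) euclidean (P \<circ> (%r. logdata (form_rep r) (pole_rep r)))"
   using continuous_on_compose[OF continuous_on_logdata cP] by simp
  ultimately have "continuous_map (Y_space G) euclidean ((P \<circ> (%r. logdata (form_rep r) (pole_rep r))) \<circ> unit_rep)"
   by (rule continuous_map_compose)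
  then show "continuous_map (Y_space G) euclidean f" unfolding f_def by (simp add: o_def)
  show "f : topspace (Y_space G) \<rightarrow> L" unfolding topspace_Y Y_good using f_config fL by auto
 qed
 have eq: "orbit n y = orbit n y' \<longleftrightarrow> f y = f y'"
  if y: "y : topspace (Y_space G)" "y' : topspace (Y_space G)" for y y'
 proof -
  obtain al v where a: "y = config_of n al v" "good al v" using y(1) unfolding topspace_Y Y_good by blast
  obtain al' v' where a': "y' = config_of n al' v'" "good al' v'" using y(2) unfolding topspace_Y Y_good by blast
  show ?thesis
  proof
   assume "orbit n y = orbit n y'"
   then obtain h where "linked (grown h al) (shrunk h v) al' v'"
    unfolding a(1) a'(1) orbit_eq_iff[OF a(2) a'(2)] by blast
   then have "logdata al' v' = (%x. logdata al v x + shift h x)"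
    using linked_good(2)[OF logdata_gauge(1)[OF a(2)]] logdata_gauge(2)[OF a(2)] by simp
   then show "f y = f y'" unfolding a(1) a'(1) f_config[OF a(2)] f_config[OF a'(2)] by (simp add: Pgauge)
  next
   assume "f y = f y'"
   then have e: "P (logdata al v) = P (logdata al' v')" unfolding a(1) a'(1) f_config[OF a(2)] f_config[OF a'(2)] .
   obtain h1 where h1: "P (logdata al v) = (%x. logdata al v x + shift h1 x)" using Psh[OF logdata_supported] by blast
   obtain h2 where h2: "P (logdata al' v') = (%x. logdata al' v' x + shift h2 x)" using Psh[OF logdata_supported] by blast
   define h where "h s = h1 s - h2 s" for s
   have "logdata al v x + shift h x = logdata al' v' x" for x
   proof -
    have "logdata al v x + shift h1 x = logdata al' v' x + shift h2 x" using fun_cong[OF e, of x] h1 h2 by metis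
    moreover have "shift h x = shift h1 x - shift h2 x" unfolding shift_def h_def by simp
    ultimately show ?thesis by simp
   qed
   then have lg: "logdata (grown h al) (shrunk h v) = logdata al' v'"
    unfolding logdata_gauge(2)[OF a(2)] by blast
   have "logdata al' v' : negative_coords" using reg a'(2) by blast
   then have "ALL (i, j, k, l, m) : S. md3 (ent (logdata al' v')) i j k ~= 0" unfolding negative_coords_def by fastforce
   then have "linked (grown h al) (shrunk h v) al' v'"
    using logdata_linked[OF logdata_gauge(1)[OF a(2)] a'(2) lg] unfolding lg by blast
   then show "orbit n y = orbit n y'" unfolding a(1) a'(1) orbit_eq_iff[OF a(2) a'(2)] by blast
  qed
 qed
 obtain al v where rc: "ALL s<n. continuous_on negative_coords (%y. al y s) & continuous_on negative_coords (%y. v y s)"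
  and rg: "ALL y:negative_coords. good (al y) (v y) & logdata (al y) (v y) = y"
  using reconstruct_good[OF nz] by blast
 have Ln: "L <= negative_coords" unfolding L_def by blast
 have "X_space G homeomorphic_space top_of_set L"
 proof (rule slice_homeomorphic[OF quotient_X cf eq])
  show "continuous_map (top_of_set L) (Y_space G) (%y. config_of n (al y) (v y))"
   by (rule continuous_map_config) (use rc rg Ln continuous_on_subset in blast)+
  show "f (config_of n (al y) (v y)) = y" if "y : topspace (top_of_set L)" for y
   using that rg Ln f_config PJid unfolding L_def by auto
 qed
 moreover have "finite J" using J finite_coords finite_subset by blast
 ultimately show ?thesis using slabs_structure[where f = twist and I = coords] RT by blast
qed

lemma regular_nonempty:
 assumes nz: "ALL (i, j, k, l, m) : S. EX s:{i, j, k}. ka l s ~= 0 | ka m s ~= 0" and adm: "admissible"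
 shows "EX al v. good al v"
proof -
 obtain R t where RT: "finite R" "ALL r:R. linform coords (twist r)"
  "{y : supported coords. y : negative_coords} = slabs coords R twist t" "R <= S" 
  "ALL (i, j, k, l, m) : R. ka i j * ka j k * ka k i ~= 0"
  using negative_slabs[OF adm order_refl] by blast
 define M where "M = Max (insert 0 (t ` R)) + 1"
 have M: "M > t r" "M > 0" if "r : R" for r
 proof -
  have "t r <= Max (insert 0 (t ` R))" "0 <= Max (insert 0 (t ` R))" using RT(1) that by (auto intro: Max_ge)
  then show "M > t r" "M > 0" unfolding M_def by linarith+
 qed
 \<comment> \<open>With all coordinates equal to \<open>M\<close> every turn of a circuit is
   \<open>M\<close> or \<open>- M\<close>. The three signs are not all equal, because
   \<open>i < j < k < i\<close> is impossible in either direction, so the twist is \<open>M\<close>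
   or \<open>- M\<close> and exceeds every threshold.\<close>
 define y where "y x = (if x : coords then M else 0)" for x
 have "\<bar>twist r y\<bar> > t r" if r: "r : R" for r
 proof -
  obtain i j k l m where e: "r = (i, j, k, l, m)" by (cases r)
  have S: "(i, j, k, l, m) : S" using RT(4) r e by blast
  have "ka i j * ka j k * ka k i ~= 0" using RT(5) r e by blast
  then have nz': "ka i j ~= 0" "ka j k ~= 0" "ka k i ~= 0" by simp_all
  have d: "i ~= j" "j ~= k" "k ~= i" using step_nbr(2)[OF S] by auto
  have nb: "nbr Q i j" "nbr Q j k" "nbr Q k i" using step_nbr(1)[OF S] d by blast+
  have tu: "turn y s u = (if s < u then M else - M)" if "nbr Q s u" "ka s u ~= 0" for s u
   using that nbr_sym[OF that(1)] nbr_less[OF that(1)] kap_sym[of u s] edge_coords[of s u] edge_coords[of u s]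
   unfolding turn_def y_def by auto
  have "twist r y = M | twist r y = - M"
   unfolding e twist_def prod.case tu[OF nb(1) nz'(1)] tu[OF nb(2) nz'(2)] tu[OF nb(3) nz'(3)]
   using d by auto
  then show ?thesis using M[OF r] by auto
 qed
 moreover have "y : supported coords" unfolding y_def supported_def by simp
 ultimately have "y : slabs coords R twist t" unfolding slabs_def by blast
 then have "y : negative_coords" using RT(3) by blast
 then show ?thesis using reconstruct_good[OF nz] by blast
qed

end

subsection \<open>Finite moduli\<close>

lemma finite_structure:
 assumes X: "X homeomorphic_space discrete_topology A" and A: "finite A"
 shows "cells X"
proof -
 obtain F where F: "homeomorphic_map X (discrete_topology A) F"
  using X homeomorphic_space by blast
 have bij: "bij_betw F (topspace X) A"
  using homeomorphic_imp_injective_map[OF F] homeomorphic_imp_surjective_map[OF F] by (simp add: bij_betw_def)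
 have sing: "openin X {x}" if "x : topspace X" for x
 proof -
  have "openin (discrete_topology A) (F ` {x})" using bij_betwE[OF bij] that by simp
  then show ?thesis using homeomorphic_map_openness_eq[OF F, of "{x}"] that by blast
 qed
 have X_disc: "discrete_topology (topspace X) = X" unfolding discrete_topology_unique using sing by blast
 have fin: "finite (topspace X)" using bij A bij_betw_finite by blast
 have point: "subtopology X {x} homeomorphic_space Y"
  if "x : topspace X" and Y: "topspace Y = {y}" for x and y :: "nat => real" and Y
 proof -
  have "homeomorphic_maps (subtopology X {x}) Y (%_. y) (%_. x)"
   unfolding homeomorphic_maps_def using that by simp
  then show ?thesis unfolding homeomorphic_space_def by blast
 qed
 have E0: "topspace (Euclidean_space 0) = {%_. 0}" unfolding topspace_Euclidean_space by auto
 have B0: "topspace (ball_space 0) = {%_. 0}" unfolding ball_space_def topspace_subtopology E0 by auto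
 have "topological_manifold 0 X"
  unfolding topological_manifold_def
 proof (intro conjI ballI)
  show "Hausdorff_space X" by (subst X_disc[symmetric]) simp
  show "second_countable X"
   unfolding second_countable_def
  proof (intro exI[of _ "(%x. {x}) ` topspace X"] conjI ballI allI impI)
   show "countable ((%x. {x}) ` topspace X)" using fin by (simp add: countable_finite)
   show "openin X V" if "V : (%x. {x}) ` topspace X" for V using that sing by blast
   fix U x assume "openin X U & x : U"
   then show "EX V:(%x. {x}) ` topspace X. x : V & V <= U" using openin_subset by fastforce
  qed
  fix x assume x: "x : topspace X"
  have "subtopology X {x} homeomorphic_space subtopology (Euclidean_space 0) {%_. 0}"
   by (rule point[OF x]) (simp add: E0)
  moreover have "openin (Euclidean_space 0) {%_. 0}" using E0 openin_topspace by metis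
  ultimately show "EX U V. openin X U & x : U & openin (Euclidean_space 0) V &
    subtopology X U homeomorphic_space subtopology (Euclidean_space 0) V"
   using sing[OF x] by blast
 qed
 moreover have "finite (connected_components_of X)"
  by (rule finite_subset[of _ "Pow (topspace X)"]) (use connected_components_of_subset fin in auto)
 moreover have "subtopology X C homeomorphic_space ball_space 0" if C: "C : connected_components_of X" for C
 proof -
  have "connectedin (discrete_topology (topspace X)) C"
   unfolding X_disc by (rule connectedin_connected_components_of[OF C])
  then obtain x where "C <= {x}" "C <= topspace X" unfolding connectedin_discrete_topology by blast
  then have "C = {x}" "x : topspace X" using nonempty_connected_components_of[OF C] by auto
  then show ?thesis using point[OF _ B0] by simp
 qed
 ultimately show ?thesis by blast
qed

text \<open>Here \<open>x\<close> is one entry of a 3 by 3 Cartan matrix with vanishing column sums,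
  from which the other entries follow. The equation is the last product condition; its leading
  coefficient \<open>4 - ka3\<close> is not zero, so it has finitely many solutions.\<close>

lemma flat_quadratic:
 fixes ka1 ka2 ka3 x :: real
 shows "(2 * x + ka1) * (2 * (2 + x) - ka2) = ka3 * (x * (2 + x)) \<longleftrightarrow>
  poly [:ka1 * (4 - ka2), 8 - 2 * ka2 + 2 * ka1 - 2 * ka3, 4 - ka3:] x = 0"
 by (simp add: algebra_simps)

lemma finite_flat_roots:
 assumes "ka3 < (4 :: real)"
 shows "finite {x. (2 * x + ka1) * (2 * (2 + x) - ka2) = ka3 * (x * (2 + x))}"
 unfolding flat_quadratic by (rule poly_roots_finite) (use assms in simp)

lemma flat_entries_generic:
 fixes ka1 ka2 ka3 u :: real
 assumes k: "0 < ka1" "0 < ka2" "0 < ka3" "ka1 < 4" "ka2 < 4" "ka3 < 4"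
  and u: "u = 4 - ka1 - ka2 - ka3" and c: "sqrt (ka1 * ka2 * ka3) <= u"
 shows "EX x. x < 0 & -2 - x < 0 & ka1 < - 2 * x & ka2 < 2 * (2 + x) &
  (2 * x + ka1) * (2 * (2 + x) - ka2) = ka3 * (x * (2 + x))"
proof -
 define y where "y = 4 - ka3"
 have y: "y > 0" using k unfolding y_def by simp
 have kp: "ka1 * ka2 * ka3 > 0" using k by simp
 have u0: "u > 0" using c kp real_sqrt_gt_zero[OF kp] by linarith
 have "(sqrt (ka1 * ka2 * ka3))\<^sup>2 <= u\<^sup>2" using c kp by (intro power_mono) simp_all
 then have w2: "ka1 * ka2 * ka3 <= u\<^sup>2" using kp by simp
 define w where "w = sqrt (u\<^sup>2 - ka1 * ka2 * ka3)"
 have w: "w >= 0" "w\<^sup>2 = u\<^sup>2 - ka1 * ka2 * ka3" unfolding w_def using w2 by simp_all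
 have "w\<^sup>2 <= u\<^sup>2" using w kp by simp
 then have wu: "w <= u" using u0 power2_le_imp_le by fastforce
 \<comment> \<open>The larger root of the polynomial in \<open>flat_quadratic\<close>, which is
   \<open>y * x^2 + 2 * (u + 2 * ka1) * x + ka1 * (4 - ka2)\<close>. A quarter of its discriminant
   is \<open>u^2 - ka1 * ka2 * ka3\<close>, the square of \<open>w\<close>.\<close>
 define x where "x = (w - u - 2 * ka1) / y"
 have xy: "x * y = w - u - 2 * ka1" unfolding x_def using y by simp
 have p13: "ka1 * ka3 > 0" and p23: "ka2 * ka3 > 0" using k by simp_all
 have "(- 2 * x - ka1) * y = 2 * u - 2 * w + ka1 * ka3"
  using xy unfolding y_def by (simp add: algebra_simps)
 then have "(- 2 * x - ka1) * y > 0" using wu p13 by linarith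
 then have 1: "ka1 < - 2 * x" using y zero_less_mult_pos2 by fastforce
 have "(2 * (2 + x) - ka2) * y = 2 * u + 2 * w + ka2 * ka3"
  using xy unfolding y_def u by (simp add: algebra_simps)
 then have "(2 * (2 + x) - ka2) * y > 0" using u0 w p23 by linarith
 then have 2: "ka2 < 2 * (2 + x)" using y zero_less_mult_pos2 by fastforce
 have "y * ((2 * x + ka1) * (2 * (2 + x) - ka2) - ka3 * (x * (2 + x))) =
   (x * y)\<^sup>2 + 2 * (u + 2 * ka1) * (x * y) + y * (ka1 * (4 - ka2))"
  unfolding y_def u by (simp add: algebra_simps power2_eq_square)
 also have "\<dots> = w\<^sup>2 - (u + 2 * ka1)\<^sup>2 + y * (ka1 * (4 - ka2))"
  unfolding xy by (simp add: algebra_simps power2_eq_square)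
 also have "\<dots> = 0" unfolding w(2) y_def u by (simp add: algebra_simps power2_eq_square)
 finally have "(2 * x + ka1) * (2 * (2 + x) - ka2) = ka3 * (x * (2 + x))" using y by simp
 then show ?thesis using 1 2 k by (intro exI[of _ x]) simp
qed

text \<open>Entries off the diagonal of a \<open>3 \<times> 3\<close> matrix with diagonal \<open>2\<close> and vanishing column sums.\<close>

lemma flat_entries:
 fixes ka1 ka2 ka3 :: real
 assumes k: "0 <= ka1" "0 <= ka2" "0 <= ka3" "ka1 < 4" "ka2 < 4" "ka3 < 4"
  and c: "if ka1 * ka2 * ka3 = 0 then ka1 + ka2 + ka3 = 4 else sqrt (ka1 * ka2 * ka3) <= 4 - ka1 - ka2 - ka3"
 shows "EX p q r p' q' r'. 2 + p' + q' = 0 & 2 + p + r' = 0 & 2 + q + r = 0 &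
  p <= 0 & q <= 0 & r <= 0 & p' <= 0 & q' <= 0 & r' <= 0 & p * p' = ka1 & q * q' = ka2 & r * r' = ka3 &
  (p = 0 \<longleftrightarrow> ka1 = 0) & (p' = 0 \<longleftrightarrow> ka1 = 0) & (q = 0 \<longleftrightarrow> ka2 = 0) & (q' = 0 \<longleftrightarrow> ka2 = 0) &
  (r = 0 \<longleftrightarrow> ka3 = 0) & (r' = 0 \<longleftrightarrow> ka3 = 0)"
proof -
 consider "ka1 = 0" "ka2 + ka3 = 4" | "ka2 = 0" "ka1 + ka3 = 4" | "ka3 = 0" "ka1 + ka2 = 4"
  | "ka1 > 0" "ka2 > 0" "ka3 > 0" "sqrt (ka1 * ka2 * ka3) <= 4 - ka1 - ka2 - ka3"
  using c k by (fastforce split: if_splits)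
 then show ?thesis
 proof cases
  \<comment> \<open>With a right angle the entries are forced: \<open>p\<close> and
    \<open>p'\<close> vanish, the column sums give \<open>q' = -2\<close> and
    \<open>r' = -2\<close>, and the products give the rest.\<close>
  case 1
  show ?thesis
   by (rule exI[of _ 0], rule exI[of _ "- ka2 / 2"], rule exI[of _ "ka2 / 2 - 2"], rule exI[of _ 0],
    rule exI[of _ "-2"], rule exI[of _ "-2"]) (use 1 k in auto)
 next
  case 2
  show ?thesis
   by (rule exI[of _ "- ka1 / 2"], rule exI[of _ 0], rule exI[of _ "-2"], rule exI[of _ "-2"], rule exI[of _ 0],
    rule exI[of _ "ka1 / 2 - 2"]) (use 2 k in auto)
 next
  case 3
  show ?thesis
   by (rule exI[of _ "-2"], rule exI[of _ "-2"], rule exI[of _ 0], rule exI[of _ "- ka1 / 2"],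
    rule exI[of _ "- ka2 / 2"], rule exI[of _ 0]) (use 3 k in auto)
 next
  case 4
  obtain x where x: "x < 0" "-2 - x < 0" "ka1 < - 2 * x" "ka2 < 2 * (2 + x)"
   "(2 * x + ka1) * (2 * (2 + x) - ka2) = ka3 * (x * (2 + x))"
   using flat_entries_generic[OF 4(1-3) k(4-6) refl 4(4)] by blast
  define p where "p = ka1 / x"
  define q where "q = ka2 / (-2 - x)"
  have p: "p * x = ka1" and q: "q * (-2 - x) = ka2" unfolding p_def q_def using x by simp_all
  have pn: "p < 0" "q < 0" unfolding p_def q_def using 4 x by (simp_all add: divide_pos_neg)
  have "(-2 - p) * x > 0" using p x by (simp add: algebra_simps)
  then have r': "-2 - p < 0" using x(1) by (simp add: zero_less_mult_iff)
  have "(-2 - q) * (-2 - x) > 0" using q x by (simp add: algebra_simps)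
  then have r: "-2 - q < 0" using x(2) by (simp add: zero_less_mult_iff)
  have "((-2 - q) * (-2 - p)) * (x * (-2 - x)) = ((-2 - p) * x) * ((-2 - q) * (-2 - x))" by simp
  also have "\<dots> = (- 2 * x - ka1) * (2 * (2 + x) - ka2)"
  proof -
   have "(-2 - p) * x = - 2 * x - ka1" "(-2 - q) * (-2 - x) = 2 * (2 + x) - ka2"
    using p q by (simp_all add: algebra_simps)
   then show ?thesis by simp
  qed
  also have "\<dots> = ka3 * (x * (-2 - x))" using x(5) by (simp add: algebra_simps)
  finally have rr: "(-2 - q) * (-2 - p) = ka3" using x by simp
  show ?thesis
   by (rule exI[of _ p], rule exI[of _ q], rule exI[of _ "-2 - q"], rule exI[of _ x], rule exI[of _ "-2 - x"],
    rule exI[of _ "-2 - p"]) (use p q rr pn r r' x 4 in simp)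
 qed
qed

definition vec4 :: "real => real => real => real => real^4" where
 "vec4 x1 x2 x3 x4 = (\<chi> r. if r = 1 then x1 else if r = 2 then x2 else if r = 3 then x3 else x4)"

lemma vec4_inner: "vec4 a1 a2 a3 a4 .* vec4 x1 x2 x3 x4 = a1 * x1 + a2 * x2 + a3 * x3 + a4 * x4"
 unfolding inner_vec_def vec4_def by (simp add: sum_4)

section \<open>A vanishing determinant leaves a single truncation\<close>

context stacked_graph
begin

text \<open>One truncation makes a triangular prism; the six zeros say that all edges of its two
  triangular faces \<open>l\<close> and \<open>m\<close> have right angles.\<close>

definition flat :: bool where
 "flat \<longleftrightarrow> card S = 1 & (EX i j k l m. (i, j, k, l, m) : S & (ALL s:{i, j, k}. ka l s = 0 & ka m s = 0))"

text \<open>If there is another truncation, then \<open>stacked_removed_neighbour\<close> yields a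
  removed triple with \<open>l\<close> or \<open>m\<close> as a member and its other two members in
  \<open>{i, j, k}\<close>. Two of its three weights vanish and the third is below 4.\<close>

lemma zero_step:
 assumes S: "(i, j, k, l, m) : S" and z: "ALL s:{i, j, k}. ka l s = 0 & ka m s = 0" and nf: "~ flat"
 shows "EX i' j' k' l' m'. (i', j', k', l', m') : S & ka i' j' * ka j' k' * ka k' i' = 0 & ka i' j' + ka j' k' + ka k' i' < 4"
proof -
 have "card S ~= 1" using nf S z unfolding flat_def by blast
 moreover have "card S ~= 0" using S stacked_finite[OF stk] by auto
 ultimately have "card S >= 2" by linarith
 then obtain T where T: "T : removed S" "T ~= {i, j, k}" "T <= {i, j, k, l} | T <= {i, j, k, m}"
  using stacked_removed_neighbour[OF stk _ S] by blast
 then obtain x where x: "x : {l, m}" "T <= insert x {i, j, k}" by blast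
 obtain i' j' k' l' m' where S': "(i', j', k', l', m') : S" "T = {i', j', k'}" using T(1) unfolding removed_def by auto
 have d: "distinct [i, j, k]" "distinct [i', j', k']" using step_nbr(2)[OF S] step_nbr(2)[OF S'(1)] by simp_all
 have xT: "x : T"
 proof (rule ccontr)
  assume "x ~: T"
  then have "T <= {i, j, k}" using x(2) by blast
  moreover have "card T = card {i, j, k}" unfolding S'(2) using d by simp
  ultimately show False using T(2) card_subset_eq[of "{i, j, k}" T] by simp
 qed
 have zx: "ka x s = 0" "ka s x = 0" if "s : T" "s ~= x" for s
 proof -
  have "s : {i, j, k}" using that x(2) by blast
  then show "ka x s = 0" using z x(1) by blast
  then show "ka s x = 0" using kap_sym by simp
 qed
 have "ka i' j' * ka j' k' * ka k' i' = 0 & ka i' j' + ka j' k' + ka k' i' < 4"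
 proof -
  have "x = i' | x = j' | x = k'" using xT unfolding S'(2) by blast
  then show ?thesis
  proof (elim disjE)
   assume "x = i'"
   then have "ka i' j' = 0" "ka k' i' = 0" using zx d unfolding S'(2) by auto
   then show ?thesis using kap_less[of j' k'] by simp
  next
   assume "x = j'"
   then have "ka i' j' = 0" "ka j' k' = 0" using zx d unfolding S'(2) by auto
   then show ?thesis using kap_less[of k' i'] by simp
  next
   assume "x = k'"
   then have "ka k' i' = 0" "ka j' k' = 0" using zx d unfolding S'(2) by auto
   then show ?thesis using kap_less[of i' j'] by simp
  qed
 qed
 then show ?thesis using S'(1) by blast
qed

lemma good_steps_det:
 assumes g: "good al v" and S: "(i, j, k, l, m) : S"
 shows "md3 (ent (logdata al v)) i j k < 0 |
  (md3 (ent (logdata al v)) i j k = 0 & (ALL s:{i, j, k}. ka l s = 0 & ka m s = 0))"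
 using steps_det[OF stk _ _ kap_weights S, of al v] g good_det3[OF g S] unfolding good_def by simp

text \<open>A vanishing determinant would come, by \<open>zero_step\<close>, with a circuit whose
  determinant is positive, and this contradicts \<open>good_steps_det\<close>.\<close>

lemma nonflat_good:
 assumes nf: "~ flat" and g: "good al v"
 shows "logdata al v : negative_coords" "admissible"
proof -
 have no: "~ (ka i j * ka j k * ka k i = 0 & ka i j + ka j k + ka k i < 4)" if S: "(i, j, k, l, m) : S" for i j k l m
 proof
  assume h: "ka i j * ka j k * ka k i = 0 & ka i j + ka j k + ka k i < 4"
  have d: "distinct [i, j, k]" using step_nbr(2)[OF S] by simp
  have "md3 (ent (logdata al v)) i j k > 0" using md3_ent[OF d, of "logdata al v" l m] h by simp
  then show False using good_steps_det[OF g S] by linarith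
 qed
 have neg: "md3 (ent (logdata al v)) i j k < 0" if S: "(i, j, k, l, m) : S" for i j k l m
  using good_steps_det[OF g S] zero_step[OF S _ nf] no by blast
 then show "logdata al v : negative_coords" unfolding negative_coords_def using logdata_supported by blast
 show "admissible"
  unfolding admissible_def
 proof (intro ballI)
  fix r assume r: "r : S"
  obtain i j k l m where e: "r = (i, j, k, l, m)" by (cases r)
  have S: "(i, j, k, l, m) : S" using r e by simp
  have d: "distinct [i, j, k]" using step_nbr(2)[OF S] by simp
  have "4 < ka i j + ka j k + ka k i" if "ka i j * ka j k * ka k i = 0"
   using neg[OF S] md3_ent[OF d, of "logdata al v" l m] that by simp
  then show "case r of (i, j, k, l, m) => ka i j * ka j k * ka k i = 0 --> 4 < ka i j + ka j k + ka k i"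
   unfolding e prod.case by blast
 qed
qed

lemma nonflat_nz:
 assumes nf: "~ flat" and adm: "admissible"
 shows "ALL (i, j, k, l, m) : S. EX s:{i, j, k}. ka l s ~= 0 | ka m s ~= 0"
proof (intro ballI)
 fix r assume r: "r : S"
 obtain i j k l m where e: "r = (i, j, k, l, m)" by (cases r)
 have "EX s:{i, j, k}. ka l s ~= 0 | ka m s ~= 0"
 proof (rule ccontr)
  assume "~ ?thesis"
  then have "ALL s:{i, j, k}. ka l s = 0 & ka m s = 0" by blast
  then obtain i' j' k' l' m' where "(i', j', k', l', m') : S" "ka i' j' * ka j' k' * ka k' i' = 0"
   "ka i' j' + ka j' k' + ka k' i' < 4" using zero_step[OF _ _ nf] r e by blast
  then show False using adm unfolding admissible_def by fastforce
 qed
 then show "case r of (i, j, k, l, m) => EX s:{i, j, k}. ka l s ~= 0 | ka m s ~= 0" unfolding e prod.case .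
qed

lemma empty_structure:
 assumes "topspace (X_space G) = {}"
 shows "cells (X_space G)"
proof (rule finite_structure)
 show "X_space G homeomorphic_space discrete_topology ({} :: nat set)"
  using assms by (simp add: homeomorphic_empty_space_eq)
qed simp

theorem nonflat_structure:
 assumes nf: "~ flat"
 shows "cells (X_space G)"
  "topspace (X_space G) = {} \<longleftrightarrow> ~ admissible"
proof -
 show e: "topspace (X_space G) = {} \<longleftrightarrow> ~ admissible"
  unfolding X_empty_iff using nonflat_good(2)[OF nf] regular_nonempty[OF nonflat_nz[OF nf]] by blast
 show "cells (X_space G)"
 proof (cases "admissible")
  case True
  show ?thesis by (rule regular_structure[OF _ nonflat_nz[OF nf True] True]) (use nonflat_good(1)[OF nf] in blast)
 next
  case False
  then show ?thesis using e empty_structure by blast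
 qed
qed

end

subsection \<open>The exceptional prism\<close>

locale prism_graph = stacked_graph G a b c d Q S n
 for G :: "'v labelled_graph" and a b c d Q S n +
 fixes i j k l m :: nat
 assumes S_eq: "S = {(i, j, k, l, m)}" and F_eq: "{..<n} = {i, j, k, l, m}"
  and tris: "fst ` Q = {{j, k, l}, {i, k, l}, {i, j, l}, {i, j, m}, {j, k, m}, {i, k, m}}"
begin

lemma in_S: "(i, j, k, l, m) : S"
 unfolding S_eq by simp

lemma ne: "i ~= j" "i ~= k" "j ~= k" "l ~= i" "l ~= j" "l ~= k" "m ~= i" "m ~= j" "m ~= k" "l ~= m"
 using step_nbr(2)[OF in_S] by auto

lemma no_lm:
 assumes "T : fst ` Q"
 shows "~ (l : T & m : T)"
proof -
 have "T = {j, k, l} | T = {i, k, l} | T = {i, j, l} | T = {i, j, m} | T = {j, k, m} | T = {i, k, m}"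
  using assms unfolding tris by simp
 then show ?thesis by (elim disjE) (simp_all add: ne ne[symmetric])
qed

lemma nbr_cases:
 assumes "nbr Q s t"
 shows "s : {i, j, k, l, m}" "t : {i, j, k, l, m}" "s ~= t" "s : {i, j, k} | t : {i, j, k}"
proof -
 show st: "s : {i, j, k, l, m}" "t : {i, j, k, l, m}" "s ~= t"
  using nbr_less[OF assms] F_eq by (metis lessThan_iff)+
 obtain T where "T : fst ` Q" "s : T" "t : T" using assms unfolding nbr_def by blast
 then show "s : {i, j, k} | t : {i, j, k}" using no_lm st by blast
qed

lemma prism_nbr: "nbr Q i j" "nbr Q j i" "nbr Q i k" "nbr Q k i" "nbr Q j k" "nbr Q k j"
 using step_nbr(1)[OF in_S] ne by blast+

end

locale flat_graph = prism_graph +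
 assumes zero: "s : {i, j, k} ==> ka l s = 0 & ka m s = 0"
begin

lemma zero_pairing:
 assumes g: "good al v" and s: "s : {i, j, k}" and x: "x : {l, m}"
 shows "al x .* v s = 0" "al s .* v x = 0"
proof -
 have "x ~= s" using s x ne by blast
 then have nb: "nbr Q x s" using step_nbr(1)[OF in_S _ s, of x] x by blast
 have "ka x s = 0" using zero[OF s] x by blast
 then show "al x .* v s = 0" "al s .* v x = 0"
  using good_mirrored(3)[OF g nb] good_mirrored(3)[OF g nbr_sym[OF nb]] kap_sym[of x s] by simp_all
qed

lemma two:
 assumes "good al v"
 shows "al i .* v i = 2" "al j .* v j = 2" "al k .* v k = 2"
 using good_mirrored(1)[OF assms] step_less[OF in_S] by blast+

lemma column_sums:
 assumes g: "good al v" and am: "al m = comb al e1 e2 e3 i j k - Z *\<^sub>R al l"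
 shows "2 * e1 + e2 * (al j .* v i) + e3 * (al k .* v i) = 0" "e1 * (al i .* v j) + 2 * e2 + e3 * (al k .* v j) = 0"
  "e1 * (al i .* v k) + e2 * (al j .* v k) + 2 * e3 = 0"
proof -
 have sum0: "e1 * (al i .* v s) + e2 * (al j .* v s) + e3 * (al k .* v s) = 0" if s: "s : {i, j, k}" for s
 proof -
  have "al m .* v s = e1 * (al i .* v s) + e2 * (al j .* v s) + e3 * (al k .* v s) - Z * (al l .* v s)"
   unfolding am by (simp add: inner_add_left inner_diff_left)
  then show ?thesis using zero_pairing(1)[OF g s] by simp
 qed
 show "2 * e1 + e2 * (al j .* v i) + e3 * (al k .* v i) = 0" "e1 * (al i .* v j) + 2 * e2 + e3 * (al k .* v j) = 0"
  "e1 * (al i .* v k) + e2 * (al j .* v k) + 2 * e3 = 0"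
  using sum0[of i] sum0[of j] sum0[of k] two[OF g] by (simp_all add: mult.commute)
qed

text \<open>Rescaling \<open>i\<close>, \<open>j\<close>, \<open>k\<close>, \<open>l\<close> makes
  all coefficients of the relation equal to 1. As \<open>l\<close> and \<open>m\<close> are
  orthogonal to the circuit, its Cartan matrix then has vanishing column sums.\<close>

definition normal :: "(nat => real^4) => (nat => real^4) => bool" where
 "normal al v \<longleftrightarrow> good al v & al m = al i + al j + al k - al l"

lemma normalize:
 assumes g: "good al v"
 shows "EX h. normal (grown h al) (shrunk h v)"
proof -
 obtain e1 e2 e3 where e: "e1 > 0" "e2 > 0" "e3 > 0"
  and am: "al m = comb al e1 e2 e3 i j k - exp (logdata al v (m, m)) *\<^sub>R al l"
  using good_step[OF g in_S] by blast
 define h where "h s = (if s = i then ln e1 else if s = j then ln e2 else if s = k then ln e3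
  else if s = l then logdata al v (m, m) else 0)" for s
 have "h i = ln e1" "h j = ln e2" "h k = ln e3" "h l = logdata al v (m, m)" "h m = 0"
  unfolding h_def using ne by simp_all
 then show ?thesis unfolding normal_def using logdata_gauge(1)[OF g, of h] am e by (intro exI[of _ h]) simp
qed

text \<open>The value of the entry \<open>al j .* v i\<close> in the normal form, computed without normalizing.\<close>

definition cross :: "(nat => real^4) => (nat => real^4) => real" where
 "cross al v = (al j .* v i) * ((al k .* v i) * (al i .* v j) - 2 * (al k .* v j)) /
  ((al j .* v i) * (al k .* v j) - 2 * (al k .* v i))"

lemma cross_denominator:
 assumes g: "good al v"
 shows "(al j .* v i) * (al k .* v j) - 2 * (al k .* v i) ~= 0"
proof
 assume 0: "(al j .* v i) * (al k .* v j) - 2 * (al k .* v i) = 0"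
 obtain e1 e2 e3 where e: "e1 > 0"
  and am: "al m = comb al e1 e2 e3 i j k - exp (logdata al v (m, m)) *\<^sub>R al l"
  using good_step[OF g in_S] by blast
 note cs = column_sums[OF g am]
 have "(4 - (al i .* v j) * (al j .* v i)) * e1 = e3 * ((al j .* v i) * (al k .* v j) - 2 * (al k .* v i))"
  using cs(1,2) by algebra
 then have "4 - (al i .* v j) * (al j .* v i) = 0" using e 0 by simp
 moreover have "(al i .* v j) * (al j .* v i) < 4" using good_mirrored(4)[OF g prism_nbr(1)] kap_less[of i j] by simp
 ultimately show False by simp
qed

lemma cross_normal:
 assumes "normal al v"
 shows "cross al v = al j .* v i"
proof -
 have g: "good al v" using assms unfolding normal_def by blast
 have "al m = comb al 1 1 1 i j k - 1 *\<^sub>R al l" using assms unfolding normal_def by simp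
 note cs = column_sums[OF g this]
 have "(al k .* v i) * (al i .* v j) - 2 * (al k .* v j) = (al j .* v i) * (al k .* v j) - 2 * (al k .* v i)"
 proof -
  have q: "al k .* v i = - 2 - al j .* v i" and r: "al k .* v j = - 2 - al i .* v j" using cs by simp_all
  show ?thesis unfolding q r by (simp add: algebra_simps)
 qed
 then show ?thesis unfolding cross_def using cross_denominator[OF g] by simp
qed

lemma cross_gauge: "cross (grown h al) (shrunk h v) = cross al v"
proof -
 define x where "x = exp (h j - h i)"
 define y where "y = exp (h k - h j)"
 have xy: "x > 0" "y > 0" unfolding x_def y_def by simp_all
 have pr: "(exp (h s) *\<^sub>R al s) .* (exp (- h t) *\<^sub>R v t) = exp (h s - h t) * (al s .* v t)" for s t
  by (simp add: exp_diff exp_minus divide_inverse)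
 have e: "exp (h k - h i) = x * y" "exp (h i - h j) = 1 / x"
  unfolding x_def y_def exp_add[symmetric] by (simp, simp add: exp_diff)
 have num: "x * (al j .* v i) * (x * y * (al k .* v i) * (1 / x * (al i .* v j)) - 2 * (y * (al k .* v j))) =
   (x * y) * ((al j .* v i) * ((al k .* v i) * (al i .* v j) - 2 * (al k .* v j)))"
  using xy by (simp add: algebra_simps)
 have den: "x * (al j .* v i) * (y * (al k .* v j)) - 2 * (x * y * (al k .* v i)) =
   (x * y) * ((al j .* v i) * (al k .* v j) - 2 * (al k .* v i))"
  by (simp add: algebra_simps)
 show ?thesis unfolding cross_def pr e x_def[symmetric] y_def[symmetric] num den
  using xy by simp
qed

lemma cross_linked:
 assumes "linked al v al' v'"
 shows "cross al' v' = cross al v"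
 unfolding cross_def using linked_pairing[OF assms] step_less[OF in_S] by simp

text \<open>Column sums and prescribed products determine every entry from
  \<open>al j .* v i\<close>. One product condition is left over and becomes a quadratic
  equation.\<close>

lemma normal_entries:
 assumes no: "normal al v"
 shows "al k .* v i = - 2 - al j .* v i" "al i .* v j = ka i j / (al j .* v i)" "al k .* v j = - 2 - al i .* v j"
  "al i .* v k = ka i k / (al k .* v i)" "al j .* v k = - 2 - al i .* v k"
  "(2 * (al j .* v i) + ka i j) * (2 * (2 + al j .* v i) - ka i k) = ka j k * ((al j .* v i) * (2 + al j .* v i))"
proof -
 have g: "good al v" using no unfolding normal_def by blast
 have "al m = comb al 1 1 1 i j k - 1 *\<^sub>R al l" using no unfolding normal_def by simp
 note cs = column_sums[OF g this]
 show q: "al k .* v i = - 2 - al j .* v i" and r': "al k .* v j = - 2 - al i .* v j" and r: "al j .* v k = - 2 - al i .* v k"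
  using cs by simp_all
 have quot: "al s .* v t = ka s t / (al t .* v s)" if st: "nbr Q s t" for s t
 proof (cases "ka s t = 0")
  case True
  then show ?thesis using good_mirrored(3)[OF g st] by simp
 next
  case False
  then have "al t .* v s ~= 0" using good_mirrored(3)[OF g nbr_sym[OF st]] kap_sym[of s t] by simp
  then show ?thesis using good_mirrored(4)[OF g st] by (simp add: field_simps)
 qed
 show "al i .* v j = ka i j / (al j .* v i)" "al i .* v k = ka i k / (al k .* v i)" by (rule quot, rule prism_nbr)+
 have "(al i .* v j) * (al j .* v i) = ka i j" "(al i .* v k) * (al k .* v i) = ka i k" "(al j .* v k) * (al k .* v j) = ka j k"
  by (rule good_mirrored(4)[OF g], rule prism_nbr)+
 note kk = this[symmetric]
 show "(2 * (al j .* v i) + ka i j) * (2 * (2 + al j .* v i) - ka i k) = ka j k * ((al j .* v i) * (2 + al j .* v i))"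
  unfolding kk q r' r by (simp add: algebra_simps)
qed

lemma normal_unique:
 assumes no: "normal al v" "normal al' v'" and eq: "al j .* v i = al' j .* v' i"
 shows "linked al v al' v'"
proof -
 have g: "good al v" "good al' v'" using no unfolding normal_def by blast+
 have rel: "related S be (%_. 1) (%_. (1, 1, 1))" if "be m = be i + be j + be k - be l" for be :: "nat => real^4"
  unfolding related_def S_eq using that by simp
 note en = normal_entries[OF no(1)] and en' = normal_entries[OF no(2)]
 have q: "al k .* v i = al' k .* v' i" unfolding en(1) en'(1) eq ..
 have p: "al i .* v j = al' i .* v' j" unfolding en(2) en'(2) eq ..
 have r': "al k .* v j = al' k .* v' j" unfolding en(3) en'(3) p ..
 have s: "al i .* v k = al' i .* v' k" unfolding en(4) en'(4) q ..
 have r: "al j .* v k = al' j .* v' k" unfolding en(5) en'(5) s ..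
 have pair: "al s .* v t = al' s .* v' t" if st: "nbr Q s t" for s t
 proof (cases "s : {i, j, k} & t : {i, j, k}")
  case True
  then show ?thesis using eq q p r' s r nbr_cases(3)[OF st] by auto
 next
  case False
  then have "(s : {i, j, k} & t : {l, m}) | (t : {i, j, k} & s : {l, m})"
   using nbr_cases(1,2,4)[OF st] by blast
  then show ?thesis
  proof (elim disjE conjE)
   assume "s : {i, j, k}" "t : {l, m}"
   then show ?thesis by (simp only: zero_pairing(2)[OF g(1)] zero_pairing(2)[OF g(2)])
  next
   assume "t : {i, j, k}" "s : {l, m}"
   then show ?thesis by (simp only: zero_pairing(1)[OF g(1)] zero_pairing(1)[OF g(2)])
  qed
 qed
 show ?thesis
  by (rule linkedI[OF rel rel g]) (use no pair in \<open>auto simp: normal_def\<close>)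
qed

text \<open>\<open>cross\<close> separates the orbits and takes only finitely many values. On a
  finite discrete set any choice of preimages is a continuous section.\<close>

lemma flat_structure:
 "cells (X_space G)"
proof -
 define f where "f y = cross (form_rep (unit_rep y)) (pole_rep (unit_rep y))" for y
 have f_config: "f (config_of n al v) = cross al v" if g: "good al v" for al v
 proof -
  obtain h where "linked (grown h al) (shrunk h v)
   (form_rep (unit_rep (config_of n al v))) (pole_rep (unit_rep (config_of n al v)))" using rep_config[OF g] ..
  from cross_linked[OF this] show ?thesis unfolding f_def cross_gauge .
 qed
 define A where "A = f ` Y_set G"
 have finA: "finite A"
 proof (rule finite_subset)
  show "finite {x. (2 * x + ka i j) * (2 * (2 + x) - ka i k) = ka j k * (x * (2 + x))}"
   by (rule finite_flat_roots[OF kap_less])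
  show "A <= {x. (2 * x + ka i j) * (2 * (2 + x) - ka i k) = ka j k * (x * (2 + x))}"
  proof
   fix x assume "x : A"
   then obtain al v where g: "good al v" and x: "x = cross al v" unfolding A_def Y_good using f_config by auto
   obtain h where no: "normal (grown h al) (shrunk h v)" using normalize[OF g] ..
   show "x : {x. (2 * x + ka i j) * (2 * (2 + x) - ka i k) = ka j k * (x * (2 + x))}"
    using normal_entries(6)[OF no] unfolding cross_normal[OF no, symmetric] cross_gauge x by blast
  qed
 qed
 have "top_of_set A = discrete_topology A"
  by (rule subtopology_eq_discrete_topology_finite) (use finA in \<open>simp_all add: Hausdorff_imp_t1_space\<close>)
 moreover have "continuous_map (Y_space G) (top_of_set A) f"
  unfolding continuous_map_in_subtopology
 proof
  have "continuous_map (Y_space G) (top_of_set good_reps) unit_rep"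
   unfolding continuous_map_in_subtopology
   using continuous_map_unit_rep rep_good(1) unfolding topspace_Y Y_good by auto
  moreover have "continuous_on good_reps (%r. cross (form_rep r) (pole_rep r))"
   unfolding cross_def
   by (intro continuous_on_divide continuous_on_mult continuous_on_diff continuous_on_pairing
    continuous_on_const step_less[OF in_S]) (use cross_denominator in \<open>auto simp: good_reps_def\<close>)
  then have "continuous_map (top_of_set good_reps) euclidean (%r. cross (form_rep r) (pole_rep r))" by simp
  ultimately have "continuous_map (Y_space G) euclidean ((%r. cross (form_rep r) (pole_rep r)) \<circ> unit_rep)"
   by (rule continuous_map_compose)
  then show "continuous_map (Y_space G) euclidean f" unfolding f_def by (simp add: o_def)
  show "f : topspace (Y_space G) \<rightarrow> A" unfolding topspace_Y A_def by auto
 qed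
 ultimately have cf: "continuous_map (Y_space G) (discrete_topology A) f" by simp
 have eq: "orbit n y = orbit n y' \<longleftrightarrow> f y = f y'"
  if y: "y : topspace (Y_space G)" "y' : topspace (Y_space G)" for y y'
 proof -
  obtain al v where a: "y = config_of n al v" "good al v" using y(1) unfolding topspace_Y Y_good by blast
  obtain al' v' where a': "y' = config_of n al' v'" "good al' v'" using y(2) unfolding topspace_Y Y_good by blast
  show ?thesis
  proof
   assume "orbit n y = orbit n y'"
   then obtain h where "linked (grown h al) (shrunk h v) al' v'"
    unfolding a(1) a'(1) orbit_eq_iff[OF a(2) a'(2)] by blast
   from cross_linked[OF this] show "f y = f y'"
    unfolding cross_gauge a(1) a'(1) f_config[OF a(2)] f_config[OF a'(2)] by simp
  next
   assume "f y = f y'"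
   then have e: "cross al v = cross al' v'" unfolding a(1) a'(1) f_config[OF a(2)] f_config[OF a'(2)] .
   obtain h where no: "normal (grown h al) (shrunk h v)" using normalize[OF a(2)] ..
   obtain h' where no': "normal (grown h' al') (shrunk h' v')" using normalize[OF a'(2)] ..
   have l: "linked (grown h al) (shrunk h v) (grown h' al') (shrunk h' v')"
    by (rule normal_unique[OF no no'])
     (use e in \<open>simp only: cross_normal[OF no, symmetric] cross_normal[OF no', symmetric] cross_gauge\<close>)
   have g: "good (grown h al) (shrunk h v)"
    "good (grown h' al') (shrunk h' v')" using no no' unfolding normal_def by blast+
   have "EX h0. linked (%s. exp (h0 s) *\<^sub>R exp (h s) *\<^sub>R al s) (%s. exp (- h0 s) *\<^sub>R exp (- h s) *\<^sub>R v s)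
     (grown h' al') (shrunk h' v')" using l by (intro exI[of _ "%_. 0"]) simp
   then show "orbit n y = orbit n y'" unfolding orbit_eq_iff[OF g, symmetric] config_gauge_eq a(1) a'(1) .
  qed
 qed
 have "X_space G homeomorphic_space discrete_topology A"
 proof (rule slice_homeomorphic[OF quotient_X cf eq])
  have inv: "inv_into (Y_set G) f x : Y_set G" "f (inv_into (Y_set G) f x) = x" if "x : A" for x
   using that unfolding A_def by (rule inv_into_into, rule f_inv_into_f)
  show "continuous_map (discrete_topology A) (Y_space G) (inv_into (Y_set G) f)"
   using inv(1) unfolding continuous_map_from_discrete_topology topspace_Y by blast
  show "f (inv_into (Y_set G) f x) = x" if "x : topspace (discrete_topology A)" for x using inv(2) that by simp
 qed
 then show ?thesis using finA by (rule finite_structure)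
qed

text \<open>In terms of \<open>removed_circuit\<close>: the circuit is affine if it has a right
  angle, and affine or spherical otherwise.\<close>

definition flat_condition :: bool where
 "flat_condition \<longleftrightarrow> (if ka i j * ka i k * ka j k = 0 then ka i j + ka i k + ka j k = 4
   else sqrt (ka i j * ka i k * ka j k) <= 4 - ka i j - ka i k - ka j k)"

lemma flat_condition_necessary:
 assumes g0: "good al0 v0"
 shows "flat_condition"
proof -
 obtain h where no: "normal (grown h al0) (shrunk h v0)" using normalize[OF g0] ..
 then obtain al v where no: "normal al v" by blast
 have g: "good al v" using no unfolding normal_def by blast
 define p q r p' q' r' where "p = al i .* v j" and "q = al i .* v k" and "r = al j .* v k"
  and "p' = al j .* v i" and "q' = al k .* v i" and "r' = al k .* v j"
 note defs = p_def q_def r_def p'_def q'_def r'_def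
 have e: "q' = -2 - p'" "r' = -2 - p" "r = -2 - q" using normal_entries[OF no] unfolding defs by blast+
 have le: "p <= 0" "q <= 0" "r <= 0" "p' <= 0" "q' <= 0" "r' <= 0"
  unfolding defs by (rule good_mirrored(2)[OF g], rule prism_nbr)+
 have kk: "p * p' = ka i j" "q * q' = ka i k" "r * r' = ka j k"
  unfolding defs by (rule good_mirrored(4)[OF g], rule prism_nbr)+
 have z: "ka i j = 0 ==> p = 0 & p' = 0" "ka i k = 0 ==> q = 0 & q' = 0" "ka j k = 0 ==> r = 0 & r' = 0"
  unfolding defs using good_mirrored(3)[OF g] prism_nbr kap_sym by metis+
 \<comment> \<open>\<open>A\<close> and \<open>B\<close> are the negatives of the two cyclic
   products. The determinant is zero, so their mean is \<open>4 - ka i j - ka i k - ka j k\<close>,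
   and their product is fixed; the inequality between the means gives the condition.\<close>
 define A where "A = - (p * r * q')"
 define B where "B = - (q * r' * p')"
 have pr: "p * r >= 0" "q * r' >= 0" using le by (simp_all add: mult_nonpos_nonpos)
 have AB: "A >= 0" "B >= 0" unfolding A_def B_def using pr le by (simp_all add: mult_nonneg_nonpos)
 have prod: "A * B = ka i j * ka i k * ka j k" unfolding A_def B_def kk[symmetric] by (simp add: algebra_simps)
 have sum: "(A + B) / 2 = 4 - ka i j - ka i k - ka j k"
  unfolding A_def B_def kk[symmetric] e by (simp add: field_simps)
 show ?thesis
 proof (cases "ka i j * ka i k * ka j k = 0")
  case True
  then have "A = 0 & B = 0" using z unfolding A_def B_def by auto
  then show ?thesis unfolding flat_condition_def using True sum by simp
 next
  case False
  have "sqrt (A * B) <= (A + B) / 2" by (rule arith_geo_mean_sqrt[OF AB])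
  then show ?thesis unfolding flat_condition_def using False unfolding prod sum by simp
 qed
qed

lemma flat_condition_sufficient:
 assumes fc: "flat_condition"
 shows "EX al v. good al v"
proof -
 have c: "if ka i j * ka i k * ka j k = 0 then ka i j + ka i k + ka j k = 4
   else sqrt (ka i j * ka i k * ka j k) <= 4 - ka i j - ka i k - ka j k" using fc unfolding flat_condition_def .
 obtain p q r p' q' r' where cs: "2 + p' + q' = 0" "2 + p + r' = 0" "2 + q + r = 0"
  and le: "p <= 0" "q <= 0" "r <= 0" "p' <= 0" "q' <= 0" "r' <= 0"
  and pr: "p * p' = ka i j" "q * q' = ka i k" "r * r' = ka j k"
  and z: "p = 0 \<longleftrightarrow> ka i j = 0" "p' = 0 \<longleftrightarrow> ka i j = 0" "q = 0 \<longleftrightarrow> ka i k = 0" "q' = 0 \<longleftrightarrow> ka i k = 0"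
   "r = 0 \<longleftrightarrow> ka j k = 0" "r' = 0 \<longleftrightarrow> ka j k = 0"
  using flat_entries[OF kap_nonneg kap_nonneg kap_nonneg kap_less kap_less kap_less c] by (elim exE conjE) (rule that)
 \<comment> \<open>Minus the coordinate forms serve for \<open>i\<close>, \<open>j\<close>,
   \<open>k\<close>, \<open>l\<close>, and \<open>al m\<close> is given by the normal relation. The
   poles of \<open>l\<close> and \<open>m\<close> lie on the fourth axis, those of the circuit in
   the first three coordinates, which makes the six mixed pairings zero once the column sums
   vanish.\<close>
 define al where "al s = (if s = i then vec4 (-1) 0 0 0 else if s = j then vec4 0 (-1) 0 0 else
  if s = k then vec4 0 0 (-1) 0 else if s = l then vec4 0 0 0 (-1) else vec4 (-1) (-1) (-1) 1)" for s
 define v where "v s = (if s = i then vec4 (-2) (-p') (-q') 0 else if s = j then vec4 (-p) (-2) (-r') 0 else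
  if s = k then vec4 (-q) (-r) (-2) 0 else if s = l then vec4 0 0 0 (-2) else vec4 0 0 0 2)" for s
 have a: "al i = vec4 (-1) 0 0 0" "al j = vec4 0 (-1) 0 0" "al k = vec4 0 0 (-1) 0" "al l = vec4 0 0 0 (-1)"
  "al m = vec4 (-1) (-1) (-1) 1" unfolding al_def using ne by auto
 have w: "v i = vec4 (-2) (-p') (-q') 0" "v j = vec4 (-p) (-2) (-r') 0" "v k = vec4 (-q) (-r) (-2) 0"
  "v l = vec4 0 0 0 (-2)" "v m = vec4 0 0 0 2" unfolding v_def using ne by auto
 have sh: "EX x. vertex_at {i, j, k, l, m} al T x" if "T : fst ` Q" for T
 proof -
  have v6: "vertex_at {i, j, k, l, m} al {j, k, l} (vec4 1 0 0 0)" "vertex_at {i, j, k, l, m} al {i, k, l} (vec4 0 1 0 0)"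
   "vertex_at {i, j, k, l, m} al {i, j, l} (vec4 0 0 1 0)" "vertex_at {i, j, k, l, m} al {i, j, m} (vec4 0 0 1 1)"
   "vertex_at {i, j, k, l, m} al {j, k, m} (vec4 1 0 0 1)" "vertex_at {i, j, k, l, m} al {i, k, m} (vec4 0 1 0 1)"
   unfolding vertex_at_def by (auto simp: a vec4_inner)
  have "T = {j, k, l} | T = {i, k, l} | T = {i, j, l} | T = {i, j, m} | T = {j, k, m} | T = {i, k, m}"
   using that unfolding tris by simp
  then show ?thesis using v6 by metis
 qed
 have "mirrored ka {i, j, k, l, m} Q al v"
  unfolding mirrored_def
 proof (intro conjI allI impI)
  show "ALL s:{i, j, k, l, m}. al s .* v s = 2" by (simp add: a w vec4_inner)
  fix s t assume st: "nbr Q s t"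
  have zl: "ka l i = 0" "ka l j = 0" "ka l k = 0" "ka i l = 0" "ka j l = 0" "ka k l = 0"
   "ka m i = 0" "ka m j = 0" "ka m k = 0" "ka i m = 0" "ka j m = 0" "ka k m = 0"
   using zero[of i] zero[of j] zero[of k] kap_sym[of l] kap_sym[of m] by simp_all
  have rs: "ka j i = ka i j" "ka k i = ka i k" "ka k j = ka j k" using kap_sym by blast+
  have "al i .* v j = p" "al i .* v k = q" "al j .* v k = r" "al j .* v i = p'" "al k .* v i = q'" "al k .* v j = r'"
   "al i .* v l = 0" "al j .* v l = 0" "al k .* v l = 0" "al i .* v m = 0" "al j .* v m = 0" "al k .* v m = 0"
   "al l .* v i = 0" "al l .* v j = 0" "al l .* v k = 0" "al m .* v i = 0" "al m .* v j = 0" "al m .* v k = 0"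
   using cs by (simp_all add: a w vec4_inner)
  note pv = this
  have pr': "p' * p = ka i j" "q' * q = ka i k" "r' * r = ka j k" using pr by (simp_all add: mult.commute)
  have "s = i | s = j | s = k | s = l | s = m" "t = i | t = j | t = k | t = l | t = m" "s ~= t"
   "~ (s : {l, m} & t : {l, m})" using nbr_cases[OF st] ne by auto
  then have "al s .* v t <= 0 & (al s .* v t = 0 \<longleftrightarrow> ka s t = 0) & (al s .* v t) * (al t .* v s) = ka s t"
   by (elim disjE) (simp_all add: pv le z pr pr' zl rs)
  then show "al s .* v t <= 0" "al s .* v t = 0 \<longleftrightarrow> ka s t = 0" "(al s .* v t) * (al t .* v s) = ka s t" by blast+
 qed
 then have "good al v" unfolding good_def F_eq shaped_def using sh by blast
 then show ?thesis by blast
qed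

lemma flat_empty: "topspace (X_space G) = {} \<longleftrightarrow> ~ flat_condition"
 unfolding X_empty_iff using flat_condition_necessary flat_condition_sufficient by blast

end

subsection \<open>Angles\<close>

text \<open>The left side is the Gram determinant with unit diagonal and the other entries minus the
  cosines. The factorization comes from pairing the four cosines on the right into products and
  turning these into sums.\<close>

lemma cos_sum_identity:
 fixes A B C :: real
 shows "1 - (cos A)\<^sup>2 - (cos B)\<^sup>2 - (cos C)\<^sup>2 - 2 * cos A * cos B * cos C =
  - 4 * cos ((A + B + C) / 2) * (cos ((B + C - A) / 2) * (cos ((A + C - B) / 2) * cos ((A + B - C) / 2)))"
proof -
 have 1: "cos ((A + B + C) / 2) * cos ((B + C - A) / 2) = (cos A + cos (B + C)) / 2"
 proof -
  have "(A + B + C) / 2 - (B + C - A) / 2 = A" "(A + B + C) / 2 + (B + C - A) / 2 = B + C" by (simp_all add: field_simps)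
  then show ?thesis by (simp only: cos_times_cos)
 qed
 have 2: "cos ((A + C - B) / 2) * cos ((A + B - C) / 2) = (cos (C - B) + cos A) / 2"
 proof -
  have "(A + C - B) / 2 - (A + B - C) / 2 = C - B" "(A + C - B) / 2 + (A + B - C) / 2 = A" by (simp_all add: field_simps)
  then show ?thesis by (simp only: cos_times_cos)
 qed
 have s: "(sin B)\<^sup>2 = 1 - (cos B)\<^sup>2" "(sin C)\<^sup>2 = 1 - (cos C)\<^sup>2" using sin_cos_squared_add[of B] sin_cos_squared_add[of C] by linarith+
 have "- 4 * cos ((A + B + C) / 2) * (cos ((B + C - A) / 2) * (cos ((A + C - B) / 2) * cos ((A + B - C) / 2))) =
   - 4 * (cos ((A + B + C) / 2) * cos ((B + C - A) / 2)) * (cos ((A + C - B) / 2) * cos ((A + B - C) / 2))" by simp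
 also have "\<dots> = - (cos A + cos (B + C)) * (cos (C - B) + cos A)" unfolding 1 2 by simp
 also have "\<dots> = - (cos A)\<^sup>2 - 2 * cos A * cos B * cos C - (cos B)\<^sup>2 * (cos C)\<^sup>2 + (sin B)\<^sup>2 * (sin C)\<^sup>2"
  unfolding cos_add cos_diff by (simp add: algebra_simps power2_eq_square)
 also have "\<dots> = 1 - (cos A)\<^sup>2 - (cos B)\<^sup>2 - (cos C)\<^sup>2 - 2 * cos A * cos B * cos C"
  unfolding s by (simp add: algebra_simps)
 finally show ?thesis by simp
qed

text \<open>For angles in this range the last three factors of \<open>cos_sum_identity\<close> are
  positive, so the sign is opposite to that of the cosine of half the sum.\<close>

lemma angle_sum_sign:
 fixes A B C :: real
 assumes "0 < A" "A <= pi / 2" "0 < B" "B <= pi / 2" "0 < C" "C <= pi / 2"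
 defines "E == 1 - (cos A)\<^sup>2 - (cos B)\<^sup>2 - (cos C)\<^sup>2 - 2 * cos A * cos B * cos C"
 shows "E > 0 \<longleftrightarrow> A + B + C > pi" "E = 0 \<longleftrightarrow> A + B + C = pi" "E < 0 \<longleftrightarrow> A + B + C < pi"
proof -
 define P where "P = cos ((B + C - A) / 2) * (cos ((A + C - B) / 2) * cos ((A + B - C) / 2))"
 have "cos ((B + C - A) / 2) > 0" "cos ((A + C - B) / 2) > 0" "cos ((A + B - C) / 2) > 0"
  by (rule cos_gt_zero_pi; use assms in simp)+
 then have P: "P > 0" unfolding P_def by simp
 have E: "E = - 4 * cos ((A + B + C) / 2) * P" unfolding E_def P_def by (rule cos_sum_identity)
 have pos: "A + B + C < pi ==> E < 0"
 proof -
  assume "A + B + C < pi"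
  then have "cos ((A + B + C) / 2) > 0" using assms by (intro cos_gt_zero_pi) simp_all
  then have "cos ((A + B + C) / 2) * P > 0" using P by simp
  then show "E < 0" unfolding E by (simp add: mult.commute)
 qed
 have zer: "A + B + C = pi ==> E = 0" unfolding E by simp
 have neg: "A + B + C > pi ==> E > 0"
 proof -
  assume gt: "A + B + C > pi"
  have "A + B + C <= pi / 2 + pi / 2 + pi / 2" using assms(2,4,6) by (intro add_mono)
  also have "\<dots> < pi * 3" by (simp add: field_simps)
  finally have lo: "- (pi / 2) < pi - (A + B + C) / 2" by (simp add: field_simps)
  have "pi - (A + B + C) / 2 < pi / 2" using gt by (simp add: field_simps)
  with lo have "cos (pi - (A + B + C) / 2) > 0" by (rule cos_gt_zero_pi)
  then have "cos ((A + B + C) / 2) < 0" by simp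
  then have "cos ((A + B + C) / 2) * P < 0" using P by (rule mult_neg_pos)
  then show "E > 0" unfolding E by (simp add: mult.commute)
 qed
 show "E > 0 \<longleftrightarrow> A + B + C > pi" "E = 0 \<longleftrightarrow> A + B + C = pi" "E < 0 \<longleftrightarrow> A + B + C < pi"
  using pos zer neg by argo+
qed

subsection \<open>Prismatic circuits\<close>

context stacked_graph
begin

lemma face_inter:
 assumes "s < n" "t < n" "s ~= t"
 shows "e : face G s Int face G t \<longleftrightarrow> e : edges G & sd e = {s, t}"
proof
 assume "e : face G s Int face G t"
 then show "e : edges G & sd e = {s, t}" using faces[OF assms(1)] edge_pair[of e s t] assms by blast
next
 assume e: "e : edges G & sd e = {s, t}"
 then have "s : sd e" "t : sd e" by simp_all
 then show "e : face G s Int face G t" unfolding sd_iff by blast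
qed

lemma circuit3_iff: "circuit3 G w \<longleftrightarrow> w <= {..<n} & card w = 3 & (ALL s:w. ALL t:w. s ~= t --> nbr Q s t)"
proof -
 have "face G s Int face G t ~= {} \<longleftrightarrow> nbr Q s t" if "s < n" "t < n" "s ~= t" for s t
  using face_inter[OF that] nbr_edge[of s t] edge_nbr[of _ s t] by blast
 then show ?thesis unfolding circuit3_def n_def[symmetric] by (meson lessThan_iff subsetD)
qed

lemma circuit_edges_iff:
 assumes "circuit3 G w"
 shows "e : circuit_edges G w \<longleftrightarrow> e : edges G & (EX s:w. EX t:w. s ~= t & sd e = {s, t})"
proof -
 have w: "w <= {..<n}" using assms unfolding circuit3_iff by blast
 have "e : face G s Int face G t \<longleftrightarrow> e : edges G & sd e = {s, t}" if "s : w" "t : w" "s ~= t" for s t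
  using face_inter[of s t e] that w by auto
 then show ?thesis unfolding circuit_edges_def by blast
qed

lemma three_set:
 assumes "card w = 3"
 obtains x y z where "w = {x, y, z}" "distinct [x, y, z]"
 using assms by (auto simp: card_3_iff)

lemma vertex_in_edge: "u : e ==> e : edges G ==> u : verts G ==> sd e <= cn u"
 using inc by blast

text \<open>Two edges of a circuit meet in a vertex exactly when the three faces form a vertex
  triple. So prismatic circuits are the cliques that are not vertices, and
  \<open>stacked_clique\<close> leaves only the removed triples.\<close>

lemma prismatic_iff:
 assumes sg: "simple_graph (verts G) (edges G)"
 shows "prismatic G w \<longleftrightarrow> w : removed S"
proof -
 have disj: "(ALL e : circuit_edges G w. ALL e' : circuit_edges G w. e ~= e' --> e Int e' = {}) \<longleftrightarrow> w ~: fst ` Q"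
  if ci: "circuit3 G w"
 proof
  obtain x y z where w: "w = {x, y, z}" "distinct [x, y, z]" using ci three_set unfolding circuit3_iff by metis
  have nb: "nbr Q x y" "nbr Q y z" using ci w unfolding circuit3_iff by auto
  obtain e where e: "e : edges G" "sd e = {x, y}" using nbr_edge[OF nb(1)] by blast
  obtain e' where e': "e' : edges G" "sd e' = {y, z}" using nbr_edge[OF nb(2)] by blast
  have ee: "e : circuit_edges G w" "e' : circuit_edges G w"
   unfolding circuit_edges_iff[OF ci] using e e' w by auto
  have "{x, y} ~= {y, z}" using w(2) by (auto simp: doubleton_eq_iff)
  then have nee: "e ~= e'" using e(2) e'(2) by auto
  assume d: "ALL e : circuit_edges G w. ALL e' : circuit_edges G w. e ~= e' --> e Int e' = {}"
  show "w ~: fst ` Q"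
  proof
   assume "w : fst ` Q"
   then have "w : cn ` verts G" using bij_betw_imp_surj_on[OF bij_cn] by simp
   then obtain u where u: "u : verts G" "cn u = w" by (metis imageE)
   then have "u : e" "u : e'" using inc e e' w by auto
   then show False using d ee nee by blast
  qed
 next
  assume nc: "w ~: fst ` Q"
  show "ALL e : circuit_edges G w. ALL e' : circuit_edges G w. e ~= e' --> e Int e' = {}"
  proof (intro ballI impI, rule ccontr)
   fix e e' assume ee: "e : circuit_edges G w" "e' : circuit_edges G w" "e ~= e'" and ne: "e Int e' ~= {}"
   obtain u where u: "u : e" "u : e'" using ne by blast
   obtain s t where st: "e : edges G" "s : w" "t : w" "s ~= t" "sd e = {s, t}"
    using ee(1) unfolding circuit_edges_iff[OF ci] by blast
   obtain s' t' where st': "e' : edges G" "s' : w" "t' : w" "s' ~= t'" "sd e' = {s', t'}"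
    using ee(2) unfolding circuit_edges_iff[OF ci] by blast
   have uv: "u : verts G" using sg st(1) u(1) unfolding simple_graph_def by blast
   have "{s, t} Un {s', t'} <= cn u"
    using vertex_in_edge[OF u(1) st(1) uv] vertex_in_edge[OF u(2) st'(1) uv] unfolding st(5) st'(5) by blast
   moreover have "{s, t} ~= {s', t'}" using sd_inj[OF st(1) st'(1)] st st' ee(3) by metis
   moreover have cc: "card w = 3" using ci unfolding circuit3_iff by blast
   have fc: "finite w" using cc card.infinite by fastforce
   have "w = {s, t} Un {s', t'}"
   proof (rule sym, rule card_subset_eq[OF fc])
    show "{s, t} Un {s', t'} <= w" using st st' by blast
    have "s' ~: {s, t} | t' ~: {s, t}" using \<open>{s, t} ~= {s', t'}\<close> st'(4) by auto
    then have "card ({s, t} Un {s', t'}) >= 3"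
    proof
     assume "s' ~: {s, t}"
     then have "card {s', s, t} = 3" using st(4) by simp
     then show ?thesis using card_mono[of "{s, t} Un {s', t'}" "{s', s, t}"] by simp
    next
     assume "t' ~: {s, t}"
     then have "card {t', s, t} = 3" using st(4) by simp
     then show ?thesis using card_mono[of "{s, t} Un {s', t'}" "{t', s, t}"] by simp
    qed
    moreover have "card ({s, t} Un {s', t'}) <= 3" using card_mono[OF fc, of "{s, t} Un {s', t'}"] st st' cc by simp
    ultimately show "card ({s, t} Un {s', t'}) = card w" using cc by simp
   qed
   ultimately have sub: "w <= cn u" by simp
   have cu: "cn u : fst ` Q" using bij_betwE[OF bij_cn] uv by blast
   have "card (cn u) = 3" "cn u <= {..<n}" using stacked_tri_card[OF stk cu] by blast+
   then have "w = cn u" using card_subset_eq[of "cn u" w] sub cc finite_subset[of "cn u" "{..<n}"] by simp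
   then show False using nc cu by simp
  qed
 qed
 show ?thesis
 proof
  assume p: "prismatic G w"
  then have ci: "circuit3 G w" unfolding prismatic_def by simp
  then have nq: "w ~: fst ` Q" using disj p unfolding prismatic_def by simp
  obtain x y z where w: "w = {x, y, z}" "distinct [x, y, z]" using ci three_set unfolding circuit3_iff by metis
  have "nbr Q x y" "nbr Q y z" "nbr Q x z" using ci w unfolding circuit3_iff by auto
  then show "w : removed S" using stacked_clique[OF stk] nq w(1) by blast
 next
  assume "w : removed S"
  then obtain i j k l m where st: "(i, j, k, l, m) : S" and w: "w = {i, j, k}" unfolding removed_def by auto
  have c3: "card w = 3" "w <= {..<n}" using step_nbr(2)[OF st] step_less[OF st] w by simp_all
  have "ALL s:w. ALL t:w. s ~= t --> nbr Q s t" using step_nbr(1)[OF st] unfolding w by blast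
  then have ci: "circuit3 G w" unfolding circuit3_iff by (rule conjI[OF c3(2) conjI[OF c3(1)]])
  have "w ~: fst ` Q" using stacked_steps[OF stk st] unfolding w by (elim conjE)
  then show "prismatic G w" unfolding prismatic_def using ci disj[OF ci] by blast
 qed
qed

text \<open>With \<open>ka\<close> four times a squared cosine, the difference of the two sides is
  four times the Gram determinant of the three labels, and \<open>angle_sum_sign\<close> translates
  its sign into the type of the circuit.\<close>

lemma removed_circuit:
 assumes st: "(i, j, k, l, m) : S"
 shows "with_right_angle G {i, j, k} \<longleftrightarrow> ka i j * ka j k * ka k i = 0"
  "spherical G {i, j, k} \<longleftrightarrow> 4 - ka i j - ka j k - ka k i > sqrt (ka i j * ka j k * ka k i)"
  "affine_circuit G {i, j, k} \<longleftrightarrow> 4 - ka i j - ka j k - ka k i = sqrt (ka i j * ka j k * ka k i)"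
  "hyperbolic G {i, j, k} \<longleftrightarrow> 4 - ka i j - ka j k - ka k i < sqrt (ka i j * ka j k * ka k i)"
proof -
 have d: "i ~= j" "i ~= k" "j ~= k" using step_nbr(2)[OF st] by auto
 have nb: "nbr Q i j" "nbr Q j k" "nbr Q k i" using step_nbr(1)[OF st] d by blast+
 obtain e1 where e1: "e1 : edges G" "sd e1 = {i, j}" using nbr_edge[OF nb(1)] by blast
 obtain e2 where e2: "e2 : edges G" "sd e2 = {j, k}" using nbr_edge[OF nb(2)] by blast
 obtain e3 where e3: "e3 : edges G" "sd e3 = {k, i}" using nbr_edge[OF nb(3)] by blast
 have "e1 ~= e2" "e1 ~= e3" "e2 ~= e3"
  using e1(2) e2(2) e3(2) d by (auto simp: doubleton_eq_iff)
 moreover have ce: "circuit_edges G {i, j, k} = {e1, e2, e3}"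
 proof -
  have lt: "i < n" "j < n" "k < n" using step_less[OF st] by blast+
  have f: "face G s Int face G t = {e}" if "e : edges G" "sd e = {s, t}" "s < n" "t < n" "s ~= t" for s t e
  proof -
   have "x : face G s Int face G t \<longleftrightarrow> x = e" for x
    using face_inter[OF that(3-5), of x] that(1,2) sd_inj[of x e] by metis
   then show ?thesis by blast
  qed
  have fe: "face G i Int face G j = {e1}" "face G j Int face G k = {e2}" "face G k Int face G i = {e3}"
   by (rule f; use e1 e2 e3 lt d in simp)+
  have "face G j Int face G i = {e1}" "face G k Int face G j = {e2}" "face G i Int face G k = {e3}"
   using fe by (simp_all only: Int_commute)
  then show ?thesis unfolding circuit_edges_def by (auto simp: fe d d[symmetric])
 qed
 ultimately have sum: "(SUM e:circuit_edges G {i, j, k}. label G e) = label G e1 + label G e2 + label G e3" by simp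
 define A where "A = label G e1"
 define B where "B = label G e2"
 define C where "C = label G e3"
 have r: "0 < A" "A <= pi / 2" "0 < B" "B <= pi / 2" "0 < C" "C <= pi / 2"
  unfolding A_def B_def C_def using labels e1(1) e2(1) e3(1) by blast+
 have ka: "ka i j = 4 * (cos A)\<^sup>2" "ka j k = 4 * (cos B)\<^sup>2" "ka k i = 4 * (cos C)\<^sup>2"
  unfolding A_def B_def C_def by (rule kap_edge, rule e1, rule e1, rule kap_edge, rule e2, rule e2, rule kap_edge, rule e3, rule e3)
 have cpos: "cos A >= 0" "cos B >= 0" "cos C >= 0" using cos_label(1) r by blast+
 have zero: "cos A = 0 \<longleftrightarrow> A = pi / 2" "cos B = 0 \<longleftrightarrow> B = pi / 2" "cos C = 0 \<longleftrightarrow> C = pi / 2"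
  using cos_label(4)[of A] cos_label(4)[of B] cos_label(4)[of C] r by simp_all
 have sq: "sqrt (ka i j * ka j k * ka k i) = 8 * (cos A * cos B * cos C)"
 proof -
  have "ka i j * ka j k * ka k i = (8 * (cos A * cos B * cos C))\<^sup>2" unfolding ka by (simp add: power_mult_distrib)
  from real_sqrt_unique[OF this[symmetric]] show ?thesis using cpos by simp
 qed
 define E where "E = 1 - (cos A)\<^sup>2 - (cos B)\<^sup>2 - (cos C)\<^sup>2 - 2 * cos A * cos B * cos C"
 have dE: "4 - ka i j - ka j k - ka k i - sqrt (ka i j * ka j k * ka k i) = 4 * E"
  unfolding sq unfolding ka E_def by simp
 note sg = angle_sum_sign[OF r, folded E_def]
 show "with_right_angle G {i, j, k} \<longleftrightarrow> ka i j * ka j k * ka k i = 0"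
  unfolding with_right_angle_def ce ka using zero by (auto simp: A_def B_def C_def)
 show "spherical G {i, j, k} \<longleftrightarrow> 4 - ka i j - ka j k - ka k i > sqrt (ka i j * ka j k * ka k i)"
  "affine_circuit G {i, j, k} \<longleftrightarrow> 4 - ka i j - ka j k - ka k i = sqrt (ka i j * ka j k * ka k i)"
  "hyperbolic G {i, j, k} \<longleftrightarrow> 4 - ka i j - ka j k - ka k i < sqrt (ka i j * ka j k * ka k i)"
  unfolding spherical_def affine_circuit_def hyperbolic_def sum A_def[symmetric] B_def[symmetric] C_def[symmetric]
   sg[symmetric] using dE by linarith+
qed

lemma m_number_positive:
 assumes sg: "simple_graph (verts G) (edges G)"
 shows "m_number G >= 1 \<longleftrightarrow> (EX w:removed S. with_right_angle G w & (affine_circuit G w | spherical G w))"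
proof -
 let ?M = "{w. prismatic G w & with_right_angle G w & (affine_circuit G w | spherical G w)}"
 have "?M <= removed S" using prismatic_iff[OF sg] by blast
 moreover have "finite (removed S)" unfolding removed_def using stacked_finite[OF stk] by simp
 ultimately have "finite ?M" by (rule finite_subset)
 then have "m_number G >= 1 \<longleftrightarrow> ?M ~= {}" unfolding m_number_def using card_gt_0_iff[of ?M] by (simp only: Suc_le_eq One_nat_def) simp
 then show ?thesis using prismatic_iff[OF sg] by blast
qed

lemma admissible_iff:
 assumes sg: "simple_graph (verts G) (edges G)"
 shows "admissible \<longleftrightarrow> ~ m_number G >= 1"
proof -
 have one: "(ka i j * ka j k * ka k i = 0 --> 4 < ka i j + ka j k + ka k i) \<longleftrightarrow>
   ~ (with_right_angle G {i, j, k} & (affine_circuit G {i, j, k} | spherical G {i, j, k}))"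
  if st: "(i, j, k, l, m) : S" for i j k l m
 proof (cases "ka i j * ka j k * ka k i = 0")
  case True
  then have "sqrt (ka i j * ka j k * ka k i) = 0" by simp
  then show ?thesis unfolding removed_circuit(1-3)[OF st] using True by linarith
 qed (simp add: removed_circuit(1)[OF st])
 show ?thesis
  unfolding admissible_def m_number_positive[OF sg] removed_def using one by fastforce
qed

end

subsection \<open>Recognizing the exceptional prism\<close>

context stacked_graph
begin

lemma edge_of:
 assumes sg: "simple_graph (verts G) (edges G)" and nb: "nbr Q s t"
  and u: "u : verts G" "w : verts G" "u ~= w" "{s, t} <= cn u" "{s, t} <= cn w"
 shows "{u, w} : edges G" "sd {u, w} = {s, t}"
proof -
 obtain e where e: "e : edges G" "sd e = {s, t}" using nbr_edge[OF nb] by blast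
 have "u : e" "w : e" using inc u e by simp_all
 moreover have "card e = 2" using sg e(1) unfolding simple_graph_def by blast
 ultimately have "e = {u, w}" using u(3) by (auto simp: card_2_iff)
 then show "{u, w} : edges G" "sd {u, w} = {s, t}" using e by simp_all
qed

lemma edge_side:
 assumes "{u, w} : edges G" "u : verts G" "w : verts G"
 shows "sd {u, w} <= cn u" "sd {u, w} <= cn w" "card (sd {u, w}) = 2"
proof -
 show "sd {u, w} <= cn u" "sd {u, w} <= cn w" using vertex_in_edge assms by simp_all
 obtain s t where "sd {u, w} = {s, t}" "nbr Q s t" using assms(1) sd_img by blast
 then show "card (sd {u, w}) = 2" using nbr_less by simp
qed

lemma right_angle_kap:
 assumes "e : edges G" "sd e = {s, t}"
 shows "ka s t = 0 \<longleftrightarrow> label G e = pi / 2"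
 using kap_edge[OF assms] cos_label(4)[of "label G e"] labels[OF assms(1)] by simp

end

context prism_graph
begin

lemma corner_prism:
 assumes "u : verts G"
 shows "cn u : fst ` Q" "card (cn u) = 3" "finite (cn u)" "l : cn u \<longleftrightarrow> m ~: cn u" "cn u <= {i, j, k, l, m}"
proof -
 show cu: "cn u : fst ` Q" using bij_betwE[OF bij_cn] assms by blast
 show "card (cn u) = 3" "cn u <= {i, j, k, l, m}" using stacked_tri_card[OF stk cu] F_eq by simp_all
 then show "finite (cn u)" using card.infinite by fastforce
 have "cn u = {j, k, l} | cn u = {i, k, l} | cn u = {i, j, l} | cn u = {i, j, m} | cn u = {j, k, m} | cn u = {i, k, m}"
  using cu unfolding tris by simp
 then show "l : cn u \<longleftrightarrow> m ~: cn u" by (elim disjE) (simp_all add: ne ne[symmetric])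
qed

lemma corner_inj: "u : verts G ==> w : verts G ==> cn u = cn w ==> u = w"
 using bij_betw_imp_inj_on[OF bij_cn] unfolding inj_on_def by blast

text \<open>The two vertices share the two faces along their edge, so they differ only by exchanging
  \<open>l\<close> and \<open>m\<close>. In particular a vertex on one triangular face has a single
  neighbour on the other.\<close>

lemma mixed_edge:
 assumes "u : verts G" "w : verts G" "{u, w} : edges G" "l : cn u" "l ~: cn w"
 shows "cn u = insert l (sd {u, w})" "cn w = insert m (sd {u, w})"
proof -
 note e = edge_side[OF assms(3,1,2)]
 have mu: "m ~: cn u" and mw: "m : cn w" using corner_prism(4) assms by blast+
 have nl: "l ~: sd {u, w}" "m ~: sd {u, w}" using e assms(5) mu by blast+
 have fs: "finite (sd {u, w})" using e(3) card.infinite by fastforce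
 show "cn u = insert l (sd {u, w})"
  by (rule card_subset_eq[symmetric]) (use corner_prism[OF assms(1)] assms(4) e nl fs in simp_all)
 show "cn w = insert m (sd {u, w})"
  by (rule card_subset_eq[symmetric]) (use corner_prism[OF assms(2)] mw e nl fs in simp_all)
qed

text \<open>If the triangle had vertices on both sides, two of its edges would cross between
  \<open>l\<close> and \<open>m\<close> from a common vertex, and by \<open>mixed_edge\<close> their
  far ends would coincide.\<close>

lemma triangle_one_side:
 assumes v: "u : verts G" "w : verts G" "x : verts G" and d: "u ~= x" "w ~= x"
  and e: "{u, w} : edges G" "{u, x} : edges G" "{w, x} : edges G"
 shows "l : cn u ==> l : cn w"
proof (rule ccontr)
 assume l: "l : cn u" "l ~: cn w"
 note uw = mixed_edge[OF v(1,2) e(1) l]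
 show False
 proof (cases "l : cn x")
  case True
  have xw: "{x, w} : edges G" using e(3) by (simp add: insert_commute)
  note m1 = mixed_edge[OF v(3,2) xw True l(2)]
  have "m ~: sd {u, w}" using edge_side(1)[OF e(1) v(1,2)] corner_prism(4)[OF v(1)] l(1) by blast
  moreover have "m ~: sd {x, w}" using edge_side(1)[OF xw v(3,2)] corner_prism(4)[OF v(3)] True by blast
  moreover have "insert m (sd {u, w}) = insert m (sd {x, w})" using uw(2) m1(2) by simp
  ultimately have "sd {u, w} = sd {x, w}" using insert_ident[of m "sd {u, w}" "sd {x, w}"] by blast
  then have "cn u = cn x" using uw(1) m1(1) by simp
  then show False using corner_inj v d by blast
 next
  case False
  note m1 = mixed_edge[OF v(1,3) e(2) l(1) False]
  have "l ~: sd {u, w}" using edge_side(2)[OF e(1) v(1,2)] l(2) by blast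
  moreover have "l ~: sd {u, x}" using edge_side(2)[OF e(2) v(1,3)] False by blast
  moreover have "insert l (sd {u, w}) = insert l (sd {u, x})" using uw(1) m1(1) by simp
  ultimately have "sd {u, w} = sd {u, x}" using insert_ident[of l "sd {u, w}" "sd {u, x}"] by blast
  then have "cn w = cn x" using uw(2) m1(2) by simp
  then show False using corner_inj v d by blast
 qed
qed

text \<open>Each edge of the triangle lies between \<open>y\<close> and one of \<open>i\<close>,
  \<open>j\<close>, \<open>k\<close>. The three edges are distinct, so all three faces of the
  circuit occur and each has a right angle with \<open>y\<close>.\<close>

lemma triangle_zero:
 assumes v: "u : verts G" "w : verts G" "x : verts G" and d: "u ~= w" "u ~= x" "w ~= x"
  and e: "{u, w} : edges G" "{u, x} : edges G" "{w, x} : edges G"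
  and y: "y = l | y = m" "y : cn u" "y : cn w" "y : cn x"
  and lab: "label G {u, w} = pi / 2" "label G {u, x} = pi / 2" "label G {w, x} = pi / 2"
  and s: "s : {i, j, k}"
 shows "ka y s = 0"
proof -
 have pair: "EX s:{i, j, k}. sd {p, q} = {y, s} & ka y s = 0"
  if p: "p : verts G" "q : verts G" "p ~= q" "{p, q} : edges G" "y : cn p" "y : cn q" "label G {p, q} = pi / 2" for p q
 proof -
  note c = corner_prism[OF p(1)] corner_prism[OF p(2)]
  have "cn p ~= cn q" using corner_inj p by blast
  then have "~ cn p <= cn q" using card_subset_eq[OF c(8), of "cn p"] c(2,7) by auto
  then have "card (cn p Int cn q) < card (cn p)" using c(3) by (intro psubset_card_mono) auto
  moreover have "sd {p, q} <= cn p Int cn q" using edge_side[OF p(4,1,2)] by blast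
  ultimately have "sd {p, q} = cn p Int cn q"
   using card_subset_eq[of "cn p Int cn q" "sd {p, q}"] edge_side(3)[OF p(4,1,2)] card_mono[of "cn p Int cn q" "sd {p, q}"] c(2,3) by simp
  then have ys: "y : sd {p, q}" using p by simp
  obtain s t where st: "sd {p, q} = {s, t}" "nbr Q s t" using p(4) sd_img by blast
  then obtain r where r: "sd {p, q} = {y, r}" "r ~= y" using ys nbr_less[OF st(2)] by (metis doubleton_eq_iff insertE singletonD)
  have "r : cn p" using r(1) edge_side(1)[OF p(4,1,2)] by blast
  then have "r : {i, j, k}" using c(4,5) y(1) p(5) r(2) by blast
  moreover have "ka y r = 0" using right_angle_kap[OF p(4) r(1)] p(7) by simp
  ultimately show ?thesis using r(1) by blast
 qed
 obtain s1 where s1: "s1 : {i, j, k}" "sd {u, w} = {y, s1}" "ka y s1 = 0" using pair[OF v(1,2) d(1) e(1) y(2,3) lab(1)] by blast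
 obtain s2 where s2: "s2 : {i, j, k}" "sd {u, x} = {y, s2}" "ka y s2 = 0" using pair[OF v(1,3) d(2) e(2) y(2,4) lab(2)] by blast
 obtain s3 where s3: "s3 : {i, j, k}" "sd {w, x} = {y, s3}" "ka y s3 = 0" using pair[OF v(2,3) d(3) e(3) y(3,4) lab(3)] by blast
 have "{u, w} ~= {u, x}" "{u, w} ~= {w, x}" "{u, x} ~= {w, x}" using d by (auto simp: doubleton_eq_iff)
 then have "s1 ~= s2" "s1 ~= s3" "s2 ~= s3" using sd_inj e s1 s2 s3 by metis+
 then have "card {s1, s2, s3} = card {i, j, k}" using ne by simp
 moreover have "{s1, s2, s3} <= {i, j, k}" using s1 s2 s3 by simp
 ultimately have "{s1, s2, s3} = {i, j, k}" by (intro card_subset_eq) simp_all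
 then have "s = s1 | s = s2 | s = s3" using s by blast
 then show ?thesis using s1 s2 s3 by blast
qed

text \<open>The definition of the prism does not say which triangle belongs to which face. Each lies
  on one side by \<open>triangle_one_side\<close>, and they lie on different sides because both
  faces \<open>l\<close> and \<open>m\<close> have vertices, so both assignments are
  treated.\<close>

lemma exceptional_zero:
 assumes ex: "exceptional_prism G" and s: "s : {i, j, k}"
 shows "ka l s = 0 & ka m s = 0"
proof -
 obtain a b c x y z where d: "distinct [a, b, c, x, y, z]" and V: "verts G = {a, b, c, x, y, z}"
  and E: "edges G = {{a, b}, {b, c}, {a, c}, {x, y}, {y, z}, {x, z}, {a, x}, {b, y}, {c, z}}"
  and lab: "ALL e : {{a, b}, {b, c}, {a, c}, {x, y}, {y, z}, {x, z}}. label G e = pi / 2"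
  using ex unfolding exceptional_prism_def by (elim exE conjE) (rule that)
 have v: "a : verts G" "b : verts G" "c : verts G" "x : verts G" "y : verts G" "z : verts G" unfolding V by simp_all
 have e: "{a, b} : edges G" "{a, c} : edges G" "{b, c} : edges G" "{b, a} : edges G" "{c, a} : edges G" "{c, b} : edges G"
  "{x, y} : edges G" "{x, z} : edges G" "{y, z} : edges G" "{y, x} : edges G" "{z, x} : edges G" "{z, y} : edges G"
  unfolding E by (simp_all add: insert_commute)
 have la: "label G {a, b} = pi / 2" "label G {a, c} = pi / 2" "label G {b, c} = pi / 2"
  "label G {x, y} = pi / 2" "label G {x, z} = pi / 2" "label G {y, z} = pi / 2" using lab by simp_all
 have ds: "a ~= b" "a ~= c" "b ~= c" "x ~= y" "x ~= z" "y ~= z" "b ~= a" "c ~= a" "c ~= b" "y ~= x" "z ~= x" "z ~= y" using d by auto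
 have abc: "l : cn a \<longleftrightarrow> l : cn b" "l : cn a \<longleftrightarrow> l : cn c"
  using triangle_one_side[OF v(1,2,3) ds(2,3) e(1,2,3)] triangle_one_side[OF v(2,1,3) ds(3,2) e(4,3,2)]
   triangle_one_side[OF v(1,3,2) ds(1,9) e(2,1,6)] triangle_one_side[OF v(3,1,2) ds(9,1) e(5,6,1)] by blast+
 have xyz: "l : cn x \<longleftrightarrow> l : cn y" "l : cn x \<longleftrightarrow> l : cn z"
  using triangle_one_side[OF v(4,5,6) ds(5,6) e(7,8,9)] triangle_one_side[OF v(5,4,6) ds(6,5) e(10,9,8)]
   triangle_one_side[OF v(4,6,5) ds(4,12) e(8,7,12)] triangle_one_side[OF v(6,4,5) ds(12,4) e(11,12,7)] by blast+
 have onto: "EX u:verts G. cn u = T" if "T : fst ` Q" for T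
 proof -
  have "T : cn ` verts G" using bij_betw_imp_surj_on[OF bij_cn] that by simp
  then show ?thesis by (metis imageE)
 qed
 have "EX u:verts G. cn u = {j, k, l}" "EX u:verts G. cn u = {j, k, m}" by (rule onto, simp add: tris)+
 then have "EX u:verts G. l : cn u" "EX u:verts G. l ~: cn u" using ne by (metis insertCI, metis insertE singletonD)
 then have ax: "l : cn a \<longleftrightarrow> l ~: cn x" using abc xyz unfolding V by blast
 have mm: "m : cn u \<longleftrightarrow> l ~: cn u" if "u : verts G" for u using corner_prism(4)[OF that] by blast
 note z1 = triangle_zero[OF v(1,2,3) ds(1,2,3) e(1,2,3) _ _ _ _ la(1,2,3) s]
 note z2 = triangle_zero[OF v(4,5,6) ds(4,5,6) e(7,8,9) _ _ _ _ la(4,5,6) s]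
 show ?thesis
 proof (cases "l : cn a")
  case True
  have "ka l s = 0" by (rule z1) (use True abc in simp_all)
  moreover have "ka m s = 0" by (rule z2) (use True abc xyz ax mm[OF v(4)] mm[OF v(5)] mm[OF v(6)] in simp_all)
  ultimately show ?thesis by blast
 next
  case False
  have "ka l s = 0" by (rule z2) (use False ax xyz in simp_all)
  moreover have "ka m s = 0" by (rule z1) (use False abc mm[OF v(1)] mm[OF v(2)] mm[OF v(3)] in simp_all)
  ultimately show ?thesis by blast
 qed
qed

end

context flat_graph
begin

lemma flat_exceptional:
 assumes sg: "simple_graph (verts G) (edges G)"
 shows "exceptional_prism G"
proof -
 have onto: "EX u:verts G. cn u = T" if "T : fst ` Q" for T
 proof -
  have "T : cn ` verts G" using bij_betw_imp_surj_on[OF bij_cn] that by simp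
  then show ?thesis by (metis imageE)
 qed
 obtain a where a: "a : verts G" "cn a = {j, k, l}" using onto[of "{j, k, l}"] unfolding tris by auto
 obtain b where b: "b : verts G" "cn b = {i, k, l}" using onto[of "{i, k, l}"] unfolding tris by auto
 obtain c where c: "c : verts G" "cn c = {i, j, l}" using onto[of "{i, j, l}"] unfolding tris by auto
 obtain x where x: "x : verts G" "cn x = {j, k, m}" using onto[of "{j, k, m}"] unfolding tris by auto
 obtain y where y: "y : verts G" "cn y = {i, k, m}" using onto[of "{i, k, m}"] unfolding tris by auto
 obtain z where z: "z : verts G" "cn z = {i, j, m}" using onto[of "{i, j, m}"] unfolding tris by auto
 note cs = a(2) b(2) c(2) x(2) y(2) z(2)
 have mem: "i ~: cn a" "j ~: cn b" "k ~: cn c" "i ~: cn x" "j ~: cn y" "k ~: cn z"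
  "i : cn b" "i : cn c" "i : cn y" "i : cn z" "j : cn a" "j : cn c" "j : cn x" "j : cn z"
  "k : cn a" "k : cn b" "k : cn x" "k : cn y" "l : cn a" "l : cn b" "l : cn c" "l ~: cn x" "l ~: cn y" "l ~: cn z"
  unfolding cs using ne by simp_all
 have ds: "a ~= b" "a ~= c" "a ~= x" "a ~= y" "a ~= z" "b ~= c" "b ~= x" "b ~= y" "b ~= z" "c ~= x" "c ~= y" "c ~= z"
  "x ~= y" "x ~= z" "y ~= z" using mem by metis+
 have V: "verts G = {a, b, c, x, y, z}"
 proof (intro equalityI subsetI)
  fix u assume u: "u : verts G"
  have "cn u = {j, k, l} | cn u = {i, k, l} | cn u = {i, j, l} | cn u = {i, j, m} | cn u = {j, k, m} | cn u = {i, k, m}"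
   using corner_prism(1)[OF u] unfolding tris by simp
  then have "cn u = cn a | cn u = cn b | cn u = cn c | cn u = cn z | cn u = cn x | cn u = cn y" unfolding cs .
  then have "u = a | u = b | u = c | u = z | u = x | u = y" using corner_inj[OF u] a b c x y z by metis
  then show "u : {a, b, c, x, y, z}" by blast
 qed (use a b c x y z in blast)
 have nbs: "nbr Q l i" "nbr Q l j" "nbr Q l k" "nbr Q m i" "nbr Q m j" "nbr Q m k"
  using step_nbr(1)[OF in_S] ne by blast+
 have sub: "{l, k} <= cn a" "{l, k} <= cn b" "{l, i} <= cn b" "{l, i} <= cn c" "{l, j} <= cn a" "{l, j} <= cn c"
  "{m, k} <= cn x" "{m, k} <= cn y" "{m, i} <= cn y" "{m, i} <= cn z" "{m, j} <= cn x" "{m, j} <= cn z"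
  "{j, k} <= cn a" "{j, k} <= cn x" "{i, k} <= cn b" "{i, k} <= cn y" "{i, j} <= cn c" "{i, j} <= cn z"
  unfolding cs by simp_all
 note ed = edge_of[OF sg nbs(3) a(1) b(1) ds(1) sub(1,2)] edge_of[OF sg nbs(1) b(1) c(1) ds(6) sub(3,4)]
  edge_of[OF sg nbs(2) a(1) c(1) ds(2) sub(5,6)] edge_of[OF sg nbs(6) x(1) y(1) ds(13) sub(7,8)]
  edge_of[OF sg nbs(4) y(1) z(1) ds(15) sub(9,10)] edge_of[OF sg nbs(5) x(1) z(1) ds(14) sub(11,12)]
  edge_of[OF sg prism_nbr(5) a(1) x(1) ds(3) sub(13,14)] edge_of[OF sg prism_nbr(3) b(1) y(1) ds(8) sub(15,16)]
  edge_of[OF sg prism_nbr(1) c(1) z(1) ds(12) sub(17,18)]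
 have E: "edges G = {{a, b}, {b, c}, {a, c}, {x, y}, {y, z}, {x, z}, {a, x}, {b, y}, {c, z}}"
 proof (intro equalityI subsetI)
  fix e assume e: "e : edges G"
  obtain s t where st: "sd e = {s, t}" "nbr Q s t" using e sd_img by blast
  have "s = i | s = j | s = k | s = l | s = m" "t = i | t = j | t = k | t = l | t = m" "s ~= t"
   "~ (s : {l, m} & t : {l, m})" using nbr_cases[OF st(2)] ne by auto
  then have "{s, t} = {l, k} | {s, t} = {l, i} | {s, t} = {l, j} | {s, t} = {m, k} | {s, t} = {m, i} | {s, t} = {m, j} |
    {s, t} = {j, k} | {s, t} = {i, k} | {s, t} = {i, j}"
   by (elim disjE) (simp_all add: insert_commute)
  then have "sd e = sd {a, b} | sd e = sd {b, c} | sd e = sd {a, c} | sd e = sd {x, y} | sd e = sd {y, z} |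
    sd e = sd {x, z} | sd e = sd {a, x} | sd e = sd {b, y} | sd e = sd {c, z}" unfolding st(1) ed .
  then have "e = {a, b} | e = {b, c} | e = {a, c} | e = {x, y} | e = {y, z} | e = {x, z} | e = {a, x} | e = {b, y} | e = {c, z}"
   using sd_inj[OF e] ed by metis
  then show "e : {{a, b}, {b, c}, {a, c}, {x, y}, {y, z}, {x, z}, {a, x}, {b, y}, {c, z}}" by simp
 qed (use ed in \<open>elim insertE emptyE; simp\<close>)
 have "ka l i = 0" "ka l j = 0" "ka l k = 0" "ka m i = 0" "ka m j = 0" "ka m k = 0" using zero by simp_all
 then have lab: "label G {a, b} = pi / 2" "label G {b, c} = pi / 2" "label G {a, c} = pi / 2"
  "label G {x, y} = pi / 2" "label G {y, z} = pi / 2" "label G {x, z} = pi / 2"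
  using right_angle_kap[OF ed(1,2)] right_angle_kap[OF ed(3,4)] right_angle_kap[OF ed(5,6)]
   right_angle_kap[OF ed(7,8)] right_angle_kap[OF ed(9,10)] right_angle_kap[OF ed(11,12)] by blast+
 have "distinct [a, b, c, x, y, z]" using ds by simp
 moreover have "ALL e : {{a, b}, {b, c}, {a, c}, {x, y}, {y, z}, {x, z}}. label G e = pi / 2" using lab by simp
 ultimately show ?thesis unfolding exceptional_prism_def using V E
  by - (rule exI[of _ a], rule exI[of _ b], rule exI[of _ c], rule exI[of _ x], rule exI[of _ y], rule exI[of _ z], intro conjI)
qed

lemma flat_empty_circuits:
 assumes sg: "simple_graph (verts G) (edges G)"
 shows "topspace (X_space G) = {} \<longleftrightarrow> (EX c. prismatic G c & hyperbolic G c) |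
  (m_number G >= 1 & ~ (EX c. prismatic G c & affine_circuit G c & with_right_angle G c))"
proof -
 have rem: "removed S = {{i, j, k}}" unfolding removed_def S_eq by simp
 have pc: "prismatic G c \<longleftrightarrow> c = {i, j, k}" for c unfolding prismatic_iff[OF sg] rem by simp
 have mn: "m_number G >= 1 \<longleftrightarrow> with_right_angle G {i, j, k} & (affine_circuit G {i, j, k} | spherical G {i, j, k})"
  unfolding m_number_positive[OF sg] rem by simp
 have p: "ka i j * ka i k * ka j k = ka i j * ka j k * ka k i" "ka i j + ka i k + ka j k = ka i j + ka j k + ka k i"
  "4 - ka i j - ka i k - ka j k = 4 - ka i j - ka j k - ka k i" using kap_sym[of i k] by simp_all
 have "flat_condition \<longleftrightarrow> (if with_right_angle G {i, j, k} then affine_circuit G {i, j, k} else ~ hyperbolic G {i, j, k})"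
  unfolding flat_condition_def removed_circuit[OF in_S] p by auto
 moreover have "hyperbolic G {i, j, k} \<longleftrightarrow> ~ affine_circuit G {i, j, k} & ~ spherical G {i, j, k}"
  "~ (affine_circuit G {i, j, k} & spherical G {i, j, k})"
  unfolding removed_circuit[OF in_S] by linarith+
 ultimately show ?thesis unfolding flat_empty pc mn by auto
qed

end

lemma (in stacked_graph) flat_graphI:
 assumes "flat"
 shows "EX i j k l m. flat_graph G a b c d Q S n i j k l m"
proof -
 have c1: "card S = 1" using assms unfolding flat_def by blast
 obtain i j k l m where S: "(i, j, k, l, m) : S" and z: "ALL s:{i, j, k}. ka l s = 0 & ka m s = 0"
  using assms unfolding flat_def by blast
 obtain i' j' k' l' m' where S': "S = {(i', j', k', l', m')}" "{..<n} = {i', j', k', l', m'}"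
  "fst ` Q = {{j', k', l'}, {i', k', l'}, {i', j', l'}, {i', j', m'}, {j', k', m'}, {i', k', m'}}"
  using stacked_single[OF stk c1] by metis
 have "(i, j, k, l, m) = (i', j', k', l', m')" using S S'(1) by simp
 then have "flat_graph G a b c d Q S n i j k l m"
  by unfold_locales (use S' z in auto)
 then show ?thesis by blast
qed

theorem mainTheorem4:
  fixes G :: "'v labelled_graph"
  assumes "marked_labelled_ecimahedron G"
  shows "(\<exists>d. topological_manifold d (X_space G) \<and>
            finite (connected_components_of (X_space G)) \<and>
            (\<forall>C \<in> connected_components_of (X_space G).
               subtopology (X_space G) C homeomorphic_space ball_space d)) \<and>
         (topspace (X_space G) = {} \<longleftrightarrow>
            (exceptional_prism G \<and> (\<exists>c. prismatic G c \<and> hyperbolic G c)) \<or>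
            (m_number G \<ge> 1 \<and>
             \<not> (exceptional_prism G \<and>
                (\<exists>c. prismatic G c \<and> affine_circuit G c \<and> with_right_angle G c))))"
proof -
 have mg: "simple_graph (verts G) (edges G)" "ALL e : edges G. 0 < label G e & label G e <= pi / 2"
  "planar_faces (verts G) (edges G) (nfaces G) (face G)"
  using assms unfolding marked_labelled_ecimahedron_def marked_labelled_graph_def by blast+
 obtain a b c d Q S where st: "stacked a b c d {..<nfaces G} Q S"
  and re: "realizes_stack (verts G) (edges G) {..<nfaces G} (face G) Q"
  using marked_stacked[OF assms] by (elim exE conjE) (rule that)
 interpret stacked_graph G a b c d Q S "nfaces G"
  by unfold_locales (use mg st re in \<open>auto simp: planar_faces_def\<close>)
 \<comment> \<open>A prism has six vertices, hence five faces, one more than a simplex.\<close>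
 have card_S: "card S = 1" if "exceptional_prism G"
 proof -
  have "card (verts G) = 6" using that unfolding exceptional_prism_def by (elim exE conjE) simp
  then have "nfaces G = 5" using marked_face_count[OF assms] by simp
  then show ?thesis using stacked_card[OF st] by simp
 qed
 show ?thesis
 proof (cases "flat")
  case True
  obtain i j k l m where fg: "flat_graph G a b c d Q S (nfaces G) i j k l m"
   using flat_graphI[OF True] by (elim exE) (rule that)
  have "exceptional_prism G" by (rule flat_graph.flat_exceptional[OF fg mg(1)])
  then show ?thesis
   using flat_graph.flat_structure[OF fg] flat_graph.flat_empty_circuits[OF fg mg(1)] by simp
 next
  case False
  have "~ exceptional_prism G"
  proof
   assume ex: "exceptional_prism G"
   obtain i j k l m where S: "S = {(i, j, k, l, m)}" "{..<nfaces G} = {i, j, k, l, m}"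
    "fst ` Q = {{j, k, l}, {i, k, l}, {i, j, l}, {i, j, m}, {j, k, m}, {i, k, m}}"
    using stacked_single[OF st card_S[OF ex]] by metis
   interpret prism_graph G a b c d Q S "nfaces G" i j k l m
    by unfold_locales (use S in simp_all)
   have "ALL s:{i, j, k}. ka l s = 0 & ka m s = 0" using exceptional_zero[OF ex] by blast
   then have "flat" unfolding flat_def using card_S[OF ex] in_S by blast
   then show False using False by simp
  qed
  then show ?thesis using nonflat_structure[OF False] admissible_iff[OF mg(1)] by simp
 qed
qed

end
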